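(* Let $\mathbf{lcGsite}$ be the 2-category of left-cancellative Grothendieck sites with covering-preserving covering-flat functors as morphisms (and natural transformations as 2-cells), and let $\mathbf{Esite}_{\max}$ be the 2-category of Ehresmann sites in which each object is below a unique maximal object, with covering-preserving covering-flat double functors as morphisms (and $\Lambda$-transformations as 2-cells). The functors $\mathbf{G}$ and $\mathbf{L}$, acting on sites by $(\mathcal{C},J)\mapsto(\mathbf{G}(\mathcal{C}),T_J)$ and $(\mathcal{G},T)\mapsto(\mathbf{L}(\mathcal{G}),J_T)$, induce a 2-adjoint biequivalence $$\mathbf{lcGsite}\simeq\mathbf{Esite}_{\max}.$$
   Context: All categories are small. An ordered groupoid is a groupoid $\mathcal{G}$ with a partial order $\le$ on its arrows, inducing one on objects via identities, such that: $a\le b$ implies $a^{-1}\le b^{-1}$; $a\le b$ and $c\le d$ imply $ac\le bd$ when both composites are defined; and for each $f\colon A\to B$ and $A'\le A$ there is a unique arrow $f|_{A'}\colon A'\to B'$ with domain $A'$ and $f|_{A'}\le f$. Groupoid arrows are called horizontal; relations $A'\le A$ are called vertical arrows. A double functor is an order-preserving functor. A category is left-cancellative if all its arrows are monomorphisms. For double functors $F,G\colon\mathcal{G}\to\mathcal{H}$: a horizontal transformation $\alpha\colon F\Rightarrow_h G$ is a family of horizontal arrows $\alpha_X\colon FX\to GX$, natural in horizontal arrows, with $\alpha_X\le\alpha_{Y}$ whenever $X\le Y$; $F\le G$ means $Fh\le Gh$ for all horizontal $h$. A $\Lambda$-transformation $(\alpha,\le)\colon F\Rightarrow G$ consists of a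 double functor $G'\le G$ and a horizontal transformation $\alpha\colon F\Rightarrow_h G'$. The vertical composite of $(\alpha\colon F\Rightarrow_h G'\le G)$ and $(\gamma\colon G\Rightarrow_h H'\le H)$ has components $\gamma_X|_{G'X}\circ\alpha_X$, followed by the resulting inequality; whiskering is $(\beta,\le)F=(\beta F,\le)$, $H(\alpha,\le)=(H\alpha,\le)$. $\mathbf{L}(\mathcal{G})$ has the objects of $\mathcal{G}$; an arrow $A\to B$ is a horizontal arrow $h\colon A\to B'$ with $B'\le B$, written $(h,\le)$; the composite of $(h\colon A\to B'\le B)$ and $(k\colon B\to C'\le C)$ is $(k|_{B'}\circ h,\le)$. $\mathbf{L}(F)$ is $F$ on objects and $(h,\le)\mapsto(F(h),\le)$ on arrows; $\mathbf{L}(\alpha,\le)$ has components $(\alpha_X,\le)$. $\mathbf{G}(\mathcal{C})$ has as objects the subobjects $[m\colon A\to B]$ in $\mathcal{C}$ ($[m]=[m']$ iff $m=m'k$, $k$ an isomorphism); horizontal arrows $[m]\to[n]$ are classes $[m,n]$ of spans $B\xleftarrow{m}A\xrightarrow{n}C$ modulo isomorphism of the apex, the composite of $[k,m]$ and $[m',n]$ with $m=m'h$, $h$ an isomorphism, being $[k,nh]$; $[n]\le[n']$ iff $n=n'h$ for some $h$, and $[m,n]\le[m',n']$ iff $m=m'h$, $n=n'h$ for some common $h$. $\mathbf{G}(K)[m]=[Km]$, $\mathbf{G}(K)[m,n]=[Km,Kn]$; for $\theta\colon K\Rightarrow K'$, $\mathbf{G}(\theta)$ has components $[Km]\xrightarrow{[Km,K'm\circ\theta_{\mathrm{dom}(m)}]}[K'm\circ\theta_{\mathrm{dom}(m)}]\le[K'm]$.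 A vertical sieve on $A$ is a downward closed subset of $\downarrow A=\{A'\mid A'\le A\}$. For a vertical sieve $\mathcal{B}$ on $B$ and $f\colon A\to B'$ with $B'\le B$, $f^*\mathcal{B}=\{A'\le A\mid \mathrm{cod}(f|_{A'})\in\mathcal{B}\}$. An Ehresmann topology $T$ on $\mathcal{G}$ assigns to each object $A$ a collection $T(A)$ of (covering) vertical sieves on $A$ such that: (ET.1) $\downarrow A\in T(A)$; (ET.2) if $\mathcal{B}\in T(B)$ and $f\colon A\to B'$ with $B'\le B$, then $f^*\mathcal{B}\in T(A)$; (ET.3) if $\mathcal{A}\in T(A)$ and $\mathcal{B}$ is a vertical sieve on $A$ with $f^*\mathcal{B}\in T(C)$ for every $f\colon C\to A'$ with $A'\in\mathcal{A}$, then $\mathcal{B}\in T(A)$. An Ehresmann site is an ordered groupoid with an Ehresmann topology. For an Ehresmann topology $T$ on $\mathcal{G}$, $J_T$ is the Grothendieck topology on $\mathbf{L}(\mathcal{G})$ in which a sieve $\{(m_i\colon B_i\to A'_i\le A)\mid i\in I\}$ is in $J_T(A)$ iff $\{A'_i\le A\mid i\in I\}\in T(A)$. For a Grothendieck topology $J$ on a left-cancellative $\mathcal{C}$, $T_J([m\colon A\to B])=\{[mS]\mid S\in J(A)\}$ with $[mS]=\{[mn]\le[m]\mid n\in S\}$. For Grothendieck sites $(\mathcal{C},J)$, $(\mathcal{C}',J')$, a functor $F\colon\mathcal{C}\to\mathcal{C}'$ is covering preserving if for each $\mathcal{A}\in J(A)$ the sieve generated by $F\mathcal{A}$ is in $J'(FA)$;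 it is covering flat if for each finite diagram $D\colon\mathcal{I}\to\mathcal{C}$ and each cone $T$ over $FD$ in $\mathcal{C}'$ with vertex $U$, the sieve $\{h\colon V\to U\mid Th\text{ factors through the }F\text{-image of some cone over }D\}$ is covering. A finite diagram in an ordered groupoid $\mathcal{G}$ is a double functor $D\colon\mathbb{I}\to\mathcal{G}$ with $\mathbb{I}$ a finite ordered groupoid; $D_i=D(i)$, $D_\alpha=D(\alpha)$. An hv-cone over $D$ consists of an object $U$ and, for each object $i$, a horizontal $\xi_i\colon U\to E_i$ with $E_i\le D_i$, such that for each horizontal $\alpha\colon i\to i'$ the arrow $D_\alpha|_{E_i}$ has codomain $E_{i'}$ and $D_\alpha|_{E_i}\circ\xi_i=\xi_{i'}$, and $\xi_i=\xi_{i'}$ whenever $i\le i'$. A double functor $M\colon(\mathcal{G},T)\to(\mathcal{G}',T')$ is covering preserving if for each $\mathcal{A}\in T(A)$ the vertical sieve generated by $M\mathcal{A}$ is in $T'(MA)$. It is covering flat if for each finite diagram $D\colon\mathbb{I}\to\mathcal{G}$ and each hv-cone $(\xi_i\colon U\to E_i\le MD_i)_i$ over $MD$ there is $\{U'_k\le U\mid k\in K\}\in T'(U)$ such that for each $k$ there are an hv-cone $(\theta_{ik}\colon T_k\to A_{ik}\le D_i)_i$ over $D$ and a horizontal $h_k\colon U'_k\to T'_k$ with $T'_k\le MT_k$ such that $\xi_i|_{U'_k}=(M\theta_{ik})|_{T'_k}\circ h_k$ for all $i$. A 2-adjoint biequivalence is a 2-adjunction (here with left adjoint $\mathbf{G}$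 and right adjoint $\mathbf{L}$) all of whose unit and counit components are equivalences in the respective 2-categories. *)

theory Defs
  imports Main "HOL-Library.FuncSet"
begin

section \<open>A universe of small sets\<close>

text \<open>
  HOL has no type of all small categories, so smallness is relative to a universe: a type whose
  elements code certain sets of elements, the small ones.  Only those closure properties of a
  Grothendieck universe are required that are independent of powersets and infinity; every
  Grothendieck universe is an instance, and so is the type of sets hereditarily of cardinality below
  an infinite regular cardinal.
\<close>

class universe =
  fixes elts :: "'a \<Rightarrow> 'a set"
  assumes extensionality: "elts x = elts y \<Longrightarrow> x = y"
    and separation: "X \<subseteq> elts x \<Longrightarrow> \<exists>y. elts y = X"
    and pairing: "\<exists>z. elts z = {x, y}"
    and union: "\<exists>y. elts y = (\<Union>z\<in>elts x. elts z)"
    and replacement: "\<exists>y. elts y = f ` elts x"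

definition small :: "'u::universe set \<Rightarrow> bool" where
  "small X \<longleftrightarrow> X \<in> range elts"

definition vset :: "'u::universe set \<Rightarrow> 'u" where
  "vset X = (THE x. elts x = X)"

definition vpair :: "'u::universe \<Rightarrow> 'u \<Rightarrow> 'u" where
  "vpair a b = vset {vset {a}, vset {a, b}}"

definition vfst :: "'u::universe \<Rightarrow> 'u" where
  "vfst p = (THE a. \<exists>b. p = vpair a b)"

definition vsnd :: "'u::universe \<Rightarrow> 'u" where
  "vsnd p = (THE b. \<exists>a. p = vpair a b)"


section \<open>Categories and functors\<close>

record ('o, 'a) cat =
  Obj :: "'o set"
  Arr :: "'a set"
  Dom :: "'a \<Rightarrow> 'o"
  Cod :: "'a \<Rightarrow> 'o"
  Ide :: "'o \<Rightarrow> 'a"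
  Cmp :: "'a \<Rightarrow> 'a \<Rightarrow> 'a" (infixl "\<cdot>\<index>" 70)

definition category :: "('o, 'a, 'x) cat_scheme \<Rightarrow> bool" where
  "category C \<longleftrightarrow>
     (\<forall>f\<in>Arr C. Dom C f \<in> Obj C \<and> Cod C f \<in> Obj C) \<and>
     (\<forall>A\<in>Obj C. Ide C A \<in> Arr C \<and> Dom C (Ide C A) = A \<and> Cod C (Ide C A) = A) \<and>
     (\<forall>f\<in>Arr C. \<forall>g\<in>Arr C. Cod C f = Dom C g \<longrightarrow>
        g \<cdot>\<^bsub>C\<^esub> f \<in> Arr C \<and> Dom C (g \<cdot>\<^bsub>C\<^esub> f) = Dom C f \<and> Cod C (g \<cdot>\<^bsub>C\<^esub> f) = Cod C g) \<and>
     (\<forall>f\<in>Arr C. f \<cdot>\<^bsub>C\<^esub> Ide C (Dom C f) = f \<and> Ide C (Cod C f) \<cdot>\<^bsub>C\<^esub> f = f) \<and>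
     (\<forall>f\<in>Arr C. \<forall>g\<in>Arr C. \<forall>h\<in>Arr C. Cod C f = Dom C g \<and> Cod C g = Dom C h \<longrightarrow>
        (h \<cdot>\<^bsub>C\<^esub> g) \<cdot>\<^bsub>C\<^esub> f = h \<cdot>\<^bsub>C\<^esub> (g \<cdot>\<^bsub>C\<^esub> f))"

text \<open>
  The structure maps of small categories, and the maps constituting functors and transformations
  between them, are \<open>undefined\<close> outside their domains, so that equality in HOL is the intended
  equality.
\<close>

definition small_category :: "('u::universe, 'u, 'x) cat_scheme \<Rightarrow> bool" where
  "small_category C \<longleftrightarrow> category C \<and> small (Obj C) \<and> small (Arr C) \<and>
     Dom C \<in> extensional (Arr C) \<and> Cod C \<in> extensional (Arr C) \<and> Ide C \<in> extensional (Obj C) \<and>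
     (\<forall>g f. \<not> (f \<in> Arr C \<and> g \<in> Arr C \<and> Cod C f = Dom C g) \<longrightarrow> g \<cdot>\<^bsub>C\<^esub> f = undefined)"

definition finite_category :: "('u::universe, 'u, 'x) cat_scheme \<Rightarrow> bool" where
  "finite_category C \<longleftrightarrow> small_category C \<and> finite (Obj C) \<and> finite (Arr C)"

definition is_inverse :: "('o, 'a, 'x) cat_scheme \<Rightarrow> 'a \<Rightarrow> 'a \<Rightarrow> bool" where
  "is_inverse C f g \<longleftrightarrow> f \<in> Arr C \<and> g \<in> Arr C \<and> Dom C g = Cod C f \<and> Cod C g = Dom C f \<and>
     g \<cdot>\<^bsub>C\<^esub> f = Ide C (Dom C f) \<and> f \<cdot>\<^bsub>C\<^esub> g = Ide C (Cod C f)"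

definition isomorphism :: "('o, 'a, 'x) cat_scheme \<Rightarrow> 'a \<Rightarrow> bool" where
  "isomorphism C f \<longleftrightarrow> (\<exists>g. is_inverse C f g)"

definition inv_arr :: "('o, 'a, 'x) cat_scheme \<Rightarrow> 'a \<Rightarrow> 'a" where
  "inv_arr C f = (THE g. is_inverse C f g)"

definition monomorphism :: "('o, 'a, 'x) cat_scheme \<Rightarrow> 'a \<Rightarrow> bool" where
  "monomorphism C m \<longleftrightarrow> m \<in> Arr C \<and>
     (\<forall>g\<in>Arr C. \<forall>h\<in>Arr C. Cod C g = Dom C m \<and> Cod C h = Dom C m \<and> Dom C g = Dom C h \<and>
        m \<cdot>\<^bsub>C\<^esub> g = m \<cdot>\<^bsub>C\<^esub> h \<longrightarrow> g = h)"

definition left_cancellative :: "('o, 'a, 'x) cat_scheme \<Rightarrow> bool" where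
  "left_cancellative C \<longleftrightarrow> (\<forall>m\<in>Arr C. monomorphism C m)"

definition is_functor ::
  "('o, 'a, 'x) cat_scheme \<Rightarrow> ('p, 'b, 'y) cat_scheme \<Rightarrow> ('o \<Rightarrow> 'p) \<Rightarrow> ('a \<Rightarrow> 'b) \<Rightarrow> bool" where
  "is_functor C D Fo Fa \<longleftrightarrow> category C \<and> category D \<and>
     (\<forall>A\<in>Obj C. Fo A \<in> Obj D \<and> Fa (Ide C A) = Ide D (Fo A)) \<and>
     (\<forall>f\<in>Arr C. Fa f \<in> Arr D \<and> Dom D (Fa f) = Fo (Dom C f) \<and> Cod D (Fa f) = Fo (Cod C f)) \<and>
     (\<forall>f\<in>Arr C. \<forall>g\<in>Arr C. Cod C f = Dom C g \<longrightarrow> Fa (g \<cdot>\<^bsub>C\<^esub> f) = Fa g \<cdot>\<^bsub>D\<^esub> Fa f)"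

record 'u fct =
  omap :: "'u \<Rightarrow> 'u"
  amap :: "'u \<Rightarrow> 'u"

definition small_functor ::
  "('u, 'u, 'x) cat_scheme \<Rightarrow> ('u, 'u, 'y) cat_scheme \<Rightarrow> 'u fct \<Rightarrow> bool" where
  "small_functor C D F \<longleftrightarrow> is_functor C D (omap F) (amap F) \<and>
     omap F \<in> extensional (Obj C) \<and> amap F \<in> extensional (Arr C)"

definition fct_id :: "('u, 'u, 'x) cat_scheme \<Rightarrow> 'u fct" where
  "fct_id C = \<lparr>omap = \<lambda>A\<in>Obj C. A, amap = \<lambda>f\<in>Arr C. f\<rparr>"

definition fct_comp :: "('u, 'u, 'x) cat_scheme \<Rightarrow> 'u fct \<Rightarrow> 'u fct \<Rightarrow> 'u fct" where
  "fct_comp C G F = \<lparr>omap = \<lambda>A\<in>Obj C. omap G (omap F A), amap = \<lambda>f\<in>Arr C. amap G (amap F f)\<rparr>"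

definition nat_transformation ::
  "('u, 'u, 'x) cat_scheme \<Rightarrow> ('u, 'u, 'y) cat_scheme \<Rightarrow> 'u fct \<Rightarrow> 'u fct \<Rightarrow> ('u \<Rightarrow> 'u) \<Rightarrow> bool" where
  "nat_transformation C D F G \<theta> \<longleftrightarrow> \<theta> \<in> extensional (Obj C) \<and>
     (\<forall>A\<in>Obj C. \<theta> A \<in> Arr D \<and> Dom D (\<theta> A) = omap F A \<and> Cod D (\<theta> A) = omap G A) \<and>
     (\<forall>f\<in>Arr C. amap G f \<cdot>\<^bsub>D\<^esub> \<theta> (Dom C f) = \<theta> (Cod C f) \<cdot>\<^bsub>D\<^esub> amap F f)"


section \<open>Strict 2-categories, 2-adjunctions and equivalences\<close>

text \<open>
  A 2-category is given by three categories: \<open>One\<close> has the 0-cells and 1-cells, \<open>Vert\<close> the 1-cells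
  and the 2-cells under vertical composition, \<open>Horz\<close> the 0-cells and the 2-cells under horizontal
  composition.
\<close>

record ('o, 'm, 'c) twocat =
  One :: "('o, 'm) cat"
  Vert :: "('m, 'c) cat"
  Horz :: "('o, 'c) cat"

definition two_category :: "('o, 'm, 'c) twocat \<Rightarrow> bool" where
  "two_category K \<longleftrightarrow> category (One K) \<and> category (Vert K) \<and> category (Horz K) \<and>
     Obj (Vert K) = Arr (One K) \<and> Obj (Horz K) = Obj (One K) \<and> Arr (Horz K) = Arr (Vert K) \<and>
     (\<forall>a\<in>Arr (Vert K).
        Dom (Horz K) a = Dom (One K) (Dom (Vert K) a) \<and>
        Dom (Horz K) a = Dom (One K) (Cod (Vert K) a) \<and>
        Cod (Horz K) a = Cod (One K) (Dom (Vert K) a) \<and>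
        Cod (Horz K) a = Cod (One K) (Cod (Vert K) a)) \<and>
     (\<forall>A\<in>Obj (One K). Ide (Horz K) A = Ide (Vert K) (Ide (One K) A)) \<and>
     (\<forall>a\<in>Arr (Vert K). \<forall>b\<in>Arr (Vert K). Cod (Horz K) a = Dom (Horz K) b \<longrightarrow>
        Dom (Vert K) (b \<cdot>\<^bsub>Horz K\<^esub> a) = Dom (Vert K) b \<cdot>\<^bsub>One K\<^esub> Dom (Vert K) a \<and>
        Cod (Vert K) (b \<cdot>\<^bsub>Horz K\<^esub> a) = Cod (Vert K) b \<cdot>\<^bsub>One K\<^esub> Cod (Vert K) a) \<and>
     (\<forall>f\<in>Arr (One K). \<forall>g\<in>Arr (One K). Cod (One K) f = Dom (One K) g \<longrightarrow>
        Ide (Vert K) g \<cdot>\<^bsub>Horz K\<^esub> Ide (Vert K) f = Ide (Vert K) (g \<cdot>\<^bsub>One K\<^esub> f)) \<and>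
     (\<forall>a\<in>Arr (Vert K). \<forall>a'\<in>Arr (Vert K). \<forall>b\<in>Arr (Vert K). \<forall>b'\<in>Arr (Vert K).
        Cod (Vert K) a = Dom (Vert K) a' \<and> Cod (Vert K) b = Dom (Vert K) b' \<and>
        Cod (Horz K) a = Dom (Horz K) b \<longrightarrow>
        (b' \<cdot>\<^bsub>Vert K\<^esub> b) \<cdot>\<^bsub>Horz K\<^esub> (a' \<cdot>\<^bsub>Vert K\<^esub> a) = (b' \<cdot>\<^bsub>Horz K\<^esub> a') \<cdot>\<^bsub>Vert K\<^esub> (b \<cdot>\<^bsub>Horz K\<^esub> a))"

record ('o, 'm, 'c, 'p, 'n, 'd) twofun =
  map0 :: "'o \<Rightarrow> 'p"
  map1 :: "'m \<Rightarrow> 'n"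
  map2 :: "'c \<Rightarrow> 'd"

definition two_functor ::
  "('o, 'm, 'c) twocat \<Rightarrow> ('p, 'n, 'd) twocat \<Rightarrow> ('o, 'm, 'c, 'p, 'n, 'd) twofun \<Rightarrow> bool" where
  "two_functor K K' F \<longleftrightarrow> two_category K \<and> two_category K' \<and>
     is_functor (One K) (One K') (map0 F) (map1 F) \<and>
     is_functor (Vert K) (Vert K') (map1 F) (map2 F) \<and>
     is_functor (Horz K) (Horz K') (map0 F) (map2 F)"

definition two_id :: "('o, 'm, 'c, 'o, 'm, 'c) twofun" where
  "two_id = \<lparr>map0 = id, map1 = id, map2 = id\<rparr>"

definition two_comp ::
  "('p, 'n, 'd, 'q, 'r, 'e) twofun \<Rightarrow> ('o, 'm, 'c, 'p, 'n, 'd) twofun \<Rightarrow>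
   ('o, 'm, 'c, 'q, 'r, 'e) twofun" where
  "two_comp G F = \<lparr>map0 = map0 G \<circ> map0 F, map1 = map1 G \<circ> map1 F, map2 = map2 G \<circ> map2 F\<rparr>"

definition two_natural ::
  "('o, 'm, 'c) twocat \<Rightarrow> ('p, 'n, 'd) twocat \<Rightarrow> ('o, 'm, 'c, 'p, 'n, 'd) twofun \<Rightarrow>
   ('o, 'm, 'c, 'p, 'n, 'd) twofun \<Rightarrow> ('o \<Rightarrow> 'n) \<Rightarrow> bool" where
  "two_natural K K' F G \<eta> \<longleftrightarrow>
     (\<forall>A\<in>Obj (One K). \<eta> A \<in> Arr (One K') \<and>
        Dom (One K') (\<eta> A) = map0 F A \<and> Cod (One K') (\<eta> A) = map0 G A) \<and>
     (\<forall>f\<in>Arr (One K).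
        map1 G f \<cdot>\<^bsub>One K'\<^esub> \<eta> (Dom (One K) f) = \<eta> (Cod (One K) f) \<cdot>\<^bsub>One K'\<^esub> map1 F f) \<and>
     (\<forall>a\<in>Arr (Vert K).
        map2 G a \<cdot>\<^bsub>Horz K'\<^esub> Ide (Vert K') (\<eta> (Dom (Horz K) a)) =
        Ide (Vert K') (\<eta> (Cod (Horz K) a)) \<cdot>\<^bsub>Horz K'\<^esub> map2 F a)"

definition two_adjunction ::
  "('o, 'm, 'c) twocat \<Rightarrow> ('p, 'n, 'd) twocat \<Rightarrow> ('o, 'm, 'c, 'p, 'n, 'd) twofun \<Rightarrow>
   ('p, 'n, 'd, 'o, 'm, 'c) twofun \<Rightarrow> ('o \<Rightarrow> 'm) \<Rightarrow> ('p \<Rightarrow> 'n) \<Rightarrow> bool" where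
  "two_adjunction K K' F G \<eta> \<epsilon> \<longleftrightarrow> two_functor K K' F \<and> two_functor K' K G \<and>
     two_natural K K two_id (two_comp G F) \<eta> \<and> two_natural K' K' (two_comp F G) two_id \<epsilon> \<and>
     (\<forall>A\<in>Obj (One K). \<epsilon> (map0 F A) \<cdot>\<^bsub>One K'\<^esub> map1 F (\<eta> A) = Ide (One K') (map0 F A)) \<and>
     (\<forall>B\<in>Obj (One K'). map1 G (\<epsilon> B) \<cdot>\<^bsub>One K\<^esub> \<eta> (map0 G B) = Ide (One K) (map0 G B))"

definition equivalence_in :: "('o, 'm, 'c) twocat \<Rightarrow> 'm \<Rightarrow> bool" where
  "equivalence_in K f \<longleftrightarrow> f \<in> Arr (One K) \<and>
     (\<exists>g\<in>Arr (One K). Dom (One K) g = Cod (One K) f \<and> Cod (One K) g = Dom (One K) f \<and>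
        (\<exists>a. isomorphism (Vert K) a \<and>
           Dom (Vert K) a = Ide (One K) (Dom (One K) f) \<and> Cod (Vert K) a = g \<cdot>\<^bsub>One K\<^esub> f) \<and>
        (\<exists>b. isomorphism (Vert K) b \<and>
           Dom (Vert K) b = f \<cdot>\<^bsub>One K\<^esub> g \<and> Cod (Vert K) b = Ide (One K) (Cod (One K) f)))"

definition two_adjoint_biequivalence ::
  "('o, 'm, 'c) twocat \<Rightarrow> ('p, 'n, 'd) twocat \<Rightarrow> ('o, 'm, 'c, 'p, 'n, 'd) twofun \<Rightarrow>
   ('p, 'n, 'd, 'o, 'm, 'c) twofun \<Rightarrow> bool" where
  "two_adjoint_biequivalence K K' F G \<longleftrightarrow>
     (\<exists>\<eta> \<epsilon>. two_adjunction K K' F G \<eta> \<epsilon> \<and>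
        (\<forall>A\<in>Obj (One K). equivalence_in K (\<eta> A)) \<and>
        (\<forall>B\<in>Obj (One K'). equivalence_in K' (\<epsilon> B)))"


section \<open>Grothendieck sites\<close>

definition sieve :: "('o, 'a, 'x) cat_scheme \<Rightarrow> 'o \<Rightarrow> 'a set \<Rightarrow> bool" where
  "sieve C A S \<longleftrightarrow> A \<in> Obj C \<and> S \<subseteq> {f \<in> Arr C. Cod C f = A} \<and>
     (\<forall>f\<in>S. \<forall>g\<in>Arr C. Cod C g = Dom C f \<longrightarrow> f \<cdot>\<^bsub>C\<^esub> g \<in> S)"

definition sieve_pullback :: "('o, 'a, 'x) cat_scheme \<Rightarrow> 'a \<Rightarrow> 'a set \<Rightarrow> 'a set" where
  "sieve_pullback C f S = {g \<in> Arr C. Cod C g = Dom C f \<and> f \<cdot>\<^bsub>C\<^esub> g \<in> S}"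

definition generated_sieve :: "('o, 'a, 'x) cat_scheme \<Rightarrow> 'a set \<Rightarrow> 'a set" where
  "generated_sieve C R = {f \<cdot>\<^bsub>C\<^esub> g | f g. f \<in> R \<and> g \<in> Arr C \<and> Cod C g = Dom C f}"

text \<open>The first condition also makes \<open>J A\<close> empty when \<open>A\<close> is not an object.\<close>

definition grothendieck_topology :: "('o, 'a, 'x) cat_scheme \<Rightarrow> ('o \<Rightarrow> 'a set set) \<Rightarrow> bool" where
  "grothendieck_topology C J \<longleftrightarrow>
     (\<forall>A. \<forall>S\<in>J A. sieve C A S) \<and>
     (\<forall>A\<in>Obj C. {f \<in> Arr C. Cod C f = A} \<in> J A) \<and>
     (\<forall>f\<in>Arr C. \<forall>S\<in>J (Cod C f). sieve_pullback C f S \<in> J (Dom C f)) \<and>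
     (\<forall>A\<in>Obj C. \<forall>S\<in>J A. \<forall>R. sieve C A R \<and> (\<forall>f\<in>S. sieve_pullback C f R \<in> J (Dom C f)) \<longrightarrow> R \<in> J A)"

type_synonym 'u gsite = "('u, 'u) cat \<times> ('u \<Rightarrow> 'u set set)"

definition cover_preserving ::
  "('u, 'u) cat \<times> ('u \<Rightarrow> 'u set set) \<Rightarrow> ('u, 'u) cat \<times> ('u \<Rightarrow> 'u set set) \<Rightarrow> 'u fct \<Rightarrow> bool" where
  "cover_preserving X Y F \<longleftrightarrow>
     (\<forall>A\<in>Obj (fst X). \<forall>S\<in>snd X A. generated_sieve (fst Y) (amap F ` S) \<in> snd Y (omap F A))"

definition cone ::
  "('u, 'u, 'x) cat_scheme \<Rightarrow> ('u, 'u, 'y) cat_scheme \<Rightarrow> 'u fct \<Rightarrow> 'u \<Rightarrow> ('u \<Rightarrow> 'u) \<Rightarrow> bool" where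
  "cone I C D U \<tau> \<longleftrightarrow> U \<in> Obj C \<and>
     (\<forall>i\<in>Obj I. \<tau> i \<in> Arr C \<and> Dom C (\<tau> i) = U \<and> Cod C (\<tau> i) = omap D i) \<and>
     (\<forall>u\<in>Arr I. amap D u \<cdot>\<^bsub>C\<^esub> \<tau> (Dom I u) = \<tau> (Cod I u))"

definition cover_flat ::
  "('u::universe) gsite \<Rightarrow> 'u gsite \<Rightarrow> 'u fct \<Rightarrow> bool" where
  "cover_flat X Y F \<longleftrightarrow>
     (\<forall>(I :: ('u, 'u) cat) D U \<tau>.
        finite_category I \<and> small_functor I (fst X) D \<and> cone I (fst Y) (fct_comp I F D) U \<tau> \<longrightarrow>
        {h \<in> Arr (fst Y). Cod (fst Y) h = U \<and>
           (\<exists>W \<sigma>. cone I (fst X) D W \<sigma> \<and>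
              (\<exists>g\<in>Arr (fst Y). Dom (fst Y) g = Dom (fst Y) h \<and> Cod (fst Y) g = omap F W \<and>
                 (\<forall>i\<in>Obj I. \<tau> i \<cdot>\<^bsub>fst Y\<^esub> h = amap F (\<sigma> i) \<cdot>\<^bsub>fst Y\<^esub> g)))} \<in> snd Y U)"

text \<open>A 1-cell, between sites whose first component is the underlying category or groupoid.\<close>

record ('s, 'u) morph =
  src :: 's
  tgt :: 's
  fct :: "'u fct"

definition morph_id ::
  "('u, 'u, 'x) cat_scheme \<times> 't \<Rightarrow> (('u, 'u, 'x) cat_scheme \<times> 't, 'u) morph" where
  "morph_id X = \<lparr>src = X, tgt = X, fct = fct_id (fst X)\<rparr>"

definition morph_comp ::
  "(('u, 'u, 'x) cat_scheme \<times> 't, 'u) morph \<Rightarrow> (('u, 'u, 'x) cat_scheme \<times> 't, 'u) morph \<Rightarrow>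
   (('u, 'u, 'x) cat_scheme \<times> 't, 'u) morph" where
  "morph_comp G F =
     \<lparr>src = src F, tgt = tgt G, fct = fct_comp (fst (src F)) (fct G) (fct F)\<rparr>"

record 'u nat2 =
  nsrc :: "('u gsite, 'u) morph"
  ntgt :: "('u gsite, 'u) morph"
  ncomp :: "'u \<Rightarrow> 'u"

definition nat2_id :: "('u gsite, 'u) morph \<Rightarrow> 'u nat2" where
  "nat2_id F = \<lparr>nsrc = F, ntgt = F,
     ncomp = \<lambda>A\<in>Obj (fst (src F)). Ide (fst (tgt F)) (omap (fct F) A)\<rparr>"

definition nat2_vcomp :: "'u nat2 \<Rightarrow> 'u nat2 \<Rightarrow> 'u nat2" where
  "nat2_vcomp \<phi> \<theta> = \<lparr>nsrc = nsrc \<theta>, ntgt = ntgt \<phi>,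
     ncomp = \<lambda>A\<in>Obj (fst (src (nsrc \<theta>))). ncomp \<phi> A \<cdot>\<^bsub>fst (tgt (nsrc \<theta>))\<^esub> ncomp \<theta> A\<rparr>"

definition nat2_hcomp :: "'u nat2 \<Rightarrow> 'u nat2 \<Rightarrow> 'u nat2" where
  "nat2_hcomp \<phi> \<theta> = \<lparr>nsrc = morph_comp (nsrc \<phi>) (nsrc \<theta>), ntgt = morph_comp (ntgt \<phi>) (ntgt \<theta>),
     ncomp = \<lambda>A\<in>Obj (fst (src (nsrc \<theta>))).
       ncomp \<phi> (omap (fct (ntgt \<theta>)) A) \<cdot>\<^bsub>fst (tgt (nsrc \<phi>))\<^esub> amap (fct (nsrc \<phi>)) (ncomp \<theta> A)\<rparr>"

definition lc_sites :: "('u::universe) gsite set" where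
  "lc_sites = {(C, J). small_category C \<and> left_cancellative C \<and> grothendieck_topology C J}"

definition lc_morphs :: "(('u::universe) gsite, 'u) morph set" where
  "lc_morphs = {F. src F \<in> lc_sites \<and> tgt F \<in> lc_sites \<and>
     small_functor (fst (src F)) (fst (tgt F)) (fct F) \<and>
     cover_preserving (src F) (tgt F) (fct F) \<and> cover_flat (src F) (tgt F) (fct F)}"

definition lc_nats :: "('u::universe) nat2 set" where
  "lc_nats = {\<theta>. nsrc \<theta> \<in> lc_morphs \<and> ntgt \<theta> \<in> lc_morphs \<and>
     src (nsrc \<theta>) = src (ntgt \<theta>) \<and> tgt (nsrc \<theta>) = tgt (ntgt \<theta>) \<and>
     nat_transformation (fst (src (nsrc \<theta>))) (fst (tgt (nsrc \<theta>)))
       (fct (nsrc \<theta>)) (fct (ntgt \<theta>)) (ncomp \<theta>)}"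

definition lcGsite :: "(('u::universe) gsite, ('u gsite, 'u) morph, 'u nat2) twocat" where
  "lcGsite = \<lparr>
     One = \<lparr>Obj = lc_sites, Arr = lc_morphs, Dom = src, Cod = tgt,
            Ide = morph_id, Cmp = morph_comp\<rparr>,
     Vert = \<lparr>Obj = lc_morphs, Arr = lc_nats, Dom = nsrc, Cod = ntgt,
             Ide = nat2_id, Cmp = nat2_vcomp\<rparr>,
     Horz = \<lparr>Obj = lc_sites, Arr = lc_nats, Dom = \<lambda>\<theta>. src (nsrc \<theta>), Cod = \<lambda>\<theta>. tgt (nsrc \<theta>),
             Ide = \<lambda>X. nat2_id (morph_id X), Cmp = nat2_hcomp\<rparr>\<rparr>"


section \<open>Ordered groupoids\<close>

record ('o, 'a) ogpd = "('o, 'a) cat" +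
  Le :: "('a \<times> 'a) set"

definition ole :: "('o, 'a, 'x) ogpd_scheme \<Rightarrow> 'o \<Rightarrow> 'o \<Rightarrow> bool" where
  "ole \<G> A B \<longleftrightarrow> A \<in> Obj \<G> \<and> B \<in> Obj \<G> \<and> (Ide \<G> A, Ide \<G> B) \<in> Le \<G>"

definition restr :: "('o, 'a, 'x) ogpd_scheme \<Rightarrow> 'a \<Rightarrow> 'o \<Rightarrow> 'a" where
  "restr \<G> f A = (THE g. g \<in> Arr \<G> \<and> Dom \<G> g = A \<and> (g, f) \<in> Le \<G>)"

definition ordered_groupoid :: "('u::universe, 'u, 'x) ogpd_scheme \<Rightarrow> bool" where
  "ordered_groupoid \<G> \<longleftrightarrow> small_category \<G> \<and> (\<forall>f\<in>Arr \<G>. isomorphism \<G> f) \<and>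
     Le \<G> \<subseteq> Arr \<G> \<times> Arr \<G> \<and> partial_order_on (Arr \<G>) (Le \<G>) \<and>
     (\<forall>a b. (a, b) \<in> Le \<G> \<longrightarrow> (inv_arr \<G> a, inv_arr \<G> b) \<in> Le \<G>) \<and>
     (\<forall>a b c d. (a, b) \<in> Le \<G> \<and> (c, d) \<in> Le \<G> \<and> Dom \<G> a = Cod \<G> c \<and> Dom \<G> b = Cod \<G> d \<longrightarrow>
        (a \<cdot>\<^bsub>\<G>\<^esub> c, b \<cdot>\<^bsub>\<G>\<^esub> d) \<in> Le \<G>) \<and>
     (\<forall>f\<in>Arr \<G>. \<forall>A. ole \<G> A (Dom \<G> f) \<longrightarrow>
        (\<exists>!g. g \<in> Arr \<G> \<and> Dom \<G> g = A \<and> (g, f) \<in> Le \<G>))"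

definition double_functor ::
  "('u, 'u, 'x) ogpd_scheme \<Rightarrow> ('u, 'u, 'y) ogpd_scheme \<Rightarrow> 'u fct \<Rightarrow> bool" where
  "double_functor \<G> \<H> F \<longleftrightarrow> small_functor \<G> \<H> F \<and>
     (\<forall>a b. (a, b) \<in> Le \<G> \<longrightarrow> (amap F a, amap F b) \<in> Le \<H>)"

definition hor_transformation ::
  "('u, 'u, 'x) ogpd_scheme \<Rightarrow> ('u, 'u, 'y) ogpd_scheme \<Rightarrow> 'u fct \<Rightarrow> 'u fct \<Rightarrow> ('u \<Rightarrow> 'u) \<Rightarrow> bool" where
  "hor_transformation \<G> \<H> F G \<alpha> \<longleftrightarrow> nat_transformation \<G> \<H> F G \<alpha> \<and>
     (\<forall>X Y. ole \<G> X Y \<longrightarrow> (\<alpha> X, \<alpha> Y) \<in> Le \<H>)"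

definition fct_le ::
  "('u, 'u, 'x) ogpd_scheme \<Rightarrow> ('u, 'u, 'y) ogpd_scheme \<Rightarrow> 'u fct \<Rightarrow> 'u fct \<Rightarrow> bool" where
  "fct_le \<G> \<H> F G \<longleftrightarrow> (\<forall>h\<in>Arr \<G>. (amap F h, amap G h) \<in> Le \<H>)"

definition has_unique_maximal :: "('o, 'a, 'x) ogpd_scheme \<Rightarrow> bool" where
  "has_unique_maximal \<G> \<longleftrightarrow>
     (\<forall>A\<in>Obj \<G>. \<exists>!M. ole \<G> A M \<and> (\<forall>N. ole \<G> M N \<longrightarrow> N = M))"


section \<open>Ehresmann sites\<close>

definition vsieve :: "('o, 'a, 'x) ogpd_scheme \<Rightarrow> 'o \<Rightarrow> 'o set \<Rightarrow> bool" where
  "vsieve \<G> A \<A> \<longleftrightarrow> A \<in> Obj \<G> \<and> \<A> \<subseteq> {A'. ole \<G> A' A} \<and> (\<forall>B\<in>\<A>. \<forall>B'. ole \<G> B' B \<longrightarrow> B' \<in> \<A>)"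

definition vsieve_pullback :: "('o, 'a, 'x) ogpd_scheme \<Rightarrow> 'a \<Rightarrow> 'o set \<Rightarrow> 'o set" where
  "vsieve_pullback \<G> f \<B> = {A'. ole \<G> A' (Dom \<G> f) \<and> Cod \<G> (restr \<G> f A') \<in> \<B>}"

definition generated_vsieve :: "('o, 'a, 'x) ogpd_scheme \<Rightarrow> 'o set \<Rightarrow> 'o set" where
  "generated_vsieve \<G> \<A> = {B. \<exists>A\<in>\<A>. ole \<G> B A}"

definition ehresmann_topology :: "('o, 'a, 'x) ogpd_scheme \<Rightarrow> ('o \<Rightarrow> 'o set set) \<Rightarrow> bool" where
  "ehresmann_topology \<G> T \<longleftrightarrow>
     (\<forall>A. \<forall>\<A>\<in>T A. vsieve \<G> A \<A>) \<and>
     (\<forall>A\<in>Obj \<G>. {A'. ole \<G> A' A} \<in> T A) \<and>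
     (\<forall>B\<in>Obj \<G>. \<forall>\<B>\<in>T B. \<forall>f\<in>Arr \<G>. ole \<G> (Cod \<G> f) B \<longrightarrow>
        vsieve_pullback \<G> f \<B> \<in> T (Dom \<G> f)) \<and>
     (\<forall>A\<in>Obj \<G>. \<forall>\<A>\<in>T A. \<forall>\<B>. vsieve \<G> A \<B> \<and>
        (\<forall>f\<in>Arr \<G>. Cod \<G> f \<in> \<A> \<longrightarrow> vsieve_pullback \<G> f \<B> \<in> T (Dom \<G> f)) \<longrightarrow> \<B> \<in> T A)"

type_synonym 'u esite = "('u, 'u) ogpd \<times> ('u \<Rightarrow> 'u set set)"

definition vcover_preserving :: "'u esite \<Rightarrow> 'u esite \<Rightarrow> 'u fct \<Rightarrow> bool" where
  "vcover_preserving X Y M \<longleftrightarrow>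
     (\<forall>A\<in>Obj (fst X). \<forall>\<A>\<in>snd X A. generated_vsieve (fst Y) (omap M ` \<A>) \<in> snd Y (omap M A))"

text \<open>The object \<open>E\<^sub>i\<close> below \<open>D\<^sub>i\<close> of an hv-cone is recorded as the codomain of \<open>\<xi> i\<close>.\<close>

definition hv_cone ::
  "('u, 'u, 'x) ogpd_scheme \<Rightarrow> ('u, 'u, 'y) ogpd_scheme \<Rightarrow> 'u fct \<Rightarrow> 'u \<Rightarrow> ('u \<Rightarrow> 'u) \<Rightarrow> bool" where
  "hv_cone I \<G> D U \<xi> \<longleftrightarrow> U \<in> Obj \<G> \<and>
     (\<forall>i\<in>Obj I. \<xi> i \<in> Arr \<G> \<and> Dom \<G> (\<xi> i) = U \<and> ole \<G> (Cod \<G> (\<xi> i)) (omap D i)) \<and>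
     (\<forall>u\<in>Arr I.
        Cod \<G> (restr \<G> (amap D u) (Cod \<G> (\<xi> (Dom I u)))) = Cod \<G> (\<xi> (Cod I u)) \<and>
        restr \<G> (amap D u) (Cod \<G> (\<xi> (Dom I u))) \<cdot>\<^bsub>\<G>\<^esub> \<xi> (Dom I u) = \<xi> (Cod I u)) \<and>
     (\<forall>i j. ole I i j \<longrightarrow> \<xi> i = \<xi> j)"

definition vcover_flat :: "('u::universe) esite \<Rightarrow> 'u esite \<Rightarrow> 'u fct \<Rightarrow> bool" where
  "vcover_flat X Y M \<longleftrightarrow>
     (\<forall>(I :: ('u, 'u) ogpd) D U \<xi>.
        ordered_groupoid I \<and> finite_category I \<and> double_functor I (fst X) D \<and>
        hv_cone I (fst Y) (fct_comp I M D) U \<xi> \<longrightarrow>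
        (\<exists>\<U>\<in>snd Y U. \<forall>U'\<in>\<U>.
           \<exists>T \<theta> h. hv_cone I (fst X) D T \<theta> \<and>
             h \<in> Arr (fst Y) \<and> Dom (fst Y) h = U' \<and> ole (fst Y) (Cod (fst Y) h) (omap M T) \<and>
             (\<forall>i\<in>Obj I. restr (fst Y) (\<xi> i) U' =
                restr (fst Y) (amap M (\<theta> i)) (Cod (fst Y) h) \<cdot>\<^bsub>fst Y\<^esub> h)))"

text \<open>
  A \<open>\<Lambda>\<close>-transformation from \<open>lsrc\<close> to \<open>ltgt\<close>; the double functor below \<open>ltgt\<close> is \<open>lmid\<close>.
\<close>

record 'u lam2 =
  lsrc :: "('u esite, 'u) morph"
  ltgt :: "('u esite, 'u) morph"
  lmid :: "'u fct"
  lcomp :: "'u \<Rightarrow> 'u"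

definition lam_transformation ::
  "('u, 'u, 'x) ogpd_scheme \<Rightarrow> ('u, 'u, 'y) ogpd_scheme \<Rightarrow> 'u fct \<Rightarrow> 'u fct \<Rightarrow> 'u fct \<Rightarrow>
   ('u \<Rightarrow> 'u) \<Rightarrow> bool" where
  "lam_transformation \<G> \<H> F G G' \<alpha> \<longleftrightarrow>
     double_functor \<G> \<H> G' \<and> fct_le \<G> \<H> G' G \<and> hor_transformation \<G> \<H> F G' \<alpha>"

definition lam2_id :: "('u esite, 'u) morph \<Rightarrow> 'u lam2" where
  "lam2_id F = \<lparr>lsrc = F, ltgt = F, lmid = fct F,
     lcomp = \<lambda>X\<in>Obj (fst (src F)). Ide (fst (tgt F)) (omap (fct F) X)\<rparr>"

text \<open>
  For \<open>\<alpha> : F \<Rightarrow> G' \<le> G\<close> and \<open>\<gamma> : G \<Rightarrow> H' \<le> H\<close>, the double functor below \<open>H\<close> in the vertical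
  composite sends \<open>X\<close> to the codomain of \<open>\<gamma>\<^sub>X\<close> restricted to \<open>G' X\<close>, and is the restriction of \<open>H'\<close>
  to these objects on arrows.
\<close>

definition lam2_vcomp :: "'u lam2 \<Rightarrow> 'u lam2 \<Rightarrow> 'u lam2" where
  "lam2_vcomp \<gamma> \<alpha> =
     (let \<G> = fst (src (lsrc \<alpha>)); \<H> = fst (tgt (lsrc \<alpha>));
          r = (\<lambda>X. restr \<H> (lcomp \<gamma> X) (omap (lmid \<alpha>) X))
      in \<lparr>lsrc = lsrc \<alpha>, ltgt = ltgt \<gamma>,
          lmid = \<lparr>omap = \<lambda>X\<in>Obj \<G>. Cod \<H> (r X),
                  amap = \<lambda>h\<in>Arr \<G>. restr \<H> (amap (lmid \<gamma>) h) (Cod \<H> (r (Dom \<G> h)))\<rparr>,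
          lcomp = \<lambda>X\<in>Obj \<G>. r X \<cdot>\<^bsub>\<H>\<^esub> lcomp \<alpha> X\<rparr>)"

definition lam2_whisker_right :: "'u lam2 \<Rightarrow> ('u esite, 'u) morph \<Rightarrow> 'u lam2" where
  "lam2_whisker_right \<beta> F =
     \<lparr>lsrc = morph_comp (lsrc \<beta>) F, ltgt = morph_comp (ltgt \<beta>) F,
      lmid = fct_comp (fst (src F)) (lmid \<beta>) (fct F),
      lcomp = \<lambda>X\<in>Obj (fst (src F)). lcomp \<beta> (omap (fct F) X)\<rparr>"

definition lam2_whisker_left :: "('u esite, 'u) morph \<Rightarrow> 'u lam2 \<Rightarrow> 'u lam2" where
  "lam2_whisker_left H \<alpha> =
     \<lparr>lsrc = morph_comp H (lsrc \<alpha>), ltgt = morph_comp H (ltgt \<alpha>),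
      lmid = fct_comp (fst (src (lsrc \<alpha>))) (fct H) (lmid \<alpha>),
      lcomp = \<lambda>X\<in>Obj (fst (src (lsrc \<alpha>))). amap (fct H) (lcomp \<alpha> X)\<rparr>"

definition lam2_hcomp :: "'u lam2 \<Rightarrow> 'u lam2 \<Rightarrow> 'u lam2" where
  "lam2_hcomp \<beta> \<alpha> =
     lam2_vcomp (lam2_whisker_right \<beta> (ltgt \<alpha>)) (lam2_whisker_left (lsrc \<beta>) \<alpha>)"

definition max_sites :: "('u::universe) esite set" where
  "max_sites = {(\<G>, T). ordered_groupoid \<G> \<and> has_unique_maximal \<G> \<and> ehresmann_topology \<G> T}"

definition max_morphs :: "(('u::universe) esite, 'u) morph set" where
  "max_morphs = {F. src F \<in> max_sites \<and> tgt F \<in> max_sites \<and>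
     double_functor (fst (src F)) (fst (tgt F)) (fct F) \<and>
     vcover_preserving (src F) (tgt F) (fct F) \<and> vcover_flat (src F) (tgt F) (fct F)}"

definition max_lams :: "('u::universe) lam2 set" where
  "max_lams = {\<alpha>. lsrc \<alpha> \<in> max_morphs \<and> ltgt \<alpha> \<in> max_morphs \<and>
     src (lsrc \<alpha>) = src (ltgt \<alpha>) \<and> tgt (lsrc \<alpha>) = tgt (ltgt \<alpha>) \<and>
     lam_transformation (fst (src (lsrc \<alpha>))) (fst (tgt (lsrc \<alpha>)))
       (fct (lsrc \<alpha>)) (fct (ltgt \<alpha>)) (lmid \<alpha>) (lcomp \<alpha>)}"

definition Esite_max :: "(('u::universe) esite, ('u esite, 'u) morph, 'u lam2) twocat" where
  "Esite_max = \<lparr>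
     One = \<lparr>Obj = max_sites, Arr = max_morphs, Dom = src, Cod = tgt,
            Ide = morph_id, Cmp = morph_comp\<rparr>,
     Vert = \<lparr>Obj = max_morphs, Arr = max_lams, Dom = lsrc, Cod = ltgt,
             Ide = lam2_id, Cmp = lam2_vcomp\<rparr>,
     Horz = \<lparr>Obj = max_sites, Arr = max_lams, Dom = \<lambda>\<alpha>. src (lsrc \<alpha>), Cod = \<lambda>\<alpha>. tgt (lsrc \<alpha>),
             Ide = \<lambda>X. lam2_id (morph_id X), Cmp = lam2_hcomp\<rparr>\<rparr>"


section \<open>The 2-functor \<open>L\<close>\<close>

text \<open>The arrow \<open>h : A \<rightarrow> B' \<le> B\<close> is coded as the pair of \<open>h\<close> and \<open>B\<close>.\<close>

definition L_arr :: "('u::universe, 'u) ogpd \<Rightarrow> 'u set" where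
  "L_arr \<G> = {vpair h B | h B. h \<in> Arr \<G> \<and> ole \<G> (Cod \<G> h) B}"

definition L_cat :: "('u::universe, 'u) ogpd \<Rightarrow> ('u, 'u) cat" where
  "L_cat \<G> = \<lparr>Obj = Obj \<G>, Arr = L_arr \<G>,
     Dom = \<lambda>x\<in>L_arr \<G>. Dom \<G> (vfst x),
     Cod = \<lambda>x\<in>L_arr \<G>. vsnd x,
     Ide = \<lambda>A\<in>Obj \<G>. vpair (Ide \<G> A) A,
     Cmp = \<lambda>y x. if x \<in> L_arr \<G> \<and> y \<in> L_arr \<G> \<and> vsnd x = Dom \<G> (vfst y)
       then vpair (restr \<G> (vfst y) (Cod \<G> (vfst x)) \<cdot>\<^bsub>\<G>\<^esub> vfst x) (vsnd y) else undefined\<rparr>"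

definition L_fct :: "('u::universe, 'u) ogpd \<Rightarrow> 'u fct \<Rightarrow> 'u fct" where
  "L_fct \<G> F = \<lparr>omap = \<lambda>A\<in>Obj \<G>. omap F A,
     amap = \<lambda>x\<in>L_arr \<G>. vpair (amap F (vfst x)) (omap F (vsnd x))\<rparr>"

definition J_of :: "('u::universe) esite \<Rightarrow> 'u \<Rightarrow> 'u set set" where
  "J_of X A = {S. sieve (L_cat (fst X)) A S \<and> (\<lambda>x. Cod (fst X) (vfst x)) ` S \<in> snd X A}"

definition L_site :: "('u::universe) esite \<Rightarrow> 'u gsite" where
  "L_site X = (L_cat (fst X), J_of X)"

definition L_morph :: "(('u::universe) esite, 'u) morph \<Rightarrow> ('u gsite, 'u) morph" where
  "L_morph F = \<lparr>src = L_site (src F), tgt = L_site (tgt F), fct = L_fct (fst (src F)) (fct F)\<rparr>"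

definition L_lam :: "('u::universe) lam2 \<Rightarrow> 'u nat2" where
  "L_lam \<alpha> = \<lparr>nsrc = L_morph (lsrc \<alpha>), ntgt = L_morph (ltgt \<alpha>),
     ncomp = \<lambda>X\<in>Obj (fst (src (lsrc \<alpha>))). vpair (lcomp \<alpha> X) (omap (fct (ltgt \<alpha>)) X)\<rparr>"

definition L_two ::
  "(('u::universe) esite, ('u esite, 'u) morph, 'u lam2, 'u gsite, ('u gsite, 'u) morph, 'u nat2) twofun"
  where "L_two = \<lparr>map0 = L_site, map1 = L_morph, map2 = L_lam\<rparr>"


section \<open>The 2-functor \<open>G\<close>\<close>

text \<open>Subobjects \<open>[m]\<close> and classes \<open>[m, n]\<close> of spans, coded as elements of the universe.\<close>

definition subob :: "('u::universe, 'u) cat \<Rightarrow> 'u \<Rightarrow> 'u" where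
  "subob C m = vset {m \<cdot>\<^bsub>C\<^esub> k | k. isomorphism C k \<and> Cod C k = Dom C m}"

definition spancl :: "('u::universe, 'u) cat \<Rightarrow> 'u \<Rightarrow> 'u \<Rightarrow> 'u" where
  "spancl C m n = vset {vpair (m \<cdot>\<^bsub>C\<^esub> k) (n \<cdot>\<^bsub>C\<^esub> k) | k. isomorphism C k \<and> Cod C k = Dom C m}"

definition is_span :: "('u, 'u) cat \<Rightarrow> 'u \<Rightarrow> 'u \<Rightarrow> bool" where
  "is_span C m n \<longleftrightarrow> m \<in> Arr C \<and> n \<in> Arr C \<and> Dom C m = Dom C n"

definition G_obj :: "('u::universe, 'u) cat \<Rightarrow> 'u set" where
  "G_obj C = subob C ` Arr C"

definition G_arr :: "('u::universe, 'u) cat \<Rightarrow> 'u set" where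
  "G_arr C = {spancl C m n | m n. is_span C m n}"

text \<open>
  In the composite, \<open>x = [k, m]\<close>, \<open>y = [m', n]\<close> and \<open>m = m' h\<close>.  On identities the order \<open>Le\<close> gives
  \<open>[n] \<le> [n']\<close> iff \<open>n = n' h\<close> for some \<open>h\<close>.
\<close>

definition G_ogpd :: "('u::universe, 'u) cat \<Rightarrow> ('u, 'u) ogpd" where
  "G_ogpd C = \<lparr>Obj = G_obj C, Arr = G_arr C,
     Dom = \<lambda>x\<in>G_arr C. THE X. \<exists>m n. is_span C m n \<and> x = spancl C m n \<and> X = subob C m,
     Cod = \<lambda>x\<in>G_arr C. THE X. \<exists>m n. is_span C m n \<and> x = spancl C m n \<and> X = subob C n,
     Ide = \<lambda>X\<in>G_obj C. THE x. \<exists>m\<in>Arr C. X = subob C m \<and> x = spancl C m m,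
     Cmp = \<lambda>y x.
       if \<exists>k m m' n. is_span C k m \<and> is_span C m' n \<and> x = spancl C k m \<and> y = spancl C m' n \<and>
            subob C m = subob C m'
       then THE z. \<exists>k m m' n h. is_span C k m \<and> is_span C m' n \<and>
              x = spancl C k m \<and> y = spancl C m' n \<and>
              isomorphism C h \<and> Cod C h = Dom C m' \<and> m = m' \<cdot>\<^bsub>C\<^esub> h \<and> z = spancl C k (n \<cdot>\<^bsub>C\<^esub> h)
       else undefined,
     Le = {(x, y). \<exists>m n m' n' h. is_span C m n \<and> is_span C m' n' \<and>
             x = spancl C m n \<and> y = spancl C m' n' \<and>
             h \<in> Arr C \<and> Cod C h = Dom C m' \<and> m = m' \<cdot>\<^bsub>C\<^esub> h \<and> n = n' \<cdot>\<^bsub>C\<^esub> h}\<rparr>"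

definition G_fct :: "('u::universe, 'u) cat \<Rightarrow> ('u, 'u) cat \<Rightarrow> 'u fct \<Rightarrow> 'u fct" where
  "G_fct C C' K = \<lparr>
     omap = \<lambda>X\<in>G_obj C. THE Y. \<exists>m\<in>Arr C. X = subob C m \<and> Y = subob C' (amap K m),
     amap = \<lambda>x\<in>G_arr C. THE y. \<exists>m n. is_span C m n \<and> x = spancl C m n \<and>
              y = spancl C' (amap K m) (amap K n)\<rparr>"

definition T_of :: "('u::universe) gsite \<Rightarrow> 'u \<Rightarrow> 'u set set" where
  "T_of X Y = {(\<lambda>n. subob (fst X) (m \<cdot>\<^bsub>fst X\<^esub> n)) ` S | m S.
     m \<in> Arr (fst X) \<and> Y = subob (fst X) m \<and> S \<in> snd X (Dom (fst X) m)}"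

definition G_site :: "('u::universe) gsite \<Rightarrow> 'u esite" where
  "G_site X = (G_ogpd (fst X), T_of X)"

definition G_morph :: "(('u::universe) gsite, 'u) morph \<Rightarrow> ('u esite, 'u) morph" where
  "G_morph F = \<lparr>src = G_site (src F), tgt = G_site (tgt F),
     fct = G_fct (fst (src F)) (fst (tgt F)) (fct F)\<rparr>"

definition G_nat :: "('u::universe) nat2 \<Rightarrow> 'u lam2" where
  "G_nat \<theta> =
     (let C = fst (src (nsrc \<theta>)); C' = fst (tgt (nsrc \<theta>));
          K = amap (fct (nsrc \<theta>)); K' = amap (fct (ntgt \<theta>));
          t = (\<lambda>m. K' m \<cdot>\<^bsub>C'\<^esub> ncomp \<theta> (Dom C m))
      in \<lparr>lsrc = G_morph (nsrc \<theta>), ltgt = G_morph (ntgt \<theta>),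
          lmid = \<lparr>
            omap = \<lambda>X\<in>G_obj C. THE Y. \<exists>m\<in>Arr C. X = subob C m \<and> Y = subob C' (t m),
            amap = \<lambda>x\<in>G_arr C. THE y. \<exists>m n. is_span C m n \<and> x = spancl C m n \<and>
                     y = spancl C' (t m) (t n)\<rparr>,
          lcomp = \<lambda>X\<in>G_obj C. THE x. \<exists>m\<in>Arr C. X = subob C m \<and> x = spancl C' (K m) (t m)\<rparr>)"

definition G_two ::
  "(('u::universe) gsite, ('u gsite, 'u) morph, 'u nat2, 'u esite, ('u esite, 'u) morph, 'u lam2) twofun"
  where "G_two = \<lparr>map0 = G_site, map1 = G_morph, map2 = G_nat\<rparr>"

end

theory Submission
  imports Defs
begin

text \<open>
  Everything on the side of ordered groupoids is read off from \<open>L\<close>.  A \<open>\<Lambda>\<close>-transformation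
  \<open>F \<Rightarrow> G' \<le> G\<close> is the same thing as a natural transformation \<open>L F \<Rightarrow> L G\<close>: its component at \<open>X\<close> is
  an arrow \<open>F X \<rightarrow> G' X \<le> G X\<close>, and \<open>G'\<close> is recovered as the restriction of \<open>G\<close> to the codomains.
  A double functor \<open>M\<close> preserves covers, or is covering flat, iff \<open>L M\<close> is.  So the laws of
  \<open>Esite_max\<close> are those of \<open>lcGsite\<close>, reflected along the faithful \<open>L\<close>.

  As for flatness, an hv-cone over \<open>D\<close> is a cone over \<open>L D\<close>, which gives one direction.  For the
  other, a finite diagram in \<open>L \<G>\<close> factors through a finite left-cancellative category \<open>Q\<close>, because
  \<open>L \<G>\<close> is left-cancellative, and its cones are those of the finite diagram \<open>G Q \<rightarrow> G L \<G> \<rightarrow> \<G>\<close>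
  in \<open>\<G>\<close>, since the unit \<open>Q \<rightarrow> L G Q\<close> is an equivalence.

  The unit \<open>\<eta>\<close> sends \<open>A\<close> to \<open>[id]\<close>; it is fully faithful and essentially surjective, and it preserves
  and reflects covers.  By its naturality, \<open>L G F\<close> is isomorphic to \<open>\<eta> F P\<close> for an inverse
  equivalence \<open>P\<close> of \<open>\<eta>\<close>, so \<open>G F\<close> is a morphism of sites when \<open>F\<close> is.  The counit sends
  \<open>[h : A \<rightarrow> B' \<le> B]\<close> to \<open>B'\<close>; its inverse sends \<open>B'\<close> to \<open>[B' \<le> M]\<close> with \<open>M\<close> the maximal object
  above \<open>B'\<close>, which is where maximal objects are needed.
\<close>

section \<open>Coding in the universe\<close>

text \<open>Two obstacles shape the argument. The two notions of flatness quantify over different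
  shapes, finite categories on one side and finite ordered groupoids on the other. Flatness is
  therefore split into a statement at one fixed diagram (\<open>flat_at\<close>,
  \<open>vflat_at\<close>), which can be compared along \<open>L_cat\<close> and transported along a
  full and essentially surjective change of shape. That class of changes contains the unit as well
  as the quotient functor onto \<open>Q\<close>, which identifies parallel arrows. The quotient is
  there because classes of spans form an ordered groupoid thanks to cancellation, which may fail in
  an arbitrary shape. The second obstacle is that an inverse equivalence between categories of the
  form \<open>L_cat \<G>\<close> need not come from a double functor. In \<open>lcGsite\<close> an
  inverse of the unit is simply chosen. In \<open>Esite_max\<close> the inverse of the counit has to
  be given explicitly, and \<open>iota_fct\<close> is a strict section of it. Both become
  equivalences under \<open>L\<close> by a formal argument: the image of the counit is a retraction
  of the unit at \<open>L_cat \<G>\<close>, and the image of \<open>iota_fct\<close> is a section of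
  that retraction.\<close>

lemma smallE:
  assumes "small X"
  obtains x where "elts x = X"
  using assms unfolding small_def by blast

lemma small_elts [simp]: "small (elts x)"
  unfolding small_def by blast

lemma elts_vset [simp]: "small X \<Longrightarrow> elts (vset X) = X"
  unfolding small_def vset_def by (metis (mono_tags, lifting) extensionality imageE theI)

lemma small_subset: "small X \<Longrightarrow> Y \<subseteq> X \<Longrightarrow> small Y"
  unfolding small_def using separation by blast

lemma small_image: "small X \<Longrightarrow> small (f ` X)" for f :: "'u::universe \<Rightarrow> 'u"
  using replacement[of f] by (metis small_elts elts_vset)

lemma small_doubleton [simp]: "small {x, y}"
  using pairing[of x y] by (metis small_elts)

lemma small_singleton [simp]: "small {x}"
  by (metis insert_absorb2 small_doubleton)

text \<open>Replacement and union speak of elements of the universe, so the family is first turned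
  into the small set of codes \<open>vset (B x)\<close>, whose union is then formed.\<close>

lemma small_UN:
  fixes B :: "'u::universe \<Rightarrow> 'u set"
  assumes "small A" "\<And>x. x \<in> A \<Longrightarrow> small (B x)"
  shows "small (\<Union>x\<in>A. B x)"
proof -
  obtain y where "elts y = (\<lambda>x. vset (B x)) ` A"
    using small_image[OF assms(1)] by (rule smallE)
  moreover obtain z where "elts z = (\<Union>w\<in>elts y. elts w)"
    using union by blast
  ultimately have "elts z = (\<Union>x\<in>A. B x)"
    using assms(2) by auto
  then show ?thesis
    by (metis small_elts)
qed

lemma small_image2:
  fixes f :: "'u::universe \<Rightarrow> 'u \<Rightarrow> 'u"
  assumes "small A" "small B"
  shows "small {f a b | a b. a \<in> A \<and> b \<in> B}"
proof -
  have "{f a b | a b. a \<in> A \<and> b \<in> B} = (\<Union>a\<in>A. f a ` B)"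
    by auto
  then show ?thesis
    using assms by (simp add: small_UN small_image)
qed

lemma vset_eq_iff: "small X \<Longrightarrow> small Y \<Longrightarrow> vset X = vset Y \<longleftrightarrow> X = Y"
  by (metis elts_vset)

lemma vpair_eq_iff [simp]: "vpair a b = vpair c d \<longleftrightarrow> a = c \<and> b = d"
  unfolding vpair_def by (auto simp: vset_eq_iff doubleton_eq_iff)

lemma vfst_vpair [simp]: "vfst (vpair a b) = a"
  unfolding vfst_def by auto

lemma vsnd_vpair [simp]: "vsnd (vpair a b) = b"
  unfolding vsnd_def by auto


section \<open>Categories and functors\<close>

lemma Dom_Obj [simp]: "category C \<Longrightarrow> f \<in> Arr C \<Longrightarrow> Dom C f \<in> Obj C"
  and Cod_Obj [simp]: "category C \<Longrightarrow> f \<in> Arr C \<Longrightarrow> Cod C f \<in> Obj C"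
  and Ide_Arr [simp]: "category C \<Longrightarrow> A \<in> Obj C \<Longrightarrow> Ide C A \<in> Arr C"
  and Dom_Ide [simp]: "category C \<Longrightarrow> A \<in> Obj C \<Longrightarrow> Dom C (Ide C A) = A"
  and Cod_Ide [simp]: "category C \<Longrightarrow> A \<in> Obj C \<Longrightarrow> Cod C (Ide C A) = A"
  and Cmp_Arr [simp]: "category C \<Longrightarrow> f \<in> Arr C \<Longrightarrow> g \<in> Arr C \<Longrightarrow> Cod C f = Dom C g \<Longrightarrow>
    g \<cdot>\<^bsub>C\<^esub> f \<in> Arr C"
  and Dom_Cmp [simp]: "category C \<Longrightarrow> f \<in> Arr C \<Longrightarrow> g \<in> Arr C \<Longrightarrow> Cod C f = Dom C g \<Longrightarrow>
    Dom C (g \<cdot>\<^bsub>C\<^esub> f) = Dom C f"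
  and Cod_Cmp [simp]: "category C \<Longrightarrow> f \<in> Arr C \<Longrightarrow> g \<in> Arr C \<Longrightarrow> Cod C f = Dom C g \<Longrightarrow>
    Cod C (g \<cdot>\<^bsub>C\<^esub> f) = Cod C g"
  and Cmp_Ide [simp]: "category C \<Longrightarrow> f \<in> Arr C \<Longrightarrow> Dom C f = A \<Longrightarrow> f \<cdot>\<^bsub>C\<^esub> Ide C A = f"
  and Ide_Cmp [simp]: "category C \<Longrightarrow> f \<in> Arr C \<Longrightarrow> Cod C f = A \<Longrightarrow> Ide C A \<cdot>\<^bsub>C\<^esub> f = f"
  and Cmp_assoc: "category C \<Longrightarrow> f \<in> Arr C \<Longrightarrow> g \<in> Arr C \<Longrightarrow> h \<in> Arr C \<Longrightarrow>
    Cod C f = Dom C g \<Longrightarrow> Cod C g = Dom C h \<Longrightarrow> (h \<cdot>\<^bsub>C\<^esub> g) \<cdot>\<^bsub>C\<^esub> f = h \<cdot>\<^bsub>C\<^esub> (g \<cdot>\<^bsub>C\<^esub> f)"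
  unfolding category_def by metis+

lemma categoryI:
  assumes "\<And>f. f \<in> Arr C \<Longrightarrow> Dom C f \<in> Obj C" "\<And>f. f \<in> Arr C \<Longrightarrow> Cod C f \<in> Obj C"
    "\<And>A. A \<in> Obj C \<Longrightarrow> Ide C A \<in> Arr C" "\<And>A. A \<in> Obj C \<Longrightarrow> Dom C (Ide C A) = A"
    "\<And>A. A \<in> Obj C \<Longrightarrow> Cod C (Ide C A) = A"
    "\<And>f g. f \<in> Arr C \<Longrightarrow> g \<in> Arr C \<Longrightarrow> Cod C f = Dom C g \<Longrightarrow> g \<cdot>\<^bsub>C\<^esub> f \<in> Arr C"
    "\<And>f g. f \<in> Arr C \<Longrightarrow> g \<in> Arr C \<Longrightarrow> Cod C f = Dom C g \<Longrightarrow> Dom C (g \<cdot>\<^bsub>C\<^esub> f) = Dom C f"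
    "\<And>f g. f \<in> Arr C \<Longrightarrow> g \<in> Arr C \<Longrightarrow> Cod C f = Dom C g \<Longrightarrow> Cod C (g \<cdot>\<^bsub>C\<^esub> f) = Cod C g"
    "\<And>f. f \<in> Arr C \<Longrightarrow> f \<cdot>\<^bsub>C\<^esub> Ide C (Dom C f) = f"
    "\<And>f. f \<in> Arr C \<Longrightarrow> Ide C (Cod C f) \<cdot>\<^bsub>C\<^esub> f = f"
    "\<And>f g h. f \<in> Arr C \<Longrightarrow> g \<in> Arr C \<Longrightarrow> h \<in> Arr C \<Longrightarrow> Cod C f = Dom C g \<Longrightarrow>
      Cod C g = Dom C h \<Longrightarrow> (h \<cdot>\<^bsub>C\<^esub> g) \<cdot>\<^bsub>C\<^esub> f = h \<cdot>\<^bsub>C\<^esub> (g \<cdot>\<^bsub>C\<^esub> f)"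
  shows "category C"
  using assms unfolding category_def by simp

text \<open>Serves to obtain the laws of a candidate category from those of a known one. The two
  sides of each law are parallel arrows with the same image, so injectivity on parallel arrows
  proves it. As \<open>is_functor\<close> contains the laws of its source, the conclusion delivers
  them too.\<close>

lemma category_reflect:
  assumes D: "category D"
    and o: "\<And>A. A \<in> Obj C \<Longrightarrow> Fo A \<in> Obj D"
    and i: "\<And>A. A \<in> Obj C \<Longrightarrow> Ide C A \<in> Arr C \<and> Dom C (Ide C A) = A \<and> Cod C (Ide C A) = A \<and>
      Fa (Ide C A) = Ide D (Fo A)"
    and a: "\<And>f. f \<in> Arr C \<Longrightarrow> Dom C f \<in> Obj C \<and> Cod C f \<in> Obj C \<and> Fa f \<in> Arr D \<and>
      Dom D (Fa f) = Fo (Dom C f) \<and> Cod D (Fa f) = Fo (Cod C f)"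
    and c: "\<And>f g. f \<in> Arr C \<Longrightarrow> g \<in> Arr C \<Longrightarrow> Cod C f = Dom C g \<Longrightarrow> g \<cdot>\<^bsub>C\<^esub> f \<in> Arr C \<and>
      Dom C (g \<cdot>\<^bsub>C\<^esub> f) = Dom C f \<and> Cod C (g \<cdot>\<^bsub>C\<^esub> f) = Cod C g \<and> Fa (g \<cdot>\<^bsub>C\<^esub> f) = Fa g \<cdot>\<^bsub>D\<^esub> Fa f"
    and inj: "\<And>f g. f \<in> Arr C \<Longrightarrow> g \<in> Arr C \<Longrightarrow> Dom C f = Dom C g \<Longrightarrow> Cod C f = Cod C g \<Longrightarrow>
      Fa f = Fa g \<Longrightarrow> f = g"
  shows "is_functor C D Fo Fa"
proof -
  have "category C"
    by (rule categoryI) (use D a i c in \<open>auto intro!: inj simp: Cmp_assoc\<close>)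
  then show ?thesis
    unfolding is_functor_def using assms by metis
qed

lemma monomorphism_cancel:
  "left_cancellative C \<Longrightarrow> m \<in> Arr C \<Longrightarrow> g \<in> Arr C \<Longrightarrow> h \<in> Arr C \<Longrightarrow> Cod C g = Dom C m \<Longrightarrow>
   Cod C h = Dom C m \<Longrightarrow> Dom C g = Dom C h \<Longrightarrow> m \<cdot>\<^bsub>C\<^esub> g = m \<cdot>\<^bsub>C\<^esub> h \<Longrightarrow> g = h"
  unfolding left_cancellative_def monomorphism_def by blast

lemma is_inverse_unique:
  assumes C: "category C" and "is_inverse C f g" "is_inverse C f h"
  shows "g = h"
proof -
  have "g = g \<cdot>\<^bsub>C\<^esub> (f \<cdot>\<^bsub>C\<^esub> h)"
    using assms by (simp add: is_inverse_def)
  also have "\<dots> = (g \<cdot>\<^bsub>C\<^esub> f) \<cdot>\<^bsub>C\<^esub> h"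
    by (rule Cmp_assoc[symmetric]) (use assms in \<open>auto simp: is_inverse_def\<close>)
  also have "\<dots> = h"
    using assms by (simp add: is_inverse_def)
  finally show ?thesis .
qed

lemma inv_arr_eqI: "category C \<Longrightarrow> is_inverse C f g \<Longrightarrow> inv_arr C f = g"
  unfolding inv_arr_def by (rule the_equality, assumption, rule is_inverse_unique)

lemma is_inverse_inv_arr: "category C \<Longrightarrow> isomorphism C f \<Longrightarrow> is_inverse C f (inv_arr C f)"
  unfolding isomorphism_def by (elim exE) (simp add: inv_arr_eqI)

lemma isomorphism_Arr [simp]: "isomorphism C f \<Longrightarrow> f \<in> Arr C"
  by (auto simp: isomorphism_def is_inverse_def)

lemma inv_arr [simp]:
  assumes "category C" "isomorphism C f"
  shows "inv_arr C f \<in> Arr C" "Dom C (inv_arr C f) = Cod C f" "Cod C (inv_arr C f) = Dom C f"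
    "inv_arr C f \<cdot>\<^bsub>C\<^esub> f = Ide C (Dom C f)" "f \<cdot>\<^bsub>C\<^esub> inv_arr C f = Ide C (Cod C f)"
  using is_inverse_inv_arr[OF assms] unfolding is_inverse_def by auto

lemma inv_arr_isomorphism [simp]: "category C \<Longrightarrow> isomorphism C f \<Longrightarrow> isomorphism C (inv_arr C f)"
  unfolding isomorphism_def[of C "inv_arr C f"] is_inverse_def by (rule exI[of _ f]) simp

text \<open>Cancellation inside a composite associated to the right, the shape in which
  \<open>Cmp_assoc\<close> leaves its results.\<close>

lemma inv_arr_Cmp [simp]:
  assumes "category C" "isomorphism C f" "g \<in> Arr C"
  shows "Cod C g = Dom C f \<Longrightarrow> inv_arr C f \<cdot>\<^bsub>C\<^esub> (f \<cdot>\<^bsub>C\<^esub> g) = g"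
    "Cod C g = Cod C f \<Longrightarrow> f \<cdot>\<^bsub>C\<^esub> (inv_arr C f \<cdot>\<^bsub>C\<^esub> g) = g"
  using assms by (simp_all add: Cmp_assoc[symmetric])

lemma isomorphism_Ide [simp]: "category C \<Longrightarrow> A \<in> Obj C \<Longrightarrow> isomorphism C (Ide C A)"
  unfolding isomorphism_def is_inverse_def by (rule exI[of _ "Ide C A"]) simp

lemma inv_arr_Ide [simp]: "category C \<Longrightarrow> A \<in> Obj C \<Longrightarrow> inv_arr C (Ide C A) = Ide C A"
  by (rule inv_arr_eqI) (simp_all add: is_inverse_def)

lemma is_inverse_Cmp:
  assumes "category C" "isomorphism C f" "isomorphism C g" "Cod C f = Dom C g"
  shows "is_inverse C (g \<cdot>\<^bsub>C\<^esub> f) (inv_arr C f \<cdot>\<^bsub>C\<^esub> inv_arr C g)"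
  using assms unfolding is_inverse_def by (simp add: Cmp_assoc)

lemma isomorphism_Cmp [simp]:
  "category C \<Longrightarrow> isomorphism C f \<Longrightarrow> isomorphism C g \<Longrightarrow> Cod C f = Dom C g \<Longrightarrow>
   isomorphism C (g \<cdot>\<^bsub>C\<^esub> f)"
  unfolding isomorphism_def[of C "g \<cdot>\<^bsub>C\<^esub> f"] by (rule exI, rule is_inverse_Cmp)

lemma isoI: "category C \<Longrightarrow> f \<in> Arr C \<Longrightarrow> g \<in> Arr C \<Longrightarrow> Dom C g = Cod C f \<Longrightarrow> Cod C g = Dom C f \<Longrightarrow>
  g \<cdot>\<^bsub>C\<^esub> f = Ide C (Dom C f) \<Longrightarrow> f \<cdot>\<^bsub>C\<^esub> g = Ide C (Cod C f) \<Longrightarrow> isomorphism C f"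
  unfolding isomorphism_def is_inverse_def by (intro exI[of _ g] conjI)

lemma functorD:
  assumes "is_functor C D Fo Fa"
  shows "category C" "category D"
    "A \<in> Obj C \<Longrightarrow> Fo A \<in> Obj D" "A \<in> Obj C \<Longrightarrow> Fa (Ide C A) = Ide D (Fo A)"
    "f \<in> Arr C \<Longrightarrow> Fa f \<in> Arr D" "f \<in> Arr C \<Longrightarrow> Dom D (Fa f) = Fo (Dom C f)"
    "f \<in> Arr C \<Longrightarrow> Cod D (Fa f) = Fo (Cod C f)"
    "f \<in> Arr C \<Longrightarrow> g \<in> Arr C \<Longrightarrow> Cod C f = Dom C g \<Longrightarrow> Fa (g \<cdot>\<^bsub>C\<^esub> f) = Fa g \<cdot>\<^bsub>D\<^esub> Fa f"
  using assms unfolding is_functor_def by auto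

lemma functorI:
  assumes "category C" "category D"
    "\<And>A. A \<in> Obj C \<Longrightarrow> Fo A \<in> Obj D" "\<And>A. A \<in> Obj C \<Longrightarrow> Fa (Ide C A) = Ide D (Fo A)"
    "\<And>f. f \<in> Arr C \<Longrightarrow> Fa f \<in> Arr D" "\<And>f. f \<in> Arr C \<Longrightarrow> Dom D (Fa f) = Fo (Dom C f)"
    "\<And>f. f \<in> Arr C \<Longrightarrow> Cod D (Fa f) = Fo (Cod C f)"
    "\<And>f g. f \<in> Arr C \<Longrightarrow> g \<in> Arr C \<Longrightarrow> Cod C f = Dom C g \<Longrightarrow> Fa (g \<cdot>\<^bsub>C\<^esub> f) = Fa g \<cdot>\<^bsub>D\<^esub> Fa f"
  shows "is_functor C D Fo Fa"
  using assms unfolding is_functor_def by auto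

lemma functor_is_inverse:
  "is_functor C D Fo Fa \<Longrightarrow> is_inverse C f g \<Longrightarrow> is_inverse D (Fa f) (Fa g)"
  unfolding is_inverse_def using functorD(3-7)[of C D Fo Fa]
  by (simp add: functorD(8)[symmetric, of C D Fo Fa] functorD(1))

lemma functor_isomorphism: "is_functor C D Fo Fa \<Longrightarrow> isomorphism C f \<Longrightarrow> isomorphism D (Fa f)"
  unfolding isomorphism_def by (elim exE, rule exI, rule functor_is_inverse)

lemma functor_inv_arr:
  "is_functor C D Fo Fa \<Longrightarrow> isomorphism C f \<Longrightarrow> inv_arr D (Fa f) = Fa (inv_arr C f)"
  by (rule inv_arr_eqI[OF functorD(2)], assumption, rule functor_is_inverse, assumption,
    rule is_inverse_inv_arr[OF functorD(1)])

lemma small_functorD: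
  assumes "small_functor C D F"
  shows "category C" "category D" "is_functor C D (omap F) (amap F)"
    "omap F \<in> extensional (Obj C)" "amap F \<in> extensional (Arr C)"
    "A \<in> Obj C \<Longrightarrow> omap F A \<in> Obj D" "A \<in> Obj C \<Longrightarrow> amap F (Ide C A) = Ide D (omap F A)"
    "f \<in> Arr C \<Longrightarrow> amap F f \<in> Arr D" "f \<in> Arr C \<Longrightarrow> Dom D (amap F f) = omap F (Dom C f)"
    "f \<in> Arr C \<Longrightarrow> Cod D (amap F f) = omap F (Cod C f)"
    "f \<in> Arr C \<Longrightarrow> g \<in> Arr C \<Longrightarrow> Cod C f = Dom C g \<Longrightarrow>
      amap F (g \<cdot>\<^bsub>C\<^esub> f) = amap F g \<cdot>\<^bsub>D\<^esub> amap F f"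
  using assms functorD[of C D "omap F" "amap F"] unfolding small_functor_def by auto

lemma small_functor_eqI:
  assumes "small_functor C D F" "small_functor C D' G"
    "\<And>A. A \<in> Obj C \<Longrightarrow> omap F A = omap G A" "\<And>f. f \<in> Arr C \<Longrightarrow> amap F f = amap G f"
  shows "F = G"
proof (rule fct.equality)
  show "omap F = omap G" "amap F = amap G"
    using assms unfolding small_functor_def by (blast intro: extensionalityI)+
qed simp

lemma omap_fct_comp [simp]: "A \<in> Obj C \<Longrightarrow> omap (fct_comp C G F) A = omap G (omap F A)"
  and amap_fct_comp [simp]: "f \<in> Arr C \<Longrightarrow> amap (fct_comp C G F) f = amap G (amap F f)"
  and omap_fct_id [simp]: "A \<in> Obj C \<Longrightarrow> omap (fct_id C) A = A"
  and amap_fct_id [simp]: "f \<in> Arr C \<Longrightarrow> amap (fct_id C) f = f"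
  by (simp_all add: fct_comp_def fct_id_def)

lemma small_functor_id: "category C \<Longrightarrow> small_functor C C (fct_id C)"
  unfolding small_functor_def by (auto intro!: functorI simp: fct_id_def)

lemma small_functor_comp:
  assumes "small_functor C D F" "small_functor D E G"
  shows "small_functor C E (fct_comp C G F)"
  unfolding small_functor_def
  using small_functorD[OF assms(1)] small_functorD[OF assms(2)]
  by (auto intro!: functorI simp: fct_comp_def)

lemma fct_comp_id_left: "small_functor C D F \<Longrightarrow> fct_comp C (fct_id D) F = F"
  by (rule small_functor_eqI[OF small_functor_comp[OF _ small_functor_id]])
    (auto simp: small_functorD)

lemma fct_comp_id_right: "small_functor C D F \<Longrightarrow> fct_comp C F (fct_id C) = F"
  by (rule small_functor_eqI[OF small_functor_comp[OF small_functor_id]])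
    (auto simp: small_functorD)

lemma fct_comp_assoc:
  assumes "small_functor C D F" "small_functor D E G" "small_functor E B H"
  shows "fct_comp C H (fct_comp C G F) = fct_comp C (fct_comp D H G) F"
  by (rule small_functor_eqI[OF small_functor_comp[OF small_functor_comp[OF assms(1,2)] assms(3)]
      small_functor_comp[OF assms(1) small_functor_comp[OF assms(2,3)]]])
    (use assms in \<open>auto simp: small_functorD\<close>)

lemma nat_transformationD:
  assumes "nat_transformation C D F G \<theta>"
  shows "\<theta> \<in> extensional (Obj C)" "A \<in> Obj C \<Longrightarrow> \<theta> A \<in> Arr D"
    "A \<in> Obj C \<Longrightarrow> Dom D (\<theta> A) = omap F A" "A \<in> Obj C \<Longrightarrow> Cod D (\<theta> A) = omap G A"
    "f \<in> Arr C \<Longrightarrow> amap G f \<cdot>\<^bsub>D\<^esub> \<theta> (Dom C f) = \<theta> (Cod C f) \<cdot>\<^bsub>D\<^esub> amap F f"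
  using assms unfolding nat_transformation_def by auto

lemma isomorphism_left_cancel:
  assumes "category C" "isomorphism C e" "f \<in> Arr C" "g \<in> Arr C" "Cod C f = Dom C e"
    "Cod C g = Dom C e" "e \<cdot>\<^bsub>C\<^esub> f = e \<cdot>\<^bsub>C\<^esub> g"
  shows "f = g"
  by (metis assms inv_arr_Cmp(1))

lemma isomorphism_right_cancel:
  assumes "category C" "isomorphism C e" "f \<in> Arr C" "g \<in> Arr C" "Dom C f = Cod C e"
    "Dom C g = Cod C e" "f \<cdot>\<^bsub>C\<^esub> e = g \<cdot>\<^bsub>C\<^esub> e"
  shows "f = g"
proof -
  have "(f \<cdot>\<^bsub>C\<^esub> e) \<cdot>\<^bsub>C\<^esub> inv_arr C e = (g \<cdot>\<^bsub>C\<^esub> e) \<cdot>\<^bsub>C\<^esub> inv_arr C e"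
    using assms by simp
  then show ?thesis
    using assms(1-6) by (simp add: Cmp_assoc)
qed

section \<open>Full, faithful and essentially surjective functors\<close>

definition full_on :: "('o, 'a, 'x) cat_scheme \<Rightarrow> ('p, 'b, 'y) cat_scheme \<Rightarrow> ('o \<Rightarrow> 'p) \<Rightarrow> ('a \<Rightarrow> 'b) \<Rightarrow>
    bool"
  where "full_on C D Fo Fa \<longleftrightarrow> (\<forall>A\<in>Obj C. \<forall>B\<in>Obj C. \<forall>g\<in>Arr D. Dom D g = Fo A \<and> Cod D g = Fo B \<longrightarrow>
    (\<exists>f\<in>Arr C. Dom C f = A \<and> Cod C f = B \<and> Fa f = g))"

definition faithful_on :: "('o, 'a, 'x) cat_scheme \<Rightarrow> ('a \<Rightarrow> 'b) \<Rightarrow> bool"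
  where "faithful_on C Fa \<longleftrightarrow> (\<forall>f\<in>Arr C. \<forall>g\<in>Arr C. Dom C f = Dom C g \<and> Cod C f = Cod C g \<and> Fa f = Fa g
      \<longrightarrow> f = g)"

definition ess_surj :: "('o, 'a, 'x) cat_scheme \<Rightarrow> ('p, 'b, 'y) cat_scheme \<Rightarrow> ('o \<Rightarrow> 'p) \<Rightarrow> bool"
  where "ess_surj C D Fo \<longleftrightarrow> (\<forall>B\<in>Obj D. \<exists>A\<in>Obj C. \<exists>e. isomorphism D e \<and> Dom D e = Fo A \<and> Cod D e = B)"

lemma fullE:
  assumes "full_on C D Fo Fa" "A \<in> Obj C" "B \<in> Obj C" "g \<in> Arr D" "Dom D g = Fo A" "Cod D g = Fo B"
  obtains f where "f \<in> Arr C" "Dom C f = A" "Cod C f = B" "Fa f = g"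
  using assms unfolding full_on_def by blast

lemma faithfulD: "faithful_on C Fa \<Longrightarrow> f \<in> Arr C \<Longrightarrow> g \<in> Arr C \<Longrightarrow> Dom C f = Dom C g \<Longrightarrow>
  Cod C f = Cod C g \<Longrightarrow> Fa f = Fa g \<Longrightarrow> f = g"
  unfolding faithful_on_def by blast

lemma ess_surjE:
  assumes "ess_surj C D Fo" "B \<in> Obj D"
  obtains A e where "A \<in> Obj C" "isomorphism D e" "Dom D e = Fo A" "Cod D e = B"
  using assms unfolding ess_surj_def by blast

lemma ff_reflects_isomorphism:
  assumes F: "is_functor C D Fo Fa" and full: "full_on C D Fo Fa" and faith: "faithful_on C Fa"
    and f: "f \<in> Arr C" "isomorphism D (Fa f)"
  shows "isomorphism C f"
proof -
  note [simp] = functorD[OF F]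
  obtain g where g: "g \<in> Arr C" "Dom C g = Cod C f" "Cod C g = Dom C f" "Fa g = inv_arr D (Fa f)"
    using full f by (elim fullE[of C D Fo Fa "Cod C f" "Dom C f" "inv_arr D (Fa f)"]) auto
  have "g \<cdot>\<^bsub>C\<^esub> f = Ide C (Dom C f)" "f \<cdot>\<^bsub>C\<^esub> g = Ide C (Cod C f)"
    using f g by (auto intro!: faithfulD[OF faith])
  with f g show ?thesis
    by (auto intro: isoI)
qed


section \<open>Grothendieck sites\<close>

lemma sieveD:
  assumes "sieve C A S" "f \<in> S"
  shows "f \<in> Arr C" "Cod C f = A" "g \<in> Arr C \<Longrightarrow> Cod C g = Dom C f \<Longrightarrow> f \<cdot>\<^bsub>C\<^esub> g \<in> S"
  using assms unfolding sieve_def by auto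

lemma sieve_Obj: "sieve C A S \<Longrightarrow> A \<in> Obj C"
  unfolding sieve_def by simp

lemma sieveI:
  assumes "A \<in> Obj C" "\<And>f. f \<in> S \<Longrightarrow> f \<in> Arr C \<and> Cod C f = A"
    "\<And>f g. f \<in> S \<Longrightarrow> g \<in> Arr C \<Longrightarrow> Cod C g = Dom C f \<Longrightarrow> f \<cdot>\<^bsub>C\<^esub> g \<in> S"
  shows "sieve C A S"
  using assms unfolding sieve_def by auto

lemma sieve_top: "category C \<Longrightarrow> A \<in> Obj C \<Longrightarrow> sieve C A {f \<in> Arr C. Cod C f = A}"
  by (rule sieveI) auto

lemma sieve_sieve_pullback:
  "category C \<Longrightarrow> f \<in> Arr C \<Longrightarrow> sieve C (Cod C f) S \<Longrightarrow> sieve C (Dom C f) (sieve_pullback C f S)"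
  by (rule sieveI) (auto simp: sieve_pullback_def Cmp_assoc[symmetric] sieveD)

lemma sieve_generated_sieve:
  assumes "category C" "A \<in> Obj C" "\<And>f. f \<in> R \<Longrightarrow> f \<in> Arr C \<and> Cod C f = A"
  shows "sieve C A (generated_sieve C R)"
proof (rule sieveI)
  fix x g assume "x \<in> generated_sieve C R" and g: "g \<in> Arr C" "Cod C g = Dom C x"
  then obtain f k where f: "x = f \<cdot>\<^bsub>C\<^esub> k" "f \<in> R" "k \<in> Arr C" "Cod C k = Dom C f"
    unfolding generated_sieve_def by auto
  then have "x \<cdot>\<^bsub>C\<^esub> g = f \<cdot>\<^bsub>C\<^esub> (k \<cdot>\<^bsub>C\<^esub> g)" "k \<cdot>\<^bsub>C\<^esub> g \<in> Arr C" "Cod C (k \<cdot>\<^bsub>C\<^esub> g) = Dom C f"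
    using assms g by (simp_all add: Cmp_assoc)
  with f(2) show "x \<cdot>\<^bsub>C\<^esub> g \<in> generated_sieve C R"
    unfolding generated_sieve_def by blast
qed (use assms in \<open>auto simp: generated_sieve_def\<close>)

lemma subset_generated_sieve:
  assumes "category C" "f \<in> R" "f \<in> Arr C"
  shows "f \<in> generated_sieve C R"
proof -
  have "f = f \<cdot>\<^bsub>C\<^esub> Ide C (Dom C f)" "Ide C (Dom C f) \<in> Arr C" "Cod C (Ide C (Dom C f)) = Dom C f"
    using assms by simp_all
  with assms(2) show ?thesis
    unfolding generated_sieve_def by blast
qed

lemma generated_sieve_sieve:
  assumes C: "category C" and S: "sieve C A S"
  shows "generated_sieve C S = S"
proof
  show "generated_sieve C S \<subseteq> S"
    using S by (auto simp: generated_sieve_def sieveD)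
  show "S \<subseteq> generated_sieve C S"
    using subset_generated_sieve[OF C] sieveD(1)[OF S] by blast
qed

lemma topologyD:
  assumes "grothendieck_topology C J"
  shows "S \<in> J A \<Longrightarrow> sieve C A S" "A \<in> Obj C \<Longrightarrow> {f \<in> Arr C. Cod C f = A} \<in> J A"
    "f \<in> Arr C \<Longrightarrow> S \<in> J (Cod C f) \<Longrightarrow> sieve_pullback C f S \<in> J (Dom C f)"
    "S \<in> J A \<Longrightarrow> sieve C A R \<Longrightarrow> (\<And>f. f \<in> S \<Longrightarrow> sieve_pullback C f R \<in> J (Dom C f)) \<Longrightarrow> R \<in> J A"
proof -
  have *: "\<forall>A. \<forall>S\<in>J A. sieve C A S" "\<forall>A\<in>Obj C. {f \<in> Arr C. Cod C f = A} \<in> J A"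
    "\<forall>f\<in>Arr C. \<forall>S\<in>J (Cod C f). sieve_pullback C f S \<in> J (Dom C f)"
    "\<forall>A\<in>Obj C. \<forall>S\<in>J A. \<forall>R. sieve C A R \<and> (\<forall>f\<in>S. sieve_pullback C f R \<in> J (Dom C f)) \<longrightarrow> R \<in> J A"
    using assms unfolding grothendieck_topology_def by blast+
  show "S \<in> J A \<Longrightarrow> sieve C A S" "A \<in> Obj C \<Longrightarrow> {f \<in> Arr C. Cod C f = A} \<in> J A"
    "f \<in> Arr C \<Longrightarrow> S \<in> J (Cod C f) \<Longrightarrow> sieve_pullback C f S \<in> J (Dom C f)"
    using * by simp_all
  show "S \<in> J A \<Longrightarrow> sieve C A R \<Longrightarrow> (\<And>f. f \<in> S \<Longrightarrow> sieve_pullback C f R \<in> J (Dom C f)) \<Longrightarrow> R \<in> J A"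
    using *(4) sieve_Obj[of C A R] by simp
qed

text \<open>Along a member \<open>f\<close> of the smaller sieve the larger one pulls back to the
  maximal sieve, because all composites of \<open>f\<close> stay in \<open>S\<close>. Transitivity
  then applies.\<close>

lemma topology_superset:
  assumes C: "category C" and J: "grothendieck_topology C J"
    and S: "S \<in> J A" and R: "sieve C A R" and "S \<subseteq> R"
  shows "R \<in> J A"
proof (rule topologyD(4)[OF J S R])
  fix f assume f: "f \<in> S"
  have S': "sieve C A S"
    using J S by (rule topologyD)
  note f' = sieveD[OF S' f]
  have "sieve_pullback C f R = {g \<in> Arr C. Cod C g = Dom C f}"
    using f'(3) \<open>S \<subseteq> R\<close> unfolding sieve_pullback_def by blast
  then show "sieve_pullback C f R \<in> J (Dom C f)"
    using topologyD(2)[OF J, of "Dom C f"] C f'(1) by simp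
qed

text \<open>Transitivity in its usable form: for each \<open>f\<close> some covering sieve
  \<open>Q\<close> inside the pullback is enough, since the pullback then covers by
  \<open>topology_superset\<close>.\<close>

lemma topology_local:
  assumes C: "category C" and J: "grothendieck_topology C J"
    and S: "S \<in> J A" and R: "sieve C A R"
    and loc: "\<And>f. f \<in> S \<Longrightarrow> \<exists>Q\<in>J (Dom C f). \<forall>q\<in>Q. f \<cdot>\<^bsub>C\<^esub> q \<in> R"
  shows "R \<in> J A"
proof (rule topologyD(4)[OF J S R])
  fix f assume f: "f \<in> S"
  note f' = sieveD[OF topologyD(1)[OF J S] f]
  obtain Q where Q: "Q \<in> J (Dom C f)" "\<forall>q\<in>Q. f \<cdot>\<^bsub>C\<^esub> q \<in> R"
    using loc[OF f] by blast
  show "sieve_pullback C f R \<in> J (Dom C f)"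
  proof (rule topology_superset[OF C J Q(1)])
    show "sieve C (Dom C f) (sieve_pullback C f R)"
      using C R f' by (auto intro: sieve_sieve_pullback)
    show "Q \<subseteq> sieve_pullback C f R"
      using Q(2) sieveD[OF topologyD(1)[OF J Q(1)]] unfolding sieve_pullback_def by blast
  qed
qed

lemma lc_sitesD:
  assumes "X \<in> lc_sites"
  shows "category (fst X)" "small_category (fst X)" "left_cancellative (fst X)"
    "grothendieck_topology (fst X) (snd X)"
  using assms unfolding lc_sites_def small_category_def by auto

lemma coneD:
  assumes "cone I C D U \<tau>"
  shows "U \<in> Obj C" "i \<in> Obj I \<Longrightarrow> \<tau> i \<in> Arr C" "i \<in> Obj I \<Longrightarrow> Dom C (\<tau> i) = U"
    "i \<in> Obj I \<Longrightarrow> Cod C (\<tau> i) = omap D i"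
    "u \<in> Arr I \<Longrightarrow> amap D u \<cdot>\<^bsub>C\<^esub> \<tau> (Dom I u) = \<tau> (Cod I u)"
  using assms unfolding cone_def by auto

lemma coneI:
  assumes "U \<in> Obj C" "\<And>i. i \<in> Obj I \<Longrightarrow> \<tau> i \<in> Arr C" "\<And>i. i \<in> Obj I \<Longrightarrow> Dom C (\<tau> i) = U"
    "\<And>i. i \<in> Obj I \<Longrightarrow> Cod C (\<tau> i) = omap D i"
    "\<And>u. u \<in> Arr I \<Longrightarrow> amap D u \<cdot>\<^bsub>C\<^esub> \<tau> (Dom I u) = \<tau> (Cod I u)"
  shows "cone I C D U \<tau>"
  using assms unfolding cone_def by auto

section \<open>Covering flatness at a fixed diagram\<close>

definition flat_sieve ::
  "('u, 'u, 'x) cat_scheme \<Rightarrow> ('u, 'u, 'y) cat_scheme \<Rightarrow> ('u, 'u, 'z) cat_scheme \<Rightarrow> 'u fct \<Rightarrow> 'u fct \<Rightarrow>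
   'u \<Rightarrow> ('u \<Rightarrow> 'u) \<Rightarrow> 'u set" where
  "flat_sieve I C C' F D U \<tau> = {h \<in> Arr C'. Cod C' h = U \<and>
     (\<exists>W \<sigma>. cone I C D W \<sigma> \<and> (\<exists>g\<in>Arr C'. Dom C' g = Dom C' h \<and> Cod C' g = omap F W \<and>
        (\<forall>i\<in>Obj I. \<tau> i \<cdot>\<^bsub>C'\<^esub> h = amap F (\<sigma> i) \<cdot>\<^bsub>C'\<^esub> g)))}"

text \<open>Later arguments change the shape \<open>I\<close> of a diagram while keeping the functor
  and the sites, so the quantifier over shapes in \<open>cover_flat\<close> has to be
  opened.\<close>

definition flat_at ::
  "('u, 'u, 'x) cat_scheme \<Rightarrow> 'u gsite \<Rightarrow> 'u gsite \<Rightarrow> 'u fct \<Rightarrow> 'u fct \<Rightarrow> bool" where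
  "flat_at I X Y F D \<longleftrightarrow> (\<forall>U \<tau>. cone I (fst Y) (fct_comp I F D) U \<tau> \<longrightarrow>
     flat_sieve I (fst X) (fst Y) F D U \<tau> \<in> snd Y U)"

lemma cover_flat_iff: "cover_flat X Y F \<longleftrightarrow>
    (\<forall>(I :: ('u::universe, 'u) cat) D. finite_category I \<and> small_functor I (fst X) D \<longrightarrow> flat_at I X Y
        F D)"
  unfolding cover_flat_def flat_at_def flat_sieve_def by blast

lemma flat_sieveI:
  assumes "h \<in> Arr C'" "Cod C' h = U" "cone I C D W \<sigma>" "g \<in> Arr C'" "Dom C' g = Dom C' h"
    "Cod C' g = omap F W" "\<And>i. i \<in> Obj I \<Longrightarrow> \<tau> i \<cdot>\<^bsub>C'\<^esub> h = amap F (\<sigma> i) \<cdot>\<^bsub>C'\<^esub> g"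
  shows "h \<in> flat_sieve I C C' F D U \<tau>"
  using assms unfolding flat_sieve_def by blast

lemma flat_sieveE:
  assumes "h \<in> flat_sieve I C C' F D U \<tau>"
  obtains W \<sigma> g where "h \<in> Arr C'" "Cod C' h = U" "cone I C D W \<sigma>" "g \<in> Arr C'" "Dom C' g = Dom C'
      h"
    "Cod C' g = omap F W" "\<And>i. i \<in> Obj I \<Longrightarrow> \<tau> i \<cdot>\<^bsub>C'\<^esub> h = amap F (\<sigma> i) \<cdot>\<^bsub>C'\<^esub> g"
  using assms unfolding flat_sieve_def by blast

lemma sieve_flat_sieve:
  assumes F: "small_functor C C' F" and D: "small_functor I C D"
    and \<tau>: "cone I C' (fct_comp I F D) U \<tau>"
  shows "sieve C' U (flat_sieve I C C' F D U \<tau>)"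
proof (rule sieveI)
  note [simp] = small_functorD[OF F] coneD[OF \<tau>]
  show "U \<in> Obj C'" by simp
  fix h k assume "h \<in> flat_sieve I C C' F D U \<tau>" and k: "k \<in> Arr C'" "Cod C' k = Dom C' h"
  then obtain W \<sigma> g where h: "h \<in> Arr C'" "Cod C' h = U" "cone I C D W \<sigma>" "g \<in> Arr C'"
    "Dom C' g = Dom C' h" "Cod C' g = omap F W"
    and e: "\<And>i. i \<in> Obj I \<Longrightarrow> \<tau> i \<cdot>\<^bsub>C'\<^esub> h = amap F (\<sigma> i) \<cdot>\<^bsub>C'\<^esub> g"
    by (auto elim: flat_sieveE)
  show "h \<cdot>\<^bsub>C'\<^esub> k \<in> flat_sieve I C C' F D U \<tau>"
  proof (rule flat_sieveI)
    show "cone I C D W \<sigma>" by fact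
    fix i assume i: "i \<in> Obj I"
    have "\<tau> i \<cdot>\<^bsub>C'\<^esub> (h \<cdot>\<^bsub>C'\<^esub> k) = (\<tau> i \<cdot>\<^bsub>C'\<^esub> h) \<cdot>\<^bsub>C'\<^esub> k"
      using h k i by (simp add: Cmp_assoc)
    then show "\<tau> i \<cdot>\<^bsub>C'\<^esub> (h \<cdot>\<^bsub>C'\<^esub> k) = amap F (\<sigma> i) \<cdot>\<^bsub>C'\<^esub> (g \<cdot>\<^bsub>C'\<^esub> k)"
      unfolding e[OF i] using h(1,2,4-6) k i coneD[OF h(3)] by (simp add: Cmp_assoc)
  qed (use h k in simp_all)
qed (auto elim: flat_sieveE)

text \<open>A member of the sieve generated in two stages has the form \<open>G (F f k) l\<close>,
  which factors through \<open>G (F f)\<close>. So that sieve is contained in the one generated by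
  the composite.\<close>

lemma cover_preserving_comp:
  assumes F: "small_functor (fst X) (fst Y) F" and G: "small_functor (fst Y) (fst Z) G"
    and J: "grothendieck_topology (fst X) (snd X)" "grothendieck_topology (fst Y) (snd Y)"
      "grothendieck_topology (fst Z) (snd Z)"
    and cF: "cover_preserving X Y F" and cG: "cover_preserving Y Z G"
  shows "cover_preserving X Z (fct_comp (fst X) G F)"
  unfolding cover_preserving_def
proof (intro ballI)
  note [simp] = small_functorD[OF F] small_functorD[OF G]
  fix A S assume A: "A \<in> Obj (fst X)" and S: "S \<in> snd X A"
  note S' = sieveD[OF topologyD(1)[OF J(1) S]]
  let ?R = "generated_sieve (fst Y) (amap F ` S)"
  have R: "?R \<in> snd Y (omap F A)"
    using cF A S unfolding cover_preserving_def by blast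
  then have RR: "generated_sieve (fst Z) (amap G ` ?R) \<in> snd Z (omap G (omap F A))"
    using cG A unfolding cover_preserving_def by simp
  have "generated_sieve (fst Z) (amap (fct_comp (fst X) G F) ` S) \<in> snd Z (omap G (omap F A))"
  proof (rule topology_superset[OF _ J(3) RR])
    show "sieve (fst Z) (omap G (omap F A)) (generated_sieve (fst Z) (amap (fct_comp (fst X) G F) `
        S))"
      using A S' by (intro sieve_generated_sieve) auto
    show "generated_sieve (fst Z) (amap G ` ?R) \<subseteq> generated_sieve (fst Z) (amap (fct_comp (fst X) G
        F) ` S)"
    proof
      fix x assume "x \<in> generated_sieve (fst Z) (amap G ` ?R)"
      then obtain f k l where x: "x = amap G (amap F f \<cdot>\<^bsub>fst Y\<^esub> k) \<cdot>\<^bsub>fst Z\<^esub> l" "f \<in> S"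
        "k \<in> Arr (fst Y)" "Cod (fst Y) k = Dom (fst Y) (amap F f)"
        "l \<in> Arr (fst Z)" "Cod (fst Z) l = Dom (fst Z) (amap G (amap F f \<cdot>\<^bsub>fst Y\<^esub> k))"
        unfolding generated_sieve_def by auto
      have "x = amap (fct_comp (fst X) G F) f \<cdot>\<^bsub>fst Z\<^esub> (amap G k \<cdot>\<^bsub>fst Z\<^esub> l)"
        "amap G k \<cdot>\<^bsub>fst Z\<^esub> l \<in> Arr (fst Z)"
        "Cod (fst Z) (amap G k \<cdot>\<^bsub>fst Z\<^esub> l) = Dom (fst Z) (amap (fct_comp (fst X) G F) f)"
        using x S' by (simp_all add: Cmp_assoc)
      then show "x \<in> generated_sieve (fst Z) (amap (fct_comp (fst X) G F) ` S)"
        using \<open>f \<in> S\<close> unfolding generated_sieve_def by blast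
    qed
  qed simp
  then show "generated_sieve (fst Z) (amap (fct_comp (fst X) G F) ` S) \<in> snd Z (omap (fct_comp (fst
      X) G F) A)"
    using A by simp
qed

text \<open>Flatness of \<open>G\<close> covers \<open>U\<close> by arrows \<open>h\<close> through
  which the cone factors over some cone above \<open>F D\<close>. Flatness of \<open>F\<close>
  covers the vertex \<open>W\<close> of that cone in turn. The second cover lives before
  \<open>G\<close>, so it is transported by \<open>G\<close>, which preserves covers, and
  \<open>topology_local\<close> combines the two.\<close>

lemma cover_flat_comp:
  assumes F: "small_functor (fst X) (fst Y) F" and G: "small_functor (fst Y) (fst Z) G"
    and J: "grothendieck_topology (fst Y) (snd Y)" "grothendieck_topology (fst Z) (snd Z)"
    and fF: "cover_flat X Y F" and fG: "cover_flat Y Z G" and cG: "cover_preserving Y Z G"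
  shows "cover_flat X Z (fct_comp (fst X) G F)"
  unfolding cover_flat_iff flat_at_def
proof (intro allI impI, elim conjE)
  note [simp] = small_functorD[OF F] small_functorD[OF G]
  fix I :: "('a, 'a) cat" and D U \<tau>
  assume I: "finite_category I" and D: "small_functor I (fst X) D"
    and \<tau>: "cone I (fst Z) (fct_comp I (fct_comp (fst X) G F) D) U \<tau>"
  have FD: "small_functor I (fst Y) (fct_comp I F D)"
    using D F by (rule small_functor_comp)
  have eq: "fct_comp I (fct_comp (fst X) G F) D = fct_comp I G (fct_comp I F D)"
    using fct_comp_assoc[OF D F G] by simp
  have S1: "flat_sieve I (fst Y) (fst Z) G (fct_comp I F D) U \<tau> \<in> snd Z U"
    using fG I FD \<tau> unfolding cover_flat_iff flat_at_def eq by blast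
  show "flat_sieve I (fst X) (fst Z) (fct_comp (fst X) G F) D U \<tau> \<in> snd Z U"
  proof (rule topology_local[OF _ J(2) S1])
    show "sieve (fst Z) U (flat_sieve I (fst X) (fst Z) (fct_comp (fst X) G F) D U \<tau>)"
      by (rule sieve_flat_sieve[OF small_functor_comp[OF F G] D \<tau>])
    fix h assume "h \<in> flat_sieve I (fst Y) (fst Z) G (fct_comp I F D) U \<tau>"
    then obtain W \<sigma>' g where h: "h \<in> Arr (fst Z)" "Cod (fst Z) h = U"
      and \<sigma>': "cone I (fst Y) (fct_comp I F D) W \<sigma>'" and g: "g \<in> Arr (fst Z)" "Dom (fst Z) g = Dom
          (fst Z) h"
      "Cod (fst Z) g = omap G W"
      and e: "\<And>i. i \<in> Obj I \<Longrightarrow> \<tau> i \<cdot>\<^bsub>fst Z\<^esub> h = amap G (\<sigma>' i) \<cdot>\<^bsub>fst Z\<^esub> g"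
      by (rule flat_sieveE) blast
    let ?S2 = "flat_sieve I (fst X) (fst Y) F D W \<sigma>'"
    have S2: "?S2 \<in> snd Y W"
      using fF I D \<sigma>' unfolding cover_flat_iff flat_at_def by blast
    have W: "W \<in> Obj (fst Y)"
      using \<sigma>' by (rule coneD)
    have "generated_sieve (fst Z) (amap G ` ?S2) \<in> snd Z (omap G W)"
      using cG S2 W unfolding cover_preserving_def by blast
    \<comment> \<open>\<open>topology_local\<close> wants a cover of the domain of \<open>h\<close>.
      Pulling back along the comparison arrow \<open>g\<close> moves the cover of
      \<open>omap G W\<close> there.\<close>
    then have Q: "sieve_pullback (fst Z) g (generated_sieve (fst Z) (amap G ` ?S2)) \<in> snd Z (Dom
        (fst Z) h)"
      using g topologyD(3)[OF J(2)] by metis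
    have "h \<cdot>\<^bsub>fst Z\<^esub> q \<in> flat_sieve I (fst X) (fst Z) (fct_comp (fst X) G F) D U \<tau>"
      if q0: "q \<in> sieve_pullback (fst Z) g (generated_sieve (fst Z) (amap G ` ?S2))" for q
    proof -
      obtain k r where q: "q \<in> Arr (fst Z)" "Cod (fst Z) q = Dom (fst Z) h"
        and gq: "g \<cdot>\<^bsub>fst Z\<^esub> q = amap G k \<cdot>\<^bsub>fst Z\<^esub> r" and k: "k \<in> ?S2"
        and r: "r \<in> Arr (fst Z)" "Cod (fst Z) r = Dom (fst Z) (amap G k)"
        using q0 g unfolding sieve_pullback_def generated_sieve_def by auto
      obtain V \<sigma> p where k': "k \<in> Arr (fst Y)" "Cod (fst Y) k = W" and \<sigma>: "cone I (fst X) D V \<sigma>"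
        and p: "p \<in> Arr (fst Y)" "Dom (fst Y) p = Dom (fst Y) k" "Cod (fst Y) p = omap F V"
        and e': "\<And>i. i \<in> Obj I \<Longrightarrow> \<sigma>' i \<cdot>\<^bsub>fst Y\<^esub> k = amap F (\<sigma> i) \<cdot>\<^bsub>fst Y\<^esub> p"
        using k by (rule flat_sieveE) blast
      have rr: "Dom (fst Z) r = Dom (fst Z) q"
        using gq r q g k' Dom_Cmp[of "fst Z" q g] Dom_Cmp[of "fst Z" r "amap G k"] by simp
      have V: "V \<in> Obj (fst X)" using \<sigma> by (rule coneD)
      show ?thesis
      proof (rule flat_sieveI[OF _ _ \<sigma>])
        show "amap G p \<cdot>\<^bsub>fst Z\<^esub> r \<in> Arr (fst Z)" "h \<cdot>\<^bsub>fst Z\<^esub> q \<in> Arr (fst Z)" "Cod (fst Z) (h \<cdot>\<^bsub>fst Z\<^esub> q)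
            = U"
          "Dom (fst Z) (amap G p \<cdot>\<^bsub>fst Z\<^esub> r) = Dom (fst Z) (h \<cdot>\<^bsub>fst Z\<^esub> q)"
          "Cod (fst Z) (amap G p \<cdot>\<^bsub>fst Z\<^esub> r) = omap (fct_comp (fst X) G F) V"
          using p r k' h q rr V by simp_all
        fix i assume i: "i \<in> Obj I"
        note [simp] = coneD[OF \<sigma>] coneD[OF \<sigma>'] coneD[OF \<tau>]
        have "\<tau> i \<cdot>\<^bsub>fst Z\<^esub> (h \<cdot>\<^bsub>fst Z\<^esub> q) = (\<tau> i \<cdot>\<^bsub>fst Z\<^esub> h) \<cdot>\<^bsub>fst Z\<^esub> q"
          using h q i by (simp add: Cmp_assoc)
        also have "\<dots> = amap G (\<sigma>' i) \<cdot>\<^bsub>fst Z\<^esub> (g \<cdot>\<^bsub>fst Z\<^esub> q)"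
          unfolding e[OF i] using g q i W by (simp add: Cmp_assoc)
        also have "\<dots> = amap G (\<sigma>' i \<cdot>\<^bsub>fst Y\<^esub> k) \<cdot>\<^bsub>fst Z\<^esub> r"
          unfolding gq using r k' i by (simp add: Cmp_assoc)
        also have "\<dots> = amap (fct_comp (fst X) G F) (\<sigma> i) \<cdot>\<^bsub>fst Z\<^esub> (amap G p \<cdot>\<^bsub>fst Z\<^esub> r)"
          unfolding e'[OF i] using r p k' i V by (simp add: Cmp_assoc)
        finally show "\<tau> i \<cdot>\<^bsub>fst Z\<^esub> (h \<cdot>\<^bsub>fst Z\<^esub> q) =
          amap (fct_comp (fst X) G F) (\<sigma> i) \<cdot>\<^bsub>fst Z\<^esub> (amap G p \<cdot>\<^bsub>fst Z\<^esub> r)" .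
      qed
    qed
    then show "\<exists>Q\<in>snd Z (Dom (fst Z) h). \<forall>q\<in>Q. h \<cdot>\<^bsub>fst Z\<^esub> q \<in>
        flat_sieve I (fst X) (fst Z) (fct_comp (fst X) G F) D U \<tau>"
      using Q by blast
  qed simp
qed

text \<open>After the vertex is moved along an isomorphism into the image of \<open>F\<close>,
  fullness lifts the legs of a cone and faithfulness lifts their compatibility. So the whole cone
  comes from one over \<open>D\<close>, every arrow into \<open>U\<close> factors as required, and
  the flat sieve is maximal.\<close>

lemma cover_flat_equivalence:
  assumes F: "small_functor (fst X) (fst Y) F" and J: "grothendieck_topology (fst Y) (snd Y)"
    and full: "full_on (fst X) (fst Y) (omap F) (amap F)" and faith: "faithful_on (fst X) (amap F)"
    and es: "ess_surj (fst X) (fst Y) (omap F)"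
  shows "cover_flat X Y F"
  unfolding cover_flat_iff flat_at_def
proof (intro allI impI, elim conjE)
  note [simp] = small_functorD[OF F]
  fix I :: "('a, 'a) cat" and D U \<tau>
  assume I: "finite_category I" and D: "small_functor I (fst X) D"
    and \<tau>: "cone I (fst Y) (fct_comp I F D) U \<tau>"
  note [simp] = small_functorD[OF D] coneD[OF \<tau>]
  obtain W e where W: "W \<in> Obj (fst X)" and e: "isomorphism (fst Y) e" "Dom (fst Y) e = omap F W"
      "Cod (fst Y) e = U"
    using es by (rule ess_surjE) auto
  have "\<exists>f. f \<in> Arr (fst X) \<and> Dom (fst X) f = W \<and> Cod (fst X) f = omap D i \<and> amap F f = \<tau> i \<cdot>\<^bsub>fst Y\<^esub>
      e"
    if "i \<in> Obj I" for i
    by (rule fullE[OF full, of W "omap D i" "\<tau> i \<cdot>\<^bsub>fst Y\<^esub> e"]) (use that W e in auto)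
  then obtain \<sigma> where \<sigma>: "\<And>i. i \<in> Obj I \<Longrightarrow> \<sigma> i \<in> Arr (fst X) \<and> Dom (fst X) (\<sigma> i) = W \<and>
      Cod (fst X) (\<sigma> i) = omap D i \<and> amap F (\<sigma> i) = \<tau> i \<cdot>\<^bsub>fst Y\<^esub> e"
    by metis
  have c: "cone I (fst X) D W \<sigma>"
  proof (rule coneI)
    fix u assume u: "u \<in> Arr I"
    have "amap F (amap D u \<cdot>\<^bsub>fst X\<^esub> \<sigma> (Dom I u)) = amap (fct_comp I F D) u \<cdot>\<^bsub>fst Y\<^esub> (\<tau> (Dom I u) \<cdot>\<^bsub>fst Y\<^esub>
        e)"
      using u \<sigma>[of "Dom I u"] by simp
    also have "\<dots> = amap F (\<sigma> (Cod I u))"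
      using u \<sigma>[of "Cod I u"] e coneD(5)[OF \<tau> u, symmetric] by (simp add: Cmp_assoc del: coneD(5)[OF
          \<tau>])
    finally show "amap D u \<cdot>\<^bsub>fst X\<^esub> \<sigma> (Dom I u) = \<sigma> (Cod I u)"
      using u \<sigma>[of "Dom I u"] \<sigma>[of "Cod I u"] by - (rule faithfulD[OF faith], simp_all)
  qed (use W \<sigma> in simp_all)
  have "flat_sieve I (fst X) (fst Y) F D U \<tau> = {f \<in> Arr (fst Y). Cod (fst Y) f = U}"
  proof (intro set_eqI iffI)
    fix h assume h: "h \<in> {f \<in> Arr (fst Y). Cod (fst Y) f = U}"
    show "h \<in> flat_sieve I (fst X) (fst Y) F D U \<tau>"
      by (rule flat_sieveI[OF _ _ c, where g = "inv_arr (fst Y) e \<cdot>\<^bsub>fst Y\<^esub> h"])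
        (use h e \<sigma> in \<open>auto simp: Cmp_assoc\<close>)
  qed (auto elim: flat_sieveE)
  then show "flat_sieve I (fst X) (fst Y) F D U \<tau> \<in> snd Y U"
    using topologyD(2)[OF J, of U] by simp
qed

lemma full_on_id: "full_on C C (omap (fct_id C)) (amap (fct_id C))"
  unfolding full_on_def by simp

lemma faithful_on_id: "faithful_on C (amap (fct_id C))"
  unfolding faithful_on_def by simp

lemma ess_surj_id: "category C \<Longrightarrow> ess_surj C C (omap (fct_id C))"
  unfolding ess_surj_def by (metis omap_fct_id isomorphism_Ide Dom_Ide Cod_Ide)

section \<open>The 2-category of left-cancellative sites\<close>

lemma lc_morphsD:
  assumes "F \<in> lc_morphs"
  shows "src F \<in> lc_sites" "tgt F \<in> lc_sites" "small_functor (fst (src F)) (fst (tgt F)) (fct F)"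
    "cover_preserving (src F) (tgt F) (fct F)" "cover_flat (src F) (tgt F) (fct F)"
  using assms unfolding lc_morphs_def by auto

lemma morph_sel [simp]: "src (morph_id X) = X" "tgt (morph_id X) = X" "fct (morph_id X) = fct_id
    (fst X)"
  "src (morph_comp G F) = src F" "tgt (morph_comp G F) = tgt G"
  "fct (morph_comp G F) = fct_comp (fst (src F)) (fct G) (fct F)"
  by (simp_all add: morph_id_def morph_comp_def)

lemma morph_eqI: "src F = src G \<Longrightarrow> tgt F = tgt G \<Longrightarrow> fct F = fct G \<Longrightarrow> F = G"
  for F G :: "('s, 'u) morph"
  by (rule morph.equality) auto

lemma morph_id_lc: "X \<in> lc_sites \<Longrightarrow> morph_id X \<in> lc_morphs"
proof -
  assume X: "X \<in> lc_sites"
  note X' = lc_sitesD[OF X]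
  have "amap (fct_id (fst X)) ` S = S" if "S \<in> snd X A" for A S
    using sieveD(1)[OF topologyD(1)[OF X'(4) that]] by force
  then have "cover_preserving X X (fct_id (fst X))"
    unfolding cover_preserving_def
    using generated_sieve_sieve[OF X'(1) topologyD(1)[OF X'(4)]] by simp
  moreover have "cover_flat X X (fct_id (fst X))"
    using X' by (intro cover_flat_equivalence small_functor_id full_on_id faithful_on_id
        ess_surj_id)
  ultimately show ?thesis
    unfolding lc_morphs_def using X X' by (simp add: small_functor_id)
qed

lemma morph_comp_lc:
  assumes F: "F \<in> lc_morphs" and G: "G \<in> lc_morphs" and "tgt F = src G"
  shows "morph_comp G F \<in> lc_morphs"
proof -
  note F' = lc_morphsD[OF F] note G' = lc_morphsD[OF G, folded assms(3)]
  note s = lc_sitesD[OF F'(1)] lc_sitesD[OF F'(2)] lc_sitesD[OF G'(2)]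
  show ?thesis
    unfolding lc_morphs_def
    using F' G' s by (auto intro: small_functor_comp cover_preserving_comp cover_flat_comp)
qed

lemma nat2_sel [simp]:
  "nsrc (nat2_id F) = F" "ntgt (nat2_id F) = F"
  "nsrc (nat2_vcomp \<phi> \<theta>) = nsrc \<theta>" "ntgt (nat2_vcomp \<phi> \<theta>) = ntgt \<phi>"
  "nsrc (nat2_hcomp \<phi> \<theta>) = morph_comp (nsrc \<phi>) (nsrc \<theta>)"
  "ntgt (nat2_hcomp \<phi> \<theta>) = morph_comp (ntgt \<phi>) (ntgt \<theta>)"
  "A \<in> Obj (fst (src F)) \<Longrightarrow> ncomp (nat2_id F) A = Ide (fst (tgt F)) (omap (fct F) A)"
  "A \<in> Obj (fst (src (nsrc \<theta>))) \<Longrightarrow>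
    ncomp (nat2_vcomp \<phi> \<theta>) A = ncomp \<phi> A \<cdot>\<^bsub>fst (tgt (nsrc \<theta>))\<^esub> ncomp \<theta> A"
  "A \<in> Obj (fst (src (nsrc \<theta>))) \<Longrightarrow> ncomp (nat2_hcomp \<phi> \<theta>) A =
    ncomp \<phi> (omap (fct (ntgt \<theta>)) A) \<cdot>\<^bsub>fst (tgt (nsrc \<phi>))\<^esub> amap (fct (nsrc \<phi>)) (ncomp \<theta> A)"
  by (simp_all add: nat2_id_def nat2_vcomp_def nat2_hcomp_def)

lemma lc_natsD:
  assumes "\<theta> \<in> lc_nats"
  shows "nsrc \<theta> \<in> lc_morphs" "ntgt \<theta> \<in> lc_morphs" "src (ntgt \<theta>) = src (nsrc \<theta>)"
    "tgt (ntgt \<theta>) = tgt (nsrc \<theta>)"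
    "nat_transformation (fst (src (nsrc \<theta>))) (fst (tgt (nsrc \<theta>)))
       (fct (nsrc \<theta>)) (fct (ntgt \<theta>)) (ncomp \<theta>)"
  using assms unfolding lc_nats_def by auto

lemma lc_natsI:
  assumes "nsrc \<theta> \<in> lc_morphs" "ntgt \<theta> \<in> lc_morphs" "src (ntgt \<theta>) = src (nsrc \<theta>)"
    "tgt (ntgt \<theta>) = tgt (nsrc \<theta>)" "ncomp \<theta> \<in> extensional (Obj (fst (src (nsrc \<theta>))))"
    "\<And>A. A \<in> Obj (fst (src (nsrc \<theta>))) \<Longrightarrow> ncomp \<theta> A \<in> Arr (fst (tgt (nsrc \<theta>)))"
    "\<And>A. A \<in> Obj (fst (src (nsrc \<theta>))) \<Longrightarrow> Dom (fst (tgt (nsrc \<theta>))) (ncomp \<theta> A) = omap (fct (nsrc \<theta>))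
        A"
    "\<And>A. A \<in> Obj (fst (src (nsrc \<theta>))) \<Longrightarrow> Cod (fst (tgt (nsrc \<theta>))) (ncomp \<theta> A) = omap (fct (ntgt \<theta>))
        A"
    "\<And>f. f \<in> Arr (fst (src (nsrc \<theta>))) \<Longrightarrow>
      amap (fct (ntgt \<theta>)) f \<cdot>\<^bsub>fst (tgt (nsrc \<theta>))\<^esub> ncomp \<theta> (Dom (fst (src (nsrc \<theta>))) f) =
      ncomp \<theta> (Cod (fst (src (nsrc \<theta>))) f) \<cdot>\<^bsub>fst (tgt (nsrc \<theta>))\<^esub> amap (fct (nsrc \<theta>)) f"
  shows "\<theta> \<in> lc_nats"
  using assms unfolding lc_nats_def nat_transformation_def by simp

lemma nat2_eqI:
  assumes "\<theta> \<in> lc_nats" "\<phi> \<in> lc_nats" "nsrc \<theta> = nsrc \<phi>" "ntgt \<theta> = ntgt \<phi>"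
    "\<And>A. A \<in> Obj (fst (src (nsrc \<phi>))) \<Longrightarrow> ncomp \<theta> A = ncomp \<phi> A"
  shows "\<theta> = \<phi>"
proof (rule nat2.equality)
  show "ncomp \<theta> = ncomp \<phi>"
    by (rule extensionalityI[where A = "Obj (fst (src (nsrc \<phi>)))"])
      (use assms nat_transformationD(1) lc_natsD(5) in \<open>metis\<close>)+
qed (use assms in simp_all)

lemma nat2_id_lc:
  assumes F: "F \<in> lc_morphs" shows "nat2_id F \<in> lc_nats"
proof (rule lc_natsI)
  note [simp] = F small_functorD[OF lc_morphsD(3)[OF F]]
  show "ncomp (nat2_id F) \<in> extensional (Obj (fst (src (nsrc (nat2_id F)))))"
    by (simp add: nat2_id_def)
qed (use assms small_functorD[OF lc_morphsD(3)[OF F]] in simp_all)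

lemma nat2_vcomp_lc:
  assumes \<theta>: "\<theta> \<in> lc_nats" and \<phi>: "\<phi> \<in> lc_nats" and e: "ntgt \<theta> = nsrc \<phi>"
  shows "nat2_vcomp \<phi> \<theta> \<in> lc_nats"
proof -
  note T = lc_natsD[OF \<theta>, unfolded e] note P = lc_natsD[OF \<phi>]
  have P': "src (nsrc \<phi>) = src (nsrc \<theta>)" "tgt (nsrc \<phi>) = tgt (nsrc \<theta>)"
    using T by simp_all
  note [simp] = small_functorD[OF lc_morphsD(3)[OF T(1)]] small_functorD[OF lc_morphsD(3)[OF P(1),
      unfolded P']]
    small_functorD[OF lc_morphsD(3)[OF P(2), unfolded P P']]
    nat_transformationD(2-4)[OF T(5)] nat_transformationD(2-4)[OF P(5), unfolded P']
  show ?thesis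
  proof (rule lc_natsI)
    show "ncomp (nat2_vcomp \<phi> \<theta>) \<in> extensional (Obj (fst (src (nsrc (nat2_vcomp \<phi> \<theta>)))))"
      by (simp add: nat2_vcomp_def)
    fix f assume "f \<in> Arr (fst (src (nsrc (nat2_vcomp \<phi> \<theta>))))"
    then have f: "f \<in> Arr (fst (src (nsrc \<theta>)))" by simp
    let ?D = "fst (tgt (nsrc \<theta>))" and ?C = "fst (src (nsrc \<theta>))"
    note n1 = nat_transformationD(5)[OF T(5) f] note n2 = nat_transformationD(5)[OF P(5)[unfolded
        P'] f]
    have "amap (fct (ntgt \<phi>)) f \<cdot>\<^bsub>?D\<^esub> (ncomp \<phi> (Dom ?C f) \<cdot>\<^bsub>?D\<^esub> ncomp \<theta> (Dom ?C f)) =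
      (ncomp \<phi> (Cod ?C f) \<cdot>\<^bsub>?D\<^esub> amap (fct (nsrc \<phi>)) f) \<cdot>\<^bsub>?D\<^esub> ncomp \<theta> (Dom ?C f)"
      using f n2[symmetric] by (simp add: Cmp_assoc)
    also have "\<dots> = (ncomp \<phi> (Cod ?C f) \<cdot>\<^bsub>?D\<^esub> ncomp \<theta> (Cod ?C f)) \<cdot>\<^bsub>?D\<^esub> amap (fct (nsrc \<theta>)) f"
      using f n1 by (simp add: Cmp_assoc)
    finally show "amap (fct (ntgt (nat2_vcomp \<phi> \<theta>))) f \<cdot>\<^bsub>fst (tgt (nsrc (nat2_vcomp \<phi> \<theta>)))\<^esub>
        ncomp (nat2_vcomp \<phi> \<theta>) (Dom (fst (src (nsrc (nat2_vcomp \<phi> \<theta>)))) f) =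
      ncomp (nat2_vcomp \<phi> \<theta>) (Cod (fst (src (nsrc (nat2_vcomp \<phi> \<theta>)))) f) \<cdot>\<^bsub>fst (tgt (nsrc (nat2_vcomp
          \<phi> \<theta>)))\<^esub>
        amap (fct (nsrc (nat2_vcomp \<phi> \<theta>))) f"
      using f by simp
  qed (use T P P' in simp_all)
qed

lemma nat2_hcomp_lc:
  assumes \<theta>: "\<theta> \<in> lc_nats" and \<phi>: "\<phi> \<in> lc_nats" and e: "tgt (nsrc \<theta>) = src (nsrc \<phi>)"
  shows "nat2_hcomp \<phi> \<theta> \<in> lc_nats"
proof -
  note T = lc_natsD[OF \<theta>, unfolded e] note P = lc_natsD[OF \<phi>]
  note [simp] = small_functorD[OF lc_morphsD(3)[OF T(1), unfolded T e]]
    small_functorD[OF lc_morphsD(3)[OF T(2), unfolded T e]]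
    small_functorD[OF lc_morphsD(3)[OF P(1)]]
    small_functorD[OF lc_morphsD(3)[OF P(2), unfolded P]]
    nat_transformationD(2-4)[OF T(5)] nat_transformationD(2-4)[OF P(5)]
  show ?thesis
  proof (rule lc_natsI)
    show "ncomp (nat2_hcomp \<phi> \<theta>) \<in> extensional (Obj (fst (src (nsrc (nat2_hcomp \<phi> \<theta>)))))"
      by (simp add: nat2_hcomp_def)
    show "nsrc (nat2_hcomp \<phi> \<theta>) \<in> lc_morphs" "ntgt (nat2_hcomp \<phi> \<theta>) \<in> lc_morphs"
      using T P e by (simp_all add: morph_comp_lc)
    fix f assume "f \<in> Arr (fst (src (nsrc (nat2_hcomp \<phi> \<theta>))))"
    then have f: "f \<in> Arr (fst (src (nsrc \<theta>)))" by simp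
    let ?E = "fst (tgt (nsrc \<phi>))" and ?D = "fst (src (nsrc \<phi>))" and ?C = "fst (src (nsrc \<theta>))"
    let ?J = "amap (fct (nsrc \<phi>))"
    note n1 = nat_transformationD(5)[OF T(5) f]
    note n2 = nat_transformationD(5)[OF P(5), of "amap (fct (ntgt \<theta>)) f"]
    have "amap (fct (ntgt \<phi>)) (amap (fct (ntgt \<theta>)) f) \<cdot>\<^bsub>?E\<^esub>
        (ncomp \<phi> (omap (fct (ntgt \<theta>)) (Dom ?C f)) \<cdot>\<^bsub>?E\<^esub> ?J (ncomp \<theta> (Dom ?C f))) =
      ncomp \<phi> (omap (fct (ntgt \<theta>)) (Cod ?C f)) \<cdot>\<^bsub>?E\<^esub> ?J (amap (fct (ntgt \<theta>)) f \<cdot>\<^bsub>?D\<^esub> ncomp \<theta> (Dom ?C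
          f))"
      using f n2 by (simp add: Cmp_assoc[symmetric])
    also have "\<dots> = (ncomp \<phi> (omap (fct (ntgt \<theta>)) (Cod ?C f)) \<cdot>\<^bsub>?E\<^esub> ?J (ncomp \<theta> (Cod ?C f))) \<cdot>\<^bsub>?E\<^esub>
        ?J (amap (fct (nsrc \<theta>)) f)"
      unfolding n1 using f by (simp add: Cmp_assoc)
    finally show "amap (fct (ntgt (nat2_hcomp \<phi> \<theta>))) f \<cdot>\<^bsub>fst (tgt (nsrc (nat2_hcomp \<phi> \<theta>)))\<^esub>
        ncomp (nat2_hcomp \<phi> \<theta>) (Dom (fst (src (nsrc (nat2_hcomp \<phi> \<theta>)))) f) =
      ncomp (nat2_hcomp \<phi> \<theta>) (Cod (fst (src (nsrc (nat2_hcomp \<phi> \<theta>)))) f) \<cdot>\<^bsub>fst (tgt (nsrc (nat2_hcomp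
          \<phi> \<theta>)))\<^esub>
        amap (fct (nsrc (nat2_hcomp \<phi> \<theta>))) f"
      using f T by simp
  qed (use T P e in simp_all)
qed

lemma lcGsite_sel [simp]:
  "Obj (One lcGsite) = lc_sites" "Arr (One lcGsite) = lc_morphs" "Dom (One lcGsite) = src"
  "Cod (One lcGsite) = tgt" "Ide (One lcGsite) = morph_id" "Cmp (One lcGsite) = morph_comp"
  "Obj (Vert lcGsite) = lc_morphs" "Arr (Vert lcGsite) = lc_nats" "Dom (Vert lcGsite) = nsrc"
  "Cod (Vert lcGsite) = ntgt" "Ide (Vert lcGsite) = nat2_id" "Cmp (Vert lcGsite) = nat2_vcomp"
  "Obj (Horz lcGsite) = lc_sites" "Arr (Horz lcGsite) = lc_nats" "Dom (Horz lcGsite) = (\<lambda>\<theta>. src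
      (nsrc \<theta>))"
  "Cod (Horz lcGsite) = (\<lambda>\<theta>. tgt (nsrc \<theta>))" "Ide (Horz lcGsite) = (\<lambda>X. nat2_id (morph_id X))"
  "Cmp (Horz lcGsite) = nat2_hcomp"
  by (simp_all add: lcGsite_def)

lemma morph_comp_id:
  assumes "small_functor (fst (src F)) (fst (tgt F)) (fct F)"
  shows "morph_comp F (morph_id (src F)) = F" "morph_comp (morph_id (tgt F)) F = F"
  using assms by (auto intro!: morph_eqI simp: fct_comp_id_left fct_comp_id_right)

lemma category_One_lcGsite: "category (One lcGsite)"
proof (rule categoryI, goal_cases)
  case (11 F G H)
  then show ?case
    using fct_comp_assoc[of "fst (src F)" "fst (tgt F)" "fct F" "fst (tgt G)" "fct G" "fst (tgt H)"
        "fct H"]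
      lc_morphsD(3)[of F] lc_morphsD(3)[of G] lc_morphsD(3)[of H]
    by (auto intro!: morph_eqI)
qed (auto simp: lc_morphsD morph_id_lc morph_comp_lc morph_comp_id)

lemma nat2_assoc:
  assumes "\<theta> \<in> lc_nats" "\<phi> \<in> lc_nats" "\<psi> \<in> lc_nats" "ntgt \<theta> = nsrc \<phi>" "ntgt \<phi> = nsrc \<psi>"
  shows "nat2_vcomp (nat2_vcomp \<psi> \<phi>) \<theta> = nat2_vcomp \<psi> (nat2_vcomp \<phi> \<theta>)"
proof -
  have e: "src (nsrc \<phi>) = src (nsrc \<theta>)" "tgt (nsrc \<phi>) = tgt (nsrc \<theta>)"
    "src (nsrc \<psi>) = src (nsrc \<theta>)" "tgt (nsrc \<psi>) = tgt (nsrc \<theta>)"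
    using assms lc_natsD(3,4) by metis+
  note [simp] = nat_transformationD(2-4)[OF lc_natsD(5)[OF assms(1)]]
    nat_transformationD(2-4)[OF lc_natsD(5)[OF assms(2)], unfolded e]
    nat_transformationD(2-4)[OF lc_natsD(5)[OF assms(3)], unfolded e]
    lc_sitesD(1)[OF lc_morphsD(2)[OF lc_natsD(1)[OF assms(1)]]]
  show ?thesis
    by (rule nat2_eqI) (use assms e in \<open>simp_all add: nat2_vcomp_lc Cmp_assoc\<close>)
qed

lemma category_Vert_lcGsite: "category (Vert lcGsite)"
proof (rule categoryI, goal_cases)
  case (9 \<theta>)
  note [simp] = nat_transformationD(2-4)[OF lc_natsD(5)[of \<theta>]]
    lc_sitesD(1)[OF lc_morphsD(2)[OF lc_natsD(1)[of \<theta>]]]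
  show ?case
    by (rule nat2_eqI) (use 9 in \<open>simp_all add: nat2_vcomp_lc nat2_id_lc lc_natsD\<close>)
next
  case (10 \<theta>)
  note [simp] = nat_transformationD(2-4)[OF lc_natsD(5)[of \<theta>]]
    lc_sitesD(1)[OF lc_morphsD(2)[OF lc_natsD(1)[of \<theta>]]]
  show ?case
    by (rule nat2_eqI) (use 10 in \<open>simp_all add: nat2_vcomp_lc nat2_id_lc lc_natsD\<close>)
qed (auto simp: lc_natsD nat2_id_lc nat2_vcomp_lc nat2_assoc)

lemma morph_comp_assoc:
  assumes "F \<in> lc_morphs" "G \<in> lc_morphs" "H \<in> lc_morphs" "tgt F = src G" "tgt G = src H"
  shows "morph_comp (morph_comp H G) F = morph_comp H (morph_comp G F)"
  using assms Cmp_assoc[OF category_One_lcGsite, of F G H] by simp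

lemma nat2_hcomp_assoc:
  assumes \<theta>: "\<theta> \<in> lc_nats" and \<phi>: "\<phi> \<in> lc_nats" and \<psi>: "\<psi> \<in> lc_nats"
    and e: "tgt (nsrc \<theta>) = src (nsrc \<phi>)" "tgt (nsrc \<phi>) = src (nsrc \<psi>)"
  shows "nat2_hcomp (nat2_hcomp \<psi> \<phi>) \<theta> = nat2_hcomp \<psi> (nat2_hcomp \<phi> \<theta>)"
proof -
  note T = lc_natsD[OF \<theta>, unfolded e] note P = lc_natsD[OF \<phi>, unfolded e] note Q = lc_natsD[OF \<psi>]
  note [simp] = small_functorD[OF lc_morphsD(3)[OF T(1), unfolded T e]]
    small_functorD[OF lc_morphsD(3)[OF T(2), unfolded T e]]
    small_functorD[OF lc_morphsD(3)[OF P(1), unfolded e]]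
    small_functorD[OF lc_morphsD(3)[OF P(2), unfolded P e]]
    small_functorD[OF lc_morphsD(3)[OF Q(1)]]
    small_functorD[OF lc_morphsD(3)[OF Q(2), unfolded Q]]
    nat_transformationD(2-4)[OF T(5)] nat_transformationD(2-4)[OF P(5)] nat_transformationD(2-4)[OF
        Q(5)]
  show ?thesis
  proof (rule nat2_eqI)
    fix A assume "A \<in> Obj (fst (src (nsrc (nat2_hcomp \<psi> (nat2_hcomp \<phi> \<theta>)))))"
    then show "ncomp (nat2_hcomp (nat2_hcomp \<psi> \<phi>) \<theta>) A = ncomp (nat2_hcomp \<psi> (nat2_hcomp \<phi> \<theta>)) A"
      using T P e by (simp add: Cmp_assoc)
  qed (use T P Q e \<theta> \<phi> \<psi> in \<open>simp_all add: nat2_hcomp_lc morph_comp_assoc\<close>)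
qed

lemma nat2_hcomp_id:
  assumes \<theta>: "\<theta> \<in> lc_nats"
  shows "nat2_hcomp \<theta> (nat2_id (morph_id (src (nsrc \<theta>)))) = \<theta>"
    "nat2_hcomp (nat2_id (morph_id (tgt (nsrc \<theta>)))) \<theta> = \<theta>"
proof -
  note T = lc_natsD[OF \<theta>]
  note [simp] = small_functorD[OF lc_morphsD(3)[OF T(1)]] nat_transformationD(2-4)[OF T(5)]
    small_functorD(6)[OF lc_morphsD(3)[OF T(2), unfolded T]]
  have [simp]: "morph_comp (nsrc \<theta>) (morph_id (src (nsrc \<theta>))) = nsrc \<theta>"
    "morph_comp (ntgt \<theta>) (morph_id (src (nsrc \<theta>))) = ntgt \<theta>"
    "morph_comp (morph_id (tgt (nsrc \<theta>))) (nsrc \<theta>) = nsrc \<theta>"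
    "morph_comp (morph_id (tgt (nsrc \<theta>))) (ntgt \<theta>) = ntgt \<theta>"
    using morph_comp_id[OF lc_morphsD(3)[OF T(1)]] morph_comp_id[OF lc_morphsD(3)[OF T(2)]] T by
        simp_all
  note s = lc_morphsD(1,2)[OF T(1)]
  show "nat2_hcomp \<theta> (nat2_id (morph_id (src (nsrc \<theta>)))) = \<theta>"
    "nat2_hcomp (nat2_id (morph_id (tgt (nsrc \<theta>)))) \<theta> = \<theta>"
    using \<theta> s T by (auto intro!: nat2_eqI nat2_hcomp_lc nat2_id_lc morph_id_lc)
qed

lemma category_Horz_lcGsite: "category (Horz lcGsite)"
  by (rule categoryI)
    (auto simp: lc_natsD lc_morphsD nat2_id_lc morph_id_lc nat2_hcomp_lc nat2_hcomp_id
        nat2_hcomp_assoc)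

text \<open>The two sides differ only in their middle factors, which naturality of
  \<open>\<phi>\<close> at the component \<open>ncomp \<theta>' A\<close> exchanges.\<close>

lemma nat2_interchange:
  assumes \<theta>: "\<theta> \<in> lc_nats" and \<theta>': "\<theta>' \<in> lc_nats" and \<phi>: "\<phi> \<in> lc_nats" and \<phi>': "\<phi>' \<in> lc_nats"
    and e: "ntgt \<theta> = nsrc \<theta>'" "ntgt \<phi> = nsrc \<phi>'" "tgt (nsrc \<theta>) = src (nsrc \<phi>)"
  shows "nat2_hcomp (nat2_vcomp \<phi>' \<phi>) (nat2_vcomp \<theta>' \<theta>) = nat2_vcomp (nat2_hcomp \<phi>' \<theta>') (nat2_hcomp
      \<phi> \<theta>)"
proof -
  note T = lc_natsD[OF \<theta>, unfolded e] note P = lc_natsD[OF \<phi>, unfolded e]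
  note T' = lc_natsD[OF \<theta>', unfolded T e] note P' = lc_natsD[OF \<phi>', unfolded P e]
  note [simp] =
    small_functorD[OF lc_morphsD(3)[OF T(1), unfolded T e]]
    small_functorD[OF lc_morphsD(3)[OF T(2), unfolded T e]]
    small_functorD[OF lc_morphsD(3)[OF T'(2), unfolded T' e]]
    small_functorD[OF lc_morphsD(3)[OF P(1)]]
    small_functorD[OF lc_morphsD(3)[OF P(2), unfolded P]]
    nat_transformationD(2-4)[OF T(5)] nat_transformationD(2-4)[OF P(5)]
    nat_transformationD(2-4)[OF T'(5)] nat_transformationD(2-4)[OF P'(5)]
  show ?thesis
  proof (rule nat2_eqI)
    fix A assume "A \<in> Obj (fst (src (nsrc (nat2_vcomp (nat2_hcomp \<phi>' \<theta>') (nat2_hcomp \<phi> \<theta>)))))"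
    then have A: "A \<in> Obj (fst (src (nsrc \<theta>)))" by simp
    have n: "amap (fct (nsrc \<phi>')) (ncomp \<theta>' A) \<cdot>\<^bsub>fst (tgt (nsrc \<phi>))\<^esub> ncomp \<phi> (omap (fct (nsrc \<theta>')) A)
        =
        ncomp \<phi> (omap (fct (ntgt \<theta>')) A) \<cdot>\<^bsub>fst (tgt (nsrc \<phi>))\<^esub> amap (fct (nsrc \<phi>)) (ncomp \<theta>' A)"
      using nat_transformationD(5)[OF P(5), of "ncomp \<theta>' A"] A by simp
    let ?c = "Cmp (fst (tgt (nsrc \<phi>)))" and ?x = "ncomp \<phi>' (omap (fct (ntgt \<theta>')) A)"
      and ?z = "amap (fct (nsrc \<phi>)) (ncomp \<theta> A)"
    have "?c (?c ?x (ncomp \<phi> (omap (fct (ntgt \<theta>')) A))) (?c (amap (fct (nsrc \<phi>)) (ncomp \<theta>' A)) ?z) =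
      ?c ?x (?c (?c (ncomp \<phi> (omap (fct (ntgt \<theta>')) A)) (amap (fct (nsrc \<phi>)) (ncomp \<theta>' A))) ?z)"
      using A by (simp add: Cmp_assoc)
    also have "\<dots> = ?c (?c ?x (amap (fct (nsrc \<phi>')) (ncomp \<theta>' A))) (?c (ncomp \<phi> (omap (fct (nsrc \<theta>'))
        A)) ?z)"
      unfolding n[symmetric] using A by (simp add: Cmp_assoc)
    finally show "ncomp (nat2_hcomp (nat2_vcomp \<phi>' \<phi>) (nat2_vcomp \<theta>' \<theta>)) A =
        ncomp (nat2_vcomp (nat2_hcomp \<phi>' \<theta>') (nat2_hcomp \<phi> \<theta>)) A"
      using A T P T' P' e by simp
  qed (use assms T P T' P' e in \<open>simp_all add: nat2_vcomp_lc nat2_hcomp_lc\<close>)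
qed

lemma two_category_lcGsite: "two_category (lcGsite :: (('u::universe) gsite, ('u gsite, 'u) morph,
    'u nat2) twocat)"
  unfolding two_category_def
proof (intro conjI ballI impI; (elim conjE)?)
  fix F G :: "('u gsite, 'u) morph"
  assume *: "F \<in> Arr (One lcGsite)" "G \<in> Arr (One lcGsite)" "Cod (One lcGsite) F = Dom (One lcGsite)
      G"
  then have F: "F \<in> lc_morphs" and G: "G \<in> lc_morphs" and e: "tgt F = src G" by simp_all
  note [simp] = small_functorD[OF lc_morphsD(3)[OF F], unfolded e] small_functorD[OF
      lc_morphsD(3)[OF G]]
  have "nat2_hcomp (nat2_id G) (nat2_id F) = nat2_id (morph_comp G F)"
    by (rule nat2_eqI) (use F G e in \<open>simp_all add: nat2_hcomp_lc nat2_id_lc morph_comp_lc\<close>)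
  then show "Ide (Vert lcGsite) G \<cdot>\<^bsub>Horz lcGsite\<^esub> Ide (Vert lcGsite) F = Ide (Vert lcGsite) (G \<cdot>\<^bsub>One
      lcGsite\<^esub> F)"
    by simp
qed (auto simp: category_One_lcGsite category_Vert_lcGsite category_Horz_lcGsite lc_natsD
    nat2_interchange)

text \<open>Conditions on covers are carried by the 1-cells alone, and these are the same for the
  inverse. So the componentwise inverses, natural by conjugation of the square, already form a
  2-cell.\<close>

lemma isomorphism_nat2:
  assumes \<theta>: "\<theta> \<in> lc_nats"
    and iso: "\<And>A. A \<in> Obj (fst (src (nsrc \<theta>))) \<Longrightarrow> isomorphism (fst (tgt (nsrc \<theta>))) (ncomp \<theta> A)"
  shows "isomorphism (Vert lcGsite) \<theta>"
proof -
  note T = lc_natsD[OF \<theta>]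
  let ?C = "fst (src (nsrc \<theta>))" and ?D = "fst (tgt (nsrc \<theta>))"
  define \<phi> where "\<phi> = \<lparr>nsrc = ntgt \<theta>, ntgt = nsrc \<theta>, ncomp = \<lambda>A\<in>Obj ?C. inv_arr ?D (ncomp \<theta> A)\<rparr>"
  have [simp]: "nsrc \<phi> = ntgt \<theta>" "ntgt \<phi> = nsrc \<theta>" "A \<in> Obj ?C \<Longrightarrow> ncomp \<phi> A = inv_arr ?D (ncomp \<theta> A)"
      for A
    by (simp_all add: \<phi>_def)
  note [simp] = small_functorD[OF lc_morphsD(3)[OF T(1)]] small_functorD[OF lc_morphsD(3)[OF T(2)],
      unfolded T]
    nat_transformationD(2-4)[OF T(5)] iso
  have \<phi>: "\<phi> \<in> lc_nats"
  proof (rule lc_natsI)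
    show "ncomp \<phi> \<in> extensional (Obj (fst (src (nsrc \<phi>))))"
      by (simp add: \<phi>_def T)
    fix f assume "f \<in> Arr (fst (src (nsrc \<phi>)))"
    then have f: "f \<in> Arr ?C" by (simp add: T)
    let ?A = "Dom ?C f" and ?B = "Cod ?C f"
    have "amap (fct (nsrc \<theta>)) f \<cdot>\<^bsub>?D\<^esub> inv_arr ?D (ncomp \<theta> ?A) =
        inv_arr ?D (ncomp \<theta> ?B) \<cdot>\<^bsub>?D\<^esub> ((ncomp \<theta> ?B \<cdot>\<^bsub>?D\<^esub> amap (fct (nsrc \<theta>)) f) \<cdot>\<^bsub>?D\<^esub> inv_arr ?D (ncomp \<theta>
            ?A))"
      using f by (simp add: Cmp_assoc)
    also have "\<dots> = inv_arr ?D (ncomp \<theta> ?B) \<cdot>\<^bsub>?D\<^esub> amap (fct (ntgt \<theta>)) f"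
      unfolding nat_transformationD(5)[OF T(5) f, symmetric] using f by (simp add: Cmp_assoc)
    finally show "amap (fct (ntgt \<phi>)) f \<cdot>\<^bsub>fst (tgt (nsrc \<phi>))\<^esub> ncomp \<phi> (Dom (fst (src (nsrc \<phi>))) f) =
        ncomp \<phi> (Cod (fst (src (nsrc \<phi>))) f) \<cdot>\<^bsub>fst (tgt (nsrc \<phi>))\<^esub> amap (fct (nsrc \<phi>)) f"
      using f T by simp
  qed (use T in simp_all)
  have "nat2_vcomp \<phi> \<theta> = nat2_id (nsrc \<theta>)" "nat2_vcomp \<theta> \<phi> = nat2_id (ntgt \<theta>)"
    by (rule nat2_eqI; use \<theta> \<phi> T in \<open>simp add: nat2_vcomp_lc nat2_id_lc\<close>)+
  then show ?thesis
    using \<theta> \<phi> by (intro isoI[OF category_Vert_lcGsite, of \<theta> \<phi>]) simp_all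
qed


section \<open>Ordered groupoids\<close>

lemma ordered_groupoidD:
  assumes "ordered_groupoid \<G>"
  shows "category \<G>" "small_category \<G>" "f \<in> Arr \<G> \<Longrightarrow> isomorphism \<G> f"
    "(a, b) \<in> Le \<G> \<Longrightarrow> a \<in> Arr \<G>" "(a, b) \<in> Le \<G> \<Longrightarrow> b \<in> Arr \<G>"
    "f \<in> Arr \<G> \<Longrightarrow> (f, f) \<in> Le \<G>"
    "(a, b) \<in> Le \<G> \<Longrightarrow> (inv_arr \<G> a, inv_arr \<G> b) \<in> Le \<G>"
    "(a, b) \<in> Le \<G> \<Longrightarrow> (c, d) \<in> Le \<G> \<Longrightarrow> Dom \<G> a = Cod \<G> c \<Longrightarrow> Dom \<G> b = Cod \<G> d \<Longrightarrow>
      (a \<cdot>\<^bsub>\<G>\<^esub> c, b \<cdot>\<^bsub>\<G>\<^esub> d) \<in> Le \<G>"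
    "f \<in> Arr \<G> \<Longrightarrow> ole \<G> A (Dom \<G> f) \<Longrightarrow> \<exists>!g. g \<in> Arr \<G> \<and> Dom \<G> g = A \<and> (g, f) \<in> Le \<G>"
proof -
  have p: "partial_order_on (Arr \<G>) (Le \<G>)" and s: "Le \<G> \<subseteq> Arr \<G> \<times> Arr \<G>"
    using assms unfolding ordered_groupoid_def by simp_all
  show "(a, b) \<in> Le \<G> \<Longrightarrow> a \<in> Arr \<G>" "(a, b) \<in> Le \<G> \<Longrightarrow> b \<in> Arr \<G>"
    using s by auto
  show "f \<in> Arr \<G> \<Longrightarrow> (f, f) \<in> Le \<G>"
    using p by (simp add: partial_order_on_def preorder_on_def refl_on_def)
qed (use assms in \<open>auto simp: ordered_groupoid_def small_category_def\<close>)

lemma le_trans: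
  assumes "ordered_groupoid \<G>" "(a, b) \<in> Le \<G>" "(b, c) \<in> Le \<G>"
  shows "(a, c) \<in> Le \<G>"
proof -
  have "trans (Le \<G>)"
    using assms(1) unfolding ordered_groupoid_def partial_order_on_def preorder_on_def by simp
  then show ?thesis
    using assms(2,3) by (rule transD)
qed

lemma le_antisym:
  assumes "ordered_groupoid \<G>" "(a, b) \<in> Le \<G>" "(b, a) \<in> Le \<G>"
  shows "a = b"
proof -
  have "antisym (Le \<G>)"
    using assms(1) unfolding ordered_groupoid_def partial_order_on_def by simp
  then show ?thesis
    using assms(2,3) by (rule antisymD)
qed

lemma oleD:
  assumes "ole \<G> A B"
  shows "A \<in> Obj \<G>" "B \<in> Obj \<G>" "(Ide \<G> A, Ide \<G> B) \<in> Le \<G>"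
  using assms unfolding ole_def by auto

lemma ole_refl: "ordered_groupoid \<G> \<Longrightarrow> A \<in> Obj \<G> \<Longrightarrow> ole \<G> A A"
  unfolding ole_def by (simp add: ordered_groupoidD)

lemma ole_trans: "ordered_groupoid \<G> \<Longrightarrow> ole \<G> A B \<Longrightarrow> ole \<G> B C \<Longrightarrow> ole \<G> A C"
  unfolding ole_def using le_trans[of \<G> "Ide \<G> A" "Ide \<G> B" "Ide \<G> C"] by simp

lemma ole_antisym: "ordered_groupoid \<G> \<Longrightarrow> ole \<G> A B \<Longrightarrow> ole \<G> B A \<Longrightarrow> A = B"
  unfolding ole_def using le_antisym[of \<G> "Ide \<G> A" "Ide \<G> B"]
  by (metis Dom_Ide ordered_groupoidD(1))

text \<open>The order on objects is that of their identities, and the identity of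
  \<open>Dom \<G> a\<close> is the composite of \<open>a\<close> with its inverse; both operations
  respect the order.\<close>

lemma le_Dom:
  assumes G: "ordered_groupoid \<G>" and ab: "(a, b) \<in> Le \<G>"
  shows "ole \<G> (Dom \<G> a) (Dom \<G> b)"
proof -
  note [simp] = ordered_groupoidD(1-6)[OF G]
  have "a \<in> Arr \<G>" "b \<in> Arr \<G>"
    using ab by simp_all
  moreover have "(inv_arr \<G> a \<cdot>\<^bsub>\<G>\<^esub> a, inv_arr \<G> b \<cdot>\<^bsub>\<G>\<^esub> b) \<in> Le \<G>"
    by (rule ordered_groupoidD(8)[OF G ordered_groupoidD(7)[OF G ab] ab]) (use ab in simp_all)
  ultimately show ?thesis
    unfolding ole_def by simp
qed

lemma le_Cod:
  assumes G: "ordered_groupoid \<G>" and ab: "(a, b) \<in> Le \<G>"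
  shows "ole \<G> (Cod \<G> a) (Cod \<G> b)"
proof -
  note [simp] = ordered_groupoidD(1-6)[OF G]
  have "a \<in> Arr \<G>" "b \<in> Arr \<G>"
    using ab by simp_all
  then show ?thesis
    using le_Dom[OF G ordered_groupoidD(7)[OF G ab]] by simp
qed

lemma restr:
  assumes "ordered_groupoid \<G>" "f \<in> Arr \<G>" "ole \<G> A (Dom \<G> f)"
  shows "restr \<G> f A \<in> Arr \<G>" "Dom \<G> (restr \<G> f A) = A" "(restr \<G> f A, f) \<in> Le \<G>"
  using theI'[OF ordered_groupoidD(9)[OF assms]] unfolding restr_def by auto

text \<open>By \<open>le_Dom\<close> an arrow below \<open>f\<close> with domain \<open>A\<close>
  already shows that \<open>A\<close> lies below the domain of \<open>f\<close>, so the restriction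
  exists and is that arrow. Restrictions are computed by exhibiting such an arrow.\<close>

lemma restr_eqI:
  assumes "ordered_groupoid \<G>" "(g, f) \<in> Le \<G>" "Dom \<G> g = A"
  shows "restr \<G> f A = g"
proof -
  have f: "f \<in> Arr \<G>" "g \<in> Arr \<G>" "ole \<G> A (Dom \<G> f)"
    using assms le_Dom ordered_groupoidD(4,5) by auto
  show ?thesis
    using ordered_groupoidD(9)[OF assms(1) f(1,3)] restr[OF assms(1) f(1,3)] f(2) assms(2,3) by
        blast
qed

lemma restr_Dom: "ordered_groupoid \<G> \<Longrightarrow> f \<in> Arr \<G> \<Longrightarrow> Dom \<G> f = A \<Longrightarrow> restr \<G> f A = f"
  by (rule restr_eqI) (simp_all add: ordered_groupoidD)

lemma restr_Ide: "ordered_groupoid \<G> \<Longrightarrow> ole \<G> A B \<Longrightarrow> restr \<G> (Ide \<G> B) A = Ide \<G> A"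
  by (rule restr_eqI) (simp_all add: ordered_groupoidD oleD)

lemma ole_Cod_restr:
  "ordered_groupoid \<G> \<Longrightarrow> f \<in> Arr \<G> \<Longrightarrow> ole \<G> A (Dom \<G> f) \<Longrightarrow> ole \<G> (Cod \<G> (restr \<G> f A)) (Cod \<G> f)"
  by (rule le_Cod) (simp_all add: restr)

lemma restr_restr:
  assumes G: "ordered_groupoid \<G>" and f: "f \<in> Arr \<G>" "ole \<G> A (Dom \<G> f)" "ole \<G> B A"
  shows "restr \<G> (restr \<G> f A) B = restr \<G> f B"
proof -
  have B: "ole \<G> B (Dom \<G> f)"
    using ole_trans[OF G f(3,2)] .
  have 1: "restr \<G> f A \<in> Arr \<G>" "ole \<G> B (Dom \<G> (restr \<G> f A))"
    using restr[OF G f(1,2)] f(3) by simp_all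
  show ?thesis
    by (rule restr_eqI[OF G, symmetric])
      (use le_trans[OF G restr(3)[OF G 1] restr(3)[OF G f(1,2)]] restr(2)[OF G 1] in simp_all)
qed

lemma ole_Cod_restr_restr:
  assumes G: "ordered_groupoid \<G>" and f: "f \<in> Arr \<G>" "ole \<G> A (Dom \<G> f)" "ole \<G> B A"
  shows "ole \<G> (Cod \<G> (restr \<G> f B)) (Cod \<G> (restr \<G> f A))"
  using ole_Cod_restr[OF G restr(1)[OF G f(1,2)], of B] restr_restr[OF assms] restr(2)[OF G f(1,2)]
      f(3)
  by simp

text \<open>\<open>restr \<G> f A\<close> and \<open>restr \<G> g A\<close> both lie below
  \<open>g\<close> with domain \<open>A\<close>, so they coincide, and the latter is a restriction
  of \<open>restr \<G> g B\<close>.\<close>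

lemma restr_mono:
  assumes G: "ordered_groupoid \<G>" and le: "(f, g) \<in> Le \<G>" "ole \<G> A (Dom \<G> f)" "ole \<G> A B" "ole \<G> B
      (Dom \<G> g)"
  shows "(restr \<G> f A, restr \<G> g B) \<in> Le \<G>"
proof -
  have f: "f \<in> Arr \<G>" "g \<in> Arr \<G>"
    using ordered_groupoidD(4,5)[OF G le(1)] by simp_all
  note r = restr[OF G f(1) le(2)] and s = restr[OF G f(2) le(4)]
  have "restr \<G> g A = restr \<G> f A"
    by (rule restr_eqI[OF G le_trans[OF G r(3) le(1)] r(2)])
  then have "restr \<G> (restr \<G> g B) A = restr \<G> f A"
    using restr_restr[OF G f(2) le(4,3)] by simp
  then show ?thesis
    using restr(3)[OF G s(1), of A] s(2) le(3) by simp
qed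

lemma restr_Cmp:
  assumes G: "ordered_groupoid \<G>" and f: "f \<in> Arr \<G>" "g \<in> Arr \<G>" "Cod \<G> f = Dom \<G> g"
    and A: "ole \<G> A (Dom \<G> f)"
  shows "restr \<G> (g \<cdot>\<^bsub>\<G>\<^esub> f) A = restr \<G> g (Cod \<G> (restr \<G> f A)) \<cdot>\<^bsub>\<G>\<^esub> restr \<G> f A"
proof (rule restr_eqI[OF G])
  have B: "ole \<G> (Cod \<G> (restr \<G> f A)) (Dom \<G> g)"
    using ole_Cod_restr[OF G f(1) A] f(3) by simp
  note r = restr[OF G f(1) A] restr[OF G f(2) B]
  note [simp] = ordered_groupoidD(1)[OF G]
  show "(restr \<G> g (Cod \<G> (restr \<G> f A)) \<cdot>\<^bsub>\<G>\<^esub> restr \<G> f A, g \<cdot>\<^bsub>\<G>\<^esub> f) \<in> Le \<G>"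
    by (rule ordered_groupoidD(8)[OF G]) (use r f in simp_all)
  show "Dom \<G> (restr \<G> g (Cod \<G> (restr \<G> f A)) \<cdot>\<^bsub>\<G>\<^esub> restr \<G> f A) = A"
    using r by simp
qed

lemma restr_inv_arr:
  assumes G: "ordered_groupoid \<G>" and f: "f \<in> Arr \<G>" "ole \<G> A (Dom \<G> f)"
  shows "restr \<G> (inv_arr \<G> f) (Cod \<G> (restr \<G> f A)) = inv_arr \<G> (restr \<G> f A)"
  by (rule restr_eqI[OF G ordered_groupoidD(7)[OF G restr(3)[OF G f]]])
    (simp add: ordered_groupoidD[OF G] restr[OF G f])

text \<open>The axiom on restrictions speaks of domains. Passing to inverses turns codomains into
  domains, and its uniqueness part then applies.\<close>

lemma le_eq_Cod:
  assumes G: "ordered_groupoid \<G>" and le: "(g, f) \<in> Le \<G>" "(h, f) \<in> Le \<G>" and e: "Cod \<G> g = Cod \<G> h"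
  shows "g = h"
proof -
  note [simp] = ordered_groupoidD(1-5)[OF G]
  have a: "g \<in> Arr \<G>" "h \<in> Arr \<G>"
    using ordered_groupoidD(4)[OF G] le by auto
  have "inv_arr \<G> g = restr \<G> (inv_arr \<G> f) (Cod \<G> g)"
    by (rule restr_eqI[OF G ordered_groupoidD(7)[OF G le(1)], symmetric]) (use a in simp)
  also have "\<dots> = inv_arr \<G> h"
    unfolding e by (rule restr_eqI[OF G ordered_groupoidD(7)[OF G le(2)]]) (use a in simp)
  finally have i: "inv_arr \<G> g = inv_arr \<G> h" .
  have "g = g \<cdot>\<^bsub>\<G>\<^esub> (inv_arr \<G> h \<cdot>\<^bsub>\<G>\<^esub> h)"
    using a arg_cong[OF i, of "Cod \<G>"] by simp
  also have "\<dots> = (g \<cdot>\<^bsub>\<G>\<^esub> inv_arr \<G> g) \<cdot>\<^bsub>\<G>\<^esub> h"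
    unfolding i using a arg_cong[OF i, of "Cod \<G>"] by (simp add: Cmp_assoc)
  finally show ?thesis
    using a e by simp
qed

text \<open>This injectivity is the source of left-cancellation in \<open>L_cat \<G>\<close>, and it
  also singles out the isomorphisms there.\<close>

lemma restr_Cod_inject:
  assumes G: "ordered_groupoid \<G>" and f: "f \<in> Arr \<G>" "ole \<G> A (Dom \<G> f)" "ole \<G> B (Dom \<G> f)"
    and e: "Cod \<G> (restr \<G> f A) = Cod \<G> (restr \<G> f B)"
  shows "A = B"
proof -
  have "Dom \<G> (restr \<G> f A) = Dom \<G> (restr \<G> f B)"
    by (rule arg_cong[OF le_eq_Cod[OF G restr(3)[OF G f(1,2)] restr(3)[OF G f(1,3)] e]])
  then show ?thesis
    unfolding restr(2)[OF G f(1,2)] restr(2)[OF G f(1,3)] .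
qed


section \<open>The category of an ordered groupoid\<close>

text \<open>In the rule for composites the middle object is a separate \<open>B\<close> with the
  premise \<open>B = Dom \<G> k\<close>, so that it also rewrites terms in which the two are written
  differently.\<close>

lemma L_cat_sel:
  "Obj (L_cat \<G>) = Obj \<G>"
  "vpair h B \<in> Arr (L_cat \<G>) \<longleftrightarrow> h \<in> Arr \<G> \<and> ole \<G> (Cod \<G> h) B"
  "h \<in> Arr \<G> \<Longrightarrow> ole \<G> (Cod \<G> h) B \<Longrightarrow> Dom (L_cat \<G>) (vpair h B) = Dom \<G> h"
  "h \<in> Arr \<G> \<Longrightarrow> ole \<G> (Cod \<G> h) B \<Longrightarrow> Cod (L_cat \<G>) (vpair h B) = B"
  "A \<in> Obj \<G> \<Longrightarrow> Ide (L_cat \<G>) A = vpair (Ide \<G> A) A"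
  "h \<in> Arr \<G> \<Longrightarrow> ole \<G> (Cod \<G> h) B \<Longrightarrow> k \<in> Arr \<G> \<Longrightarrow> ole \<G> (Cod \<G> k) C \<Longrightarrow> B = Dom \<G> k \<Longrightarrow>
    vpair k C \<cdot>\<^bsub>L_cat \<G>\<^esub> vpair h B = vpair (restr \<G> k (Cod \<G> h) \<cdot>\<^bsub>\<G>\<^esub> h) C"
  by (auto simp: L_cat_def L_arr_def)

lemma L_arrE:
  assumes "x \<in> Arr (L_cat \<G>)"
  obtains h B where "x = vpair h B" "h \<in> Arr \<G>" "ole \<G> (Cod \<G> h) B"
  using assms unfolding L_cat_def L_arr_def by auto

text \<open>Associativity is the only law with content: \<open>restr_Cmp\<close> splits the
  restriction of a composite, and \<open>restr_restr\<close> merges the two successive restrictions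
  of the last factor.\<close>

lemma category_L_cat:
  assumes G: "ordered_groupoid \<G>"
  shows "category (L_cat \<G>)"
proof -
  note [simp] = ordered_groupoidD(1,6)[OF G] L_cat_sel ole_refl[OF G] restr[OF G] oleD(1,2)
    restr_Dom[OF G] restr_Ide[OF G]
  have 1: "ole \<G> (Cod \<G> (restr \<G> k (Cod \<G> h))) C"
    if "k \<in> Arr \<G>" "ole \<G> (Cod \<G> k) C" "ole \<G> (Cod \<G> h) (Dom \<G> k)" for h k C
    using ole_trans[OF G ole_Cod_restr[OF G that(1,3)] that(2)] .
  show ?thesis
  proof (rule categoryI, goal_cases)
    case (11 x y z)
    then obtain f B g C h D where x: "x = vpair f B" "f \<in> Arr \<G>" "ole \<G> (Cod \<G> f) B"
      and y: "y = vpair g C" "g \<in> Arr \<G>" "ole \<G> (Cod \<G> g) C"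
      and z: "z = vpair h D" "h \<in> Arr \<G>" "ole \<G> (Cod \<G> h) D"
      by (metis L_arrE)
    have e: "B = Dom \<G> g" "C = Dom \<G> h"
      using 11 x y z by simp_all
    have "restr \<G> (restr \<G> h (Cod \<G> g) \<cdot>\<^bsub>\<G>\<^esub> g) (Cod \<G> f) =
        restr \<G> (restr \<G> h (Cod \<G> g)) (Cod \<G> (restr \<G> g (Cod \<G> f))) \<cdot>\<^bsub>\<G>\<^esub> restr \<G> g (Cod \<G> f)"
      by (rule restr_Cmp[OF G]) (use x y z e in simp_all)
    also have "restr \<G> (restr \<G> h (Cod \<G> g)) (Cod \<G> (restr \<G> g (Cod \<G> f))) =
        restr \<G> h (Cod \<G> (restr \<G> g (Cod \<G> f)))"
      by (rule restr_restr[OF G]) (use x y z e ole_Cod_restr[OF G] in simp_all)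
    finally show ?case
      using x y z e 1 by (simp add: Cmp_assoc)
  qed (auto elim!: L_arrE simp: 1)
qed

lemma small_category_L_cat:
  assumes G: "ordered_groupoid \<G>"
  shows "small_category (L_cat \<G>)"
proof -
  have s: "small (Obj \<G>)" "small (Arr \<G>)"
    using ordered_groupoidD(2)[OF G] unfolding small_category_def by simp_all
  have "L_arr \<G> \<subseteq> {vpair h B | h B. h \<in> Arr \<G> \<and> B \<in> Obj \<G>}"
    unfolding L_arr_def by (auto dest: oleD)
  then have "small (L_arr \<G>)"
    using small_image2[OF s(2,1), of vpair] by (rule small_subset[rotated])
  moreover have "g \<cdot>\<^bsub>L_cat \<G>\<^esub> f = undefined"
    if "\<not> (f \<in> Arr (L_cat \<G>) \<and> g \<in> Arr (L_cat \<G>) \<and> Cod (L_cat \<G>) f = Dom (L_cat \<G>) g)" for f g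
    using that unfolding L_cat_def by auto
  ultimately show ?thesis
    unfolding small_category_def using category_L_cat[OF G] s by (auto simp: L_cat_def)
qed

text \<open>Equal composites have equal codomains, and a restriction of \<open>h\<close> is
  determined by its codomain. So both composites contain the same restriction of \<open>h\<close>,
  an isomorphism of \<G>, which cancels. The vertical part of an arrow is fixed by its
  codomain.\<close>

lemma left_cancellative_L_cat:
  assumes G: "ordered_groupoid \<G>"
  shows "left_cancellative (L_cat \<G>)"
  unfolding left_cancellative_def monomorphism_def
proof (intro ballI conjI impI, assumption, elim conjE)
  note [simp] = ordered_groupoidD(1,3,6)[OF G] L_cat_sel ole_refl[OF G] restr[OF G] oleD(1,2)
  fix m x y assume *: "m \<in> Arr (L_cat \<G>)" "x \<in> Arr (L_cat \<G>)" "y \<in> Arr (L_cat \<G>)"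
    "Cod (L_cat \<G>) x = Dom (L_cat \<G>) m" "Cod (L_cat \<G>) y = Dom (L_cat \<G>) m"
    "Dom (L_cat \<G>) x = Dom (L_cat \<G>) y" "m \<cdot>\<^bsub>L_cat \<G>\<^esub> x = m \<cdot>\<^bsub>L_cat \<G>\<^esub> y"
  then obtain h B f A g A' where m: "m = vpair h B" "h \<in> Arr \<G>" "ole \<G> (Cod \<G> h) B"
    and x: "x = vpair f A" "f \<in> Arr \<G>" "ole \<G> (Cod \<G> f) A"
    and y: "y = vpair g A'" "g \<in> Arr \<G>" "ole \<G> (Cod \<G> g) A'"
    by (metis L_arrE)
  have A: "A = Dom \<G> h" "A' = Dom \<G> h"
    using * m x y by simp_all
  have e: "restr \<G> h (Cod \<G> f) \<cdot>\<^bsub>\<G>\<^esub> f = restr \<G> h (Cod \<G> g) \<cdot>\<^bsub>\<G>\<^esub> g"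
    using *(7) m x y A by simp
  have "Cod \<G> (restr \<G> h (Cod \<G> f)) = Cod \<G> (restr \<G> h (Cod \<G> g))"
    using arg_cong[OF e, of "Cod \<G>"] m x y A by simp
  then have c: "Cod \<G> f = Cod \<G> g"
    using restr_Cod_inject[OF G m(2)] x y A by simp
  have "f = g"
    using e m x y A c by (intro isomorphism_left_cancel[of \<G> "restr \<G> h (Cod \<G> f)" f g]) simp_all
  then show "x = y"
    using x y A by simp
qed

text \<open>If \<open>l\<close> after \<open>k\<close> is an identity, then the domain of
  \<open>k\<close> is the codomain of a restriction of \<open>l\<close> and so lies below the
  codomain of \<open>l\<close>. The latter lies below the domain of \<open>k\<close> by typing, so
  the two agree, and \<open>restr_Cod_inject\<close> removes the vertical part of
  \<open>k\<close>.\<close>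

lemma isomorphism_L_cat_iff:
  assumes G: "ordered_groupoid \<G>"
  shows "isomorphism (L_cat \<G>) x \<longleftrightarrow> (\<exists>k\<in>Arr \<G>. x = vpair k (Cod \<G> k))"
proof
  note [simp] = ordered_groupoidD(1,3,6)[OF G] L_cat_sel ole_refl[OF G] restr[OF G] oleD(1,2)
    restr_Dom[OF G]
  show "isomorphism (L_cat \<G>) x" if ex: "\<exists>k\<in>Arr \<G>. x = vpair k (Cod \<G> k)"
  proof -
    obtain k where k: "k \<in> Arr \<G>" "x = vpair k (Cod \<G> k)"
      using ex by blast
    then show ?thesis
      by (intro isoI[OF category_L_cat[OF G], of _ "vpair (inv_arr \<G> k) (Dom \<G> k)"]) simp_all
  qed
  assume "isomorphism (L_cat \<G>) x"
  then obtain y where *: "x \<in> Arr (L_cat \<G>)" "y \<in> Arr (L_cat \<G>)" "Dom (L_cat \<G>) y = Cod (L_cat \<G>) x"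
    "Cod (L_cat \<G>) y = Dom (L_cat \<G>) x" "y \<cdot>\<^bsub>L_cat \<G>\<^esub> x = Ide (L_cat \<G>) (Dom (L_cat \<G>) x)"
    unfolding isomorphism_def is_inverse_def by blast
  then obtain k B l A where x: "x = vpair k B" "k \<in> Arr \<G>" "ole \<G> (Cod \<G> k) B"
    and y: "y = vpair l A" "l \<in> Arr \<G>" "ole \<G> (Cod \<G> l) A"
    by (metis L_arrE)
  have A: "A = Dom \<G> k" "B = Dom \<G> l"
    using * x y by simp_all
  have e: "restr \<G> l (Cod \<G> k) \<cdot>\<^bsub>\<G>\<^esub> k = Ide \<G> (Dom \<G> k)"
    using *(5) x y A by simp
  have "Cod \<G> (restr \<G> l (Cod \<G> k)) = Dom \<G> k"
    using arg_cong[OF e, of "Cod \<G>"] x y A by simp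
  moreover have "ole \<G> (Cod \<G> (restr \<G> l (Cod \<G> k))) (Cod \<G> l)"
    using ole_Cod_restr[OF G y(2)] x A by simp
  ultimately have "Cod \<G> l = Dom \<G> k"
    using y A ole_antisym[OF G] by metis
  then have "Cod \<G> (restr \<G> l (Cod \<G> k)) = Cod \<G> (restr \<G> l (Dom \<G> l))"
    using \<open>Cod \<G> (restr \<G> l (Cod \<G> k)) = Dom \<G> k\<close> y by simp
  then have "Cod \<G> k = Dom \<G> l"
    by (rule restr_Cod_inject[OF G y(2), rotated 2]) (use x y A in simp_all)
  then show "\<exists>k\<in>Arr \<G>. x = vpair k (Cod \<G> k)"
    using x A by auto
qed


section \<open>The topology on the category of an Ehresmann site\<close>

lemma vsieveD:
  assumes "vsieve \<G> A \<A>"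
  shows "A \<in> Obj \<G>" "B \<in> \<A> \<Longrightarrow> ole \<G> B A" "B \<in> \<A> \<Longrightarrow> ole \<G> B' B \<Longrightarrow> B' \<in> \<A>"
  using assms unfolding vsieve_def by auto

lemma ehresmannD:
  assumes "ehresmann_topology \<G> T"
  shows "\<A> \<in> T A \<Longrightarrow> vsieve \<G> A \<A>" "A \<in> Obj \<G> \<Longrightarrow> {A'. ole \<G> A' A} \<in> T A"
    "\<B> \<in> T B \<Longrightarrow> f \<in> Arr \<G> \<Longrightarrow> ole \<G> (Cod \<G> f) B \<Longrightarrow> vsieve_pullback \<G> f \<B> \<in> T (Dom \<G> f)"
    "\<A> \<in> T A \<Longrightarrow> vsieve \<G> A \<B> \<Longrightarrow>
      (\<And>f. f \<in> Arr \<G> \<Longrightarrow> Cod \<G> f \<in> \<A> \<Longrightarrow> vsieve_pullback \<G> f \<B> \<in> T (Dom \<G> f)) \<Longrightarrow> \<B> \<in> T A"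
proof -
  have *: "\<forall>A. \<forall>\<A>\<in>T A. vsieve \<G> A \<A>" "\<forall>A\<in>Obj \<G>. {A'. ole \<G> A' A} \<in> T A"
    "\<forall>B\<in>Obj \<G>. \<forall>\<B>\<in>T B. \<forall>f\<in>Arr \<G>. ole \<G> (Cod \<G> f) B \<longrightarrow> vsieve_pullback \<G> f \<B> \<in> T (Dom \<G> f)"
    "\<forall>A\<in>Obj \<G>. \<forall>\<A>\<in>T A. \<forall>\<B>. vsieve \<G> A \<B> \<and>
        (\<forall>f\<in>Arr \<G>. Cod \<G> f \<in> \<A> \<longrightarrow> vsieve_pullback \<G> f \<B> \<in> T (Dom \<G> f)) \<longrightarrow> \<B> \<in> T A"
    using assms unfolding ehresmann_topology_def by blast+
  show "\<A> \<in> T A \<Longrightarrow> vsieve \<G> A \<A>" "A \<in> Obj \<G> \<Longrightarrow> {A'. ole \<G> A' A} \<in> T A"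
    using * by simp_all
  show "\<B> \<in> T B \<Longrightarrow> f \<in> Arr \<G> \<Longrightarrow> ole \<G> (Cod \<G> f) B \<Longrightarrow> vsieve_pullback \<G> f \<B> \<in> T (Dom \<G> f)"
    using *(3) oleD(2)[of \<G> "Cod \<G> f" B] by simp
  show "\<A> \<in> T A \<Longrightarrow> vsieve \<G> A \<B> \<Longrightarrow>
      (\<And>f. f \<in> Arr \<G> \<Longrightarrow> Cod \<G> f \<in> \<A> \<Longrightarrow> vsieve_pullback \<G> f \<B> \<in> T (Dom \<G> f)) \<Longrightarrow> \<B> \<in> T A"
    using *(4) vsieveD(1)[of \<G> A \<B>] by simp
qed

section \<open>Sieves of \<open>L_cat\<close> as vertical sieves\<close>

definition vimg :: "('u::universe, 'u) ogpd \<Rightarrow> 'u set \<Rightarrow> 'u set" where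
  "vimg \<G> S = (\<lambda>x. Cod \<G> (vfst x)) ` S"

text \<open>Inverse to \<open>vimg\<close> on vertical sieves on \<open>A\<close>: all arrows to
  \<open>A\<close> whose horizontal part ends in a member.\<close>

definition hsieve :: "('u::universe, 'u) ogpd \<Rightarrow> 'u \<Rightarrow> 'u set \<Rightarrow> 'u set" where
  "hsieve \<G> A \<A> = {vpair h A | h. h \<in> Arr \<G> \<and> Cod \<G> h \<in> \<A>}"

lemma J_of_iff: "S \<in> J_of X A \<longleftrightarrow> sieve (L_cat (fst X)) A S \<and> vimg (fst X) S \<in> snd X A"
  unfolding J_of_def vimg_def by simp

text \<open>A sieve is closed under precomposition with the horizontal isomorphism
  \<open>inv_arr \<G> k\<close> after \<open>h\<close>, which turns an arrow with horizontal part
  \<open>k\<close> into any other one with the same horizontal codomain. So a sieve is recovered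
  from its vertical image, and covers can be compared there.\<close>

lemma sieve_L_cat_iff:
  assumes G: "ordered_groupoid \<G>" and S: "sieve (L_cat \<G>) A S"
  shows "x \<in> S \<longleftrightarrow> (\<exists>h\<in>Arr \<G>. x = vpair h A \<and> Cod \<G> h \<in> vimg \<G> S)"
proof
  note [simp] = ordered_groupoidD(1,3,6)[OF G] L_cat_sel ole_refl[OF G] restr[OF G] oleD(1,2)
    restr_Dom[OF G]
  show "\<exists>h\<in>Arr \<G>. x = vpair h A \<and> Cod \<G> h \<in> vimg \<G> S" if "x \<in> S"
  proof -
    have "x \<in> Arr (L_cat \<G>)" "Cod (L_cat \<G>) x = A"
      using sieveD[OF S that] by simp_all
    then obtain h where "x = vpair h A" "h \<in> Arr \<G>"
      by (auto elim: L_arrE)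
    then show ?thesis
      using that unfolding vimg_def by force
  qed
  assume "\<exists>h\<in>Arr \<G>. x = vpair h A \<and> Cod \<G> h \<in> vimg \<G> S"
  then obtain h y where h: "h \<in> Arr \<G>" "x = vpair h A" "y \<in> S" "Cod \<G> h = Cod \<G> (vfst y)"
    unfolding vimg_def by auto
  have y: "y \<in> Arr (L_cat \<G>)" "Cod (L_cat \<G>) y = A"
    using sieveD[OF S h(3)] by simp_all
  then obtain k where k: "y = vpair k A" "k \<in> Arr \<G>" "ole \<G> (Cod \<G> k) A"
    by (auto elim: L_arrE)
  have "y \<cdot>\<^bsub>L_cat \<G>\<^esub> vpair (inv_arr \<G> k \<cdot>\<^bsub>\<G>\<^esub> h) (Dom \<G> k) \<in> S"
    by (rule sieveD(3)[OF S h(3)]) (use k h in simp_all)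
  then show "x \<in> S"
    using k h by (simp add: Cmp_assoc[symmetric])
qed

lemma vsieve_vimg:
  assumes G: "ordered_groupoid \<G>" and S: "sieve (L_cat \<G>) A S"
  shows "vsieve \<G> A (vimg \<G> S)"
  unfolding vsieve_def
proof (intro conjI subsetI ballI allI impI)
  note [simp] = ordered_groupoidD(1,3,6)[OF G] L_cat_sel ole_refl[OF G] restr[OF G] oleD(1,2)
    restr_Dom[OF G] restr_Ide[OF G]
  note S_iff = sieve_L_cat_iff[OF G S]
  show "A \<in> Obj \<G>"
    using sieve_Obj[OF S] by simp
  show B: "B \<in> {A'. ole \<G> A' A}" if *: "B \<in> vimg \<G> S" for B
  proof -
    obtain x where x: "x \<in> S" "B = Cod \<G> (vfst x)"
      using * unfolding vimg_def by auto
    then obtain h where h: "h \<in> Arr \<G>" "vpair h A \<in> S" "B = Cod \<G> h"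
      using S_iff[of x] by auto
    show ?thesis
      using sieveD(1)[OF S h(2)] h by simp
  qed
  fix B B' assume *: "B \<in> vimg \<G> S" "ole \<G> B' B"
  then have "vpair (Ide \<G> B) A \<in> S"
    unfolding S_iff using oleD(2)[OF *(2)] by auto
  then have "vpair (Ide \<G> B) A \<cdot>\<^bsub>L_cat \<G>\<^esub> vpair (Ide \<G> B') B \<in> S"
    by (rule sieveD(3)[OF S]) (use * B in simp_all)
  moreover have "vpair (Ide \<G> B) A \<cdot>\<^bsub>L_cat \<G>\<^esub> vpair (Ide \<G> B') B = vpair (Ide \<G> B') A"
    using * B[OF *(1)] by simp
  ultimately show "B' \<in> vimg \<G> S"
    unfolding vimg_def using oleD(1)[OF *(2)] by (force intro!: image_eqI[where x = "vpair (Ide \<G>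
        B') A"])
qed

lemma sieve_hsieve:
  assumes G: "ordered_groupoid \<G>" and A: "vsieve \<G> A \<A>"
  shows "sieve (L_cat \<G>) A (hsieve \<G> A \<A>)"
proof (rule sieveI)
  note [simp] = ordered_groupoidD(1,3,6)[OF G] L_cat_sel ole_refl[OF G] restr[OF G] oleD(1,2)
  note v = vsieveD[OF A]
  show "A \<in> Obj (L_cat \<G>)" using v by simp
  show "f \<in> Arr (L_cat \<G>) \<and> Cod (L_cat \<G>) f = A" if "f \<in> hsieve \<G> A \<A>" for f
    using that v(2) unfolding hsieve_def by auto
  fix f g assume "f \<in> hsieve \<G> A \<A>" and g: "g \<in> Arr (L_cat \<G>)" "Cod (L_cat \<G>) g = Dom (L_cat \<G>) f"
  then obtain h where h: "h \<in> Arr \<G>" "Cod \<G> h \<in> \<A>" "f = vpair h A"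
    unfolding hsieve_def by auto
  obtain k where k: "g = vpair k (Dom \<G> h)" "k \<in> Arr \<G>" "ole \<G> (Cod \<G> k) (Dom \<G> h)"
    using g h v(2)[OF h(2)] by (auto elim!: L_arrE)
  have "Cod \<G> (restr \<G> h (Cod \<G> k)) \<in> \<A>"
    using v(3)[OF h(2)] ole_Cod_restr[OF G h(1) k(3)] by simp
  then show "f \<cdot>\<^bsub>L_cat \<G>\<^esub> g \<in> hsieve \<G> A \<A>"
    unfolding hsieve_def using h k v(2)[OF h(2)] by auto
qed

lemma vimg_hsieve:
  assumes G: "ordered_groupoid \<G>" and A: "vsieve \<G> A \<A>"
  shows "vimg \<G> (hsieve \<G> A \<A>) = \<A>"
proof (intro set_eqI iffI)
  fix B assume B: "B \<in> \<A>"
  then have "B \<in> Obj \<G>"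
    using oleD(1)[OF vsieveD(2)[OF A]] by simp
  then show "B \<in> vimg \<G> (hsieve \<G> A \<A>)"
    unfolding vimg_def hsieve_def using B ordered_groupoidD(1)[OF G]
    by (force intro!: image_eqI[where x = "vpair (Ide \<G> B) A"])
qed (auto simp: vimg_def hsieve_def)

lemma hsieve_in_J_of:
  assumes "ordered_groupoid (fst X)" "ehresmann_topology (fst X) (snd X)" "\<A> \<in> snd X A"
  shows "hsieve (fst X) A \<A> \<in> J_of X A"
  unfolding J_of_iff using assms sieve_hsieve vimg_hsieve ehresmannD(1) by metis

text \<open>Every object of the vertical pullback is realised by a vertical arrow into the domain of
  \<open>f\<close>. Through this identity, stability and transitivity of \<open>J_of\<close> become
  the corresponding axioms for vertical sieves.\<close>

lemma vimg_sieve_pullback: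
  assumes G: "ordered_groupoid \<G>" and S: "sieve (L_cat \<G>) A S" and f: "f \<in> Arr \<G>" "ole \<G> (Cod \<G> f)
      A"
  shows "vimg \<G> (sieve_pullback (L_cat \<G>) (vpair f A) S) = vsieve_pullback \<G> f (vimg \<G> S)"
proof (intro set_eqI iffI)
  note [simp] = ordered_groupoidD(1,3,6)[OF G] L_cat_sel ole_refl[OF G] restr[OF G] oleD(1,2)
    restr_Dom[OF G] restr_Ide[OF G]
  note S_iff = sieve_L_cat_iff[OF G S]
  fix B
  {
    assume "B \<in> vimg \<G> (sieve_pullback (L_cat \<G>) (vpair f A) S)"
    then obtain g where g: "g \<in> Arr (L_cat \<G>)" "Cod (L_cat \<G>) g = Dom \<G> f"
      "vpair f A \<cdot>\<^bsub>L_cat \<G>\<^esub> g \<in> S" "B = Cod \<G> (vfst g)"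
      unfolding vimg_def sieve_pullback_def using f by auto
    obtain k where k: "g = vpair k (Dom \<G> f)" "k \<in> Arr \<G>" "ole \<G> (Cod \<G> k) (Dom \<G> f)"
      using g by (auto elim!: L_arrE)
    then have "Cod \<G> (restr \<G> f (Cod \<G> k) \<cdot>\<^bsub>\<G>\<^esub> k) \<in> vimg \<G> S"
      using g(3) f unfolding S_iff by auto
    then show "B \<in> vsieve_pullback \<G> f (vimg \<G> S)"
      unfolding vsieve_pullback_def using k g f by simp
  }
  assume B: "B \<in> vsieve_pullback \<G> f (vimg \<G> S)"
  then have B': "ole \<G> B (Dom \<G> f)" "Cod \<G> (restr \<G> f B) \<in> vimg \<G> S"
    unfolding vsieve_pullback_def by simp_all
  have "vpair f A \<cdot>\<^bsub>L_cat \<G>\<^esub> vpair (Ide \<G> B) (Dom \<G> f) \<in> S"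
    unfolding S_iff using B' f oleD(1)[OF B'(1)] by auto
  then show "B \<in> vimg \<G> (sieve_pullback (L_cat \<G>) (vpair f A) S)"
    unfolding vimg_def sieve_pullback_def using B' f oleD(1)[OF B'(1)]
    by (auto intro!: image_eqI[where x = "vpair (Ide \<G> B) (Dom \<G> f)"])
qed

text \<open>The arrows of a sieve are exactly those whose horizontal part ends in the vertical
  image. This is the range of the quantifier in the transitivity axiom of an Ehresmann topology, so
  the axioms translate one by one.\<close>

lemma topology_J_of:
  assumes G: "ordered_groupoid (fst X)" and T: "ehresmann_topology (fst X) (snd X)"
  shows "grothendieck_topology (L_cat (fst X)) (J_of X)"
  unfolding grothendieck_topology_def
proof (intro conjI allI ballI impI; (elim conjE)?)
  note [simp] = ordered_groupoidD(1,3,6)[OF G] L_cat_sel ole_refl[OF G] restr[OF G] oleD(1,2)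
    category_L_cat[OF G]
  show "sieve (L_cat (fst X)) A S" if "S \<in> J_of X A" for A S
    using that by (simp add: J_of_iff)
  show "{f \<in> Arr (L_cat (fst X)). Cod (L_cat (fst X)) f = A} \<in> J_of X A"
    if "A \<in> Obj (L_cat (fst X))" for A
  proof -
    have "vimg (fst X) {f \<in> Arr (L_cat (fst X)). Cod (L_cat (fst X)) f = A} = {A'. ole (fst X) A'
        A}"
    proof (intro set_eqI iffI)
      fix B assume "B \<in> {A'. ole (fst X) A' A}"
      then show "B \<in> vimg (fst X) {f \<in> Arr (L_cat (fst X)). Cod (L_cat (fst X)) f = A}"
        unfolding vimg_def using oleD(1)[of "fst X" B A]
        by (auto intro!: image_eqI[where x = "vpair (Ide (fst X) B) A"])
    qed (auto simp: vimg_def elim!: L_arrE)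
    then show ?thesis
      using that ehresmannD(2)[OF T] by (simp add: J_of_iff sieve_top)
  qed
  fix x S assume x: "x \<in> Arr (L_cat (fst X))" and S: "S \<in> J_of X (Cod (L_cat (fst X)) x)"
  then obtain f A where f: "x = vpair f A" "f \<in> Arr (fst X)" "ole (fst X) (Cod (fst X) f) A"
    by (auto elim: L_arrE)
  then have S': "sieve (L_cat (fst X)) A S" "vimg (fst X) S \<in> snd X A"
    using S by (simp_all add: J_of_iff)
  show "sieve_pullback (L_cat (fst X)) x S \<in> J_of X (Dom (L_cat (fst X)) x)"
    unfolding J_of_iff
    using sieve_sieve_pullback[of "L_cat (fst X)" x S] x S' f ehresmannD(3)[OF T S'(2) f(2,3)]
      vimg_sieve_pullback[OF G S'(1) f(2,3)] by simp
next
  note [simp] = ordered_groupoidD(1,3,6)[OF G] L_cat_sel ole_refl[OF G] restr[OF G] oleD(1,2)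
    category_L_cat[OF G]
  fix A S R assume "A \<in> Obj (L_cat (fst X))" "S \<in> J_of X A" and R: "sieve (L_cat (fst X)) A R"
    and loc: "\<forall>f\<in>S. sieve_pullback (L_cat (fst X)) f R \<in> J_of X (Dom (L_cat (fst X)) f)"
  then have A: "A \<in> Obj (fst X)" and S: "sieve (L_cat (fst X)) A S" "vimg (fst X) S \<in> snd X A"
    by (simp_all add: J_of_iff)
  have "vimg (fst X) R \<in> snd X A"
  proof (rule ehresmannD(4)[OF T S(2) vsieve_vimg[OF G R]])
    fix f assume f: "f \<in> Arr (fst X)" "Cod (fst X) f \<in> vimg (fst X) S"
    then have "vpair f A \<in> S"
      unfolding sieve_L_cat_iff[OF G S(1)] by blast
    moreover have fA: "ole (fst X) (Cod (fst X) f) A"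
      using vsieveD(2)[OF vsieve_vimg[OF G S(1)] f(2)] .
    ultimately show "vsieve_pullback (fst X) f (vimg (fst X) R) \<in> snd X (Dom (fst X) f)"
      using loc f vimg_sieve_pullback[OF G R f(1) fA] unfolding J_of_iff by force
  qed
  then show "R \<in> J_of X A"
    using R by (simp add: J_of_iff)
qed

lemma max_sitesD:
  assumes "X \<in> max_sites"
  shows "ordered_groupoid (fst X)" "has_unique_maximal (fst X)" "ehresmann_topology (fst X) (snd X)"
  using assms unfolding max_sites_def by auto

lemma L_site_sel [simp]: "fst (L_site X) = L_cat (fst X)" "snd (L_site X) = J_of X"
  by (simp_all add: L_site_def)

lemma L_site_lc:
  assumes "X \<in> max_sites"
  shows "L_site X \<in> lc_sites"
  using max_sitesD[OF assms] unfolding lc_sites_def L_site_def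
  by (simp add: small_category_L_cat left_cancellative_L_cat topology_J_of)


section \<open>The functor induced by a double functor\<close>

lemma double_functorD:
  assumes "double_functor \<G> \<H> F"
  shows "small_functor \<G> \<H> F" "(a, b) \<in> Le \<G> \<Longrightarrow> (amap F a, amap F b) \<in> Le \<H>"
    "ole \<G> A B \<Longrightarrow> ole \<H> (omap F A) (omap F B)"
proof -
  show F: "small_functor \<G> \<H> F" and le: "(a, b) \<in> Le \<G> \<Longrightarrow> (amap F a, amap F b) \<in> Le \<H>" for a b
    using assms unfolding double_functor_def by auto
  show "ole \<G> A B \<Longrightarrow> ole \<H> (omap F A) (omap F B)"
    unfolding ole_def using le small_functorD(6,7)[OF F] by force
qed

text \<open>The image of the restriction is below the image of \<open>f\<close> and has the right
  domain, so uniqueness identifies it. This is what makes \<open>L_fct\<close> respect composition,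
  which involves a restriction.\<close>

lemma double_functor_restr:
  assumes G: "ordered_groupoid \<G>" and H: "ordered_groupoid \<H>" and F: "double_functor \<G> \<H> F"
    and f: "f \<in> Arr \<G>" "ole \<G> A (Dom \<G> f)"
  shows "restr \<H> (amap F f) (omap F A) = amap F (restr \<G> f A)"
  using restr[OF G f] double_functorD[OF F] small_functorD(9)[OF double_functorD(1)[OF F]]
  by (intro restr_eqI[OF H]) simp_all

lemma double_functor_comp:
  assumes G: "ordered_groupoid \<G>" and F: "double_functor \<G> \<H> F" and F': "double_functor \<H> \<K> F'"
  shows "double_functor \<G> \<K> (fct_comp \<G> F' F)"
  unfolding double_functor_def
  using small_functor_comp[OF double_functorD(1)[OF F] double_functorD(1)[OF F']]
    double_functorD(2)[OF F' double_functorD(2)[OF F]] ordered_groupoidD(4,5)[OF G] by simp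

lemma double_functor_id: "ordered_groupoid \<G> \<Longrightarrow> double_functor \<G> \<G> (fct_id \<G>)"
  unfolding double_functor_def by (simp add: small_functor_id ordered_groupoidD)


lemma omap_L_fct [simp]: "A \<in> Obj \<G> \<Longrightarrow> omap (L_fct \<G> F) A = omap F A"
  and amap_L_fct [simp]: "h \<in> Arr \<G> \<Longrightarrow> ole \<G> (Cod \<G> h) B \<Longrightarrow>
    amap (L_fct \<G> F) (vpair h B) = vpair (amap F h) (omap F B)"
  by (auto simp: L_fct_def L_arr_def)

lemma small_functor_L_fct:
  assumes G: "ordered_groupoid \<G>" and H: "ordered_groupoid \<H>" and F: "double_functor \<G> \<H> F"
  shows "small_functor (L_cat \<G>) (L_cat \<H>) (L_fct \<G> F)"
proof -
  note [simp] = ordered_groupoidD(1,3,6)[OF G] ordered_groupoidD(1,3,6)[OF H] L_cat_sel ole_refl[OF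
      G]
    ole_refl[OF H] restr[OF G] restr[OF H] oleD(1,2) small_functorD[OF double_functorD(1)[OF F]]
    double_functorD(2,3)[OF F] category_L_cat[OF G] category_L_cat[OF H] double_functor_restr[OF G H
        F]
  have le: "ole \<H> (omap F (Cod \<G> h)) (omap F B)" if "ole \<G> (Cod \<G> h) B" for h B
    using double_functorD(3)[OF F that] .
  have "is_functor (L_cat \<G>) (L_cat \<H>) (omap (L_fct \<G> F)) (amap (L_fct \<G> F))"
  proof (rule functorI, goal_cases)
    case (8 x y)
    then obtain f B g C where x: "x = vpair f B" "f \<in> Arr \<G>" "ole \<G> (Cod \<G> f) B"
      and y: "y = vpair g C" "g \<in> Arr \<G>" "ole \<G> (Cod \<G> g) C"
      by (metis L_arrE)
    have B: "B = Dom \<G> g"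
      using 8 x y by simp
    have "ole \<G> (Cod \<G> (restr \<G> g (Cod \<G> f))) C"
      using ole_trans[OF G ole_Cod_restr[OF G y(2)] y(3)] x B by simp
    then show ?case
      using x y B by (simp add: le)
  qed (auto elim!: L_arrE simp: le)
  then show ?thesis
    unfolding small_functor_def by (auto simp: L_fct_def L_cat_def)
qed

lemma L_fct_id: "ordered_groupoid \<G> \<Longrightarrow> L_fct \<G> (fct_id \<G>) = fct_id (L_cat \<G>)"
  by (rule small_functor_eqI[OF small_functor_L_fct[OF _ _ double_functor_id] small_functor_id[OF
      category_L_cat]])
    (auto elim!: L_arrE simp: L_cat_sel oleD)

lemma L_fct_comp:
  fixes \<G> \<H> \<K> :: "('u::universe, 'u) ogpd"
  assumes G: "ordered_groupoid \<G>" and H: "ordered_groupoid \<H>" and K: "ordered_groupoid \<K>"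
    and F: "double_functor \<G> \<H> F" and F': "double_functor \<H> \<K> F'"
  shows "L_fct \<G> (fct_comp \<G> F' F) = fct_comp (L_cat \<G>) (L_fct \<H> F') (L_fct \<G> F)"
proof -
  note [simp] = small_functorD[OF double_functorD(1)[OF F]] double_functorD(3)[OF F] L_cat_sel oleD
  have le: "ole \<H> (omap F (Cod \<G> h)) (omap F B)" if "ole \<G> (Cod \<G> h) B" for h B
    using double_functorD(3)[OF F that] .
  show ?thesis
    by (rule small_functor_eqI[OF small_functor_L_fct[OF G K double_functor_comp[OF G F F']]
        small_functor_comp[OF small_functor_L_fct[OF G H F] small_functor_L_fct[OF H K F']]])
      (auto elim!: L_arrE simp: le)
qed

text \<open>A horizontal \<open>h\<close> is visible in \<open>L_cat \<G>\<close> as the arrow with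
  trivial vertical part, \<open>vpair h (Cod \<G> h)\<close>, so the values of \<open>F\<close> can
  be read off.\<close>

lemma L_fct_inject:
  assumes G: "ordered_groupoid \<G>" and F: "double_functor \<G> \<H> F" and F': "double_functor \<G> \<H>' F'"
    and e: "L_fct \<G> F = L_fct \<G> F'"
  shows "F = F'"
proof (rule small_functor_eqI[OF double_functorD(1)[OF F] double_functorD(1)[OF F']])
  fix A assume "A \<in> Obj \<G>"
  then show "omap F A = omap F' A"
    using arg_cong[OF e, of "\<lambda>F. omap F A"] by simp
next
  fix h assume h: "h \<in> Arr \<G>"
  then have "ole \<G> (Cod \<G> h) (Cod \<G> h)"
    using ole_refl[OF G] ordered_groupoidD(1)[OF G] by simp
  then show "amap F h = amap F' h"
    using arg_cong[OF e, of "\<lambda>F. amap F (vpair h (Cod \<G> h))"] h by simp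
qed

text \<open>Precomposing the image of \<open>h\<close> with an arrow only restricts it, and so moves
  its codomain down; conversely each object below the image of \<open>Cod \<G> h\<close> is reached
  by a vertical arrow. This is the bridge between the two notions of cover preservation.\<close>

lemma vimg_generated_sieve:
  assumes G: "ordered_groupoid \<G>" and H: "ordered_groupoid \<H>" and M: "double_functor \<G> \<H> M"
    and S: "sieve (L_cat \<G>) A S"
  shows "vimg \<H> (generated_sieve (L_cat \<H>) (amap (L_fct \<G> M) ` S)) =
    generated_vsieve \<H> (omap M ` vimg \<G> S)"
proof (intro set_eqI iffI)
  note [simp] = ordered_groupoidD(1,3,6)[OF G] ordered_groupoidD(1,3,6)[OF H] L_cat_sel ole_refl[OF
      G]
    ole_refl[OF H] restr[OF G] restr[OF H] oleD(1,2) small_functorD[OF double_functorD(1)[OF M]]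
    restr_Ide[OF H]
  note S_iff = sieve_L_cat_iff[OF G S] note v = vsieveD[OF vsieve_vimg[OF G S]]
  have le: "ole \<H> (omap M (Cod \<G> h)) (omap M B)" if "ole \<G> (Cod \<G> h) B" for h B
    using double_functorD(3)[OF M that] .
  fix B
  {
    assume "B \<in> vimg \<H> (generated_sieve (L_cat \<H>) (amap (L_fct \<G> M) ` S))"
    then obtain x g where x: "x \<in> S" "g \<in> Arr (L_cat \<H>)" "Cod (L_cat \<H>) g = Dom (L_cat \<H>) (amap
        (L_fct \<G> M) x)"
      "B = Cod \<H> (vfst (amap (L_fct \<G> M) x \<cdot>\<^bsub>L_cat \<H>\<^esub> g))"
      unfolding vimg_def generated_sieve_def by auto
    then obtain h where h: "h \<in> Arr \<G>" "x = vpair h A" "Cod \<G> h \<in> vimg \<G> S"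
      using S_iff by auto
    have hA: "ole \<G> (Cod \<G> h) A"
      using v(2)[OF h(3)] .
    then obtain k where k: "g = vpair k (omap M (Dom \<G> h))" "k \<in> Arr \<H>" "ole \<H> (Cod \<H> k) (omap M
        (Dom \<G> h))"
      using x h le[OF hA] by (auto elim!: L_arrE)
    have "ole \<H> B (omap M (Cod \<G> h))"
      using x(4) h k hA le[OF hA] ole_Cod_restr[OF H, of "amap M h" "Cod \<H> k"] by simp
    then show "B \<in> generated_vsieve \<H> (omap M ` vimg \<G> S)"
      unfolding generated_vsieve_def using h(3) by blast
  }
  assume "B \<in> generated_vsieve \<H> (omap M ` vimg \<G> S)"
  then obtain C where C: "C \<in> vimg \<G> S" "ole \<H> B (omap M C)"
    unfolding generated_vsieve_def by auto
  have CA: "ole \<G> C A"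
    using v(2)[OF C(1)] .
  have C0: "C \<in> Obj \<G>" "ole \<H> (omap M C) (omap M A)"
    using CA double_functorD(3)[OF M CA] by (auto dest: oleD)
  have B0: "B \<in> Obj \<H>"
    using oleD(1)[OF C(2)] .
  have x: "vpair (Ide \<G> C) A \<in> S"
    unfolding S_iff using C C0 by auto
  let ?g = "vpair (Ide \<H> B) (omap M C)"
  have "amap (L_fct \<G> M) (vpair (Ide \<G> C) A) \<cdot>\<^bsub>L_cat \<H>\<^esub> ?g \<in> generated_sieve (L_cat \<H>) (amap (L_fct \<G>
      M) ` S)"
    unfolding generated_sieve_def
    by (rule CollectI, intro exI conjI, rule refl, rule imageI[OF x]) (use C C0 CA B0 in simp_all)
  then show "B \<in> vimg \<H> (generated_sieve (L_cat \<H>) (amap (L_fct \<G> M) ` S))"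
    unfolding vimg_def by (rule image_eqI[rotated]) (use C C0 CA B0 in simp)
qed

text \<open>One direction compares vertical images of the generated sieves. For the other, a
  covering vertical sieve \<A> is tested through the covering sieve
  \<open>hsieve (fst X) A \<A>\<close>, whose vertical image it is.\<close>

lemma vcover_preserving_iff:
  assumes G: "ordered_groupoid (fst X)" and H: "ordered_groupoid (fst Y)"
    and T: "ehresmann_topology (fst X) (snd X)" and M: "double_functor (fst X) (fst Y) M"
  shows "vcover_preserving X Y M \<longleftrightarrow> cover_preserving (L_site X) (L_site Y) (L_fct (fst X) M)"
proof
  note sf = small_functorD[OF small_functor_L_fct[OF G H M]]
  assume c: "vcover_preserving X Y M"
  show "cover_preserving (L_site X) (L_site Y) (L_fct (fst X) M)"
    unfolding cover_preserving_def
  proof (intro ballI)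
    fix A S assume "A \<in> Obj (fst (L_site X))" and "S \<in> snd (L_site X) A"
    then have A: "A \<in> Obj (fst X)" and S: "sieve (L_cat (fst X)) A S" "vimg (fst X) S \<in> snd X A"
      by (simp_all add: J_of_iff L_cat_sel)
    have "sieve (L_cat (fst Y)) (omap M A) (generated_sieve (L_cat (fst Y)) (amap (L_fct (fst X) M)
        ` S))"
      by (rule sieve_generated_sieve[OF category_L_cat[OF H]])
        (use A sieveD(1,2)[OF S(1)] sf small_functorD(6)[OF double_functorD(1)[OF M]] in \<open>auto simp:
            L_cat_sel\<close>)
    then show "generated_sieve (fst (L_site Y)) (amap (L_fct (fst X) M) ` S) \<in> snd (L_site Y) (omap
        (L_fct (fst X) M) A)"
      using c A S(2) vimg_generated_sieve[OF G H M S(1)]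
      unfolding vcover_preserving_def by (simp add: J_of_iff)
  qed
next
  assume c: "cover_preserving (L_site X) (L_site Y) (L_fct (fst X) M)"
  show "vcover_preserving X Y M"
    unfolding vcover_preserving_def
  proof (intro ballI)
    fix A \<A> assume A: "A \<in> Obj (fst X)" and \<A>: "\<A> \<in> snd X A"
    note v = ehresmannD(1)[OF T \<A>]
    have "generated_sieve (L_cat (fst Y)) (amap (L_fct (fst X) M) ` hsieve (fst X) A \<A>) \<in> J_of Y
        (omap M A)"
      using c A hsieve_in_J_of[OF G T \<A>] unfolding cover_preserving_def by (simp add: L_cat_sel)
    then show "generated_vsieve (fst Y) (omap M ` \<A>) \<in> snd Y (omap M A)"
      using vimg_generated_sieve[OF G H M sieve_hsieve[OF G v]] vimg_hsieve[OF G v] by (simp add: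
          J_of_iff)
  qed
qed

section \<open>hv-cones and cones in the associated category\<close>

lemma hv_coneD:
  assumes "hv_cone I \<G> D U \<xi>"
  shows "U \<in> Obj \<G>" "i \<in> Obj I \<Longrightarrow> \<xi> i \<in> Arr \<G>" "i \<in> Obj I \<Longrightarrow> Dom \<G> (\<xi> i) = U"
    "i \<in> Obj I \<Longrightarrow> ole \<G> (Cod \<G> (\<xi> i)) (omap D i)"
    "u \<in> Arr I \<Longrightarrow> Cod \<G> (restr \<G> (amap D u) (Cod \<G> (\<xi> (Dom I u)))) = Cod \<G> (\<xi> (Cod I u))"
    "u \<in> Arr I \<Longrightarrow> restr \<G> (amap D u) (Cod \<G> (\<xi> (Dom I u))) \<cdot>\<^bsub>\<G>\<^esub> \<xi> (Dom I u) = \<xi> (Cod I u)"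
    "ole I i j \<Longrightarrow> \<xi> i = \<xi> j"
  using assms unfolding hv_cone_def by auto

text \<open>An arrow of \<open>L_cat I\<close> is a horizontal \<open>u\<close> followed by an
  inequality \<open>Cod I u\<close> \<le> \<open>j\<close>. The cone equation for it combines the
  horizontal condition at \<open>u\<close> with the constancy of the legs along the order.\<close>

lemma cone_of_hv_cone:
  assumes I: "ordered_groupoid I" and G: "ordered_groupoid \<G>" and D: "double_functor I \<G> D"
    and c: "hv_cone I \<G> D U \<xi>"
  shows "cone (L_cat I) (L_cat \<G>) (L_fct I D) U (\<lambda>i. vpair (\<xi> i) (omap D i))"
proof (rule coneI)
  note [simp] = ordered_groupoidD(1,3,6)[OF I] ordered_groupoidD(1,3,6)[OF G] L_cat_sel ole_refl[OF
      I]
    ole_refl[OF G] restr[OF G] oleD(1,2) small_functorD[OF double_functorD(1)[OF D]]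
        hv_coneD(1-4)[OF c]
  fix v assume "v \<in> Arr (L_cat I)"
  then obtain u j where v: "v = vpair u j" "u \<in> Arr I" "ole I (Cod I u) j"
    by (rule L_arrE)
  have [simp]: "ole \<G> (omap D (Cod I u)) (omap D j)"
    using double_functorD(3)[OF D v(3)] .
  have "restr \<G> (amap D u) (Cod \<G> (\<xi> (Dom I u))) \<cdot>\<^bsub>\<G>\<^esub> \<xi> (Dom I u) = \<xi> j"
    using hv_coneD(6)[OF c v(2)] hv_coneD(7)[OF c v(3)] by simp
  then show "amap (L_fct I D) v \<cdot>\<^bsub>L_cat \<G>\<^esub> vpair (\<xi> (Dom (L_cat I) v)) (omap D (Dom (L_cat I) v)) =
      vpair (\<xi> (Cod (L_cat I) v)) (omap D (Cod (L_cat I) v))"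
    using v by simp
qed (use hv_coneD(1-4)[OF c] in \<open>simp_all add: L_cat_sel\<close>)

lemma cone_L_eq:
  assumes c: "cone (L_cat I) (L_cat \<G>) (L_fct I D) U \<tau>" and i: "i \<in> Obj I"
  shows "\<tau> i = vpair (vfst (\<tau> i)) (omap D i)" "vfst (\<tau> i) \<in> Arr \<G>" "Dom \<G> (vfst (\<tau> i)) = U"
    "ole \<G> (Cod \<G> (vfst (\<tau> i))) (omap D i)"
proof -
  have "\<tau> i \<in> Arr (L_cat \<G>)" "Cod (L_cat \<G>) (\<tau> i) = omap D i" "Dom (L_cat \<G>) (\<tau> i) = U"
    using coneD(2-4)[OF c, of i] i by (simp_all add: L_cat_sel)
  then show "\<tau> i = vpair (vfst (\<tau> i)) (omap D i)" "vfst (\<tau> i) \<in> Arr \<G>" "Dom \<G> (vfst (\<tau> i)) = U"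
    "ole \<G> (Cod \<G> (vfst (\<tau> i))) (omap D i)"
    by (auto elim!: L_arrE simp: L_cat_sel)
qed

text \<open>The two kinds of conditions come from two kinds of arrows of \<open>L_cat I\<close>:
  those with trivial vertical part give the horizontal equation, and
  \<open>vpair (Ide I i) j\<close> gives the equality of the legs at \<open>i\<close> \<le>
  \<open>j\<close>.\<close>

lemma hv_cone_of_cone:
  assumes I: "ordered_groupoid I" and G: "ordered_groupoid \<G>" and D: "double_functor I \<G> D"
    and c: "cone (L_cat I) (L_cat \<G>) (L_fct I D) U \<tau>"
  shows "hv_cone I \<G> D U (\<lambda>i. vfst (\<tau> i))"
  unfolding hv_cone_def
proof (intro conjI ballI allI impI)
  note [simp] = ordered_groupoidD(1,3,6)[OF I] ordered_groupoidD(1,3,6)[OF G] L_cat_sel ole_refl[OF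
      I]
    ole_refl[OF G] restr[OF G] oleD(1,2) small_functorD[OF double_functorD(1)[OF D]]
  note t = cone_L_eq[OF c]
  show "U \<in> Obj \<G>"
    using coneD(1)[OF c] by simp
  have n: "restr \<G> (amap D u) (Cod \<G> (vfst (\<tau> (Dom I u)))) \<cdot>\<^bsub>\<G>\<^esub> vfst (\<tau> (Dom I u)) = vfst (\<tau> j)"
    if u: "u \<in> Arr I" "ole I (Cod I u) j" for u j
  proof -
    have "ole \<G> (omap D (Cod I u)) (omap D j)"
      using double_functorD(3)[OF D u(2)] .
    moreover have "vpair (amap D u) (omap D j) \<cdot>\<^bsub>L_cat \<G>\<^esub> \<tau> (Dom I u) = \<tau> j"
      using coneD(5)[OF c, of "vpair u j"] u by simp
    ultimately show ?thesis
      using t[of "Dom I u"] u by (metis (no_types, lifting) L_cat_sel(6) Dom_Obj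
          ordered_groupoidD(1)[OF I]
          small_functorD(8-10)[OF double_functorD(1)[OF D]] vfst_vpair)
  qed
  fix u assume u: "u \<in> Arr I"
  show "restr \<G> (amap D u) (Cod \<G> (vfst (\<tau> (Dom I u)))) \<cdot>\<^bsub>\<G>\<^esub> vfst (\<tau> (Dom I u)) = vfst (\<tau> (Cod I u))"
    using n[OF u] u by simp
  then show "Cod \<G> (restr \<G> (amap D u) (Cod \<G> (vfst (\<tau> (Dom I u))))) = Cod \<G> (vfst (\<tau> (Cod I u)))"
    using Cod_Cmp[of \<G> "vfst (\<tau> (Dom I u))" "restr \<G> (amap D u) (Cod \<G> (vfst (\<tau> (Dom I u))))"]
      u t(2-4)[of "Dom I u"] by simp
next
  note [simp] = ordered_groupoidD(1,3,6)[OF I] ordered_groupoidD(1,3,6)[OF G] L_cat_sel ole_refl[OF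
      I]
    ole_refl[OF G] restr[OF G] oleD(1,2) small_functorD[OF double_functorD(1)[OF D]]
  note t = cone_L_eq[OF c]
  fix i j assume ij: "ole I i j"
  then have i: "i \<in> Obj I" by simp
  have le: "ole \<G> (omap D i) (omap D j)"
    using double_functorD(3)[OF D ij] .
  obtain h where h: "\<tau> i = vpair h (omap D i)" "h \<in> Arr \<G>" "ole \<G> (Cod \<G> h) (omap D i)"
    using t[OF i] by metis
  have "vpair (Ide \<G> (omap D i)) (omap D j) \<cdot>\<^bsub>L_cat \<G>\<^esub> \<tau> i = \<tau> j"
    using coneD(5)[OF c, of "vpair (Ide I i) j"] i ij by simp
  then have "\<tau> j = vpair h (omap D j)"
    using h i le by (simp add: restr_Ide[OF G])
  then show "vfst (\<tau> i) = vfst (\<tau> j)"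
    using h by simp
qed (use cone_L_eq[OF c] in simp_all)

lemma finite_category_L_cat:
  assumes I: "ordered_groupoid I" and fin: "finite_category I"
  shows "finite_category (L_cat I)"
proof -
  have "Arr (L_cat I) \<subseteq> (\<lambda>(h, B). vpair h B) ` (Arr I \<times> Obj I)"
    by (auto elim!: L_arrE dest: oleD)
  moreover have "finite ((\<lambda>(h, B). vpair h B) ` (Arr I \<times> Obj I))"
    using fin unfolding finite_category_def by simp
  ultimately have "finite (Arr (L_cat I))"
    by (rule finite_subset)
  then show ?thesis
    using fin small_category_L_cat[OF I] unfolding finite_category_def by (simp add: L_cat_sel)
qed

definition vflat_at ::
  "('u::universe, 'u) ogpd \<Rightarrow> 'u esite \<Rightarrow> 'u esite \<Rightarrow> 'u fct \<Rightarrow> 'u fct \<Rightarrow> bool" where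
  "vflat_at I X Y M D \<longleftrightarrow> (\<forall>U \<xi>. hv_cone I (fst Y) (fct_comp I M D) U \<xi> \<longrightarrow>
        (\<exists>\<U>\<in>snd Y U. \<forall>U'\<in>\<U>.
           \<exists>T \<theta> h. hv_cone I (fst X) D T \<theta> \<and>
             h \<in> Arr (fst Y) \<and> Dom (fst Y) h = U' \<and> ole (fst Y) (Cod (fst Y) h) (omap M T) \<and>
             (\<forall>i\<in>Obj I. restr (fst Y) (\<xi> i) U' =
                restr (fst Y) (amap M (\<theta> i)) (Cod (fst Y) h) \<cdot>\<^bsub>fst Y\<^esub> h)))"

lemma vcover_flat_iff: "vcover_flat X Y M \<longleftrightarrow>
    (\<forall>(I :: ('u::universe, 'u) ogpd) D. ordered_groupoid I \<and> finite_category I \<and> double_functor I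
        (fst X) D \<longrightarrow>
      vflat_at I X Y M D)"
  unfolding vcover_flat_def vflat_at_def by blast

text \<open>A member \<open>U'\<close> of a vertical cover corresponds to the vertical arrow from
  \<open>U'\<close> to \<open>U\<close> in the flat sieve. Given a vertical cover \<U>, the sieve
  \<open>hsieve (fst Y) U \<U>\<close> is contained in the flat sieve. Given the flat sieve, its
  vertical image is the cover looked for.\<close>

lemma vflat_at_iff:
  fixes I :: "('u::universe, 'u) ogpd"
  assumes G: "ordered_groupoid (fst X)" and H: "ordered_groupoid (fst Y)"
    and T: "ehresmann_topology (fst Y) (snd Y)" and M: "double_functor (fst X) (fst Y) M"
    and I: "ordered_groupoid I" and D: "double_functor I (fst X) D"
  shows "vflat_at I X Y M D \<longleftrightarrow> flat_at (L_cat I) (L_site X) (L_site Y) (L_fct (fst X) M) (L_fct I D)"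
proof
  let ?G = "fst X" and ?H = "fst Y"
  have MD: "double_functor I ?H (fct_comp I M D)"
    using double_functor_comp[OF I D M] .
  note LMD = L_fct_comp[OF I G H D M, symmetric]
  note [simp] = ordered_groupoidD(1,3,6)[OF G] ordered_groupoidD(1,3,6)[OF H] L_cat_sel
    ole_refl[OF H] restr[OF H] oleD(1,2) small_functorD[OF double_functorD(1)[OF D]]
    small_functorD[OF double_functorD(1)[OF M]] restr_Ide[OF H]
  {
    assume v: "vflat_at I X Y M D"
    show "flat_at (L_cat I) (L_site X) (L_site Y) (L_fct (fst X) M) (L_fct I D)"
      unfolding flat_at_def
    proof (intro allI impI)
      fix U \<tau> assume "cone (L_cat I) (fst (L_site Y)) (fct_comp (L_cat I) (L_fct ?G M) (L_fct I D))
          U \<tau>"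
      then have c: "cone (L_cat I) (L_cat ?H) (L_fct I (fct_comp I M D)) U \<tau>"
        by (simp add: LMD)
      note t = cone_L_eq[OF c]
      have hc: "hv_cone I ?H (fct_comp I M D) U (\<lambda>i. vfst (\<tau> i))"
        by (rule hv_cone_of_cone[OF I H MD c])
      obtain \<U> where \<U>: "\<U> \<in> snd Y U" and f: "\<forall>U'\<in>\<U>. \<exists>T \<theta> h. hv_cone I ?G D T \<theta> \<and>
             h \<in> Arr ?H \<and> Dom ?H h = U' \<and> ole ?H (Cod ?H h) (omap M T) \<and>
             (\<forall>i\<in>Obj I. restr ?H (vfst (\<tau> i)) U' = restr ?H (amap M (\<theta> i)) (Cod ?H h) \<cdot>\<^bsub>?H\<^esub> h)"
        using v[unfolded vflat_at_def, rule_format, OF hc] by (rule bexE)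
      note vU = vsieveD[OF ehresmannD(1)[OF T \<U>]]
      let ?Z = "flat_sieve (L_cat I) (L_cat ?G) (L_cat ?H) (L_fct ?G M) (L_fct I D) U \<tau>"
      have Z: "sieve (L_cat ?H) U ?Z"
        by (rule sieve_flat_sieve[OF small_functor_L_fct[OF G H M] small_functor_L_fct[OF I G D]])
          (use c in \<open>simp add: LMD\<close>)
      have "hsieve ?H U \<U> \<subseteq> ?Z"
      proof
        fix x assume "x \<in> hsieve ?H U \<U>"
        then obtain k where k: "x = vpair k U" "k \<in> Arr ?H" "Cod ?H k \<in> \<U>"
          unfolding hsieve_def by auto
        obtain W \<theta> h where \<theta>: "hv_cone I ?G D W \<theta>" and h: "h \<in> Arr ?H" "Dom ?H h = Cod ?H k"
          "ole ?H (Cod ?H h) (omap M W)"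
          and e: "\<And>i. i \<in> Obj I \<Longrightarrow> restr ?H (vfst (\<tau> i)) (Cod ?H k) = restr ?H (amap M (\<theta> i)) (Cod ?H
              h) \<cdot>\<^bsub>?H\<^esub> h"
          using bspec[OF f k(3)] by blast
        note [simp] = hv_coneD(1-4)[OF \<theta>]
        have kU: "ole ?H (Cod ?H k) U"
          using vU(2)[OF k(3)] .
        \<comment> \<open>The hypothesis speaks of vertical arrows into \<open>U\<close>, so the
          vertical part of \<open>x\<close> is treated alone. Its horizontal part \<open>k\<close>
          is put back by closure of the sieve.\<close>
        have "vpair (Ide ?H (Cod ?H k)) U \<in> ?Z"
        proof (rule flat_sieveI[where g = "vpair h (omap M W)"])
          show "cone (L_cat I) (L_cat ?G) (L_fct I D) W (\<lambda>i. vpair (\<theta> i) (omap D i))"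
            by (rule cone_of_hv_cone[OF I G D \<theta>])
          fix i assume "i \<in> Obj (L_cat I)"
          then have i: "i \<in> Obj I" by simp
          have le: "ole ?H (omap M (Cod ?G (\<theta> i))) (omap M (omap D i))"
            using double_functorD(3)[OF M hv_coneD(4)[OF \<theta> i]] .
          have "\<tau> i \<cdot>\<^bsub>L_cat ?H\<^esub> vpair (Ide ?H (Cod ?H k)) U = vpair (vfst (\<tau> i)) (omap M (omap D i))
              \<cdot>\<^bsub>L_cat ?H\<^esub> vpair (Ide ?H (Cod ?H k)) U"
            using t(1)[OF i] i by simp
          also have "\<dots> = vpair (restr ?H (vfst (\<tau> i)) (Cod ?H k)) (omap M (omap D i))"
            using t(2-4)[OF i] i k kU by simp
          finally show "\<tau> i \<cdot>\<^bsub>L_cat ?H\<^esub> vpair (Ide ?H (Cod ?H k)) U =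
              amap (L_fct ?G M) (vpair (\<theta> i) (omap D i)) \<cdot>\<^bsub>L_cat ?H\<^esub> vpair h (omap M W)"
            using e[OF i] i h le by simp
        qed (use k kU h in simp_all)
        then have "vpair (Ide ?H (Cod ?H k)) U \<cdot>\<^bsub>L_cat ?H\<^esub> vpair k (Cod ?H k) \<in> ?Z"
          by (rule sieveD(3)[OF Z]) (use k kU in simp_all)
        then show "x \<in> ?Z"
          using k kU by simp
      qed
      then show "flat_sieve (L_cat I) (fst (L_site X)) (fst (L_site Y)) (L_fct ?G M) (L_fct I D) U \<tau>
          \<in> snd (L_site Y) U"
        using topology_superset[OF category_L_cat[OF H] topology_J_of[OF H T] hsieve_in_J_of[OF H T
            \<U>] Z] by simp
    qed
  }
  assume v: "flat_at (L_cat I) (L_site X) (L_site Y) (L_fct (fst X) M) (L_fct I D)"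
  show "vflat_at I X Y M D"
    unfolding vflat_at_def
  proof (intro allI impI)
    fix U \<xi> assume hc: "hv_cone I ?H (fct_comp I M D) U \<xi>"
    let ?\<tau> = "\<lambda>i. vpair (\<xi> i) (omap (fct_comp I M D) i)"
    let ?Z = "flat_sieve (L_cat I) (L_cat ?G) (L_cat ?H) (L_fct ?G M) (L_fct I D) U ?\<tau>"
    have "cone (L_cat I) (L_cat ?H) (L_fct I (fct_comp I M D)) U ?\<tau>"
      by (rule cone_of_hv_cone[OF I H MD hc])
    then have Z: "?Z \<in> J_of Y U"
      using v unfolding flat_at_def by (simp add: LMD)
    have Z': "sieve (L_cat ?H) U ?Z" "vimg ?H ?Z \<in> snd Y U"
      using Z by (simp_all add: J_of_iff)
    note vZ = vsieveD[OF vsieve_vimg[OF H Z'(1)]]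
    show "\<exists>\<U>\<in>snd Y U. \<forall>U'\<in>\<U>.
           \<exists>T \<theta> h. hv_cone I (fst X) D T \<theta> \<and>
             h \<in> Arr (fst Y) \<and> Dom (fst Y) h = U' \<and> ole (fst Y) (Cod (fst Y) h) (omap M T) \<and>
             (\<forall>i\<in>Obj I. restr (fst Y) (\<xi> i) U' =
                restr (fst Y) (amap M (\<theta> i)) (Cod (fst Y) h) \<cdot>\<^bsub>fst Y\<^esub> h)"
    proof (intro bexI[OF _ Z'(2)] ballI)
      fix U' assume U': "U' \<in> vimg ?H ?Z"
      have le: "ole ?H U' U"
        using vZ(2)[OF U'] .
      then have "vpair (Ide ?H U') U \<in> ?Z"
        unfolding sieve_L_cat_iff[OF H Z'(1)] using U' by (intro bexI[of _ "Ide ?H U'"]) simp_all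
      then obtain W \<sigma> g where \<sigma>: "cone (L_cat I) (L_cat ?G) (L_fct I D) W \<sigma>"
        and g: "g \<in> Arr (L_cat ?H)" "Dom (L_cat ?H) g = Dom (L_cat ?H) (vpair (Ide ?H U') U)"
          "Cod (L_cat ?H) g = omap (L_fct ?G M) W"
        and e: "\<And>i. i \<in> Obj (L_cat I) \<Longrightarrow> ?\<tau> i \<cdot>\<^bsub>L_cat ?H\<^esub> vpair (Ide ?H U') U = amap (L_fct ?G M) (\<sigma> i)
            \<cdot>\<^bsub>L_cat ?H\<^esub> g"
        by (rule flat_sieveE) blast
      have W: "W \<in> Obj ?G"
        using coneD(1)[OF \<sigma>] by simp
      obtain h where h: "g = vpair h (omap M W)" "h \<in> Arr ?H" "Dom ?H h = U'" "ole ?H (Cod ?H h)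
          (omap M W)"
        using g le W by (auto elim!: L_arrE)
      have "restr ?H (\<xi> i) U' = restr ?H (amap M (vfst (\<sigma> i))) (Cod ?H h) \<cdot>\<^bsub>?H\<^esub> h" if i: "i \<in> Obj I"
          for i
      proof -
        note s = cone_L_eq[OF \<sigma> i]
        have l: "ole ?H (omap M (Cod ?G (vfst (\<sigma> i)))) (omap M (omap D i))"
          using double_functorD(3)[OF M s(4)] .
        have "amap (L_fct ?G M) (\<sigma> i) = amap (L_fct ?G M) (vpair (vfst (\<sigma> i)) (omap D i))"
          using s(1) by (rule arg_cong)
        also have "\<dots> = vpair (amap M (vfst (\<sigma> i))) (omap M (omap D i))"
          using s(2-4) by simp
        finally have "?\<tau> i \<cdot>\<^bsub>L_cat ?H\<^esub> vpair (Ide ?H U') U =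
            vpair (amap M (vfst (\<sigma> i))) (omap M (omap D i)) \<cdot>\<^bsub>L_cat ?H\<^esub> vpair h (omap M W)"
          using e[of i] i h(1) by simp
        then show ?thesis
          using i h le l s(2-4) hv_coneD(1-4)[OF hc] by simp
      qed
      then show "\<exists>T \<theta> h. hv_cone I ?G D T \<theta> \<and> h \<in> Arr ?H \<and> Dom ?H h = U' \<and> ole ?H (Cod ?H h) (omap M
          T) \<and>
          (\<forall>i\<in>Obj I. restr ?H (\<xi> i) U' = restr ?H (amap M (\<theta> i)) (Cod ?H h) \<cdot>\<^bsub>?H\<^esub> h)"
        using hv_cone_of_cone[OF I G D \<sigma>] h by blast
    qed
  qed
qed

lemma vcover_flat_of_L:
  fixes X Y :: "'u::universe esite"
  assumes G: "ordered_groupoid (fst X)" and H: "ordered_groupoid (fst Y)"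
    and T: "ehresmann_topology (fst Y) (snd Y)" and M: "double_functor (fst X) (fst Y) M"
    and f: "cover_flat (L_site X) (L_site Y) (L_fct (fst X) M)"
  shows "vcover_flat X Y M"
  unfolding vcover_flat_iff
proof (intro allI impI, elim conjE)
  fix I :: "('u, 'u) ogpd" and D
  assume I: "ordered_groupoid I" "finite_category I" and D: "double_functor I (fst X) D"
  have "flat_at (L_cat I) (L_site X) (L_site Y) (L_fct (fst X) M) (L_fct I D)"
    using f finite_category_L_cat[OF I] small_functor_L_fct[OF I(1) G D]
    unfolding cover_flat_iff by simp
  then show "vflat_at I X Y M D"
    unfolding vflat_at_iff[OF G H T M I(1) D] .
qed


section \<open>Lambda-transformations as natural transformations\<close>

lemma lam_transformationD:
  assumes G: "ordered_groupoid \<G>" and H: "ordered_groupoid \<H>" and l: "lam_transformation \<G> \<H> F G G'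
      \<alpha>"
  shows "double_functor \<G> \<H> G'" "\<alpha> \<in> extensional (Obj \<G>)" "X \<in> Obj \<G> \<Longrightarrow> \<alpha> X \<in> Arr \<H>"
    "X \<in> Obj \<G> \<Longrightarrow> Dom \<H> (\<alpha> X) = omap F X" "X \<in> Obj \<G> \<Longrightarrow> Cod \<H> (\<alpha> X) = omap G' X"
    "f \<in> Arr \<G> \<Longrightarrow> (amap G' f, amap G f) \<in> Le \<H>"
    "f \<in> Arr \<G> \<Longrightarrow> amap G' f \<cdot>\<^bsub>\<H>\<^esub> \<alpha> (Dom \<G> f) = \<alpha> (Cod \<G> f) \<cdot>\<^bsub>\<H>\<^esub> amap F f"
    "ole \<G> X Y \<Longrightarrow> (\<alpha> X, \<alpha> Y) \<in> Le \<H>"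
    "f \<in> Arr \<G> \<Longrightarrow> amap G' f = restr \<H> (amap G f) (Cod \<H> (\<alpha> (Dom \<G> f)))"
    "X \<in> Obj \<G> \<Longrightarrow> double_functor \<G> \<H> G \<Longrightarrow> ole \<H> (omap G' X) (omap G X)"
proof -
  show G': "double_functor \<G> \<H> G'"
    and n: "\<alpha> \<in> extensional (Obj \<G>)" "X \<in> Obj \<G> \<Longrightarrow> \<alpha> X \<in> Arr \<H>"
    "X \<in> Obj \<G> \<Longrightarrow> Dom \<H> (\<alpha> X) = omap F X" "X \<in> Obj \<G> \<Longrightarrow> Cod \<H> (\<alpha> X) = omap G' X"
    and le: "f \<in> Arr \<G> \<Longrightarrow> (amap G' f, amap G f) \<in> Le \<H>"
    "f \<in> Arr \<G> \<Longrightarrow> amap G' f \<cdot>\<^bsub>\<H>\<^esub> \<alpha> (Dom \<G> f) = \<alpha> (Cod \<G> f) \<cdot>\<^bsub>\<H>\<^esub> amap F f"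
    "ole \<G> X Y \<Longrightarrow> (\<alpha> X, \<alpha> Y) \<in> Le \<H>" for X Y f
    using l unfolding lam_transformation_def hor_transformation_def fct_le_def
        nat_transformation_def by auto
  note s = small_functorD[OF double_functorD(1)[OF G']]
  show "f \<in> Arr \<G> \<Longrightarrow> amap G' f = restr \<H> (amap G f) (Cod \<H> (\<alpha> (Dom \<G> f)))"
    using restr_eqI[OF H le(1)] s(9) n(4) ordered_groupoidD(1)[OF G] by simp
  show "ole \<H> (omap G' X) (omap G X)" if X: "X \<in> Obj \<G>" and G: "double_functor \<G> \<H> G"
  proof -
    note s' = small_functorD[OF double_functorD(1)[OF G]]
    show ?thesis
      using le(1)[of "Ide \<G> X"] X s s' unfolding ole_def by simp
  qed
qed

text \<open>The naturality square at an arrow of \<open>L_cat \<G>\<close> has a horizontal half,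
  which is naturality of \<alpha> towards \<open>K'\<close>, and a vertical half: the restriction of
  \<open>\<alpha> B\<close> is \<open>\<alpha> (Cod \<G> h)\<close>, which is monotonicity of
  \<alpha>.\<close>

lemma nat_of_lam:
  assumes G: "ordered_groupoid \<G>" and H: "ordered_groupoid \<H>"
    and F: "double_functor \<G> \<H> F" and K: "double_functor \<G> \<H> K" and l: "lam_transformation \<G> \<H> F K
        K' \<alpha>"
  shows "nat_transformation (L_cat \<G>) (L_cat \<H>) (L_fct \<G> F) (L_fct \<G> K) (\<lambda>X\<in>Obj \<G>. vpair (\<alpha> X) (omap
      K X))"
  unfolding nat_transformation_def
proof (intro conjI ballI)
  note L = lam_transformationD[OF G H l]
  note [simp] = ordered_groupoidD(1,3,6)[OF G] ordered_groupoidD(1,3,6)[OF H] L_cat_sel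
    ole_refl[OF H] restr[OF H] oleD(1,2) L(3-5) L(10)[OF _ K]
    small_functorD[OF double_functorD(1)[OF F]] small_functorD[OF double_functorD(1)[OF K]]
  fix x assume "x \<in> Arr (L_cat \<G>)"
  then obtain h B where x: "x = vpair h B" "h \<in> Arr \<G>" "ole \<G> (Cod \<G> h) B"
    by (rule L_arrE)
  have B: "B \<in> Obj \<G>"
    using x by simp
  have le [simp]: "ole \<H> (omap F (Cod \<G> h)) (omap F B)" "ole \<H> (omap K (Cod \<G> h)) (omap K B)"
    using double_functorD(3)[OF F x(3)] double_functorD(3)[OF K x(3)] by simp_all
  have "restr \<H> (\<alpha> B) (omap F (Cod \<G> h)) = \<alpha> (Cod \<G> h)"
    by (rule restr_eqI[OF H L(8)[OF x(3)]]) (use x in simp)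
  moreover have "restr \<H> (amap K h) (omap K' (Dom \<G> h)) \<cdot>\<^bsub>\<H>\<^esub> \<alpha> (Dom \<G> h) = \<alpha> (Cod \<G> h) \<cdot>\<^bsub>\<H>\<^esub> amap F h"
    using L(7,9)[OF x(2)] x by simp
  ultimately show "amap (L_fct \<G> K) x \<cdot>\<^bsub>L_cat \<H>\<^esub> (\<lambda>X\<in>Obj \<G>. vpair (\<alpha> X) (omap K X)) (Dom (L_cat \<G>) x)
      =
      (\<lambda>X\<in>Obj \<G>. vpair (\<alpha> X) (omap K X)) (Cod (L_cat \<G>) x) \<cdot>\<^bsub>L_cat \<H>\<^esub> amap (L_fct \<G> F) x"
    using x B by simp
qed (use lam_transformationD(3-5,10)[OF G H l] K small_functorD(6)[OF double_functorD(1)[OF K]] in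
    \<open>simp_all add: L_cat_sel\<close>)

definition lam_mid :: "('u, 'u, 'x) ogpd_scheme \<Rightarrow> ('u, 'u, 'y) ogpd_scheme \<Rightarrow> 'u fct \<Rightarrow> ('u \<Rightarrow> 'u) \<Rightarrow> 'u
    fct" where
  "lam_mid \<G> \<H> K \<alpha> = \<lparr>omap = \<lambda>X\<in>Obj \<G>. Cod \<H> (\<alpha> X),
    amap = \<lambda>h\<in>Arr \<G>. restr \<H> (amap K h) (Cod \<H> (\<alpha> (Dom \<G> h)))\<rparr>"

lemma lam_mid_sel [simp]: "X \<in> Obj \<G> \<Longrightarrow> omap (lam_mid \<G> \<H> K \<alpha>) X = Cod \<H> (\<alpha> X)"
  "h \<in> Arr \<G> \<Longrightarrow> amap (lam_mid \<G> \<H> K \<alpha>) h = restr \<H> (amap K h) (Cod \<H> (\<alpha> (Dom \<G> h)))"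
  by (simp_all add: lam_mid_def)

text \<open>Arrows below \<open>amap K h\<close> are determined by their domain, and the domain is
  prescribed by the component. Hence equality of \<Lambda>-transformations can be checked on
  components.\<close>

lemma lam_mid_unique:
  assumes G: "ordered_groupoid \<G>" and H: "ordered_groupoid \<H>" and l: "lam_transformation \<G> \<H> F K K'
      \<alpha>"
  shows "K' = lam_mid \<G> \<H> K \<alpha>"
proof -
  note L = lam_transformationD[OF G H l]
  note s = small_functorD(4,5)[OF double_functorD(1)[OF L(1)]]
  show ?thesis
  proof (rule fct.equality)
    show "omap K' = omap (lam_mid \<G> \<H> K \<alpha>)"
      by (rule extensionalityI[OF s(1)]) (simp_all add: lam_mid_def L(5))
    show "amap K' = amap (lam_mid \<G> \<H> K \<alpha>)"
      by (rule extensionalityI[OF s(2)]) (simp_all add: lam_mid_def L(9))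
  qed simp
qed

text \<open>Naturality at horizontal arrows gives a square towards the restriction of
  \<open>K\<close>, and comparing the codomains of that square makes \<open>lam_mid\<close> respect
  codomains. Naturality at the vertical arrow from \<open>X\<close> to \<open>Y\<close> says that
  \<open>\<alpha> X\<close> is a restriction of \<open>\<alpha> Y\<close>, so \<alpha> is
  monotone.\<close>

lemma lam_of_nat:
  assumes G: "ordered_groupoid \<G>" and H: "ordered_groupoid \<H>"
    and F: "double_functor \<G> \<H> F" and K: "double_functor \<G> \<H> K"
    and n: "nat_transformation (L_cat \<G>) (L_cat \<H>) (L_fct \<G> F) (L_fct \<G> K) \<theta>"
    and \<alpha>: "\<alpha> \<in> extensional (Obj \<G>)" "\<And>X. X \<in> Obj \<G> \<Longrightarrow> \<alpha> X = vfst (\<theta> X)"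
  shows "lam_transformation \<G> \<H> F K (lam_mid \<G> \<H> K \<alpha>) \<alpha>" "X \<in> Obj \<G> \<Longrightarrow> \<theta> X = vpair (\<alpha> X) (omap K X)"
proof -
  note [simp] = ordered_groupoidD(1,3,6)[OF G] ordered_groupoidD(1,3,6)[OF H] L_cat_sel
    ole_refl[OF G] ole_refl[OF H] restr[OF H] oleD(1,2)
    small_functorD[OF double_functorD(1)[OF F]] small_functorD[OF double_functorD(1)[OF K]]
    restr_Ide[OF H] restr_Dom[OF H]
  have t: "\<theta> X = vpair (\<alpha> X) (omap K X) \<and> \<alpha> X \<in> Arr \<H> \<and> Dom \<H> (\<alpha> X) = omap F X \<and> ole \<H> (Cod \<H> (\<alpha> X))
      (omap K X)"
    if X: "X \<in> Obj \<G>" for X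
  proof -
    have "\<theta> X \<in> Arr (L_cat \<H>)" "Dom (L_cat \<H>) (\<theta> X) = omap F X" "Cod (L_cat \<H>) (\<theta> X) = omap K X"
      using nat_transformationD(2-4)[OF n, of X] X by simp_all
    then show ?thesis
      using \<alpha>(2)[OF X] by (auto elim!: L_arrE)
  qed
  then show "X \<in> Obj \<G> \<Longrightarrow> \<theta> X = vpair (\<alpha> X) (omap K X)"
    by simp
  have [simp]: "\<alpha> X \<in> Arr \<H>" "Dom \<H> (\<alpha> X) = omap F X" "ole \<H> (Cod \<H> (\<alpha> X)) (omap K X)" if "X \<in> Obj
      \<G>" for X
    using t[OF that] by simp_all
  have nat: "restr \<H> (amap K h) (Cod \<H> (\<alpha> (Dom \<G> h))) \<cdot>\<^bsub>\<H>\<^esub> \<alpha> (Dom \<G> h) =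
      restr \<H> (\<alpha> B) (omap F (Cod \<G> h)) \<cdot>\<^bsub>\<H>\<^esub> amap F h"
    if h: "h \<in> Arr \<G>" "ole \<G> (Cod \<G> h) B" for h B
  proof -
    have le [simp]: "ole \<H> (omap F (Cod \<G> h)) (omap F B)" "ole \<H> (omap K (Cod \<G> h)) (omap K B)"
      using double_functorD(3)[OF F h(2)] double_functorD(3)[OF K h(2)] by simp_all
    have "B \<in> Obj \<G>" using h by simp
    then show ?thesis
      using nat_transformationD(5)[OF n, of "vpair h B"] h t[of B] t[of "Dom \<G> h"] by simp
  qed
  have nat1: "restr \<H> (amap K h) (Cod \<H> (\<alpha> (Dom \<G> h))) \<cdot>\<^bsub>\<H>\<^esub> \<alpha> (Dom \<G> h) = \<alpha> (Cod \<G> h) \<cdot>\<^bsub>\<H>\<^esub> amap F h"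
    if h: "h \<in> Arr \<G>" for h
    using nat[OF h, of "Cod \<G> h"] h by simp
  have c: "Cod \<H> (restr \<H> (amap K h) (Cod \<H> (\<alpha> (Dom \<G> h)))) = Cod \<H> (\<alpha> (Cod \<G> h))" if h: "h \<in> Arr \<G>"
      for h
    using arg_cong[OF nat1[OF h], of "Cod \<H>"] h by simp
  have le: "(\<alpha> X, \<alpha> Y) \<in> Le \<H>" if XY: "ole \<G> X Y" for X Y
  proof -
    have X: "X \<in> Obj \<G>" "Y \<in> Obj \<G>"
      using XY by simp_all
    have r: "ole \<H> (omap F X) (omap F Y)"
      using double_functorD(3)[OF F XY] .
    have "\<alpha> X = restr \<H> (\<alpha> Y) (omap F X)"
      using nat[of "Ide \<G> X" Y] X XY r by simp
    then show ?thesis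
      using restr(3)[OF H, of "\<alpha> Y" "omap F X"] X r by simp
  qed
  let ?K' = "lam_mid \<G> \<H> K \<alpha>"
  have "is_functor \<G> \<H> (omap ?K') (amap ?K')"
    by (rule functorI) (simp_all add: c restr_Cmp[OF H])
  then have "small_functor \<G> \<H> ?K'"
    unfolding small_functor_def by (simp add: lam_mid_def)
  moreover have "(amap ?K' a, amap ?K' b) \<in> Le \<H>" if ab: "(a, b) \<in> Le \<G>" for a b
  proof -
    have a: "a \<in> Arr \<G>" "b \<in> Arr \<G>"
      using ordered_groupoidD(4,5)[OF G ab] by simp_all
    show ?thesis
      using a restr_mono[OF H double_functorD(2)[OF K ab], of "Cod \<H> (\<alpha> (Dom \<G> a))" "Cod \<H> (\<alpha> (Dom \<G>
          b))"]
        le_Cod[OF H le[OF le_Dom[OF G ab]]] by simp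
  qed
  ultimately show "lam_transformation \<G> \<H> F K ?K' \<alpha>"
    unfolding lam_transformation_def hor_transformation_def nat_transformation_def fct_le_def
        double_functor_def
    using \<alpha>(1) le nat1 by simp
qed


section \<open>The ordered groupoid of a left-cancellative category\<close>

locale lc_category =
  fixes C :: "('u::universe, 'u) cat"
  assumes small: "small_category C" and lc: "left_cancellative C"
begin

lemma cat [simp]: "category C"
  using small unfolding small_category_def by simp

lemma cancel: "m \<in> Arr C \<Longrightarrow> g \<in> Arr C \<Longrightarrow> h \<in> Arr C \<Longrightarrow> Cod C g = Dom C m \<Longrightarrow> Cod C h = Dom C m \<Longrightarrow>
    Dom C g = Dom C h \<Longrightarrow> m \<cdot>\<^bsub>C\<^esub> g = m \<cdot>\<^bsub>C\<^esub> h \<Longrightarrow> g = h"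
  by (rule monomorphism_cancel[OF lc])

text \<open>The premise of \<open>cancel\<close> on domains is supplied by the equal composites
  themselves.\<close>

lemma cancel': "m \<in> Arr C \<Longrightarrow> g \<in> Arr C \<Longrightarrow> h \<in> Arr C \<Longrightarrow> Cod C g = Dom C m \<Longrightarrow> Cod C h = Dom C m \<Longrightarrow>
    m \<cdot>\<^bsub>C\<^esub> g = m \<cdot>\<^bsub>C\<^esub> h \<Longrightarrow> g = h"
  using cancel[of m g h] Dom_Cmp[of C g m] Dom_Cmp[of C h m] by simp

lemma elts_subob:
  assumes "m \<in> Arr C"
  shows "elts (subob C m) = {m \<cdot>\<^bsub>C\<^esub> k | k. isomorphism C k \<and> Cod C k = Dom C m}"
proof -
  have "{m \<cdot>\<^bsub>C\<^esub> k | k. isomorphism C k \<and> Cod C k = Dom C m} \<subseteq> Arr C"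
    using assms by auto
  moreover have "small (Arr C)"
    using small unfolding small_category_def by simp
  ultimately have "small {m \<cdot>\<^bsub>C\<^esub> k | k. isomorphism C k \<and> Cod C k = Dom C m}"
    using small_subset by blast
  then show ?thesis
    unfolding subob_def by simp
qed

lemma subob_eq_iff:
  assumes m: "m \<in> Arr C" and m': "m' \<in> Arr C"
  shows "subob C m = subob C m' \<longleftrightarrow> (\<exists>k. isomorphism C k \<and> Cod C k = Dom C m \<and> m' = m \<cdot>\<^bsub>C\<^esub> k)"
proof
  assume e: "subob C m = subob C m'"
  have "m' \<in> elts (subob C m')"
    unfolding elts_subob[OF m'] by (rule CollectI, rule exI[of _ "Ide C (Dom C m')"]) (use m' in
        simp)
  then show "\<exists>k. isomorphism C k \<and> Cod C k = Dom C m \<and> m' = m \<cdot>\<^bsub>C\<^esub> k"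
    unfolding e[symmetric] elts_subob[OF m] by auto
next
  assume "\<exists>k. isomorphism C k \<and> Cod C k = Dom C m \<and> m' = m \<cdot>\<^bsub>C\<^esub> k"
  then obtain k where k: "isomorphism C k" "Cod C k = Dom C m" "m' = m \<cdot>\<^bsub>C\<^esub> k"
    by blast
  have "elts (subob C m) = elts (subob C m')"
    unfolding elts_subob[OF m] elts_subob[OF m']
  proof (intro set_eqI iffI)
    fix x assume "x \<in> {m \<cdot>\<^bsub>C\<^esub> k | k. isomorphism C k \<and> Cod C k = Dom C m}"
    then obtain l where l: "x = m \<cdot>\<^bsub>C\<^esub> l" "isomorphism C l" "Cod C l = Dom C m"
      by blast
    show "x \<in> {m' \<cdot>\<^bsub>C\<^esub> k | k. isomorphism C k \<and> Cod C k = Dom C m'}"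
      by (rule CollectI, rule exI[of _ "inv_arr C k \<cdot>\<^bsub>C\<^esub> l"]) (use k l m in \<open>simp add: Cmp_assoc\<close>)
  next
    fix x assume "x \<in> {m' \<cdot>\<^bsub>C\<^esub> k | k. isomorphism C k \<and> Cod C k = Dom C m'}"
    then obtain l where l: "x = m' \<cdot>\<^bsub>C\<^esub> l" "isomorphism C l" "Cod C l = Dom C m'"
      by blast
    show "x \<in> {m \<cdot>\<^bsub>C\<^esub> k | k. isomorphism C k \<and> Cod C k = Dom C m}"
      by (rule CollectI, rule exI[of _ "k \<cdot>\<^bsub>C\<^esub> l"]) (use k l m in \<open>simp add: Cmp_assoc\<close>)
  qed
  then show "subob C m = subob C m'"
    by (rule extensionality)
qed

lemma span_Arr [simp]: "is_span C m n \<Longrightarrow> m \<in> Arr C" "is_span C m n \<Longrightarrow> n \<in> Arr C"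
  unfolding is_span_def by auto

lemma span_Dom: "is_span C m n \<Longrightarrow> Dom C n = Dom C m"
  unfolding is_span_def by simp

lemma span_Cmp [simp]: "is_span C m n \<Longrightarrow> k \<in> Arr C \<Longrightarrow> Cod C k = Dom C m \<Longrightarrow>
    is_span C (m \<cdot>\<^bsub>C\<^esub> k) (n \<cdot>\<^bsub>C\<^esub> k)"
  unfolding is_span_def by simp

lemma span_refl [simp]: "m \<in> Arr C \<Longrightarrow> is_span C m m"
  unfolding is_span_def by simp

lemma elts_spancl:
  assumes s: "is_span C m n"
  shows "elts (spancl C m n) = {vpair (m \<cdot>\<^bsub>C\<^esub> k) (n \<cdot>\<^bsub>C\<^esub> k) | k. isomorphism C k \<and> Cod C k = Dom C m}"
proof -
  have "{vpair (m \<cdot>\<^bsub>C\<^esub> k) (n \<cdot>\<^bsub>C\<^esub> k) | k. isomorphism C k \<and> Cod C k = Dom C m} \<subseteq>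
      {vpair a b | a b. a \<in> Arr C \<and> b \<in> Arr C}"
    using s by (auto simp: span_Dom)
  moreover have "small {vpair a b | a b. a \<in> Arr C \<and> b \<in> Arr C}"
    using small small_image2[of "Arr C" "Arr C" vpair] unfolding small_category_def by simp
  ultimately have "small {vpair (m \<cdot>\<^bsub>C\<^esub> k) (n \<cdot>\<^bsub>C\<^esub> k) | k. isomorphism C k \<and> Cod C k = Dom C m}"
    using small_subset by blast
  then show ?thesis
    unfolding spancl_def by simp
qed

lemma spancl_Cmp_iso:
  assumes s: "is_span C m n" and k: "isomorphism C k" "Cod C k = Dom C m"
  shows "spancl C (m \<cdot>\<^bsub>C\<^esub> k) (n \<cdot>\<^bsub>C\<^esub> k) = spancl C m n"
proof -
  have s': "is_span C (m \<cdot>\<^bsub>C\<^esub> k) (n \<cdot>\<^bsub>C\<^esub> k)"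
    using s k by simp
  have "elts (spancl C m n) = elts (spancl C (m \<cdot>\<^bsub>C\<^esub> k) (n \<cdot>\<^bsub>C\<^esub> k))"
    unfolding elts_spancl[OF s] elts_spancl[OF s']
  proof (intro set_eqI iffI)
    fix x assume "x \<in> {vpair (m \<cdot>\<^bsub>C\<^esub> k) (n \<cdot>\<^bsub>C\<^esub> k) | k. isomorphism C k \<and> Cod C k = Dom C m}"
    then obtain l where l: "x = vpair (m \<cdot>\<^bsub>C\<^esub> l) (n \<cdot>\<^bsub>C\<^esub> l)" "isomorphism C l" "Cod C l = Dom C m"
      by blast
    show "x \<in> {vpair (m \<cdot>\<^bsub>C\<^esub> k \<cdot>\<^bsub>C\<^esub> l) (n \<cdot>\<^bsub>C\<^esub> k \<cdot>\<^bsub>C\<^esub> l) | l. isomorphism C l \<and> Cod C l = Dom C (m \<cdot>\<^bsub>C\<^esub> k)}"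
      by (rule CollectI, rule exI[of _ "inv_arr C k \<cdot>\<^bsub>C\<^esub> l"])
        (use k l s in \<open>simp add: Cmp_assoc span_Dom\<close>)
  next
    fix x assume "x \<in> {vpair (m \<cdot>\<^bsub>C\<^esub> k \<cdot>\<^bsub>C\<^esub> l) (n \<cdot>\<^bsub>C\<^esub> k \<cdot>\<^bsub>C\<^esub> l) | l. isomorphism C l \<and> Cod C l = Dom C (m
        \<cdot>\<^bsub>C\<^esub> k)}"
    then obtain l where l: "x = vpair (m \<cdot>\<^bsub>C\<^esub> k \<cdot>\<^bsub>C\<^esub> l) (n \<cdot>\<^bsub>C\<^esub> k \<cdot>\<^bsub>C\<^esub> l)" "isomorphism C l" "Cod C l = Dom
        C (m \<cdot>\<^bsub>C\<^esub> k)"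
      by blast
    show "x \<in> {vpair (m \<cdot>\<^bsub>C\<^esub> k) (n \<cdot>\<^bsub>C\<^esub> k) | k. isomorphism C k \<and> Cod C k = Dom C m}"
      by (rule CollectI, rule exI[of _ "k \<cdot>\<^bsub>C\<^esub> l"]) (use k l s in \<open>simp add: Cmp_assoc span_Dom\<close>)
  qed
  then show ?thesis
    by (rule extensionality[symmetric])
qed

lemma spancl_eqE:
  assumes s: "is_span C m n" and s': "is_span C m' n'" and e: "spancl C m n = spancl C m' n'"
  obtains k where "isomorphism C k" "Cod C k = Dom C m" "m' = m \<cdot>\<^bsub>C\<^esub> k" "n' = n \<cdot>\<^bsub>C\<^esub> k" "Dom C k = Dom C
      m'"
proof -
  have "vpair m' n' \<in> elts (spancl C m' n')"
    unfolding elts_spancl[OF s'] by (rule CollectI, rule exI[of _ "Ide C (Dom C m')"])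
      (use s' in \<open>simp add: span_Dom\<close>)
  then obtain k where "isomorphism C k" "Cod C k = Dom C m" "m' = m \<cdot>\<^bsub>C\<^esub> k" "n' = n \<cdot>\<^bsub>C\<^esub> k"
    unfolding e[symmetric] elts_spancl[OF s] by auto
  then show thesis
    using s by (auto intro!: that)
qed

lemma subob_eqE:
  assumes "m \<in> Arr C" "m' \<in> Arr C" "subob C m = subob C m'"
  obtains k where "isomorphism C k" "Cod C k = Dom C m" "m' = m \<cdot>\<^bsub>C\<^esub> k" "Dom C k = Dom C m'"
  using assms subob_eq_iff by auto

lemma subob_Cmp_iso: "m \<in> Arr C \<Longrightarrow> isomorphism C k \<Longrightarrow> Cod C k = Dom C m \<Longrightarrow>
    subob C (m \<cdot>\<^bsub>C\<^esub> k) = subob C m"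
  using subob_eq_iff[of m "m \<cdot>\<^bsub>C\<^esub> k"] by auto

text \<open>An isomorphism of apexes that fixes the left leg is an identity, by cancelling that leg.
  So once the left leg is chosen, the class determines the right one.\<close>

lemma spancl_inject:
  assumes "is_span C m n" "is_span C m n'" "spancl C m n = spancl C m n'"
  shows "n = n'"
proof -
  obtain k where k: "isomorphism C k" "Cod C k = Dom C m" "m = m \<cdot>\<^bsub>C\<^esub> k" "n' = n \<cdot>\<^bsub>C\<^esub> k" "Dom C k = Dom
      C m"
    using assms by (rule spancl_eqE)
  have "k = Ide C (Dom C m)"
    by (rule cancel[of m]) (use k assms in simp_all)
  then show ?thesis
    using k assms(1) by (simp add: span_Dom)
qed

section \<open>The structure of the ordered groupoid of subobjects\<close>

lemma G_ogpd_Obj: "Obj (G_ogpd C) = G_obj C" and G_ogpd_Arr: "Arr (G_ogpd C) = G_arr C"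
  by (simp_all add: G_ogpd_def)

lemma subob_Obj [simp]: "m \<in> Arr C \<Longrightarrow> subob C m \<in> Obj (G_ogpd C)"
  and spancl_Arr [simp]: "is_span C m n \<Longrightarrow> spancl C m n \<in> Arr (G_ogpd C)"
  by (auto simp: G_ogpd_def G_obj_def G_arr_def)

lemma G_ObjE:
  assumes "X \<in> Obj (G_ogpd C)"
  obtains m where "X = subob C m" "m \<in> Arr C"
  using assms by (auto simp: G_ogpd_def G_obj_def)

lemma G_ArrE:
  assumes "x \<in> Arr (G_ogpd C)"
  obtains m n where "x = spancl C m n" "is_span C m n"
  using assms by (auto simp: G_ogpd_def G_arr_def)

lemma Dom_spancl [simp]:
  assumes s: "is_span C m n"
  shows "Dom (G_ogpd C) (spancl C m n) = subob C m"
proof -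
  have "(THE X. \<exists>m' n'. is_span C m' n' \<and> spancl C m n = spancl C m' n' \<and> X = subob C m') = subob C
      m"
  proof (rule the_equality)
    fix X assume "\<exists>m' n'. is_span C m' n' \<and> spancl C m n = spancl C m' n' \<and> X = subob C m'"
    then obtain m' n' where m': "is_span C m' n'" "spancl C m n = spancl C m' n'" "X = subob C m'"
      by blast
    show "X = subob C m"
      using s m'(1,2) by (rule spancl_eqE) (use m'(3) s in \<open>simp add: subob_Cmp_iso\<close>)
  qed (use s in blast)
  then show ?thesis
    using s spancl_Arr[OF s] by (simp add: G_ogpd_def)
qed

lemma Cod_spancl [simp]:
  assumes s: "is_span C m n"
  shows "Cod (G_ogpd C) (spancl C m n) = subob C n"
proof -
  have "(THE X. \<exists>m' n'. is_span C m' n' \<and> spancl C m n = spancl C m' n' \<and> X = subob C n') = subob C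
      n"
  proof (rule the_equality)
    fix X assume "\<exists>m' n'. is_span C m' n' \<and> spancl C m n = spancl C m' n' \<and> X = subob C n'"
    then obtain m' n' where m': "is_span C m' n'" "spancl C m n = spancl C m' n'" "X = subob C n'"
      by blast
    show "X = subob C n"
      using s m'(1,2) by (rule spancl_eqE) (use m'(3) s in \<open>simp add: subob_Cmp_iso span_Dom\<close>)
  qed (use s in blast)
  then show ?thesis
    using s spancl_Arr[OF s] by (simp add: G_ogpd_def)
qed

lemma Ide_subob [simp]:
  assumes m: "m \<in> Arr C"
  shows "Ide (G_ogpd C) (subob C m) = spancl C m m"
proof -
  have "(THE x. \<exists>m'\<in>Arr C. subob C m = subob C m' \<and> x = spancl C m' m') = spancl C m m"
  proof (rule the_equality)
    fix x assume "\<exists>m'\<in>Arr C. subob C m = subob C m' \<and> x = spancl C m' m'"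
    then obtain m' where m': "m' \<in> Arr C" "subob C m = subob C m'" "x = spancl C m' m'"
      by blast
    show "x = spancl C m m"
      using m m'(1,2) by (rule subob_eqE) (use m'(3) m in \<open>simp add: spancl_Cmp_iso\<close>)
  qed (use m in blast)
  then show ?thesis
    using m subob_Obj[OF m] by (simp add: G_ogpd_def)
qed

text \<open>Lets a class be represented with any prescribed left leg representing its domain.
  Composable classes thereby get representatives with a common middle leg, and composition becomes
  \<open>Cmp_spancl\<close>.\<close>

lemma spancl_DomE:
  assumes "y \<in> Arr (G_ogpd C)" "m \<in> Arr C" "Dom (G_ogpd C) y = subob C m"
  obtains n where "y = spancl C m n" "is_span C m n"
proof -
  obtain m' n' where y: "y = spancl C m' n'" "is_span C m' n'"
    using assms(1) by (rule G_ArrE)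
  have "subob C m' = subob C m"
    using assms(3) y by simp
  with span_Arr(1)[OF y(2)] assms(2) obtain k where k: "isomorphism C k" "Cod C k = Dom C m'" "m =
      m' \<cdot>\<^bsub>C\<^esub> k" "Dom C k = Dom C m"
    by (rule subob_eqE)
  show thesis
    by (rule that[of "n' \<cdot>\<^bsub>C\<^esub> k"]) (use k y in \<open>simp_all add: spancl_Cmp_iso\<close>)
qed

lemma span_trans: "is_span C k m \<Longrightarrow> is_span C m n \<Longrightarrow> is_span C k n"
  unfolding is_span_def by simp

lemma span_sym: "is_span C k m \<Longrightarrow> is_span C m k"
  unfolding is_span_def by simp

text \<open>Other representatives differ by isomorphisms \<open>a\<close> and \<open>b\<close>, and
  the matching isomorphism \<open>h\<close> of the definition satisfies \<open>m a = m b h\<close>.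
  Cancelling \<open>m\<close> gives \<open>a = b h\<close>, so the resulting class is always that of
  \<open>k a\<close> and \<open>n a\<close>.\<close>

lemma Cmp_spancl [simp]:
  assumes s: "is_span C k m" and s': "is_span C m n"
  shows "spancl C m n \<cdot>\<^bsub>G_ogpd C\<^esub> spancl C k m = spancl C k n"
proof -
  have "(THE z. \<exists>k1 m1 m1' n1 h. is_span C k1 m1 \<and> is_span C m1' n1 \<and>
      spancl C k m = spancl C k1 m1 \<and> spancl C m n = spancl C m1' n1 \<and>
      isomorphism C h \<and> Cod C h = Dom C m1' \<and> m1 = m1' \<cdot>\<^bsub>C\<^esub> h \<and> z = spancl C k1 (n1 \<cdot>\<^bsub>C\<^esub> h)) = spancl C
          k n"
  proof (rule the_equality)
    show "\<exists>k1 m1 m1' n1 h. is_span C k1 m1 \<and> is_span C m1' n1 \<and>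
      spancl C k m = spancl C k1 m1 \<and> spancl C m n = spancl C m1' n1 \<and>
      isomorphism C h \<and> Cod C h = Dom C m1' \<and> m1 = m1' \<cdot>\<^bsub>C\<^esub> h \<and> spancl C k n = spancl C k1 (n1 \<cdot>\<^bsub>C\<^esub> h)"
      by (intro exI[of _ k] exI[of _ m] exI[of _ n] exI[of _ "Ide C (Dom C m)"])
        (use s s' in \<open>simp add: span_Dom\<close>)
    fix z assume "\<exists>k1 m1 m1' n1 h. is_span C k1 m1 \<and> is_span C m1' n1 \<and>
      spancl C k m = spancl C k1 m1 \<and> spancl C m n = spancl C m1' n1 \<and>
      isomorphism C h \<and> Cod C h = Dom C m1' \<and> m1 = m1' \<cdot>\<^bsub>C\<^esub> h \<and> z = spancl C k1 (n1 \<cdot>\<^bsub>C\<^esub> h)"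
    then obtain k1 m1 m1' n1 h where *: "is_span C k1 m1" "is_span C m1' n1"
      "spancl C k m = spancl C k1 m1" "spancl C m n = spancl C m1' n1"
      and h: "isomorphism C h" "Cod C h = Dom C m1'" "m1 = m1' \<cdot>\<^bsub>C\<^esub> h" "z = spancl C k1 (n1 \<cdot>\<^bsub>C\<^esub> h)"
      by blast
    obtain a where a: "isomorphism C a" "Cod C a = Dom C k" "k1 = k \<cdot>\<^bsub>C\<^esub> a" "m1 = m \<cdot>\<^bsub>C\<^esub> a"
      using s *(1,3) by (rule spancl_eqE)
    obtain b where b: "isomorphism C b" "Cod C b = Dom C m" "m1' = m \<cdot>\<^bsub>C\<^esub> b" "n1 = n \<cdot>\<^bsub>C\<^esub> b" "Dom C b =
        Dom C m1'"
      using s' *(2,4) by (rule spancl_eqE)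
    have "a = b \<cdot>\<^bsub>C\<^esub> h"
      by (rule cancel'[of m]) (use a b(1-4) h s s' in \<open>simp_all add: span_Dom Cmp_assoc\<close>)
    then have "n1 \<cdot>\<^bsub>C\<^esub> h = n \<cdot>\<^bsub>C\<^esub> a"
      using b(1-4) h s' by (simp add: Cmp_assoc span_Dom)
    then show "z = spancl C k n"
      using h a spancl_Cmp_iso[OF span_trans[OF s s']] by simp
  qed
  moreover have "\<exists>k1 m1 m1' n1. is_span C k1 m1 \<and> is_span C m1' n1 \<and> spancl C k m = spancl C k1 m1 \<and>
      spancl C m n = spancl C m1' n1 \<and> subob C m1 = subob C m1'"
    using s s' by blast
  ultimately show ?thesis
    by (simp add: G_ogpd_def)
qed

lemma category_G_ogpd [simp]: "category (G_ogpd C)"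
proof (rule categoryI, goal_cases)
  case (6 x y)
  obtain k m where x: "x = spancl C k m" "is_span C k m" using 6(1) by (rule G_ArrE)
  obtain n where "y = spancl C m n" "is_span C m n"
    by (rule spancl_DomE[OF 6(2), of m]) (use 6 x in simp_all)
  then show ?case using x span_trans[of k m n] by simp
next
  case (7 x y)
  obtain k m where x: "x = spancl C k m" "is_span C k m" using 7(1) by (rule G_ArrE)
  obtain n where "y = spancl C m n" "is_span C m n"
    by (rule spancl_DomE[OF 7(2), of m]) (use 7 x in simp_all)
  then show ?case using x span_trans[of k m n] by simp
next
  case (8 x y)
  obtain k m where x: "x = spancl C k m" "is_span C k m" using 8(1) by (rule G_ArrE)
  obtain n where "y = spancl C m n" "is_span C m n"
    by (rule spancl_DomE[OF 8(2), of m]) (use 8 x in simp_all)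
  then show ?case using x span_trans[of k m n] by simp
next
  case (11 x y z)
  obtain k m where x: "x = spancl C k m" "is_span C k m" using 11(1) by (rule G_ArrE)
  obtain n where y: "y = spancl C m n" "is_span C m n"
    by (rule spancl_DomE[OF 11(2), of m]) (use 11 x in simp_all)
  obtain p where z: "z = spancl C n p" "is_span C n p"
    by (rule spancl_DomE[OF 11(3), of n]) (use 11 y in simp_all)
  show ?case using x y z span_trans[of k m n] span_trans[of m n p] by simp
qed (auto elim!: G_ArrE G_ObjE)

lemma is_inverse_spancl: "is_span C m n \<Longrightarrow> is_inverse (G_ogpd C) (spancl C m n) (spancl C n m)"
  unfolding is_inverse_def by (simp add: span_sym)

lemma inv_arr_spancl [simp]: "is_span C m n \<Longrightarrow> inv_arr (G_ogpd C) (spancl C m n) = spancl C n m"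
  by (rule inv_arr_eqI[OF category_G_ogpd is_inverse_spancl])

text \<open>The definition of the order asks for a common factor of some representatives. Composing
  it on both sides with the isomorphisms to the given representatives yields a factor for
  these.\<close>

lemma Le_G_iff:
  assumes s: "is_span C m n" and s': "is_span C m' n'"
  shows "(spancl C m n, spancl C m' n') \<in> Le (G_ogpd C) \<longleftrightarrow>
    (\<exists>h\<in>Arr C. Cod C h = Dom C m' \<and> m = m' \<cdot>\<^bsub>C\<^esub> h \<and> n = n' \<cdot>\<^bsub>C\<^esub> h)"
proof
  assume "\<exists>h\<in>Arr C. Cod C h = Dom C m' \<and> m = m' \<cdot>\<^bsub>C\<^esub> h \<and> n = n' \<cdot>\<^bsub>C\<^esub> h"
  then show "(spancl C m n, spancl C m' n') \<in> Le (G_ogpd C)"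
    unfolding G_ogpd_def using s s' by (simp, blast)
next
  assume "(spancl C m n, spancl C m' n') \<in> Le (G_ogpd C)"
  then obtain m1 n1 m1' n1' h where *: "is_span C m1 n1" "is_span C m1' n1'"
    "spancl C m n = spancl C m1 n1" "spancl C m' n' = spancl C m1' n1'"
    and h: "h \<in> Arr C" "Cod C h = Dom C m1'" "m1 = m1' \<cdot>\<^bsub>C\<^esub> h" "n1 = n1' \<cdot>\<^bsub>C\<^esub> h"
    unfolding G_ogpd_def by auto
  obtain a where a: "isomorphism C a" "Cod C a = Dom C m1" "m = m1 \<cdot>\<^bsub>C\<^esub> a" "n = n1 \<cdot>\<^bsub>C\<^esub> a" "Dom C a =
      Dom C m"
    using *(1) s *(3)[symmetric] by (rule spancl_eqE)
  obtain b where b: "isomorphism C b" "Cod C b = Dom C m'" "m1' = m' \<cdot>\<^bsub>C\<^esub> b" "n1' = n' \<cdot>\<^bsub>C\<^esub> b" "Dom C b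
      = Dom C m1'"
    using s' *(2,4) by (rule spancl_eqE)
  show "\<exists>h\<in>Arr C. Cod C h = Dom C m' \<and> m = m' \<cdot>\<^bsub>C\<^esub> h \<and> n = n' \<cdot>\<^bsub>C\<^esub> h"
    by (rule bexI[of _ "b \<cdot>\<^bsub>C\<^esub> h \<cdot>\<^bsub>C\<^esub> a"]) (use a(1-4) b(1-4) h *(1,2) s s' in \<open>simp_all add: Cmp_assoc
        span_Dom\<close>)
qed

lemma Le_GE:
  assumes "(x, y) \<in> Le (G_ogpd C)"
  obtains m n h where "y = spancl C m n" "is_span C m n" "h \<in> Arr C" "Cod C h = Dom C m"
    "x = spancl C (m \<cdot>\<^bsub>C\<^esub> h) (n \<cdot>\<^bsub>C\<^esub> h)" "is_span C (m \<cdot>\<^bsub>C\<^esub> h) (n \<cdot>\<^bsub>C\<^esub> h)"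
  using assms unfolding G_ogpd_def by auto

lemma Le_G_Cmp [simp]: "is_span C m n \<Longrightarrow> h \<in> Arr C \<Longrightarrow> Cod C h = Dom C m \<Longrightarrow>
    (spancl C (m \<cdot>\<^bsub>C\<^esub> h) (n \<cdot>\<^bsub>C\<^esub> h), spancl C m n) \<in> Le (G_ogpd C)"
  by (subst Le_G_iff) auto

lemma ole_G_iff: "m \<in> Arr C \<Longrightarrow> n \<in> Arr C \<Longrightarrow>
    ole (G_ogpd C) (subob C m) (subob C n) \<longleftrightarrow> (\<exists>h\<in>Arr C. Cod C h = Dom C n \<and> m = n \<cdot>\<^bsub>C\<^esub> h)"
  unfolding ole_def by (simp add: Le_G_iff)

lemma ole_G_Cmp [simp]: "m \<in> Arr C \<Longrightarrow> h \<in> Arr C \<Longrightarrow> Cod C h = Dom C m \<Longrightarrow>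
    ole (G_ogpd C) (subob C (m \<cdot>\<^bsub>C\<^esub> h)) (subob C m)"
  by (subst ole_G_iff) auto

lemma ole_GE:
  assumes "ole (G_ogpd C) X (subob C m)" "m \<in> Arr C"
  obtains h where "h \<in> Arr C" "Cod C h = Dom C m" "X = subob C (m \<cdot>\<^bsub>C\<^esub> h)"
proof -
  obtain n where n: "X = subob C n" "n \<in> Arr C"
    using oleD(1)[OF assms(1)] by (rule G_ObjE)
  then show thesis
    using assms ole_G_iff[of n m] that by auto
qed

lemma Le_G_trans:
  assumes "(x, y) \<in> Le (G_ogpd C)" "(y, z) \<in> Le (G_ogpd C)"
  shows "(x, z) \<in> Le (G_ogpd C)"
proof -
  obtain m n h where z: "z = spancl C m n" "is_span C m n" and h: "h \<in> Arr C" "Cod C h = Dom C m"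
    and y: "y = spancl C (m \<cdot>\<^bsub>C\<^esub> h) (n \<cdot>\<^bsub>C\<^esub> h)" "is_span C (m \<cdot>\<^bsub>C\<^esub> h) (n \<cdot>\<^bsub>C\<^esub> h)"
    using assms(2) by (rule Le_GE)
  obtain m' n' where x: "x = spancl C m' n'" "is_span C m' n'"
    using assms(1) by (rule Le_GE) blast
  obtain l where l: "l \<in> Arr C" "Cod C l = Dom C (m \<cdot>\<^bsub>C\<^esub> h)" "m' = m \<cdot>\<^bsub>C\<^esub> h \<cdot>\<^bsub>C\<^esub> l" "n' = n \<cdot>\<^bsub>C\<^esub> h \<cdot>\<^bsub>C\<^esub> l"
    using assms(1) Le_G_iff[OF x(2) y(2)] x y by auto
  show ?thesis
    unfolding x(1) z(1) Le_G_iff[OF x(2) z(2)]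
    by (rule bexI[of _ "h \<cdot>\<^bsub>C\<^esub> l"]) (use l h z in \<open>simp_all add: Cmp_assoc span_Dom\<close>)
qed

text \<open>Left-cancellation makes the two factors inverse to each other: cancelling
  \<open>m\<close> gives \<open>h l = id\<close>, and cancelling \<open>h\<close> then gives
  \<open>l h = id\<close>.\<close>

lemma Le_G_antisym:
  assumes "(x, y) \<in> Le (G_ogpd C)" "(y, x) \<in> Le (G_ogpd C)"
  shows "x = y"
proof -
  obtain m n h where y: "y = spancl C m n" "is_span C m n" and h: "h \<in> Arr C" "Cod C h = Dom C m"
    and x: "x = spancl C (m \<cdot>\<^bsub>C\<^esub> h) (n \<cdot>\<^bsub>C\<^esub> h)" "is_span C (m \<cdot>\<^bsub>C\<^esub> h) (n \<cdot>\<^bsub>C\<^esub> h)"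
    using assms(1) by (rule Le_GE)
  obtain l where l: "l \<in> Arr C" "Cod C l = Dom C (m \<cdot>\<^bsub>C\<^esub> h)" "m = m \<cdot>\<^bsub>C\<^esub> h \<cdot>\<^bsub>C\<^esub> l"
    using assms(2) Le_G_iff[OF y(2) x(2)] x y by auto
  have mA: "m \<in> Arr C" using y by simp
  have hl: "h \<cdot>\<^bsub>C\<^esub> l = Ide C (Dom C m)"
    by (rule cancel'[of m]) (use l h mA in \<open>simp_all add: Cmp_assoc\<close>)
  have D: "Dom C l = Cod C h"
    using arg_cong[OF hl, of "Dom C"] l h mA by simp
  have "l \<cdot>\<^bsub>C\<^esub> h = Ide C (Dom C h)"
  proof (rule cancel'[of h])
    show "h \<cdot>\<^bsub>C\<^esub> (l \<cdot>\<^bsub>C\<^esub> h) = h \<cdot>\<^bsub>C\<^esub> Ide C (Dom C h)"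
      using hl l h mA D by (simp add: Cmp_assoc[symmetric])
  qed (use l h mA D in simp_all)
  then have "isomorphism C h"
    using hl l h mA D by (intro isoI[of C h l]) simp_all
  then show ?thesis
    using x y h by (simp add: spancl_Cmp_iso)
qed

text \<open>With the left leg of \<open>g\<close> normalised to \<open>m h\<close>, the common
  factor witnessing that \<open>g\<close> lies below the span agrees with \<open>h\<close> after
  composition with \<open>m\<close>, hence equals \<open>h\<close>.\<close>

lemma restr_spancl_ex1:
  assumes s: "is_span C m n" and h: "h \<in> Arr C" "Cod C h = Dom C m"
    and g: "g \<in> Arr (G_ogpd C)" "Dom (G_ogpd C) g = subob C (m \<cdot>\<^bsub>C\<^esub> h)" "(g, spancl C m n) \<in> Le
        (G_ogpd C)"
  shows "g = spancl C (m \<cdot>\<^bsub>C\<^esub> h) (n \<cdot>\<^bsub>C\<^esub> h)"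
proof -
  have mA: "m \<in> Arr C" "m \<cdot>\<^bsub>C\<^esub> h \<in> Arr C" using s h by simp_all
  obtain n' where n': "g = spancl C (m \<cdot>\<^bsub>C\<^esub> h) n'" "is_span C (m \<cdot>\<^bsub>C\<^esub> h) n'"
    using g(1) mA(2) g(2) by (rule spancl_DomE)
  obtain l where l: "l \<in> Arr C" "Cod C l = Dom C m" "m \<cdot>\<^bsub>C\<^esub> h = m \<cdot>\<^bsub>C\<^esub> l" "n' = n \<cdot>\<^bsub>C\<^esub> l"
    using g(3) n' s by (auto simp: Le_G_iff)
  have "h = l"
    by (rule cancel'[of m]) (use mA h l in simp_all)
  then show ?thesis
    using n' l by simp
qed

lemma ordered_groupoid_G [simp]: "ordered_groupoid (G_ogpd C)"
proof -
  have s: "small (Arr C)"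
    using small unfolding small_category_def by simp
  have "Arr (G_ogpd C) \<subseteq> {spancl C m n | m n. m \<in> Arr C \<and> n \<in> Arr C}"
    by (auto elim!: G_ArrE intro: span_Arr)
  then have sA: "small (Arr (G_ogpd C))"
    using small_image2[OF s s, of "spancl C"] by (rule small_subset[rotated])
  have sO: "small (Obj (G_ogpd C))"
    using small_image[OF s, of "subob C"] by (simp add: G_ogpd_def G_obj_def)
  have u: "y \<cdot>\<^bsub>G_ogpd C\<^esub> x = undefined"
    if n: "\<not> (x \<in> Arr (G_ogpd C) \<and> y \<in> Arr (G_ogpd C) \<and> Cod (G_ogpd C) x = Dom (G_ogpd C) y)" for x
        y
  proof -
    have "\<not> (\<exists>k m m' n. is_span C k m \<and> is_span C m' n \<and> x = spancl C k m \<and> y = spancl C m' n \<and>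
        subob C m = subob C m')"
      using n by auto
    then show ?thesis
      unfolding G_ogpd_def cat.simps by (rule if_not_P)
  qed
  have sc: "small_category (G_ogpd C)"
    unfolding small_category_def using sA sO u by (simp add: G_ogpd_Obj G_ogpd_Arr) (simp add:
        G_ogpd_def)
  have L: "Le (G_ogpd C) \<subseteq> Arr (G_ogpd C) \<times> Arr (G_ogpd C)"
    by (auto elim!: Le_GE)
  have po: "partial_order_on (Arr (G_ogpd C)) (Le (G_ogpd C))"
    unfolding partial_order_on_def preorder_on_def
  proof (intro conjI)
    show "Le (G_ogpd C) \<subseteq> Arr (G_ogpd C) \<times> Arr (G_ogpd C)" by (rule L)
    show "refl_on (Arr (G_ogpd C)) (Le (G_ogpd C))"
      unfolding refl_on_def
    proof (intro ballI)
      fix x assume "x \<in> Arr (G_ogpd C)"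
      then obtain m n where x: "x = spancl C m n" "is_span C m n"
        by (rule G_ArrE)
      show "(x, x) \<in> Le (G_ogpd C)"
        unfolding x(1) Le_G_iff[OF x(2) x(2)]
        by (rule bexI[of _ "Ide C (Dom C m)"]) (use x in \<open>simp_all add: span_Dom\<close>)
    qed
    show "trans (Le (G_ogpd C))"
      by (rule transI) (rule Le_G_trans)
    show "antisym (Le (G_ogpd C))"
      by (rule antisymI) (rule Le_G_antisym)
  qed
  have iso: "isomorphism (G_ogpd C) f" if "f \<in> Arr (G_ogpd C)" for f
    using that is_inverse_spancl unfolding isomorphism_def by (blast elim: G_ArrE)
  have inv: "(inv_arr (G_ogpd C) a, inv_arr (G_ogpd C) b) \<in> Le (G_ogpd C)" if "(a, b) \<in> Le (G_ogpd
      C)" for a b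
    using that by (rule Le_GE) (simp add: span_sym span_Dom)
  have cmp: "(a \<cdot>\<^bsub>G_ogpd C\<^esub> c, b \<cdot>\<^bsub>G_ogpd C\<^esub> d) \<in> Le (G_ogpd C)"
    if le: "(a, b) \<in> Le (G_ogpd C)" "(c, d) \<in> Le (G_ogpd C)" and D: "Dom (G_ogpd C) a = Cod (G_ogpd
        C) c"
      "Dom (G_ogpd C) b = Cod (G_ogpd C) d" for a b c d
  proof -
    obtain k m h where d: "d = spancl C k m" "is_span C k m" and h: "h \<in> Arr C" "Cod C h = Dom C k"
      and c: "c = spancl C (k \<cdot>\<^bsub>C\<^esub> h) (m \<cdot>\<^bsub>C\<^esub> h)" "is_span C (k \<cdot>\<^bsub>C\<^esub> h) (m \<cdot>\<^bsub>C\<^esub> h)"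
      using le(2) by (rule Le_GE)
    have A: "a \<in> Arr (G_ogpd C)" "b \<in> Arr (G_ogpd C)"
      using L le(1) by auto
    obtain n where b: "b = spancl C m n" "is_span C m n"
      by (rule spancl_DomE[OF A(2), of m]) (use D d in simp_all)
    \<comment> \<open>\<open>a\<close> lies below \<open>b\<close> and starts at the codomain of
      \<open>c\<close>, so it is a restriction of \<open>b\<close>. By uniqueness it is given by the
      same \<open>h\<close> that restricts \<open>d\<close> to \<open>c\<close>.\<close>
    have a: "a = spancl C (m \<cdot>\<^bsub>C\<^esub> h) (n \<cdot>\<^bsub>C\<^esub> h)"
      by (rule restr_spancl_ex1[OF b(2) h(1) _ A(1)]) (use D c d h le(1) b in \<open>simp_all add:
          span_Dom\<close>)
    have "is_span C (m \<cdot>\<^bsub>C\<^esub> h) (n \<cdot>\<^bsub>C\<^esub> h)" "is_span C k n"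
      using span_Cmp[OF b(2) h(1)] h(2) span_Dom[OF d(2)] span_trans[OF d(2) b(2)] by simp_all
    then show ?thesis
      using a b c d h by simp
  qed
  have restr: "\<exists>!g. g \<in> Arr (G_ogpd C) \<and> Dom (G_ogpd C) g = A \<and> (g, f) \<in> Le (G_ogpd C)"
    if f: "f \<in> Arr (G_ogpd C)" and A: "ole (G_ogpd C) A (Dom (G_ogpd C) f)" for f A
  proof -
    obtain m n where m: "f = spancl C m n" "is_span C m n"
      using f by (rule G_ArrE)
    obtain h where h: "h \<in> Arr C" "Cod C h = Dom C m" "A = subob C (m \<cdot>\<^bsub>C\<^esub> h)"
      by (rule ole_GE[of A m]) (use A m in simp_all)
    show ?thesis
    proof (rule ex1I[of _ "spancl C (m \<cdot>\<^bsub>C\<^esub> h) (n \<cdot>\<^bsub>C\<^esub> h)"])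
      fix g assume "g \<in> Arr (G_ogpd C) \<and> Dom (G_ogpd C) g = A \<and> (g, f) \<in> Le (G_ogpd C)"
      then show "g = spancl C (m \<cdot>\<^bsub>C\<^esub> h) (n \<cdot>\<^bsub>C\<^esub> h)"
        using m h restr_spancl_ex1 by simp
    qed (use m h in simp)
  qed
  show ?thesis
    unfolding ordered_groupoid_def using sc L po by (intro conjI) (auto intro!: iso inv cmp restr)
qed

lemma restr_spancl [simp]: "is_span C m n \<Longrightarrow> h \<in> Arr C \<Longrightarrow> Cod C h = Dom C m \<Longrightarrow>
    restr (G_ogpd C) (spancl C m n) (subob C (m \<cdot>\<^bsub>C\<^esub> h)) = spancl C (m \<cdot>\<^bsub>C\<^esub> h) (n \<cdot>\<^bsub>C\<^esub> h)"
  by (rule restr_eqI[OF ordered_groupoid_G]) simp_all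

lemma ole_G_max: "m \<in> Arr C \<Longrightarrow> ole (G_ogpd C) (subob C m) (subob C (Ide C (Cod C m)))"
  by (subst ole_G_iff) (auto intro!: bexI[of _ m])

lemma ole_G_Cod: "m \<in> Arr C \<Longrightarrow> n \<in> Arr C \<Longrightarrow> ole (G_ogpd C) (subob C m) (subob C n) \<Longrightarrow> Cod C m = Cod C
    n"
  by (auto simp: ole_G_iff)

text \<open>Comparable subobjects have the same codomain, and among the subobjects of one object the
  class of its identity is the largest. So the order splits into the posets of subobjects of the
  single objects, each with a top.\<close>

lemma has_unique_maximal_G: "has_unique_maximal (G_ogpd C)"
  unfolding has_unique_maximal_def
proof (intro ballI)
  fix A assume "A \<in> Obj (G_ogpd C)"
  then obtain m where m: "A = subob C m" "m \<in> Arr C"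
    by (rule G_ObjE)
  show "\<exists>!M. ole (G_ogpd C) A M \<and> (\<forall>N. ole (G_ogpd C) M N \<longrightarrow> N = M)"
  proof (intro ex1I[of _ "subob C (Ide C (Cod C m))"] conjI allI impI)
    fix N assume N: "ole (G_ogpd C) (subob C (Ide C (Cod C m))) N"
    obtain n where n: "N = subob C n" "n \<in> Arr C"
      using oleD(2)[OF N] by (rule G_ObjE)
    have c: "Cod C n = Cod C m"
      using ole_G_Cod[of "Ide C (Cod C m)" n] N m n by simp
    show "N = subob C (Ide C (Cod C m))"
      by (rule ole_antisym[OF ordered_groupoid_G _ N]) (use ole_G_max[OF n(2)] n c in simp)
  next
    fix M assume M: "ole (G_ogpd C) A M \<and> (\<forall>N. ole (G_ogpd C) M N \<longrightarrow> N = M)"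
    obtain n where n: "M = subob C n" "n \<in> Arr C"
      using oleD(2)[OF conjunct1[OF M]] by (rule G_ObjE)
    have "Cod C n = Cod C m"
      using ole_G_Cod[of m n] M m n by simp
    then show "M = subob C (Ide C (Cod C m))"
      using conjunct2[OF M] ole_G_max[OF n(2)] unfolding n(1) by metis
  qed (use ole_G_max m in simp)
qed

section \<open>Vertical sieves of subobjects and the induced topology\<close>

definition gsieve :: "'u \<Rightarrow> 'u set \<Rightarrow> 'u set" where
  "gsieve m \<A> = {r \<in> Arr C. Cod C r = Dom C m \<and> subob C (m \<cdot>\<^bsub>C\<^esub> r) \<in> \<A>}"

text \<open>With \<open>gsieve m\<close> this is a bijection between the sieves on the domain of
  \<open>m\<close> and the vertical sieves on its class: each subobject below
  \<open>subob C m\<close> comes from an \<open>r\<close> that is unique up to isomorphism.\<close>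

definition gimg :: "'u \<Rightarrow> 'u set \<Rightarrow> 'u set" where
  "gimg m S = (\<lambda>n. subob C (m \<cdot>\<^bsub>C\<^esub> n)) ` S"

lemma gsieve_gimg:
  assumes m: "m \<in> Arr C" and S: "sieve C (Dom C m) S"
  shows "gsieve m (gimg m S) = S"
proof (intro set_eqI iffI)
  fix r assume "r \<in> gsieve m (gimg m S)"
  then obtain n where r: "r \<in> Arr C" "Cod C r = Dom C m" and n: "n \<in> S" "subob C (m \<cdot>\<^bsub>C\<^esub> n) = subob C
      (m \<cdot>\<^bsub>C\<^esub> r)"
    unfolding gsieve_def gimg_def by auto
  note n' = sieveD[OF S n(1)]
  obtain k where k: "isomorphism C k" "Cod C k = Dom C (m \<cdot>\<^bsub>C\<^esub> n)" "m \<cdot>\<^bsub>C\<^esub> r = m \<cdot>\<^bsub>C\<^esub> n \<cdot>\<^bsub>C\<^esub> k"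
    by (rule subob_eqE[OF _ _ n(2)]) (use m n' r in simp_all)
  have "r = n \<cdot>\<^bsub>C\<^esub> k"
    by (rule cancel'[of m]) (use m r n' k in \<open>simp_all add: Cmp_assoc\<close>)
  then show "r \<in> S"
    using n' k m by simp
next
  fix r assume "r \<in> S"
  then show "r \<in> gsieve m (gimg m S)"
    unfolding gsieve_def gimg_def using sieveD[OF S] by simp
qed

lemma gimg_gsieve:
  assumes m: "m \<in> Arr C" and A: "vsieve (G_ogpd C) (subob C m) \<A>"
  shows "gimg m (gsieve m \<A>) = \<A>"
proof (intro set_eqI iffI)
  fix X assume X: "X \<in> \<A>"
  obtain h where h: "h \<in> Arr C" "Cod C h = Dom C m" "X = subob C (m \<cdot>\<^bsub>C\<^esub> h)"
    using vsieveD(2)[OF A X] m by (rule ole_GE)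
  then show "X \<in> gimg m (gsieve m \<A>)"
    unfolding gimg_def gsieve_def using X by simp
qed (auto simp: gimg_def gsieve_def)

lemma vsieve_gimg:
  assumes m: "m \<in> Arr C" and S: "sieve C (Dom C m) S"
  shows "vsieve (G_ogpd C) (subob C m) (gimg m S)"
  unfolding vsieve_def
proof (intro conjI subsetI ballI allI impI)
  show "B \<in> {A'. ole (G_ogpd C) A' (subob C m)}" if "B \<in> gimg m S" for B
    using that sieveD(1,2)[OF S] m unfolding gimg_def by auto
  fix B B' assume "B \<in> gimg m S" and le: "ole (G_ogpd C) B' B"
  then obtain n where n: "n \<in> S" "B = subob C (m \<cdot>\<^bsub>C\<^esub> n)"
    unfolding gimg_def by auto
  note n' = sieveD[OF S n(1)]
  obtain h where h: "h \<in> Arr C" "Cod C h = Dom C (m \<cdot>\<^bsub>C\<^esub> n)" "B' = subob C (m \<cdot>\<^bsub>C\<^esub> n \<cdot>\<^bsub>C\<^esub> h)"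
    by (rule ole_GE[of B' "m \<cdot>\<^bsub>C\<^esub> n"]) (use le n n' m in simp_all)
  show "B' \<in> gimg m S"
    unfolding gimg_def by (rule image_eqI[of _ _ "n \<cdot>\<^bsub>C\<^esub> h"]) (use h n' m in \<open>simp_all add:
        Cmp_assoc\<close>)
qed (use m in simp)

lemma sieve_gsieve:
  assumes m: "m \<in> Arr C" and A: "vsieve (G_ogpd C) (subob C m) \<A>"
  shows "sieve C (Dom C m) (gsieve m \<A>)"
proof (rule sieveI)
  fix f g assume "f \<in> gsieve m \<A>" and g: "g \<in> Arr C" "Cod C g = Dom C f"
  then have f: "f \<in> Arr C" "Cod C f = Dom C m" "subob C (m \<cdot>\<^bsub>C\<^esub> f) \<in> \<A>"
    unfolding gsieve_def by simp_all
  have "subob C (m \<cdot>\<^bsub>C\<^esub> f \<cdot>\<^bsub>C\<^esub> g) \<in> \<A>"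
    by (rule vsieveD(3)[OF A f(3)]) (use f g m in simp)
  then show "f \<cdot>\<^bsub>C\<^esub> g \<in> gsieve m \<A>"
    unfolding gsieve_def using f g m by (simp add: Cmp_assoc)
qed (use m in \<open>auto simp: gsieve_def\<close>)

lemma gsieve_Cmp: "m \<in> Arr C \<Longrightarrow> k \<in> Arr C \<Longrightarrow> Cod C k = Dom C m \<Longrightarrow>
    gsieve (m \<cdot>\<^bsub>C\<^esub> k) \<A> = sieve_pullback C k (gsieve m \<A>)"
  unfolding gsieve_def sieve_pullback_def by (auto simp: Cmp_assoc)

text \<open>\<open>T_of\<close> ranges over all representatives of a subobject. Changing
  \<open>m\<close> by an isomorphism \<open>k\<close> changes \<open>gsieve m \<A>\<close> by
  pullback along \<open>k\<close>, under which covers are stable, so one chosen representative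
  decides.\<close>

lemma T_of_iff:
  assumes J: "grothendieck_topology C J" and m: "m \<in> Arr C"
  shows "\<A> \<in> T_of (C, J) (subob C m) \<longleftrightarrow> vsieve (G_ogpd C) (subob C m) \<A> \<and> gsieve m \<A> \<in> J (Dom C m)"
proof
  assume "\<A> \<in> T_of (C, J) (subob C m)"
  then obtain m' S where m': "m' \<in> Arr C" "subob C m' = subob C m" and S: "S \<in> J (Dom C m')" "\<A> =
      gimg m' S"
    unfolding T_of_def gimg_def by auto
  note S' = topologyD(1)[OF J S(1)]
  obtain k where k: "isomorphism C k" "Cod C k = Dom C m'" "m = m' \<cdot>\<^bsub>C\<^esub> k"
    using m'(1) m m'(2) by (rule subob_eqE)
  have "gsieve m \<A> = sieve_pullback C k S"
    using gsieve_Cmp[of m' k] m' k gsieve_gimg[OF m'(1) S'] S(2) by simp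
  then show "vsieve (G_ogpd C) (subob C m) \<A> \<and> gsieve m \<A> \<in> J (Dom C m)"
    using vsieve_gimg[OF m'(1) S'] m' S k topologyD(3)[OF J, of k S] by simp
next
  assume *: "vsieve (G_ogpd C) (subob C m) \<A> \<and> gsieve m \<A> \<in> J (Dom C m)"
  then have "\<A> = gimg m (gsieve m \<A>)"
    using gimg_gsieve[OF m] by simp
  then show "\<A> \<in> T_of (C, J) (subob C m)"
    unfolding T_of_def gimg_def using * m by auto
qed

text \<open>Each axiom is moved to \<open>J\<close> by \<open>T_of_iff\<close>. A horizontal arrow
  from the class of \<open>m\<close> to that of \<open>n\<close>, where \<open>n = b h\<close>,
  pulls vertical sieves below the class of \<open>b\<close> back as \<open>h\<close> pulls back
  sieves of \<open>C\<close>.\<close>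

lemma ehresmann_T_of:
  assumes J: "grothendieck_topology C J"
  shows "ehresmann_topology (G_ogpd C) (T_of (C, J))"
  unfolding ehresmann_topology_def
proof (intro conjI allI ballI impI; (elim conjE)?)
  fix A \<A> assume A: "\<A> \<in> T_of (C, J) A"
  then obtain m where "A = subob C m" "m \<in> Arr C"
    unfolding T_of_def by auto
  then show "vsieve (G_ogpd C) A \<A>"
    using T_of_iff[OF J] A by simp
next
  fix A assume "A \<in> Obj (G_ogpd C)"
  then obtain m where m: "A = subob C m" "m \<in> Arr C"
    by (rule G_ObjE)
  have "gsieve m {A'. ole (G_ogpd C) A' (subob C m)} = {f \<in> Arr C. Cod C f = Dom C m}"
    unfolding gsieve_def using m by auto
  moreover have "vsieve (G_ogpd C) (subob C m) {A'. ole (G_ogpd C) A' (subob C m)}"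
    unfolding vsieve_def using m ole_trans[OF ordered_groupoid_G] by auto
  ultimately show "{A'. ole (G_ogpd C) A' A} \<in> T_of (C, J) A"
    using m T_of_iff[OF J] topologyD(2)[OF J] by simp
next
  fix B \<B> f assume "B \<in> Obj (G_ogpd C)" and \<B>: "\<B> \<in> T_of (C, J) B" and f: "f \<in> Arr (G_ogpd C)"
    and le: "ole (G_ogpd C) (Cod (G_ogpd C) f) B"
  then obtain b where b: "B = subob C b" "b \<in> Arr C"
    by (elim G_ObjE)
  obtain m n where m: "f = spancl C m n" "is_span C m n"
    using f by (rule G_ArrE)
  have nA: "n \<in> Arr C" "m \<in> Arr C" using m by simp_all
  obtain h where h: "h \<in> Arr C" "Cod C h = Dom C b" "n = b \<cdot>\<^bsub>C\<^esub> h"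
    using le m b ole_G_iff[OF nA(1) b(2)] by auto
  have V: "vsieve (G_ogpd C) B \<B>" "gsieve b \<B> \<in> J (Dom C b)"
    using \<B> T_of_iff[OF J b(2)] b by simp_all
  have Dh: "Dom C h = Dom C m"
    using span_Dom[OF m(2)] h b by simp
  have "gsieve m (vsieve_pullback (G_ogpd C) f \<B>) = sieve_pullback C h (gsieve b \<B>)"
    unfolding gsieve_def vsieve_pullback_def sieve_pullback_def
    using m h b nA Dh span_Cmp[OF m(2)] by (auto simp: Cmp_assoc span_Dom)
  moreover have "vsieve (G_ogpd C) (subob C m) (vsieve_pullback (G_ogpd C) f \<B>)"
    unfolding vsieve_def
  proof (intro conjI subsetI ballI allI impI)
    fix A A' assume "A \<in> vsieve_pullback (G_ogpd C) f \<B>" and A': "ole (G_ogpd C) A' A"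
    then have A: "ole (G_ogpd C) A (Dom (G_ogpd C) f)" "Cod (G_ogpd C) (restr (G_ogpd C) f A) \<in> \<B>"
      unfolding vsieve_pullback_def by simp_all
    show "A' \<in> vsieve_pullback (G_ogpd C) f \<B>"
      unfolding vsieve_pullback_def
      using vsieveD(3)[OF V(1) A(2) ole_Cod_restr_restr[OF ordered_groupoid_G f A(1) A']]
        ole_trans[OF ordered_groupoid_G A' A(1)] by simp
  qed (use m nA in \<open>auto simp: vsieve_pullback_def\<close>)
  ultimately show "vsieve_pullback (G_ogpd C) f \<B> \<in> T_of (C, J) (Dom (G_ogpd C) f)"
    using m nA T_of_iff[OF J nA(2)] topologyD(3)[OF J h(1)] V(2) h Dh by simp
next
  fix A \<A> \<B> assume "A \<in> Obj (G_ogpd C)" and \<A>: "\<A> \<in> T_of (C, J) A" and \<B>: "vsieve (G_ogpd C) A \<B>"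
    and loc: "\<forall>f\<in>Arr (G_ogpd C). Cod (G_ogpd C) f \<in> \<A> \<longrightarrow>
        vsieve_pullback (G_ogpd C) f \<B> \<in> T_of (C, J) (Dom (G_ogpd C) f)"
  then obtain m where m: "A = subob C m" "m \<in> Arr C"
    by (elim G_ObjE)
  have S: "gsieve m \<A> \<in> J (Dom C m)"
    using \<A> T_of_iff[OF J m(2)] m by simp
  have "gsieve m \<B> \<in> J (Dom C m)"
  proof (rule topologyD(4)[OF J S])
    show "sieve C (Dom C m) (gsieve m \<B>)"
      using sieve_gsieve[OF m(2)] \<B> m by simp
    fix s assume "s \<in> gsieve m \<A>"
    then have s: "s \<in> Arr C" "Cod C s = Dom C m" "subob C (m \<cdot>\<^bsub>C\<^esub> s) \<in> \<A>"
      unfolding gsieve_def by simp_all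
    \<comment> \<open>The identity of the class of \<open>m s\<close>. Vertical pullback along it
      just cuts \<B> down to the objects below that class.\<close>
    let ?f = "spancl C (m \<cdot>\<^bsub>C\<^esub> s) (m \<cdot>\<^bsub>C\<^esub> s)"
    have ms: "m \<cdot>\<^bsub>C\<^esub> s \<in> Arr C" "Dom C (m \<cdot>\<^bsub>C\<^esub> s) = Dom C s"
      using s m by simp_all
    have "vsieve_pullback (G_ogpd C) ?f \<B> \<in> T_of (C, J) (subob C (m \<cdot>\<^bsub>C\<^esub> s))"
      using bspec[OF loc, of ?f] s(3) ms(1) by simp
    then have "gsieve (m \<cdot>\<^bsub>C\<^esub> s) (vsieve_pullback (G_ogpd C) ?f \<B>) \<in> J (Dom C s)"
      using T_of_iff[OF J ms(1)] ms by simp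
    moreover have "gsieve (m \<cdot>\<^bsub>C\<^esub> s) (vsieve_pullback (G_ogpd C) ?f \<B>) = gsieve (m \<cdot>\<^bsub>C\<^esub> s) \<B>"
      unfolding gsieve_def vsieve_pullback_def using ms by auto
    ultimately show "sieve_pullback C s (gsieve m \<B>) \<in> J (Dom C s)"
      using gsieve_Cmp[of m s] m s by simp
  qed
  then show "\<B> \<in> T_of (C, J) A"
    using T_of_iff[OF J m(2)] m \<B> by simp
qed

end

lemma lc_sites_lc_category: "X \<in> lc_sites \<Longrightarrow> lc_category (fst X)"
  unfolding lc_category_def by (simp add: lc_sitesD)

lemma G_site_sel [simp]: "fst (G_site X) = G_ogpd (fst X)" "snd (G_site X) = T_of X"
  by (simp_all add: G_site_def)

lemma G_site_max:
  assumes X: "X \<in> lc_sites"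
  shows "G_site X \<in> max_sites"
proof -
  interpret lc_category "fst X"
    using X by (rule lc_sites_lc_category)
  show ?thesis
    using ehresmann_T_of[OF lc_sitesD(4)[OF X]] has_unique_maximal_G
    unfolding max_sites_def G_site_def by simp
qed


section \<open>Double functors and transformations from equivariant maps\<close>

text \<open>With \<open>t\<close> the arrow map of a functor \<open>K\<close>, \<open>G_map\<close> is \<open>G_fct\<close>; with \<open>t m = K' m \<cdot> \<theta>\<close> it is the
  double functor in the middle of \<open>G_nat \<theta>\<close>.\<close>

definition equivariant :: "('u, 'u) cat \<Rightarrow> ('u, 'u) cat \<Rightarrow> 'u fct \<Rightarrow> ('u \<Rightarrow> 'u) \<Rightarrow> bool" where
  "equivariant C C' K t \<longleftrightarrow> (\<forall>m\<in>Arr C. t m \<in> Arr C' \<and> Dom C' (t m) = omap K (Dom C m)) \<and>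
    (\<forall>m\<in>Arr C. \<forall>h\<in>Arr C. Cod C h = Dom C m \<longrightarrow> t (m \<cdot>\<^bsub>C\<^esub> h) = t m \<cdot>\<^bsub>C'\<^esub> amap K h)"

definition G_map :: "('u::universe, 'u) cat \<Rightarrow> ('u, 'u) cat \<Rightarrow> ('u \<Rightarrow> 'u) \<Rightarrow> 'u fct" where
  "G_map C C' t = \<lparr>
     omap = \<lambda>X\<in>G_obj C. THE Y. \<exists>m\<in>Arr C. X = subob C m \<and> Y = subob C' (t m),
     amap = \<lambda>x\<in>G_arr C. THE y. \<exists>m n. is_span C m n \<and> x = spancl C m n \<and> y = spancl C' (t m) (t n)\<rparr>"

definition G_comp :: "('u::universe, 'u) cat \<Rightarrow> ('u, 'u) cat \<Rightarrow> ('u \<Rightarrow> 'u) \<Rightarrow> ('u \<Rightarrow> 'u) \<Rightarrow> 'u \<Rightarrow> 'u" where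
  "G_comp C C' s t = (\<lambda>X\<in>G_obj C. THE x. \<exists>m\<in>Arr C. X = subob C m \<and> x = spancl C' (s m) (t m))"

lemma G_fct_eq: "G_fct C C' K = G_map C C' (amap K)"
  by (simp add: G_fct_def G_map_def)

locale lc_functor = C: lc_category C + C': lc_category C'
  for C C' :: "('u::universe, 'u) cat" +
  fixes K :: "'u fct"
  assumes K: "small_functor C C' K"
begin

lemmas K_simps [simp] = small_functorD(6-11)[OF K]

lemma K_iso [simp]: "isomorphism C k \<Longrightarrow> isomorphism C' (amap K k)"
  by (rule functor_isomorphism[OF small_functorD(3)[OF K]])

lemma equivariantD:
  assumes "equivariant C C' K t"
  shows "m \<in> Arr C \<Longrightarrow> t m \<in> Arr C'" "m \<in> Arr C \<Longrightarrow> Dom C' (t m) = omap K (Dom C m)"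
    "m \<in> Arr C \<Longrightarrow> h \<in> Arr C \<Longrightarrow> Cod C h = Dom C m \<Longrightarrow> t (m \<cdot>\<^bsub>C\<^esub> h) = t m \<cdot>\<^bsub>C'\<^esub> amap K h"
    "is_span C m n \<Longrightarrow> is_span C' (t m) (t n)"
  using assms unfolding equivariant_def is_span_def by simp_all

lemma span_equivariant:
  "equivariant C C' K s \<Longrightarrow> equivariant C C' K t \<Longrightarrow> m \<in> Arr C \<Longrightarrow> is_span C' (s m) (t m)"
  unfolding equivariant_def is_span_def by simp

lemma equivariant_functor: "equivariant C C' K (amap K)"
  unfolding equivariant_def by simp

context
  fixes t assumes t: "equivariant C C' K t"
begin

lemma omap_G_map:
  assumes m: "m \<in> Arr C"
  shows "omap (G_map C C' t) (subob C m) = subob C' (t m)"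
proof -
  note [simp] = equivariantD[OF t]
  have "(THE Y. \<exists>m'\<in>Arr C. subob C m = subob C m' \<and> Y = subob C' (t m')) = subob C' (t m)"
  proof (rule the_equality)
    fix Y assume "\<exists>m'\<in>Arr C. subob C m = subob C m' \<and> Y = subob C' (t m')"
    then obtain m' where m': "m' \<in> Arr C" "subob C m = subob C m'" "Y = subob C' (t m')"
      by blast
    show "Y = subob C' (t m)"
      using m m'(1,2) by (rule C.subob_eqE) (use m m'(3) in \<open>simp add: C'.subob_Cmp_iso\<close>)
  qed (use m in blast)
  then show ?thesis
    using C.subob_Obj[OF m] by (simp add: G_map_def C.G_ogpd_Obj)
qed

lemma amap_G_map:
  assumes s: "is_span C m n"
  shows "amap (G_map C C' t) (spancl C m n) = spancl C' (t m) (t n)"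
proof -
  note [simp] = equivariantD[OF t]
  have "(THE y. \<exists>m' n'. is_span C m' n' \<and> spancl C m n = spancl C m' n' \<and> y = spancl C' (t m') (t
      n')) =
      spancl C' (t m) (t n)"
  proof (rule the_equality)
    fix y assume "\<exists>m' n'. is_span C m' n' \<and> spancl C m n = spancl C m' n' \<and> y = spancl C' (t m') (t
        n')"
    then obtain m' n' where m': "is_span C m' n'" "spancl C m n = spancl C m' n'" "y = spancl C' (t
        m') (t n')"
      by blast
    show "y = spancl C' (t m) (t n)"
      using s m'(1,2)
    proof (rule C.spancl_eqE)
      fix k assume k: "isomorphism C k" "Cod C k = Dom C m" "m' = m \<cdot>\<^bsub>C\<^esub> k" "n' = n \<cdot>\<^bsub>C\<^esub> k"
      show ?thesis
        using k m'(3) s C'.spancl_Cmp_iso[of "t m" "t n" "amap K k"] by (simp add: C.span_Dom)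
    qed
  qed (use s in blast)
  then show ?thesis
    using C.spancl_Arr[OF s] by (simp add: G_map_def C.G_ogpd_Arr)
qed

text \<open>Changes of representatives and the order are both given by precomposition, and
  \<open>t\<close> turns precomposition with \<open>h\<close> into precomposition with
  \<open>amap K h\<close>. That is what makes a map on representatives descend and preserve the
  order.\<close>

lemma double_functor_G_map: "double_functor (G_ogpd C) (G_ogpd C') (G_map C C' t)"
proof -
  note [simp] = omap_G_map amap_G_map equivariantD[OF t]
  have "is_functor (G_ogpd C) (G_ogpd C') (omap (G_map C C' t)) (amap (G_map C C' t))"
  proof (rule functorI, goal_cases)
    case (8 x y)
    obtain k m where x: "x = spancl C k m" "is_span C k m" using 8(1) by (rule C.G_ArrE)
    obtain n where "y = spancl C m n" "is_span C m n"
      by (rule C.spancl_DomE[OF 8(2), of m]) (use 8 x in simp_all)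
    then show ?case using x C.span_trans[of k m n] by simp
  qed (auto elim!: C.G_ObjE C.G_ArrE)
  moreover have "(amap (G_map C C' t) a, amap (G_map C C' t) b) \<in> Le (G_ogpd C')" if "(a, b) \<in> Le
      (G_ogpd C)" for a b
    using that by (rule C.Le_GE) (simp add: C.span_Dom)
  ultimately show ?thesis
    unfolding double_functor_def small_functor_def by (simp add: G_map_def C.G_ogpd_Obj
        C.G_ogpd_Arr)
qed

end

lemma G_comp_subob:
  assumes s: "equivariant C C' K s" and t: "equivariant C C' K t" and m: "m \<in> Arr C"
  shows "G_comp C C' s t (subob C m) = spancl C' (s m) (t m)"
proof -
  note [simp] = equivariantD[OF s] equivariantD[OF t] span_equivariant[OF s t]
  have "(THE x. \<exists>m'\<in>Arr C. subob C m = subob C m' \<and> x = spancl C' (s m') (t m')) = spancl C' (s m)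
      (t m)"
  proof (rule the_equality)
    fix x assume "\<exists>m'\<in>Arr C. subob C m = subob C m' \<and> x = spancl C' (s m') (t m')"
    then obtain m' where m': "m' \<in> Arr C" "subob C m = subob C m'" "x = spancl C' (s m') (t m')"
      by blast
    show "x = spancl C' (s m) (t m)"
      using m m'(1,2)
      by (rule C.subob_eqE) (use m m'(3) in \<open>simp add: C'.spancl_Cmp_iso\<close>)
  qed (use m in blast)
  then show ?thesis
    using C.subob_Obj[OF m] by (simp add: G_comp_def C.G_ogpd_Obj)
qed

text \<open>At the class of a span \<open>m\<close>, \<open>n\<close> both composites are the class
  of \<open>s m\<close> and \<open>t n\<close>: one passes through \<open>t m\<close>, the other
  through \<open>s n\<close>.\<close>

lemma hor_transformation_G_comp:
  assumes s: "equivariant C C' K s" and t: "equivariant C C' K t"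
  shows "hor_transformation (G_ogpd C) (G_ogpd C') (G_map C C' s) (G_map C C' t) (G_comp C C' s t)"
proof -
  note [simp] = equivariantD[OF s] equivariantD[OF t] span_equivariant[OF s t] G_comp_subob[OF s t]
    omap_G_map[OF s] omap_G_map[OF t] amap_G_map[OF s] amap_G_map[OF t]
  have extG: "G_comp C C' s t \<in> extensional (Obj (G_ogpd C))"
    by (simp add: G_comp_def C.G_ogpd_Obj)
  have "(G_comp C C' s t X, G_comp C C' s t Y) \<in> Le (G_ogpd C')" if XY: "ole (G_ogpd C) X Y" for X Y
  proof -
    obtain m where m: "Y = subob C m" "m \<in> Arr C"
      using oleD(2)[OF XY] by (rule C.G_ObjE)
    obtain h where "h \<in> Arr C" "Cod C h = Dom C m" "X = subob C (m \<cdot>\<^bsub>C\<^esub> h)"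
      by (rule C.ole_GE[of X m]) (use XY m in simp_all)
    then show ?thesis
      using m by simp
  qed
  moreover have "amap (G_map C C' t) f \<cdot>\<^bsub>G_ogpd C'\<^esub> G_comp C C' s t (Dom (G_ogpd C) f) =
      G_comp C C' s t (Cod (G_ogpd C) f) \<cdot>\<^bsub>G_ogpd C'\<^esub> amap (G_map C C' s) f" if "f \<in> Arr (G_ogpd C)"
          for f
    using that by (rule C.G_ArrE) simp
  ultimately show ?thesis
    using extG unfolding hor_transformation_def nat_transformation_def
    by (auto elim!: C.G_ObjE)
qed

end


section \<open>Equivalences of categories\<close>

text \<open>Objects \<open>a X\<close> and isomorphisms \<open>e X\<close> are chosen; an arrow is
  conjugated by them and lifted through fullness. Faithfulness makes the lifts functorial.\<close>

lemma equivalence_inverse: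
  fixes E :: "'u fct"
  assumes E: "small_functor C D E" and full: "full_on C D (omap E) (amap E)"
    and faith: "faithful_on C (amap E)" and es: "ess_surj C D (omap E)"
  obtains P \<psi> where "small_functor D C P" "nat_transformation D D (fct_comp D E P) (fct_id D) \<psi>"
    "\<And>X. X \<in> Obj D \<Longrightarrow> isomorphism D (\<psi> X)"
proof -
  note [simp] = small_functorD[OF E]
  have "\<forall>X. \<exists>A e. X \<in> Obj D \<longrightarrow> A \<in> Obj C \<and> isomorphism D e \<and> Dom D e = omap E A \<and> Cod D e = X"
    using es unfolding ess_surj_def by blast
  then obtain a e where ae: "\<And>X. X \<in> Obj D \<Longrightarrow> a X \<in> Obj C \<and> isomorphism D (e X) \<and>
      Dom D (e X) = omap E (a X) \<and> Cod D (e X) = X"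
    by metis
  then have [simp]: "a X \<in> Obj C" "isomorphism D (e X)" "Dom D (e X) = omap E (a X)" "Cod D (e X) =
      X"
    if "X \<in> Obj D" for X
    using that by simp_all
  let ?g = "\<lambda>f. inv_arr D (e (Cod D f)) \<cdot>\<^bsub>D\<^esub> (f \<cdot>\<^bsub>D\<^esub> e (Dom D f))"
  have "\<exists>h. f \<in> Arr D \<longrightarrow> h \<in> Arr C \<and> Dom C h = a (Dom D f) \<and> Cod C h = a (Cod D f) \<and> amap E h = ?g f"
      for f
  proof (cases "f \<in> Arr D")
    case True
    obtain h where "h \<in> Arr C" "Dom C h = a (Dom D f)" "Cod C h = a (Cod D f)" "amap E h = ?g f"
      by (rule fullE[OF full, of "a (Dom D f)" "a (Cod D f)" "?g f"]) (use True in simp_all)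
    then show ?thesis by blast
  qed simp
  then obtain p where p: "\<And>f. f \<in> Arr D \<Longrightarrow> p f \<in> Arr C \<and> Dom C (p f) = a (Dom D f) \<and>
      Cod C (p f) = a (Cod D f) \<and> amap E (p f) = ?g f"
    by metis
  then have [simp]: "p f \<in> Arr C" "Dom C (p f) = a (Dom D f)" "Cod C (p f) = a (Cod D f)" "amap E (p
      f) = ?g f"
    if "f \<in> Arr D" for f
    using that by simp_all
  define P where "P = \<lparr>omap = \<lambda>X\<in>Obj D. a X, amap = \<lambda>f\<in>Arr D. p f\<rparr>"
  define \<psi> where "\<psi> = (\<lambda>X\<in>Obj D. e X)"
  have [simp]: "X \<in> Obj D \<Longrightarrow> omap P X = a X" "f \<in> Arr D \<Longrightarrow> amap P f = p f" "X \<in> Obj D \<Longrightarrow> \<psi> X = e X" for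
      X f
    by (simp_all add: P_def \<psi>_def)
  have "is_functor D C (omap P) (amap P)"
  proof (rule functorI, goal_cases)
    case (4 A)
    show ?case
      by (rule faithfulD[OF faith]) (use 4 in simp_all)
  next
    case (8 f g)
    show ?case
      by (rule faithfulD[OF faith]) (use 8 in \<open>simp_all add: Cmp_assoc\<close>)
  qed simp_all
  then have "small_functor D C P"
    unfolding small_functor_def by (simp add: P_def)
  moreover have "nat_transformation D D (fct_comp D E P) (fct_id D) \<psi>"
    unfolding nat_transformation_def
  proof (intro conjI ballI)
    show "\<psi> \<in> extensional (Obj D)"
      by (simp add: \<psi>_def)
  qed (simp_all add: Cmp_assoc)
  moreover have "isomorphism D (\<psi> X)" if "X \<in> Obj D" for X
    using that by simp
  ultimately show thesis
    by (rule that)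
qed

text \<open>The inverse of \<open>\<psi>\<close> at \<open>omap E A\<close> is lifted through the
  full and faithful \<open>E\<close>. \<open>P\<close> and \<open>\<psi>\<close> are parameters, so
  that this serves both for a chosen inverse of the unit and for the explicit inverse of the
  counit.\<close>

lemma equivalence_unit:
  fixes E P :: "'u fct"
  assumes E: "small_functor C D E" and full: "full_on C D (omap E) (amap E)"
    and faith: "faithful_on C (amap E)" and P: "small_functor D C P"
    and \<psi>: "nat_transformation D D (fct_comp D E P) (fct_id D) \<psi>" "\<And>X. X \<in> Obj D \<Longrightarrow> isomorphism D (\<psi>
        X)"
  obtains \<theta> where "nat_transformation C C (fct_id C) (fct_comp C P E) \<theta>" "\<And>A. A \<in> Obj C \<Longrightarrow>
      isomorphism C (\<theta> A)"
proof -
  note [simp] = small_functorD[OF E] small_functorD[OF P] nat_transformationD(2-4)[OF \<psi>(1)] \<psi>(2)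
  have "\<exists>h. A \<in> Obj C \<longrightarrow> h \<in> Arr C \<and> Dom C h = A \<and> Cod C h = omap P (omap E A) \<and>
      amap E h = inv_arr D (\<psi> (omap E A))" for A
  proof (cases "A \<in> Obj C")
    case True
    obtain h where "h \<in> Arr C" "Dom C h = A" "Cod C h = omap P (omap E A)" "amap E h = inv_arr D (\<psi>
        (omap E A))"
      by (rule fullE[OF full, of A "omap P (omap E A)" "inv_arr D (\<psi> (omap E A))"]) (use True in
          simp_all)
    then show ?thesis by blast
  qed simp
  then obtain t where t: "\<And>A. A \<in> Obj C \<Longrightarrow> t A \<in> Arr C \<and> Dom C (t A) = A \<and> Cod C (t A) = omap P (omap
      E A) \<and>
      amap E (t A) = inv_arr D (\<psi> (omap E A))"
    by metis
  then have [simp]: "t A \<in> Arr C" "Dom C (t A) = A" "Cod C (t A) = omap P (omap E A)"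
      "amap E (t A) = inv_arr D (\<psi> (omap E A))" if "A \<in> Obj C" for A
    using that by simp_all
  define \<theta> where "\<theta> = (\<lambda>A\<in>Obj C. t A)"
  have [simp]: "A \<in> Obj C \<Longrightarrow> \<theta> A = t A" for A
    by (simp add: \<theta>_def)
  have nat: "amap P (amap E f) \<cdot>\<^bsub>C\<^esub> t (Dom C f) = t (Cod C f) \<cdot>\<^bsub>C\<^esub> f" if f: "f \<in> Arr C" for f
  proof (rule faithfulD[OF faith])
    let ?a = "\<psi> (omap E (Dom C f))" and ?b = "\<psi> (omap E (Cod C f))"
    have n: "amap E f \<cdot>\<^bsub>D\<^esub> ?a = ?b \<cdot>\<^bsub>D\<^esub> amap E (amap P (amap E f))"
      using nat_transformationD(5)[OF \<psi>(1), of "amap E f"] f by simp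
    have "amap E (amap P (amap E f)) \<cdot>\<^bsub>D\<^esub> inv_arr D ?a =
        inv_arr D ?b \<cdot>\<^bsub>D\<^esub> ((?b \<cdot>\<^bsub>D\<^esub> amap E (amap P (amap E f))) \<cdot>\<^bsub>D\<^esub> inv_arr D ?a)"
      using f by (simp add: Cmp_assoc)
    also have "\<dots> = inv_arr D ?b \<cdot>\<^bsub>D\<^esub> amap E f"
      unfolding n[symmetric] using f by (simp add: Cmp_assoc)
    finally show "amap E (amap P (amap E f) \<cdot>\<^bsub>C\<^esub> t (Dom C f)) = amap E (t (Cod C f) \<cdot>\<^bsub>C\<^esub> f)"
      using f by simp
  qed (use f in simp_all)
  have "nat_transformation C C (fct_id C) (fct_comp C P E) \<theta>"
    unfolding nat_transformation_def
  proof (intro conjI ballI)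
    show "\<theta> \<in> extensional (Obj C)"
      by (simp add: \<theta>_def)
  qed (simp_all add: nat)
  moreover have "isomorphism C (\<theta> A)" if "A \<in> Obj C" for A
    by (rule ff_reflects_isomorphism[OF small_functorD(3)[OF E] full faith]) (use that in simp_all)
  ultimately show thesis
    by (rule that)
qed

text \<open>Every object of \<open>D\<close> is isomorphic to one in the image of \<open>E\<close>.
  Conjugating by these isomorphisms moves any question about arrows of \<open>D\<close> to arrows in
  the image of the full \<open>E\<close>, where \<open>Q\<close> undoes \<open>E\<close>. It will
  apply to the image of the counit under \<open>L\<close>, which undoes the unit.\<close>

lemma retraction_ff:
  assumes E: "small_functor C D E" and full: "full_on C D (omap E) (amap E)" and es: "ess_surj C D
      (omap E)"
    and Q: "small_functor D C Q" and QE: "fct_comp C Q E = fct_id C"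
  shows "full_on D C (omap Q) (amap Q)" "faithful_on D (amap Q)" "ess_surj D C (omap Q)"
proof -
  note [simp] = small_functorD[OF E] small_functorD[OF Q]
  have QEo [simp]: "omap Q (omap E A) = A" if "A \<in> Obj C" for A
    using arg_cong[OF QE, of "\<lambda>F. omap F A"] that by simp
  have QEa [simp]: "amap Q (amap E f) = f" if "f \<in> Arr C" for f
    using arg_cong[OF QE, of "\<lambda>F. amap F f"] that by simp
  have Qi [simp]: "isomorphism C (amap Q e)" if "isomorphism D e" for e
    by (rule functor_isomorphism[OF small_functorD(3)[OF Q] that])
  show "ess_surj D C (omap Q)"
    unfolding ess_surj_def
  proof (intro ballI)
    fix A assume A: "A \<in> Obj C"
    show "\<exists>B\<in>Obj D. \<exists>e. isomorphism C e \<and> Dom C e = omap Q B \<and> Cod C e = A"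
      by (rule bexI[of _ "omap E A"], rule exI[of _ "Ide C A"]) (use A in simp_all)
  qed
  show "faithful_on D (amap Q)"
    unfolding faithful_on_def
  proof (intro ballI impI, elim conjE)
    fix f g assume fg: "f \<in> Arr D" "g \<in> Arr D" "Dom D f = Dom D g" "Cod D f = Cod D g" "amap Q f =
        amap Q g"
    obtain A a where a: "A \<in> Obj C" "isomorphism D a" "Dom D a = omap E A" "Cod D a = Dom D g"
      using es by (rule ess_surjE[of C D "omap E" "Dom D g"]) (use fg in simp)
    obtain B b where b: "B \<in> Obj C" "isomorphism D b" "Dom D b = omap E B" "Cod D b = Cod D g"
      using es by (rule ess_surjE[of C D "omap E" "Cod D g"]) (use fg in simp)
    let ?c = "\<lambda>f. inv_arr D b \<cdot>\<^bsub>D\<^esub> (f \<cdot>\<^bsub>D\<^esub> a)"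
    obtain f' where f': "f' \<in> Arr C" "Dom C f' = A" "Cod C f' = B" "amap E f' = ?c f"
      by (rule fullE[OF full, of A B "?c f"]) (use fg a b in simp_all)
    obtain g' where g': "g' \<in> Arr C" "Dom C g' = A" "Cod C g' = B" "amap E g' = ?c g"
      by (rule fullE[OF full, of A B "?c g"]) (use fg a b in simp_all)
    have "amap Q (?c f) = amap Q (?c g)"
      using fg a b by simp
    then have "f' = g'"
      using f' g' QEa by metis
    then have "?c f = ?c g"
      using f' g' by simp
    then have "b \<cdot>\<^bsub>D\<^esub> ?c f \<cdot>\<^bsub>D\<^esub> inv_arr D a = b \<cdot>\<^bsub>D\<^esub> ?c g \<cdot>\<^bsub>D\<^esub> inv_arr D a"
      by simp
    then show "f = g"
      using fg a b by (simp add: Cmp_assoc)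
  qed
  show "full_on D C (omap Q) (amap Q)"
    unfolding full_on_def
  proof (intro ballI impI, elim conjE)
    fix X Y u assume u: "X \<in> Obj D" "Y \<in> Obj D" "u \<in> Arr C" "Dom C u = omap Q X" "Cod C u = omap Q
        Y"
    obtain A a where a: "A \<in> Obj C" "isomorphism D a" "Dom D a = omap E A" "Cod D a = X"
      using es u(1) by (rule ess_surjE)
    obtain B b where b: "B \<in> Obj C" "isomorphism D b" "Dom D b = omap E B" "Cod D b = Y"
      using es u(2) by (rule ess_surjE)
    let ?f' = "inv_arr C (amap Q b) \<cdot>\<^bsub>C\<^esub> (u \<cdot>\<^bsub>C\<^esub> amap Q a)"
    have f': "?f' \<in> Arr C" "Dom C ?f' = A" "Cod C ?f' = B"
      using u a b by simp_all
    let ?f = "b \<cdot>\<^bsub>D\<^esub> (amap E ?f' \<cdot>\<^bsub>D\<^esub> inv_arr D a)"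
    have "amap Q ?f = amap Q b \<cdot>\<^bsub>C\<^esub> (?f' \<cdot>\<^bsub>C\<^esub> inv_arr C (amap Q a))"
      using u a b f' functor_inv_arr[OF small_functorD(3)[OF Q] a(2)]
      by (simp del: small_functorD(11)[OF E])
    also have "\<dots> = u"
      using u a b by (simp add: Cmp_assoc)
    finally show "\<exists>f\<in>Arr D. Dom D f = X \<and> Cod D f = Y \<and> amap Q f = u"
      using u a b f' by (intro bexI[of _ ?f]) (simp_all del: small_functorD(11)[OF E])
  qed
qed

text \<open>An arrow \<open>g\<close> between objects of the image of \<open>I\<close> and the arrow
  \<open>I (Q g)\<close> agree under the faithful \<open>Q\<close>, so \<open>Q g\<close> is a
  preimage of \<open>g\<close>. Lifting the identity of \<open>omap Q Y\<close> through
  \<open>Q\<close> gives an isomorphism from \<open>I (Q Y)\<close> to \<open>Y\<close>.\<close>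

lemma section_ff:
  assumes Q: "small_functor D C Q" and full: "full_on D C (omap Q) (amap Q)" and faith: "faithful_on
      D (amap Q)"
    and I: "small_functor C D I" and QI: "fct_comp C Q I = fct_id C"
  shows "full_on C D (omap I) (amap I)" "faithful_on C (amap I)" "ess_surj C D (omap I)"
proof -
  note [simp] = small_functorD[OF I] small_functorD[OF Q]
  have QIo [simp]: "omap Q (omap I A) = A" if "A \<in> Obj C" for A
    using arg_cong[OF QI, of "\<lambda>F. omap F A"] that by simp
  have QIa [simp]: "amap Q (amap I f) = f" if "f \<in> Arr C" for f
    using arg_cong[OF QI, of "\<lambda>F. amap F f"] that by simp
  show "faithful_on C (amap I)"
    unfolding faithful_on_def by (metis QIa)
  show "full_on C D (omap I) (amap I)"
    unfolding full_on_def
  proof (intro ballI impI, elim conjE)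
    fix A B g assume *: "A \<in> Obj C" "B \<in> Obj C" "g \<in> Arr D" "Dom D g = omap I A" "Cod D g = omap I
        B"
    have "amap I (amap Q g) = g"
      by (rule faithfulD[OF faith]) (use * in simp_all)
    then show "\<exists>f\<in>Arr C. Dom C f = A \<and> Cod C f = B \<and> amap I f = g"
      using * by (intro bexI[of _ "amap Q g"]) simp_all
  qed
  show "ess_surj C D (omap I)"
    unfolding ess_surj_def
  proof (intro ballI)
    fix Y assume Y: "Y \<in> Obj D"
    obtain f where f: "f \<in> Arr D" "Dom D f = omap I (omap Q Y)" "Cod D f = Y" "amap Q f = Ide C
        (omap Q Y)"
      by (rule fullE[OF full, of "omap I (omap Q Y)" Y "Ide C (omap Q Y)"]) (use Y in simp_all)
    have "isomorphism D f"
      by (rule ff_reflects_isomorphism[OF small_functorD(3)[OF Q] full faith]) (use f Y in simp_all)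
    then show "\<exists>A\<in>Obj C. \<exists>e. isomorphism D e \<and> Dom D e = omap I A \<and> Cod D e = Y"
      using f Y by (intro bexI[of _ "omap Q Y"] exI[of _ f]) simp_all
  qed
qed


section \<open>The unit\<close>

text \<open>On an arrow \<open>f\<close> this is the class of the span of an identity and
  \<open>f\<close>, followed by the inequality between the class of \<open>f\<close> and the maximal
  subobject of \<open>Cod C f\<close>.\<close>

definition eta_fct :: "('u::universe, 'u) cat \<Rightarrow> 'u fct" where
  "eta_fct C = \<lparr>omap = \<lambda>A\<in>Obj C. subob C (Ide C A),
    amap = \<lambda>f\<in>Arr C. vpair (spancl C (Ide C (Dom C f)) f) (subob C (Ide C (Cod C f)))\<rparr>"

context lc_category
begin

text \<open>\<open>garr m h b\<close> is the arrow \<open>[m] \<rightarrow> [b h] \<le> [b]\<close>.\<close>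

definition garr :: "'u \<Rightarrow> 'u \<Rightarrow> 'u \<Rightarrow> 'u" where
  "garr m h b = vpair (spancl C m (b \<cdot>\<^bsub>C\<^esub> h)) (subob C b)"

abbreviation LG :: "('u, 'u) cat" where "LG \<equiv> L_cat (G_ogpd C)"

text \<open>The typing conditions under which \<open>garr m h b\<close> is an arrow, kept folded so
  that each arrow contributes a single premise to the rules below.\<close>

definition ghom :: "'u \<Rightarrow> 'u \<Rightarrow> 'u \<Rightarrow> bool" where
  "ghom m h b \<longleftrightarrow> m \<in> Arr C \<and> h \<in> Arr C \<and> b \<in> Arr C \<and> Dom C h = Dom C m \<and> Cod C h = Dom C b"

lemma ghom_span: "ghom m h b \<Longrightarrow> is_span C m (b \<cdot>\<^bsub>C\<^esub> h)"
  unfolding ghom_def is_span_def by simp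

lemma category_LG [simp]: "category LG"
  by (rule category_L_cat[OF ordered_groupoid_G])

lemma LG_Obj [simp]: "m \<in> Arr C \<Longrightarrow> subob C m \<in> Obj LG"
  by (simp add: L_cat_sel)

lemma LG_ObjE:
  assumes "X \<in> Obj LG"
  obtains m where "X = subob C m" "m \<in> Arr C"
  using assms by (auto simp: L_cat_sel elim: G_ObjE)

lemma garr_Arr [simp]: "ghom m h b \<Longrightarrow> garr m h b \<in> Arr LG"
  and Dom_garr [simp]: "ghom m h b \<Longrightarrow> Dom LG (garr m h b) = subob C m"
  and Cod_garr [simp]: "ghom m h b \<Longrightarrow> Cod LG (garr m h b) = subob C b"
proof -
  have "garr m h b \<in> Arr LG \<and> Dom LG (garr m h b) = subob C m \<and> Cod LG (garr m h b) = subob C b" if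
      g: "ghom m h b"
  proof -
    have "ole (G_ogpd C) (subob C (b \<cdot>\<^bsub>C\<^esub> h)) (subob C b)"
      using g unfolding ghom_def by simp
    then show ?thesis
      using ghom_span[OF g] by (simp add: garr_def L_cat_sel)
  qed
  then show "ghom m h b \<Longrightarrow> garr m h b \<in> Arr LG" "ghom m h b \<Longrightarrow> Dom LG (garr m h b) = subob C m"
    "ghom m h b \<Longrightarrow> Cod LG (garr m h b) = subob C b"
    by simp_all
qed

lemma Ide_LG: "m \<in> Arr C \<Longrightarrow> Ide LG (subob C m) = garr m (Ide C (Dom C m)) m"
  by (simp add: garr_def L_cat_sel)

text \<open>In these coordinates composition is that of \<open>C\<close>: restricting the second
  span to the class of \<open>b h\<close> turns its right leg \<open>c k\<close> into
  \<open>c k h\<close>.\<close>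

lemma Cmp_garr [simp]:
  assumes h: "ghom m h b" and k: "ghom b k c"
  shows "garr b k c \<cdot>\<^bsub>LG\<^esub> garr m h b = garr m (k \<cdot>\<^bsub>C\<^esub> h) c"
proof -
  have [simp]: "m \<in> Arr C" "h \<in> Arr C" "b \<in> Arr C" "Dom C h = Dom C m" "Cod C h = Dom C b"
    "k \<in> Arr C" "c \<in> Arr C" "Dom C k = Dom C b" "Cod C k = Dom C c"
    using h k unfolding ghom_def by simp_all
  note s = ghom_span[OF h] ghom_span[OF k]
  have s3: "is_span C (b \<cdot>\<^bsub>C\<^esub> h) (c \<cdot>\<^bsub>C\<^esub> (k \<cdot>\<^bsub>C\<^esub> h))"
    unfolding is_span_def by simp
  have "vpair (spancl C b (c \<cdot>\<^bsub>C\<^esub> k)) (subob C c) \<cdot>\<^bsub>LG\<^esub> vpair (spancl C m (b \<cdot>\<^bsub>C\<^esub> h)) (subob C b) =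
      vpair (spancl C (b \<cdot>\<^bsub>C\<^esub> h) (c \<cdot>\<^bsub>C\<^esub> k \<cdot>\<^bsub>C\<^esub> h) \<cdot>\<^bsub>G_ogpd C\<^esub> spancl C m (b \<cdot>\<^bsub>C\<^esub> h)) (subob C c)"
    using s by (subst L_cat_sel(6)) simp_all
  then show ?thesis
    unfolding garr_def using s s3 by (simp add: Cmp_assoc)
qed

lemma garr_inject: "ghom m h b \<Longrightarrow> ghom m h' b \<Longrightarrow> garr m h b = garr m h' b \<Longrightarrow> h = h'"
  using spancl_inject[OF ghom_span ghom_span, of m h b h' b] cancel'[of b h h']
  unfolding garr_def ghom_def by simp

text \<open>Together with \<open>garr_inject\<close> this identifies the arrows of \<open>LG\<close>
  between the classes of \<open>m\<close> and \<open>b\<close> with the arrows of \<open>C\<close>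
  between the domains of \<open>m\<close> and \<open>b\<close>. Fullness and faithfulness of the
  unit are the case of identities.\<close>

lemma garrE:
  assumes x: "x \<in> Arr LG" and m: "m \<in> Arr C" "Dom LG x = subob C m" and b: "b \<in> Arr C" "Cod LG x =
      subob C b"
  obtains h where "x = garr m h b" "ghom m h b"
proof -
  obtain y B where y: "x = vpair y B" "y \<in> Arr (G_ogpd C)" "ole (G_ogpd C) (Cod (G_ogpd C) y) B"
    using x by (rule L_arrE)
  have e: "B = subob C b" "Dom (G_ogpd C) y = subob C m"
    using m b y by (simp_all add: L_cat_sel)
  obtain n where n: "y = spancl C m n" "is_span C m n"
    using y(2) m(1) e(2) by (rule spancl_DomE)
  have nA: "n \<in> Arr C"
    using n by simp
  obtain h where h: "h \<in> Arr C" "Cod C h = Dom C b" "n = b \<cdot>\<^bsub>C\<^esub> h"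
    using y(3) e n ole_G_iff[OF nA b(1)] by auto
  show thesis
    by (rule that[of h]) (use h n y e m b span_Dom[OF n(2)] in \<open>simp_all add: garr_def ghom_def\<close>)
qed

lemma iso_garr:
  assumes "ghom m h b" "isomorphism C h"
  shows "isomorphism LG (garr m h b)"
proof (rule isoI[OF category_LG])
  have i: "ghom b (inv_arr C h) m"
    using assms unfolding ghom_def by simp
  have *: "m \<in> Arr C" "b \<in> Arr C" "Dom C h = Dom C m" "Cod C h = Dom C b"
    using assms unfolding ghom_def by simp_all
  show "garr m h b \<in> Arr LG" "garr b (inv_arr C h) m \<in> Arr LG"
    "Dom LG (garr b (inv_arr C h) m) = Cod LG (garr m h b)" "Cod LG (garr b (inv_arr C h) m) = Dom
        LG (garr m h b)"
    "garr b (inv_arr C h) m \<cdot>\<^bsub>LG\<^esub> garr m h b = Ide LG (Dom LG (garr m h b))"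
    "garr m h b \<cdot>\<^bsub>LG\<^esub> garr b (inv_arr C h) m = Ide LG (Cod LG (garr m h b))"
    using assms i * by (simp_all add: Ide_LG)
qed

lemma omap_eta [simp]: "A \<in> Obj C \<Longrightarrow> omap (eta_fct C) A = subob C (Ide C A)"
  by (simp add: eta_fct_def)

lemma amap_eta: "f \<in> Arr C \<Longrightarrow> amap (eta_fct C) f = garr (Ide C (Dom C f)) f (Ide C (Cod C f))"
  by (simp add: eta_fct_def garr_def)

lemma ghom_eta [simp]: "f \<in> Arr C \<Longrightarrow> Dom C f = A \<Longrightarrow> Cod C f = B \<Longrightarrow> ghom (Ide C A) f (Ide C B)"
  unfolding ghom_def by auto

lemma small_functor_eta: "small_functor C LG (eta_fct C)"
proof -
  have "is_functor C LG (omap (eta_fct C)) (amap (eta_fct C))"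
  proof (rule functorI, goal_cases)
    case (8 f g)
    have "ghom (Ide C (Dom C f)) f (Ide C (Dom C g))" "ghom (Ide C (Dom C g)) g (Ide C (Cod C g))"
      using 8 by simp_all
    then show ?case
      using 8 by (simp add: amap_eta)
  qed (simp_all add: amap_eta Ide_LG)
  then show ?thesis
    unfolding small_functor_def by (simp add: eta_fct_def)
qed

lemma full_eta: "full_on C LG (omap (eta_fct C)) (amap (eta_fct C))"
  unfolding full_on_def
proof (intro ballI impI, elim conjE)
  fix A B g assume *: "A \<in> Obj C" "B \<in> Obj C" "g \<in> Arr LG" "Dom LG g = omap (eta_fct C) A" "Cod LG g
      = omap (eta_fct C) B"
  obtain h where h: "g = garr (Ide C A) h (Ide C B)" "ghom (Ide C A) h (Ide C B)"
    by (rule garrE[OF *(3), of "Ide C A" "Ide C B"]) (use * in simp_all)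
  then have "h \<in> Arr C" "Dom C h = A" "Cod C h = B"
    using * unfolding ghom_def by simp_all
  then show "\<exists>f\<in>Arr C. Dom C f = A \<and> Cod C f = B \<and> amap (eta_fct C) f = g"
    using h by (intro bexI[of _ h]) (simp_all add: amap_eta)
qed

lemma faithful_eta: "faithful_on C (amap (eta_fct C))"
  unfolding faithful_on_def
proof (intro ballI impI, elim conjE)
  fix f g assume *: "f \<in> Arr C" "g \<in> Arr C" "Dom C f = Dom C g" "Cod C f = Cod C g" "amap (eta_fct
      C) f = amap (eta_fct C) g"
  show "f = g"
    by (rule garr_inject[of "Ide C (Dom C g)" f "Ide C (Cod C g)"]) (use * in \<open>simp_all add:
        amap_eta\<close>)
qed

text \<open>The horizontal span of an identity and \<open>m\<close> joins the maximal subobject of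
  \<open>Dom C m\<close> to the class of \<open>m\<close>, and horizontal arrows are
  invertible.\<close>

lemma ess_surj_eta: "ess_surj C LG (omap (eta_fct C))"
  unfolding ess_surj_def
proof (intro ballI)
  fix X assume "X \<in> Obj LG"
  then obtain m where m: "X = subob C m" "m \<in> Arr C"
    by (rule LG_ObjE)
  have g: "ghom (Ide C (Dom C m)) (Ide C (Dom C m)) m"
    using m unfolding ghom_def by simp
  show "\<exists>A\<in>Obj C. \<exists>e. isomorphism LG e \<and> Dom LG e = omap (eta_fct C) A \<and> Cod LG e = X"
    by (rule bexI[of _ "Dom C m"], rule exI[of _ "garr (Ide C (Dom C m)) (Ide C (Dom C m)) m"])
      (use m g in \<open>simp_all add: iso_garr\<close>)
qed

text \<open>An arrow into the image of \<open>f\<close> has the form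
  \<open>garr m h (Ide C (Dom C f))\<close>, and composing it with that image gives the subobject
  represented by \<open>f h\<close>. Any other representative differs by an isomorphism, so it is
  again in \<open>R\<close>: generation adds nothing.\<close>

lemma vimg_generated_eta:
  assumes R: "sieve C A R"
  shows "gsieve (Ide C A) (vimg (G_ogpd C) (generated_sieve LG (amap (eta_fct C) ` R))) = R"
proof (intro set_eqI iffI)
  have A: "A \<in> Obj C"
    using R by (rule sieve_Obj)
  fix r
  {
    assume "r \<in> gsieve (Ide C A) (vimg (G_ogpd C) (generated_sieve LG (amap (eta_fct C) ` R)))"
    then obtain f g where r: "r \<in> Arr C" "Cod C r = A" and f: "f \<in> R" and g: "g \<in> Arr LG"
      "Cod LG g = Dom LG (amap (eta_fct C) f)"
      and e: "subob C r = Cod (G_ogpd C) (vfst (amap (eta_fct C) f \<cdot>\<^bsub>LG\<^esub> g))"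
      unfolding gsieve_def vimg_def generated_sieve_def using A by auto
    note f' = sieveD[OF R f]
    obtain m where m: "Dom LG g = subob C m" "m \<in> Arr C"
      using Dom_Obj[OF category_LG g(1)] by (rule LG_ObjE)
    obtain h where h: "g = garr m h (Ide C (Dom C f))" "ghom m h (Ide C (Dom C f))"
      by (rule garrE[OF g(1) m(2,1), of "Ide C (Dom C f)"]) (use f'(1) g(2) in \<open>simp_all add:
          amap_eta\<close>)
    have h': "h \<in> Arr C" "Cod C h = Dom C f" "Dom C h = Dom C m"
      using h(2) f'(1) unfolding ghom_def by simp_all
    have "amap (eta_fct C) f \<cdot>\<^bsub>LG\<^esub> g = garr m (f \<cdot>\<^bsub>C\<^esub> h) (Ide C A)"
      using h f'(1,2) by (simp add: amap_eta)
    moreover have "is_span C m (f \<cdot>\<^bsub>C\<^esub> h)"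
      unfolding is_span_def using f'(1) h' m(2) by simp
    ultimately have "subob C (f \<cdot>\<^bsub>C\<^esub> h) = subob C r"
      using e f'(1,2) h'(1,2) by (simp add: garr_def)
    moreover have "f \<cdot>\<^bsub>C\<^esub> h \<in> Arr C"
      using f' h' by simp
    ultimately obtain k where "isomorphism C k" "Cod C k = Dom C (f \<cdot>\<^bsub>C\<^esub> h)" "r = f \<cdot>\<^bsub>C\<^esub> h \<cdot>\<^bsub>C\<^esub> k"
      using subob_eq_iff[of "f \<cdot>\<^bsub>C\<^esub> h" r] r(1) by auto
    then show "r \<in> R"
      using f' h' by (simp add: Cmp_assoc)
  }
  assume r: "r \<in> R"
  note r' = sieveD[OF R r]
  have "amap (eta_fct C) r \<in> generated_sieve LG (amap (eta_fct C) ` R)"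
    by (rule subset_generated_sieve[OF category_LG imageI[OF r]]) (use r' in \<open>simp add: amap_eta\<close>)
  moreover have "is_span C (Ide C (Dom C r)) r"
    unfolding is_span_def using r'(1) by simp
  then have e: "Cod (G_ogpd C) (vfst (amap (eta_fct C) r)) = subob C r"
    using r' by (simp add: amap_eta garr_def)
  ultimately have "Cod (G_ogpd C) (vfst (amap (eta_fct C) r)) \<in> vimg (G_ogpd C) (generated_sieve LG
      (amap (eta_fct C) ` R))"
    unfolding vimg_def by (intro imageI)
  then show "r \<in> gsieve (Ide C A) (vimg (G_ogpd C) (generated_sieve LG (amap (eta_fct C) ` R)))"
    unfolding gsieve_def e using r' A by simp
qed

lemma sieve_generated_eta:
  assumes R: "sieve C A R"
  shows "sieve LG (subob C (Ide C A)) (generated_sieve LG (amap (eta_fct C) ` R))"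
  by (rule sieve_generated_sieve) (use sieveD[OF R] sieve_Obj[OF R] in \<open>auto simp: amap_eta\<close>)

text \<open>The direction from right to left makes the unit preserve covers. The reflection of
  covers in the other direction makes an inverse equivalence of the unit preserve them.\<close>

lemma eta_covers_iff:
  assumes J: "grothendieck_topology C J" and R: "sieve C A R"
  shows "generated_sieve LG (amap (eta_fct C) ` R) \<in> J_of (G_site (C, J)) (subob C (Ide C A)) \<longleftrightarrow> R \<in>
      J A"
  using J_of_iff[of _ "G_site (C, J)"] sieve_generated_eta[OF R] T_of_iff[OF J, of "Ide C A"]
    vsieve_vimg[OF ordered_groupoid_G sieve_generated_eta[OF R]] vimg_generated_eta[OF R]
        sieve_Obj[OF R]
  by simp

end


section \<open>The counit\<close>

text \<open>A span with horizontal parts \<open>h\<close> and \<open>k\<close> goes to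
  \<open>k\<close> after the inverse of \<open>h\<close>, a horizontal arrow between their
  codomains; the vertical parts are forgotten.\<close>

definition eps_fct :: "('u::universe, 'u) ogpd \<Rightarrow> 'u fct" where
  "eps_fct \<G> = \<lparr>
    omap = \<lambda>Y\<in>G_obj (L_cat \<G>). THE B. \<exists>m\<in>Arr (L_cat \<G>). Y = subob (L_cat \<G>) m \<and> B = Cod \<G> (vfst m),
    amap = \<lambda>x\<in>G_arr (L_cat \<G>). THE y. \<exists>m n. is_span (L_cat \<G>) m n \<and> x = spancl (L_cat \<G>) m n \<and>
      y = vfst n \<cdot>\<^bsub>\<G>\<^esub> inv_arr \<G> (vfst m)\<rparr>"

definition max_above :: "('u::universe, 'u) ogpd \<Rightarrow> 'u \<Rightarrow> 'u" where
  "max_above \<G> A = (THE M. ole \<G> A M \<and> (\<forall>N. ole \<G> M N \<longrightarrow> N = M))"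

text \<open>Each object needs an object above it, chosen so that comparable objects get the same
  one; otherwise the order would not be preserved. The maximal object has this property by
  \<open>max_above_eq\<close>.\<close>

definition iota_fct :: "('u::universe, 'u) ogpd \<Rightarrow> 'u fct" where
  "iota_fct \<G> = \<lparr>
    omap = \<lambda>B\<in>Obj \<G>. subob (L_cat \<G>) (vpair (Ide \<G> B) (max_above \<G> B)),
    amap = \<lambda>f\<in>Arr \<G>. spancl (L_cat \<G>) (vpair (Ide \<G> (Dom \<G> f)) (max_above \<G> (Dom \<G> f)))
      (vpair f (max_above \<G> (Cod \<G> f)))\<rparr>"

locale ogpd =
  fixes \<G> :: "('u::universe, 'u) ogpd"
  assumes og [simp]: "ordered_groupoid \<G>"
begin

abbreviation L where "L \<equiv> L_cat \<G>"

sublocale L: lc_category L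
  unfolding lc_category_def using small_category_L_cat[OF og] left_cancellative_L_cat[OF og] by simp

lemmas og_simps [simp] = ordered_groupoidD(1,3,6)[OF og] ole_refl[OF og] restr(1,2)[OF og] oleD(1,2)
  restr_Dom[OF og] restr_Ide[OF og]

lemma ole_Cod_restr' [simp]: "f \<in> Arr \<G> \<Longrightarrow> ole \<G> A (Dom \<G> f) \<Longrightarrow> ole \<G> (Cod \<G> f) B \<Longrightarrow> ole \<G> (Cod \<G>
    (restr \<G> f A)) B"
  using ole_trans[OF og ole_Cod_restr[OF og]] by blast

lemma L_span_iff: "h \<in> Arr \<G> \<Longrightarrow> ole \<G> (Cod \<G> h) B \<Longrightarrow> k \<in> Arr \<G> \<Longrightarrow> ole \<G> (Cod \<G> k) D \<Longrightarrow>
    is_span L (vpair h B) (vpair k D) \<longleftrightarrow> Dom \<G> h = Dom \<G> k"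
  unfolding is_span_def by (simp add: L_cat_sel)

lemma L_spanE:
  assumes "is_span L m n"
  obtains h B k D where "m = vpair h B" "n = vpair k D" "h \<in> Arr \<G>" "k \<in> Arr \<G>" "ole \<G> (Cod \<G> h) B"
    "ole \<G> (Cod \<G> k) D" "Dom \<G> k = Dom \<G> h"
proof -
  obtain h B where h: "m = vpair h B" "h \<in> Arr \<G>" "ole \<G> (Cod \<G> h) B"
    using L.span_Arr(1)[OF assms] by (rule L_arrE)
  obtain k D where k: "n = vpair k D" "k \<in> Arr \<G>" "ole \<G> (Cod \<G> k) D"
    using L.span_Arr(2)[OF assms] by (rule L_arrE)
  show thesis
    by (rule that[OF h(1) k(1) h(2) k(2) h(3) k(3)]) (use assms h k L_span_iff in simp)
qed

lemma L_iso_Cmp: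
  assumes k: "isomorphism L k" and h: "h \<in> Arr \<G>" "ole \<G> (Cod \<G> h) B" and c: "Cod L k = Dom \<G> h"
  obtains l where "l \<in> Arr \<G>" "k = vpair l (Cod \<G> l)" "Cod \<G> l = Dom \<G> h"
    "vpair h B \<cdot>\<^bsub>L\<^esub> k = vpair (h \<cdot>\<^bsub>\<G>\<^esub> l) B"
proof -
  obtain l where l: "l \<in> Arr \<G>" "k = vpair l (Cod \<G> l)"
    using k isomorphism_L_cat_iff[OF og] by auto
  have "Cod \<G> l = Dom \<G> h"
    using c l by (simp add: L_cat_sel)
  then show thesis
    using that[of l] l h by (simp add: L_cat_sel)
qed

lemma omap_eps:
  assumes h: "h \<in> Arr \<G>" "ole \<G> (Cod \<G> h) B"
  shows "omap (eps_fct \<G>) (subob L (vpair h B)) = Cod \<G> h"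
proof -
  have m: "vpair h B \<in> Arr L"
    using h by (simp add: L_cat_sel)
  have "(THE B'. \<exists>m\<in>Arr L. subob L (vpair h B) = subob L m \<and> B' = Cod \<G> (vfst m)) = Cod \<G> h"
  proof (rule the_equality)
    fix B' assume "\<exists>m\<in>Arr L. subob L (vpair h B) = subob L m \<and> B' = Cod \<G> (vfst m)"
    then obtain m' where m': "m' \<in> Arr L" "subob L (vpair h B) = subob L m'" "B' = Cod \<G> (vfst m')"
      by blast
    obtain k where k: "isomorphism L k" "Cod L k = Dom L (vpair h B)" "m' = vpair h B \<cdot>\<^bsub>L\<^esub> k"
      using m m'(1,2) by (rule L.subob_eqE)
    have "Cod L k = Dom \<G> h"
      using k h by (simp add: L_cat_sel)
    with k(1) h obtain l where "l \<in> Arr \<G>" "Cod \<G> l = Dom \<G> h" "vpair h B \<cdot>\<^bsub>L\<^esub> k = vpair (h \<cdot>\<^bsub>\<G>\<^esub> l) B"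
      by (rule L_iso_Cmp)
    then show "B' = Cod \<G> h"
      using m'(3) k(3) h by simp
  qed (use m in \<open>auto intro!: bexI[of _ "vpair h B"]\<close>)
  then show ?thesis
    using L.subob_Obj[OF m] by (simp add: eps_fct_def L.G_ogpd_Obj)
qed

text \<open>An isomorphism of apexes is a horizontal \<open>l\<close>. It replaces \<open>h\<close>
  and \<open>k\<close> by \<open>h l\<close> and \<open>k l\<close>, and cancels in the composite of
  one with the inverse of the other.\<close>

lemma amap_eps:
  assumes h: "h \<in> Arr \<G>" "ole \<G> (Cod \<G> h) B" and k: "k \<in> Arr \<G>" "ole \<G> (Cod \<G> k) D" and e: "Dom \<G> k
      = Dom \<G> h"
  shows "amap (eps_fct \<G>) (spancl L (vpair h B) (vpair k D)) = k \<cdot>\<^bsub>\<G>\<^esub> inv_arr \<G> h"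
proof -
  have s: "is_span L (vpair h B) (vpair k D)"
    using h k e by (simp add: L_span_iff)
  have "(THE y. \<exists>m n. is_span L m n \<and> spancl L (vpair h B) (vpair k D) = spancl L m n \<and>
      y = vfst n \<cdot>\<^bsub>\<G>\<^esub> inv_arr \<G> (vfst m)) = k \<cdot>\<^bsub>\<G>\<^esub> inv_arr \<G> h"
  proof (rule the_equality)
    show "\<exists>m n. is_span L m n \<and> spancl L (vpair h B) (vpair k D) = spancl L m n \<and>
      k \<cdot>\<^bsub>\<G>\<^esub> inv_arr \<G> h = vfst n \<cdot>\<^bsub>\<G>\<^esub> inv_arr \<G> (vfst m)"
      using s by (intro exI[of _ "vpair h B"] exI[of _ "vpair k D"]) simp
    fix y assume "\<exists>m n. is_span L m n \<and> spancl L (vpair h B) (vpair k D) = spancl L m n \<and>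
      y = vfst n \<cdot>\<^bsub>\<G>\<^esub> inv_arr \<G> (vfst m)"
    then obtain m n where m: "is_span L m n" "spancl L (vpair h B) (vpair k D) = spancl L m n"
      "y = vfst n \<cdot>\<^bsub>\<G>\<^esub> inv_arr \<G> (vfst m)"
      by blast
    obtain i where i: "isomorphism L i" "Cod L i = Dom L (vpair h B)" "m = vpair h B \<cdot>\<^bsub>L\<^esub> i" "n =
        vpair k D \<cdot>\<^bsub>L\<^esub> i"
      using s m(1,2) by (rule L.spancl_eqE)
    have c: "Cod L i = Dom \<G> h"
      using i h by (simp add: L_cat_sel)
    with i(1) h obtain l where l: "l \<in> Arr \<G>" "i = vpair l (Cod \<G> l)" "Cod \<G> l = Dom \<G> h" "vpair h B
        \<cdot>\<^bsub>L\<^esub> i = vpair (h \<cdot>\<^bsub>\<G>\<^esub> l) B"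
      by (rule L_iso_Cmp)
    have n: "n = vpair (k \<cdot>\<^bsub>\<G>\<^esub> l) D"
      using i(4) l h k e by (simp add: L_cat_sel)
    have "inv_arr \<G> (h \<cdot>\<^bsub>\<G>\<^esub> l) = inv_arr \<G> l \<cdot>\<^bsub>\<G>\<^esub> inv_arr \<G> h"
      using l h by (intro inv_arr_eqI is_inverse_Cmp) simp_all
    then show "y = k \<cdot>\<^bsub>\<G>\<^esub> inv_arr \<G> h"
      using m(3) n i(3) l h k e by (simp add: Cmp_assoc)
  qed
  then show ?thesis
    using L.spancl_Arr[OF s] by (simp add: eps_fct_def L.G_ogpd_Arr)
qed

lemma double_functor_eps: "double_functor (G_ogpd L) \<G> (eps_fct \<G>)"
proof -
  note [simp] = omap_eps amap_eps
  have "is_functor (G_ogpd L) \<G> (omap (eps_fct \<G>)) (amap (eps_fct \<G>))"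
  proof (rule functorI, goal_cases)
    case (3 X)
    then show ?case by (elim L.G_ObjE L_arrE) simp
  next
    case (4 X)
    then show ?case by (elim L.G_ObjE) (auto elim!: L_arrE)
  next
    case (5 x)
    then show ?case by (elim L.G_ArrE L_spanE) simp
  next
    case (6 x)
    then show ?case by (elim L.G_ArrE) (auto elim!: L_spanE simp: L_span_iff)
  next
    case (7 x)
    then show ?case by (elim L.G_ArrE) (auto elim!: L_spanE simp: L_span_iff)
  next
    case (8 x y)
    obtain k m where x: "x = spancl L k m" "is_span L k m" using 8(1) by (rule L.G_ArrE)
    obtain n where y: "y = spancl L m n" "is_span L m n"
      by (rule L.spancl_DomE[OF 8(2), of m]) (use 8 x in simp_all)
    obtain h B i D where 1: "k = vpair h B" "m = vpair i D" "h \<in> Arr \<G>" "i \<in> Arr \<G>" "ole \<G> (Cod \<G> h)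
        B"
      "ole \<G> (Cod \<G> i) D" "Dom \<G> i = Dom \<G> h"
      using x(2) by (rule L_spanE)
    obtain j E where 2: "n = vpair j E" "j \<in> Arr \<G>" "ole \<G> (Cod \<G> j) E" "Dom \<G> j = Dom \<G> i"
      using y(2) 1 by (auto elim!: L_spanE)
    show ?case
      using x y 1 2 L.span_trans[OF x(2) y(2)] by (simp add: Cmp_assoc)
  qed simp_all
  moreover have "(amap (eps_fct \<G>) a, amap (eps_fct \<G>) b) \<in> Le \<G>" if "(a, b) \<in> Le (G_ogpd L)" for a
      b
    using that
  proof (rule L.Le_GE)
    fix m n x assume b: "b = spancl L m n" "is_span L m n" and x: "x \<in> Arr L" "Cod L x = Dom L m"
      and a: "a = spancl L (m \<cdot>\<^bsub>L\<^esub> x) (n \<cdot>\<^bsub>L\<^esub> x)" "is_span L (m \<cdot>\<^bsub>L\<^esub> x) (n \<cdot>\<^bsub>L\<^esub> x)"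
    obtain h B k D where 1: "m = vpair h B" "n = vpair k D" "h \<in> Arr \<G>" "k \<in> Arr \<G>" "ole \<G> (Cod \<G> h)
        B"
      "ole \<G> (Cod \<G> k) D" "Dom \<G> k = Dom \<G> h"
      using b(2) by (rule L_spanE)
    obtain l where l: "x = vpair l (Dom \<G> h)" "l \<in> Arr \<G>" "ole \<G> (Cod \<G> l) (Dom \<G> h)"
      using x 1 by (auto elim!: L_arrE simp: L_cat_sel)
    \<comment> \<open>A common factor \<open>x\<close> with horizontal part \<open>l\<close>
      restricts both legs to the codomain of \<open>l\<close> and precomposes them with
      \<open>l\<close>, which cancels in the value of the counit.\<close>
    let ?h = "restr \<G> h (Cod \<G> l)" and ?k = "restr \<G> k (Cod \<G> l)"
    have c: "m \<cdot>\<^bsub>L\<^esub> x = vpair (?h \<cdot>\<^bsub>\<G>\<^esub> l) B" "n \<cdot>\<^bsub>L\<^esub> x = vpair (?k \<cdot>\<^bsub>\<G>\<^esub> l) D"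
      using 1 l by (simp_all add: L_cat_sel)
    have "inv_arr \<G> (?h \<cdot>\<^bsub>\<G>\<^esub> l) = inv_arr \<G> l \<cdot>\<^bsub>\<G>\<^esub> inv_arr \<G> ?h"
      using 1 l by (intro inv_arr_eqI is_inverse_Cmp) simp_all
    then have "amap (eps_fct \<G>) a = ?k \<cdot>\<^bsub>\<G>\<^esub> inv_arr \<G> ?h"
      using a c 1 l by (simp add: Cmp_assoc)
    moreover have "(?k \<cdot>\<^bsub>\<G>\<^esub> inv_arr \<G> ?h, k \<cdot>\<^bsub>\<G>\<^esub> inv_arr \<G> h) \<in> Le \<G>"
      using 1 l by (intro ordered_groupoidD(8)[OF og] ordered_groupoidD(7)[OF og] restr(3)[OF og])
          simp_all
    ultimately show "(amap (eps_fct \<G>) a, amap (eps_fct \<G>) b) \<in> Le \<G>"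
      using b 1 by simp
  qed
  ultimately show ?thesis
    unfolding double_functor_def small_functor_def by (simp add: eps_fct_def L.G_ogpd_Obj
        L.G_ogpd_Arr)
qed

text \<open>The unit sends an arrow with horizontal part \<open>h\<close> to a span with horizontal
  parts an identity and \<open>h\<close>, from which the counit recovers \<open>h\<close>. The
  identity is strict and holds for every ordered groupoid; it is a triangle identity and also the
  input of \<open>retraction_ff\<close>.\<close>

lemma L_eps_eta: "fct_comp L (L_fct (G_ogpd L) (eps_fct \<G>)) (eta_fct L) = fct_id L"
proof (rule small_functor_eqI[OF small_functor_comp[OF L.small_functor_eta
        small_functor_L_fct[OF L.ordered_groupoid_G og double_functor_eps]] small_functor_id[OF
            L.cat]])
  fix A assume "A \<in> Obj L"
  then have A: "A \<in> Obj \<G>" by (simp add: L_cat_sel)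
  then show "omap (fct_comp L (L_fct (G_ogpd L) (eps_fct \<G>)) (eta_fct L)) A = omap (fct_id L) A"
    using L.subob_Obj[of "vpair (Ide \<G> A) A"] by (simp add: L_cat_sel omap_eps)
next
  fix x assume x: "x \<in> Arr L"
  then obtain h B where h: "x = vpair h B" "h \<in> Arr \<G>" "ole \<G> (Cod \<G> h) B"
    by (rule L_arrE)
  have B: "B \<in> Obj \<G>" using h by simp
  have s: "is_span L (vpair (Ide \<G> (Dom \<G> h)) (Dom \<G> h)) (vpair h B)"
    using h by (simp add: L_span_iff)
  have bA: "vpair (Ide \<G> B) B \<in> Arr L" "vpair h B \<in> Arr L"
    using B h by (simp_all add: L_cat_sel)
  have "ole (G_ogpd L) (subob L (vpair h B)) (subob L (vpair (Ide \<G> B) B))"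
    using L.ole_G_max[OF bA(2)] h B by (simp add: L_cat_sel)
  then show "amap (fct_comp L (L_fct (G_ogpd L) (eps_fct \<G>)) (eta_fct L)) x = amap (fct_id L) x"
    using h s B L.amap_eta[OF x] by (simp add: L.garr_def L_cat_sel omap_eps amap_eps eta_fct_def)
qed

end

section \<open>Inverting the counit in the presence of maximal objects\<close>

locale max_ogpd = ogpd +
  assumes max: "has_unique_maximal \<G>"
begin

lemma max_above:
  assumes "A \<in> Obj \<G>"
  shows "ole \<G> A (max_above \<G> A)" "ole \<G> (max_above \<G> A) N \<Longrightarrow> N = max_above \<G> A"
proof -
  have "\<exists>!M. ole \<G> A M \<and> (\<forall>N. ole \<G> M N \<longrightarrow> N = M)"
    using max assms unfolding has_unique_maximal_def by blast
  from theI'[OF this] show "ole \<G> A (max_above \<G> A)" "ole \<G> (max_above \<G> A) N \<Longrightarrow> N = max_above \<G> A"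
    unfolding max_above_def by blast+
qed

lemma max_above_eq:
  assumes AB: "ole \<G> A B"
  shows "max_above \<G> A = max_above \<G> B"
proof -
  have A: "A \<in> Obj \<G>" and B: "B \<in> Obj \<G>"
    using oleD(1,2)[OF AB] by simp_all
  have "\<exists>!M. ole \<G> A M \<and> (\<forall>N. ole \<G> M N \<longrightarrow> N = M)"
    using max A unfolding has_unique_maximal_def by simp
  moreover have "ole \<G> A (max_above \<G> B) \<and> (\<forall>N. ole \<G> (max_above \<G> B) N \<longrightarrow> N = max_above \<G> B)"
    using ole_trans[OF og AB max_above(1)[OF B]] max_above(2)[OF B] by simp
  ultimately show ?thesis
    unfolding max_above_def[of \<G> A] by (rule the1_equality)
qed

lemmas max_simps [simp] = max_above(1)

lemma omap_iota [simp]: "B \<in> Obj \<G> \<Longrightarrow> omap (iota_fct \<G>) B = subob L (vpair (Ide \<G> B) (max_above \<G>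
    B))"
  and amap_iota [simp]: "f \<in> Arr \<G> \<Longrightarrow> amap (iota_fct \<G>) f =
    spancl L (vpair (Ide \<G> (Dom \<G> f)) (max_above \<G> (Dom \<G> f))) (vpair f (max_above \<G> (Cod \<G> f)))"
  by (simp_all add: iota_fct_def)

text \<open>The arrow with horizontal part \<open>h\<close> and trivial vertical part is invertible
  in \<open>L\<close>, so each subobject has a purely vertical representative.\<close>

lemma subob_iota: "h \<in> Arr \<G> \<Longrightarrow> ole \<G> (Cod \<G> h) B \<Longrightarrow> subob L (vpair h B) = subob L (vpair (Ide \<G> (Cod
    \<G> h)) B)"
  using L.subob_Cmp_iso[of "vpair (Ide \<G> (Cod \<G> h)) B" "vpair h (Cod \<G> h)"] isomorphism_L_cat_iff[OF
      og]
  by (simp add: L_cat_sel)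

lemma double_functor_iota: "double_functor \<G> (G_ogpd L) (iota_fct \<G>)"
proof -
  have s [simp]: "is_span L (vpair (Ide \<G> (Dom \<G> f)) (max_above \<G> (Dom \<G> f))) (vpair f (max_above \<G>
      (Cod \<G> f)))"
    if "f \<in> Arr \<G>" for f
    using that by (simp add: L_span_iff)
  have "is_functor \<G> (G_ogpd L) (omap (iota_fct \<G>)) (amap (iota_fct \<G>))"
  proof (rule functorI, goal_cases)
    case (3 A)
    then show ?case by (simp add: L_cat_sel)
  next
    case (4 A)
    then show ?case by (simp add: L_cat_sel)
  next
    case (7 f)
    then show ?case by (simp add: subob_iota[of f])
  next
    case (8 f g)
    let ?M = "max_above \<G>"
    have i: "isomorphism L (vpair f (Cod \<G> f))"
      using 8 isomorphism_L_cat_iff[OF og] by auto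
    \<comment> \<open>The span for \<open>g\<close> is reparametrised along the isomorphism given by
      \<open>f\<close>, so that its left leg becomes the right leg of the span for
      \<open>f\<close>.\<close>
    have "spancl L (vpair (Ide \<G> (Dom \<G> g)) (?M (Dom \<G> g))) (vpair g (?M (Cod \<G> g))) =
        spancl L (vpair (Ide \<G> (Dom \<G> g)) (?M (Dom \<G> g)) \<cdot>\<^bsub>L\<^esub> vpair f (Cod \<G> f)) (vpair g (?M (Cod \<G>
            g)) \<cdot>\<^bsub>L\<^esub> vpair f (Cod \<G> f))"
      using L.spancl_Cmp_iso[OF s[OF 8(2)] i] 8 by (simp add: L_cat_sel)
    also have "\<dots> = spancl L (vpair f (?M (Cod \<G> f))) (vpair (g \<cdot>\<^bsub>\<G>\<^esub> f) (?M (Cod \<G> g)))"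
      using 8 by (simp add: L_cat_sel)
    finally show ?case
      using 8 by (simp add: L_span_iff)
  qed simp_all
  moreover have "(amap (iota_fct \<G>) f, amap (iota_fct \<G>) g) \<in> Le (G_ogpd L)" if fg: "(f, g) \<in> Le \<G>"
      for f g
  proof -
    have a: "f \<in> Arr \<G>" "g \<in> Arr \<G>"
      using ordered_groupoidD(4,5)[OF og fg] by simp_all
    have le: "ole \<G> (Dom \<G> f) (Dom \<G> g)" "ole \<G> (Cod \<G> f) (Cod \<G> g)"
      using le_Dom[OF og fg] le_Cod[OF og fg] by simp_all
    have r: "restr \<G> g (Dom \<G> f) = f"
      by (rule restr_eqI[OF og fg refl])
    \<comment> \<open>The vertical arrow from \<open>Dom \<G> f\<close> to
      \<open>Dom \<G> g\<close>. It is a common factor of both legs because the maximal objects for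
      \<open>f\<close> and \<open>g\<close> coincide.\<close>
    let ?x = "vpair (Ide \<G> (Dom \<G> f)) (Dom \<G> g)"
    show ?thesis
      unfolding amap_iota[OF a(1)] amap_iota[OF a(2)] L.Le_G_iff[OF s[OF a(1)] s[OF a(2)]]
      by (rule bexI[of _ ?x]) (use a le r max_above_eq[OF le(1)] max_above_eq[OF le(2)] in \<open>simp_all
          add: L_cat_sel\<close>)
  qed
  ultimately show ?thesis
    unfolding double_functor_def small_functor_def by (simp add: iota_fct_def)
qed

lemma eps_iota: "fct_comp \<G> (eps_fct \<G>) (iota_fct \<G>) = fct_id \<G>"
  by (rule small_functor_eqI[OF double_functorD(1)[OF double_functor_comp[OF og double_functor_iota
      double_functor_eps]]
      double_functorD(1)[OF double_functor_id[OF og]]]) (simp_all add: omap_eps amap_eps)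

end


section \<open>Covering flatness and the category of an ordered groupoid\<close>

text \<open>A cone over \<open>D'\<close> composed with \<open>E\<close> extends to one over
  \<open>D'\<close>: the leg at \<open>X\<close> is the leg at some \<open>a X\<close> moved along
  \<open>e X\<close>. Cones over \<open>D'\<close> in \<open>fst X\<close> restrict along
  \<open>E\<close>, so the flat sieve for \<open>D'\<close> is contained in that for the
  composite.\<close>

lemma flat_at_full_ess_surj:
  assumes E: "small_functor I I' E" and full: "full_on I I' (omap E) (amap E)" and es: "ess_surj I
      I' (omap E)"
    and D': "small_functor I' (fst X) D'" and F: "small_functor (fst X) (fst Y) F"
    and J: "grothendieck_topology (fst Y) (snd Y)" and f: "flat_at I' X Y F D'"
  shows "flat_at I X Y F (fct_comp I D' E)"
  unfolding flat_at_def
proof (intro allI impI)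
  let ?D = "fct_comp I D' E"
  note [simp] = small_functorD[OF E] small_functorD[OF D'] small_functorD[OF F]
  have D: "small_functor I (fst X) ?D"
    using E D' by (rule small_functor_comp)
  fix U \<tau> assume \<tau>: "cone I (fst Y) (fct_comp I F ?D) U \<tau>"
  have [simp]: "U \<in> Obj (fst Y)" "i \<in> Obj I \<Longrightarrow> \<tau> i \<in> Arr (fst Y)" "i \<in> Obj I \<Longrightarrow> Dom (fst Y) (\<tau> i) = U"
    "i \<in> Obj I \<Longrightarrow> Cod (fst Y) (\<tau> i) = omap F (omap D' (omap E i))" for i
    using coneD(1-4)[OF \<tau>] by simp_all
  have n: "amap F (amap D' (amap E u)) \<cdot>\<^bsub>fst Y\<^esub> \<tau> (Dom I u) = \<tau> (Cod I u)" if "u \<in> Arr I" for u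
    using coneD(5)[OF \<tau> that] that by simp
  have "\<forall>X. \<exists>i e. X \<in> Obj I' \<longrightarrow> i \<in> Obj I \<and> isomorphism I' e \<and> Dom I' e = omap E i \<and> Cod I' e = X"
    using es unfolding ess_surj_def by blast
  then obtain a e where ae: "\<And>X. X \<in> Obj I' \<Longrightarrow> a X \<in> Obj I \<and> isomorphism I' (e X) \<and>
      Dom I' (e X) = omap E (a X) \<and> Cod I' (e X) = X"
    by metis
  then have [simp]: "a X \<in> Obj I" "isomorphism I' (e X)" "Dom I' (e X) = omap E (a X)" "Cod I' (e X)
      = X"
    if "X \<in> Obj I'" for X
    using that by simp_all
  define \<tau>' where "\<tau>' X = amap F (amap D' (e X)) \<cdot>\<^bsub>fst Y\<^esub> \<tau> (a X)" for X
  \<comment> \<open>The extended leg does not depend on the choice of \<open>a\<close> and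
    \<open>e\<close>: by fullness, any arrow from an object of the image of \<open>E\<close> is
    \<open>e\<close> after an arrow of the image, for which the given cone is compatible.\<close>
  have n': "amap F (amap D' f) \<cdot>\<^bsub>fst Y\<^esub> \<tau> i = \<tau>' (Cod I' f)"
    if f: "f \<in> Arr I'" "i \<in> Obj I" "Dom I' f = omap E i" for f i
  proof -
    obtain u where u: "u \<in> Arr I" "Dom I u = i" "Cod I u = a (Cod I' f)" "amap E u = inv_arr I' (e
        (Cod I' f)) \<cdot>\<^bsub>I'\<^esub> f"
      by (rule fullE[OF full, of i "a (Cod I' f)" "inv_arr I' (e (Cod I' f)) \<cdot>\<^bsub>I'\<^esub> f"]) (use f in
          simp_all)
    have "f = e (Cod I' f) \<cdot>\<^bsub>I'\<^esub> amap E u"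
      using u f by simp
    then have "amap F (amap D' f) = amap F (amap D' (e (Cod I' f) \<cdot>\<^bsub>I'\<^esub> amap E u))"
      by simp
    also have "\<dots> = amap F (amap D' (e (Cod I' f))) \<cdot>\<^bsub>fst Y\<^esub> amap F (amap D' (amap E u))"
      using u(1-3) f by simp
    finally have "amap F (amap D' f) = amap F (amap D' (e (Cod I' f))) \<cdot>\<^bsub>fst Y\<^esub> amap F (amap D' (amap
        E u))" .
    then show ?thesis
      unfolding \<tau>'_def using n[OF u(1)] u(1-3) f by (simp add: Cmp_assoc)
  qed
  have c': "cone I' (fst Y) (fct_comp I' F D') U \<tau>'"
  proof (rule coneI)
    fix f assume f: "f \<in> Arr I'"
    have "amap F (amap D' f) \<cdot>\<^bsub>fst Y\<^esub> \<tau>' (Dom I' f) =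
        amap F (amap D' (f \<cdot>\<^bsub>I'\<^esub> e (Dom I' f))) \<cdot>\<^bsub>fst Y\<^esub> \<tau> (a (Dom I' f))"
      unfolding \<tau>'_def using f by (simp add: Cmp_assoc)
    also have "\<dots> = \<tau>' (Cod I' f)"
      using f n'[of "f \<cdot>\<^bsub>I'\<^esub> e (Dom I' f)" "a (Dom I' f)"] by (simp del: small_functorD(11)[OF D'])
    finally show "amap (fct_comp I' F D') f \<cdot>\<^bsub>fst Y\<^esub> \<tau>' (Dom I' f) = \<tau>' (Cod I' f)"
      using f by simp
  qed (simp_all add: \<tau>'_def)
  have \<tau>'E: "\<tau>' (omap E i) = \<tau> i" if i: "i \<in> Obj I" for i
    using n'[of "Ide I' (omap E i)" i] i by simp
  have Z': "flat_sieve I' (fst X) (fst Y) F D' U \<tau>' \<in> snd Y U"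
    using f c' unfolding flat_at_def by blast
  show "flat_sieve I (fst X) (fst Y) F ?D U \<tau> \<in> snd Y U"
  proof (rule topology_superset[OF _ J Z' sieve_flat_sieve[OF F D \<tau>]])
    show "flat_sieve I' (fst X) (fst Y) F D' U \<tau>' \<subseteq> flat_sieve I (fst X) (fst Y) F ?D U \<tau>"
    proof
      fix h assume "h \<in> flat_sieve I' (fst X) (fst Y) F D' U \<tau>'"
      then obtain W \<sigma> g where *: "h \<in> Arr (fst Y)" "Cod (fst Y) h = U" and \<sigma>: "cone I' (fst X) D' W
          \<sigma>"
        and g: "g \<in> Arr (fst Y)" "Dom (fst Y) g = Dom (fst Y) h" "Cod (fst Y) g = omap F W"
        and eq: "\<And>i. i \<in> Obj I' \<Longrightarrow> \<tau>' i \<cdot>\<^bsub>fst Y\<^esub> h = amap F (\<sigma> i) \<cdot>\<^bsub>fst Y\<^esub> g"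
        by (rule flat_sieveE) blast
      show "h \<in> flat_sieve I (fst X) (fst Y) F ?D U \<tau>"
      proof (rule flat_sieveI[OF *])
        show "cone I (fst X) ?D W (\<lambda>i. \<sigma> (omap E i))"
        proof (rule coneI)
          fix u assume u: "u \<in> Arr I"
          then show "amap ?D u \<cdot>\<^bsub>fst X\<^esub> \<sigma> (omap E (Dom I u)) = \<sigma> (omap E (Cod I u))"
            using coneD(5)[OF \<sigma>, of "amap E u"] by simp
        qed (use coneD(1-4)[OF \<sigma>] in simp_all)
        fix i assume "i \<in> Obj I"
        then show "\<tau> i \<cdot>\<^bsub>fst Y\<^esub> h = amap F (\<sigma> (omap E i)) \<cdot>\<^bsub>fst Y\<^esub> g"
          using eq[of "omap E i"] \<tau>'E by simp
      qed (use g in simp_all)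
    qed
  qed simp
qed

text \<open>The category through which a functor \<open>D\<close> factors as a quotient functor, bijective on objects,
  followed by a faithful one; it is left-cancellative when the target of \<open>D\<close> is.\<close>

definition quot_arr :: "('u::universe, 'u, 'x) cat_scheme \<Rightarrow> 'u fct \<Rightarrow> 'u \<Rightarrow> 'u" where
  "quot_arr I D u = vpair (vpair (Dom I u) (Cod I u)) (amap D u)"

definition quot_cat :: "('u::universe, 'u, 'x) cat_scheme \<Rightarrow> ('u, 'u, 'y) cat_scheme \<Rightarrow> 'u fct \<Rightarrow> ('u,
    'u) cat" where
  "quot_cat I C D = \<lparr>Obj = Obj I, Arr = quot_arr I D ` Arr I,
     Dom = \<lambda>x\<in>quot_arr I D ` Arr I. vfst (vfst x),
     Cod = \<lambda>x\<in>quot_arr I D ` Arr I. vsnd (vfst x),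
     Ide = \<lambda>i\<in>Obj I. quot_arr I D (Ide I i),
     Cmp = \<lambda>y x. if x \<in> quot_arr I D ` Arr I \<and> y \<in> quot_arr I D ` Arr I \<and> vsnd (vfst x) = vfst (vfst
         y)
       then vpair (vpair (vfst (vfst x)) (vsnd (vfst y))) (vsnd y \<cdot>\<^bsub>C\<^esub> vsnd x) else undefined\<rparr>"

context
  fixes I :: "('u::universe, 'u) cat" and C :: "('u, 'u) cat" and D :: "'u fct"
  assumes D: "small_functor I C D"
begin

lemma quot_sel:
  "Obj (quot_cat I C D) = Obj I" "Arr (quot_cat I C D) = quot_arr I D ` Arr I"
  "u \<in> Arr I \<Longrightarrow> Dom (quot_cat I C D) (quot_arr I D u) = Dom I u"
  "u \<in> Arr I \<Longrightarrow> Cod (quot_cat I C D) (quot_arr I D u) = Cod I u"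
  "i \<in> Obj I \<Longrightarrow> Ide (quot_cat I C D) i = quot_arr I D (Ide I i)"
  "u \<in> Arr I \<Longrightarrow> v \<in> Arr I \<Longrightarrow> Cod I u = Dom I v \<Longrightarrow>
    quot_arr I D v \<cdot>\<^bsub>quot_cat I C D\<^esub> quot_arr I D u = quot_arr I D (v \<cdot>\<^bsub>I\<^esub> u)"
  "vsnd (quot_arr I D u) = amap D u"
  "quot_arr I D u = quot_arr I D v \<longleftrightarrow> Dom I u = Dom I v \<and> Cod I u = Cod I v \<and> amap D u = amap D v"
proof -
  note [simp] = small_functorD(1,6-11)[OF D]
  have [simp]: "vfst (vfst (quot_arr I D u)) = Dom I u" "vsnd (vfst (quot_arr I D u)) = Cod I u" for
      u
    by (simp_all add: quot_arr_def)
  show v [simp]: "vsnd (quot_arr I D u) = amap D u" for u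
    by (simp add: quot_arr_def)
  show "Obj (quot_cat I C D) = Obj I" "Arr (quot_cat I C D) = quot_arr I D ` Arr I"
    "u \<in> Arr I \<Longrightarrow> Dom (quot_cat I C D) (quot_arr I D u) = Dom I u"
    "u \<in> Arr I \<Longrightarrow> Cod (quot_cat I C D) (quot_arr I D u) = Cod I u"
    "i \<in> Obj I \<Longrightarrow> Ide (quot_cat I C D) i = quot_arr I D (Ide I i)"
    by (simp_all add: quot_cat_def)
  have c: "quot_arr I D (v \<cdot>\<^bsub>I\<^esub> u) = vpair (vpair (Dom I u) (Cod I v)) (amap D v \<cdot>\<^bsub>C\<^esub> amap D u)"
    if "u \<in> Arr I" "v \<in> Arr I" "Cod I u = Dom I v"
    using that by (simp add: quot_arr_def)
  show "u \<in> Arr I \<Longrightarrow> v \<in> Arr I \<Longrightarrow> Cod I u = Dom I v \<Longrightarrow>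
    quot_arr I D v \<cdot>\<^bsub>quot_cat I C D\<^esub> quot_arr I D u = quot_arr I D (v \<cdot>\<^bsub>I\<^esub> u)"
    by (simp add: c) (simp add: quot_cat_def)
  show "quot_arr I D u = quot_arr I D v \<longleftrightarrow> Dom I u = Dom I v \<and> Cod I u = Cod I v \<and> amap D u = amap D
      v"
    by (auto simp: quot_arr_def)
qed

text \<open>By construction parallel arrows of the quotient are equal when their second components
  are, so the laws are reflected from \<open>C\<close>.\<close>

lemma is_functor_quot: "is_functor (quot_cat I C D) C (omap D) vsnd"
proof (rule category_reflect[OF small_functorD(2)[OF D]], goal_cases)
  case (4 f g)
  then obtain u v where u: "u \<in> Arr I" "f = quot_arr I D u" and v: "v \<in> Arr I" "g = quot_arr I D v"
    by (auto simp: quot_sel(2))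
  have "Cod I u = Dom I v"
    using 4 u v by (simp add: quot_sel)
  then show ?case
    using u v small_functorD[OF D] by (auto simp: quot_sel intro!: image_eqI[of _ _ "v \<cdot>\<^bsub>I\<^esub> u"])
qed (use small_functorD[OF D] in \<open>auto simp: quot_sel\<close>)

text \<open>Cancelling in \<open>C\<close> makes the images of two parallel arrows equal, and for
  parallel arrows this is equality in the quotient.\<close>

lemma lc_category_quot:
  assumes I: "small_category I" and C: "left_cancellative C"
  shows "lc_category (quot_cat I C D)"
proof -
  note [simp] = small_functorD[OF D]
  have "small (quot_arr I D ` Arr I)" "small (Obj I)"
    using I small_image unfolding small_category_def by auto
  moreover have "y \<cdot>\<^bsub>quot_cat I C D\<^esub> x = undefined"
    if n: "\<not> (x \<in> Arr (quot_cat I C D) \<and> y \<in> Arr (quot_cat I C D) \<and> Cod (quot_cat I C D) x = Dom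
        (quot_cat I C D) y)" for x y
    using n by (auto simp: quot_cat_def)
  ultimately have "small_category (quot_cat I C D)"
    unfolding small_category_def using functorD(1)[OF is_functor_quot] by (simp add: quot_sel(1,2))
        (simp add: quot_cat_def)
  moreover have "left_cancellative (quot_cat I C D)"
    unfolding left_cancellative_def monomorphism_def
  proof (intro ballI conjI impI, assumption, elim conjE)
    fix m x y assume *: "m \<in> Arr (quot_cat I C D)" "x \<in> Arr (quot_cat I C D)" "y \<in> Arr (quot_cat I C
        D)"
      "Cod (quot_cat I C D) x = Dom (quot_cat I C D) m" "Cod (quot_cat I C D) y = Dom (quot_cat I C
          D) m"
      "Dom (quot_cat I C D) x = Dom (quot_cat I C D) y"
      "m \<cdot>\<^bsub>quot_cat I C D\<^esub> x = m \<cdot>\<^bsub>quot_cat I C D\<^esub> y"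
    then obtain u v w where u: "u \<in> Arr I" "m = quot_arr I D u" and v: "v \<in> Arr I" "x = quot_arr I D
        v"
      and w: "w \<in> Arr I" "y = quot_arr I D w"
      by (auto simp: quot_sel(2))
    have d: "Cod I v = Dom I u" "Cod I w = Dom I u" "Dom I v = Dom I w"
      using * u v w by (simp_all add: quot_sel)
    then have "amap D u \<cdot>\<^bsub>C\<^esub> amap D v = amap D u \<cdot>\<^bsub>C\<^esub> amap D w"
      using *(7) u v w by (simp add: quot_sel)
    then have "amap D v = amap D w"
      using u v w d by - (rule monomorphism_cancel[OF C, of "amap D u"], simp_all)
    then show "x = y"
      using v w d by (simp add: quot_sel)
  qed
  ultimately show ?thesis
    unfolding lc_category_def by simp
qed

definition quot_fct :: "'u fct" where
  "quot_fct = \<lparr>omap = \<lambda>i\<in>Obj I. i, amap = \<lambda>u\<in>Arr I. quot_arr I D u\<rparr>"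

definition quot_lift :: "'u fct" where
  "quot_lift = \<lparr>omap = omap D, amap = \<lambda>x\<in>quot_arr I D ` Arr I. vsnd x\<rparr>"

lemma quot_fct: "small_functor I (quot_cat I C D) quot_fct"
  "full_on I (quot_cat I C D) (omap quot_fct) (amap quot_fct)" "ess_surj I (quot_cat I C D) (omap
      quot_fct)"
proof -
  note [simp] = small_functorD[OF D] functorD(1)[OF is_functor_quot]
  have [simp]: "i \<in> Obj I \<Longrightarrow> omap quot_fct i = i" "u \<in> Arr I \<Longrightarrow> amap quot_fct u = quot_arr I D u" for
      i u
    by (simp_all add: quot_fct_def)
  have "is_functor I (quot_cat I C D) (omap quot_fct) (amap quot_fct)"
    by (rule functorI) (simp_all add: quot_sel)
  then show "small_functor I (quot_cat I C D) quot_fct"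
    unfolding small_functor_def by (simp add: quot_fct_def)
  show "full_on I (quot_cat I C D) (omap quot_fct) (amap quot_fct)"
    unfolding full_on_def by (auto simp: quot_sel(1-4))
  show "ess_surj I (quot_cat I C D) (omap quot_fct)"
    unfolding ess_surj_def
  proof (intro ballI)
    fix i assume i: "i \<in> Obj (quot_cat I C D)"
    show "\<exists>A\<in>Obj I. \<exists>e. isomorphism (quot_cat I C D) e \<and> Dom (quot_cat I C D) e = omap quot_fct A \<and>
        Cod (quot_cat I C D) e = i"
      by (rule bexI[of _ i], rule exI[of _ "Ide (quot_cat I C D) i"]) (use i in \<open>simp_all add:
          quot_sel(1)\<close>)
  qed
qed

lemma quot_lift: "small_functor (quot_cat I C D) C quot_lift" "fct_comp I quot_lift quot_fct = D"
proof -
  note [simp] = small_functorD[OF D]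
  note [simp] = functorD(1)[OF is_functor_quot]
  have [simp]: "x \<in> Arr (quot_cat I C D) \<Longrightarrow> amap quot_lift x = vsnd x" "omap quot_lift = omap D" for
      x
    by (simp_all add: quot_lift_def quot_sel(2))
  have "is_functor (quot_cat I C D) C (omap quot_lift) (amap quot_lift)"
    by (rule functorI) (simp_all add: functorD(3-8)[OF is_functor_quot])
  then show l: "small_functor (quot_cat I C D) C quot_lift"
    unfolding small_functor_def by (simp add: quot_lift_def quot_sel(1,2))
  show "fct_comp I quot_lift quot_fct = D"
    by (rule small_functor_eqI[OF small_functor_comp[OF quot_fct(1) l] D])
      (simp_all add: quot_lift_def quot_fct_def quot_sel)
qed

end

section \<open>Naturality of the unit and of the counit\<close>

lemma eta_natural:
  assumes "lc_functor C C' K"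
  shows "fct_comp C (L_fct (G_ogpd C) (G_fct C C' K)) (eta_fct C) = fct_comp C (eta_fct C') K"
proof -
  interpret lc_functor C C' K by fact
  note [simp] = omap_G_map[OF equivariant_functor] amap_G_map[OF equivariant_functor]
  note df = double_functor_G_map[OF equivariant_functor]
  show ?thesis
    unfolding G_fct_eq
  proof (rule small_functor_eqI[OF small_functor_comp[OF C.small_functor_eta small_functor_L_fct[OF
      C.ordered_groupoid_G C'.ordered_groupoid_G df]]
          small_functor_comp[OF K C'.small_functor_eta]])
    fix f assume f: "f \<in> Arr C"
    then have g: "C.ghom (Ide C (Dom C f)) f (Ide C (Cod C f))"
      by simp
    have s: "is_span C (Ide C (Dom C f)) f"
      using C.ghom_span[OF g] f by simp
    have "ole (G_ogpd C) (subob C f) (subob C (Ide C (Cod C f)))"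
      by (rule C.ole_G_max[OF f])
    then show "amap (fct_comp C (L_fct (G_ogpd C) (G_map C C' (amap K))) (eta_fct C)) f = amap
        (fct_comp C (eta_fct C') K) f"
      using f s by (simp add: eta_fct_def)
  qed simp_all
qed

text \<open>\<open>L_fct\<close> applies \<open>M\<close> to the horizontal parts of a span, and
  \<open>M\<close> commutes with composing one of them with the inverse of the other.\<close>

lemma eps_natural:
  assumes G: "ordered_groupoid \<G>" and H: "ordered_groupoid \<H>" and M: "double_functor \<G> \<H> M"
  shows "fct_comp (G_ogpd (L_cat \<G>)) (eps_fct \<H>) (G_fct (L_cat \<G>) (L_cat \<H>) (L_fct \<G> M)) =
    fct_comp (G_ogpd (L_cat \<G>)) M (eps_fct \<G>)"
proof -
  interpret G: ogpd \<G> using G by unfold_locales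
  interpret H: ogpd \<H> using H by unfold_locales
  interpret lc_functor "L_cat \<G>" "L_cat \<H>" "L_fct \<G> M"
    by unfold_locales (rule small_functor_L_fct[OF G H M])
  note [simp] = omap_G_map[OF equivariant_functor] amap_G_map[OF equivariant_functor]
  note df = double_functor_G_map[OF equivariant_functor]
  note [simp] = small_functorD(6-11)[OF double_functorD(1)[OF M]]
  have le: "ole \<H> (omap M (Cod \<G> h)) (omap M B)" if "ole \<G> (Cod \<G> h) B" for h B
    using double_functorD(3)[OF M that] .
  show ?thesis
    unfolding G_fct_eq
  proof (rule small_functor_eqI[OF double_functorD(1)[OF double_functor_comp[OF
      G.L.ordered_groupoid_G df H.double_functor_eps]]
        double_functorD(1)[OF double_functor_comp[OF G.L.ordered_groupoid_G G.double_functor_eps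
            M]]])
    fix X assume X: "X \<in> Obj (G_ogpd (L_cat \<G>))"
    then obtain m where m: "X = subob (L_cat \<G>) m" "m \<in> Arr (L_cat \<G>)"
      by (rule G.L.G_ObjE)
    obtain h B where h: "m = vpair h B" "h \<in> Arr \<G>" "ole \<G> (Cod \<G> h) B"
      using m(2) by (rule L_arrE)
    show "omap (fct_comp (G_ogpd (L_cat \<G>)) (eps_fct \<H>) (G_map (L_cat \<G>) (L_cat \<H>) (amap (L_fct \<G>
        M)))) X =
        omap (fct_comp (G_ogpd (L_cat \<G>)) M (eps_fct \<G>)) X"
      using m h le[OF h(3)] by (simp add: G.omap_eps H.omap_eps)
  next
    fix x assume "x \<in> Arr (G_ogpd (L_cat \<G>))"
    then obtain m n where m: "x = spancl (L_cat \<G>) m n" "is_span (L_cat \<G>) m n"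
      by (rule G.L.G_ArrE)
    obtain h B k D where h: "m = vpair h B" "n = vpair k D" "h \<in> Arr \<G>" "k \<in> Arr \<G>" "ole \<G> (Cod \<G> h)
        B"
        "ole \<G> (Cod \<G> k) D" "Dom \<G> k = Dom \<G> h"
      using m(2) by (rule G.L_spanE)
    have "inv_arr \<H> (amap M h) = amap M (inv_arr \<G> h)"
      by (rule functor_inv_arr[OF small_functorD(3)[OF double_functorD(1)[OF M]]]) (use h in simp)
    then show "amap (fct_comp (G_ogpd (L_cat \<G>)) (eps_fct \<H>) (G_map (L_cat \<G>) (L_cat \<H>) (amap (L_fct
        \<G> M)))) x =
        amap (fct_comp (G_ogpd (L_cat \<G>)) M (eps_fct \<G>)) x"
      using m h le[OF h(5)] le[OF h(6)] by (simp add: G.amap_eps H.amap_eps)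
  qed
qed

text \<open>Flatness is used at the diagram \<open>?D'\<close> of shape \<open>G_ogpd ?Q\<close>,
  read in the categories by \<open>vflat_at_iff\<close>, and then pulled back along the unit of
  \<open>?Q\<close> and along the quotient functor. The chain of equations shows that the resulting
  diagram on \<open>?Q\<close> is \<open>?l\<close>: naturality of the unit moves it past
  \<open>?l\<close>, where \<open>L_eps_eta\<close> cancels it against the counit.\<close>

lemma cover_flat_L:
  fixes X Y :: "'u::universe esite"
  assumes G: "ordered_groupoid (fst X)" and H: "ordered_groupoid (fst Y)"
    and T: "ehresmann_topology (fst Y) (snd Y)" and M: "double_functor (fst X) (fst Y) M"
    and f: "vcover_flat X Y M"
  shows "cover_flat (L_site X) (L_site Y) (L_fct (fst X) M)"
  unfolding cover_flat_iff
proof (intro allI impI, elim conjE)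
  let ?L = "L_cat (fst X)"
  fix I :: "('u, 'u) cat" and D
  assume fin: "finite_category I" and "small_functor I (fst (L_site X)) D"
  then have D: "small_functor I ?L D" by simp
  interpret G: ogpd "fst X" using G by unfold_locales
  let ?Q = "quot_cat I ?L D" and ?q = "quot_fct I D" and ?l = "quot_lift I D"
  note q = quot_fct[OF D] and l = quot_lift[OF D]
  interpret Q: lc_category ?Q
    using lc_category_quot[OF D _ G.L.lc] fin unfolding finite_category_def by simp
  interpret lc_functor ?Q ?L ?l
    by unfold_locales (rule l(1))
  note df = double_functor_G_map[OF equivariant_functor, folded G_fct_eq]
  let ?D' = "fct_comp (G_ogpd ?Q) (eps_fct (fst X)) (G_fct ?Q ?L ?l)"
  have D': "double_functor (G_ogpd ?Q) (fst X) ?D'"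
    by (rule double_functor_comp[OF Q.ordered_groupoid_G df G.double_functor_eps])
  have finQ: "finite (Arr ?Q)"
    using fin quot_sel(2)[OF D] unfolding finite_category_def by simp
  have "finite (Arr (G_ogpd ?Q))"
    by (rule finite_subset[of _ "(\<lambda>(m, n). spancl ?Q m n) ` (Arr ?Q \<times> Arr ?Q)"])
      (use finQ Q.span_Arr in \<open>force elim!: Q.G_ArrE\<close>)+
  moreover have "finite (Obj (G_ogpd ?Q))"
    using finQ by (simp add: Q.G_ogpd_Obj G_obj_def)
  ultimately have "finite_category (G_ogpd ?Q)"
    unfolding finite_category_def using ordered_groupoidD(2)[OF Q.ordered_groupoid_G] by simp
  then have "vflat_at (G_ogpd ?Q) X Y M ?D'"
    using f D' Q.ordered_groupoid_G unfolding vcover_flat_iff by blast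
  then have 1: "flat_at (L_cat (G_ogpd ?Q)) (L_site X) (L_site Y) (L_fct (fst X) M) (L_fct (G_ogpd
      ?Q) ?D')"
    unfolding vflat_at_iff[OF G H T M Q.ordered_groupoid_G D'] .
  have LD': "small_functor (L_cat (G_ogpd ?Q)) (fst (L_site X)) (L_fct (G_ogpd ?Q) ?D')"
    using small_functor_L_fct[OF Q.ordered_groupoid_G G D'] by simp
  have LM: "small_functor (fst (L_site X)) (fst (L_site Y)) (L_fct (fst X) M)"
    using small_functor_L_fct[OF G H M] by simp
  have J: "grothendieck_topology (fst (L_site Y)) (snd (L_site Y))"
    using topology_J_of[OF H T] by simp
  have 2: "flat_at ?Q (L_site X) (L_site Y) (L_fct (fst X) M) (fct_comp ?Q (L_fct (G_ogpd ?Q) ?D')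
      (eta_fct ?Q))"
    by (rule flat_at_full_ess_surj[OF Q.small_functor_eta Q.full_eta Q.ess_surj_eta LD' LM J 1])
  have "fct_comp ?Q (L_fct (G_ogpd ?Q) ?D') (eta_fct ?Q) =
      fct_comp ?Q (fct_comp (L_cat (G_ogpd ?Q)) (L_fct (G_ogpd ?L) (eps_fct (fst X))) (L_fct (G_ogpd
          ?Q) (G_fct ?Q ?L ?l))) (eta_fct ?Q)"
    by (simp only: L_fct_comp[OF Q.ordered_groupoid_G G.L.ordered_groupoid_G G df
        G.double_functor_eps])
  also have "\<dots> = fct_comp ?Q (L_fct (G_ogpd ?L) (eps_fct (fst X))) (fct_comp ?Q (L_fct (G_ogpd ?Q)
      (G_fct ?Q ?L ?l)) (eta_fct ?Q))"
    by (rule fct_comp_assoc[OF Q.small_functor_eta small_functor_L_fct[OF Q.ordered_groupoid_G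
        G.L.ordered_groupoid_G df]
          small_functor_L_fct[OF G.L.ordered_groupoid_G G G.double_functor_eps], symmetric])
  also have "\<dots> = fct_comp ?Q (L_fct (G_ogpd ?L) (eps_fct (fst X))) (fct_comp ?Q (eta_fct ?L) ?l)"
    using eta_natural[OF lc_functor_axioms] by simp
  also have "\<dots> = fct_comp ?Q (fct_comp ?L (L_fct (G_ogpd ?L) (eps_fct (fst X))) (eta_fct ?L)) ?l"
    by (rule fct_comp_assoc[OF l(1) G.L.small_functor_eta small_functor_L_fct[OF
        G.L.ordered_groupoid_G G G.double_functor_eps]])
  also have "\<dots> = ?l"
    using G.L_eps_eta fct_comp_id_left[OF l(1)] by simp
  finally have "flat_at ?Q (L_site X) (L_site Y) (L_fct (fst X) M) ?l"
    using 2 by simp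
  then have "flat_at I (L_site X) (L_site Y) (L_fct (fst X) M) (fct_comp I ?l ?q)"
    by (rule flat_at_full_ess_surj[OF q _ LM J, rotated]) (use l(1) in simp)
  then show "flat_at I (L_site X) (L_site Y) (L_fct (fst X) M) D"
    using l(2) by simp
qed


section \<open>The 2-category of Ehresmann sites\<close>

lemma L_morph_sel [simp]: "src (L_morph F) = L_site (src F)" "tgt (L_morph F) = L_site (tgt F)"
  "fct (L_morph F) = L_fct (fst (src F)) (fct F)"
  by (simp_all add: L_morph_def)

lemma max_morphsD:
  assumes "F \<in> max_morphs"
  shows "src F \<in> max_sites" "tgt F \<in> max_sites" "double_functor (fst (src F)) (fst (tgt F)) (fct F)"
    "ordered_groupoid (fst (src F))" "ordered_groupoid (fst (tgt F))"
  using assms max_sitesD(1)[of "src F"] max_sitesD(1)[of "tgt F"] unfolding max_morphs_def by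
      simp_all

text \<open>Both the preservation of covers and flatness are equivalent to those of the image under
  \<open>L\<close>. Closure under composition is thereby inherited from
  \<open>lc_morphs\<close>.\<close>

lemma max_morphs_iff:
  fixes F :: "('u::universe esite, 'u) morph"
  assumes S: "src F \<in> max_sites" "tgt F \<in> max_sites" and d: "double_functor (fst (src F)) (fst (tgt
      F)) (fct F)"
  shows "F \<in> max_morphs \<longleftrightarrow> L_morph F \<in> lc_morphs"
proof -
  note s = max_sitesD[OF S(1)] and t = max_sitesD[OF S(2)]
  have "L_site (src F) \<in> lc_sites" "L_site (tgt F) \<in> lc_sites"
    using S by (simp_all add: L_site_lc)
  then show ?thesis
    unfolding max_morphs_def lc_morphs_def
    using S d small_functor_L_fct[OF s(1) t(1) d] vcover_preserving_iff[OF s(1) t(1) s(3) d]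
      cover_flat_L[OF s(1) t(1) t(3) d] vcover_flat_of_L[OF s(1) t(1) t(3) d] by auto
qed

lemma L_morph_lc: "F \<in> max_morphs \<Longrightarrow> L_morph F \<in> lc_morphs"
  using max_morphs_iff[of F] max_morphsD[of F] by simp

lemma L_morph_id: "X \<in> max_sites \<Longrightarrow> L_morph (morph_id X) = morph_id (L_site X)"
  by (rule morph_eqI) (simp_all add: L_fct_id max_sitesD)

lemma L_morph_comp:
  assumes "F \<in> max_morphs" "G \<in> max_morphs" "tgt F = src G"
  shows "L_morph (morph_comp G F) = morph_comp (L_morph G) (L_morph F)"
proof -
  note f = max_morphsD[OF assms(1)] and g = max_morphsD[OF assms(2), folded assms(3)]
  show ?thesis
    by (rule morph_eqI) (use L_fct_comp[OF f(4,5) g(5) f(3) g(3)] assms(3) in simp_all)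
qed

lemma morph_id_max: "X \<in> max_sites \<Longrightarrow> morph_id X \<in> max_morphs"
  by (subst max_morphs_iff) (simp_all add: L_morph_id double_functor_id max_sitesD morph_id_lc
      L_site_lc)

lemma morph_comp_max:
  assumes "F \<in> max_morphs" "G \<in> max_morphs" "tgt F = src G"
  shows "morph_comp G F \<in> max_morphs"
proof -
  note f = max_morphsD[OF assms(1)] and g = max_morphsD[OF assms(2), folded assms(3)]
  have "L_morph (morph_comp G F) \<in> lc_morphs"
    unfolding L_morph_comp[OF assms] using assms by (intro morph_comp_lc L_morph_lc) simp_all
  then show ?thesis
    using max_morphs_iff[of "morph_comp G F"] f g double_functor_comp[OF f(4,3) g(3)] by simp
qed

text \<open>Sources and targets are compared separately, because \<open>L_morph\<close> records them
  only through \<open>L_site\<close>. This is the injectivity on parallel arrows that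
  \<open>category_reflect\<close> asks for.\<close>

lemma L_morph_inject:
  assumes "F \<in> max_morphs" "G \<in> max_morphs" "src F = src G" "tgt F = tgt G" "L_morph F = L_morph G"
  shows "F = G"
proof (rule morph_eqI)
  note f = max_morphsD[OF assms(1)] and g = max_morphsD[OF assms(2)]
  show "fct F = fct G"
    by (rule L_fct_inject[OF f(4,3) g(3)[folded assms(3)]])
      (use arg_cong[OF assms(5), of fct] assms(3) in simp)
qed (use assms in simp_all)

lemma Esite_sel [simp]:
  "Obj (One Esite_max) = max_sites" "Arr (One Esite_max) = max_morphs" "Dom (One Esite_max) = src"
  "Cod (One Esite_max) = tgt" "Ide (One Esite_max) = morph_id" "Cmp (One Esite_max) = morph_comp"
  "Obj (Vert Esite_max) = max_morphs" "Arr (Vert Esite_max) = max_lams" "Dom (Vert Esite_max) =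
      lsrc"
  "Cod (Vert Esite_max) = ltgt" "Ide (Vert Esite_max) = lam2_id" "Cmp (Vert Esite_max) = lam2_vcomp"
  "Obj (Horz Esite_max) = max_sites" "Arr (Horz Esite_max) = max_lams" "Dom (Horz Esite_max) = (\<lambda>\<alpha>.
      src (lsrc \<alpha>))"
  "Cod (Horz Esite_max) = (\<lambda>\<alpha>. tgt (lsrc \<alpha>))" "Ide (Horz Esite_max) = (\<lambda>X. lam2_id (morph_id X))"
  "Cmp (Horz Esite_max) = lam2_hcomp"
  by (simp_all add: Esite_max_def)

lemma is_functor_One_L: "is_functor (One Esite_max) (One lcGsite) L_site L_morph"
  by (rule category_reflect[OF category_One_lcGsite])
    (auto simp: L_site_lc morph_id_max L_morph_id max_morphsD L_morph_lc morph_comp_max L_morph_comp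
      intro: L_morph_inject)

section \<open>2-cells of Ehresmann sites and their images under \<open>L\<close>\<close>

lemma L_lam_sel [simp]: "nsrc (L_lam \<alpha>) = L_morph (lsrc \<alpha>)" "ntgt (L_lam \<alpha>) = L_morph (ltgt \<alpha>)"
  "X \<in> Obj (fst (src (lsrc \<alpha>))) \<Longrightarrow> ncomp (L_lam \<alpha>) X = vpair (lcomp \<alpha> X) (omap (fct (ltgt \<alpha>)) X)"
  by (simp_all add: L_lam_def)

lemma max_lamsD:
  assumes "\<alpha> \<in> max_lams"
  shows "lsrc \<alpha> \<in> max_morphs" "ltgt \<alpha> \<in> max_morphs" "src (ltgt \<alpha>) = src (lsrc \<alpha>)" "tgt (ltgt \<alpha>) =
      tgt (lsrc \<alpha>)"
    "lam_transformation (fst (src (lsrc \<alpha>))) (fst (tgt (lsrc \<alpha>))) (fct (lsrc \<alpha>)) (fct (ltgt \<alpha>))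
        (lmid \<alpha>) (lcomp \<alpha>)"
  using assms unfolding max_lams_def by auto

lemma max_lams_comp:
  assumes "\<alpha> \<in> max_lams"
  shows "lmid \<alpha> = lam_mid (fst (src (lsrc \<alpha>))) (fst (tgt (lsrc \<alpha>))) (fct (ltgt \<alpha>)) (lcomp \<alpha>)"
    "lcomp \<alpha> \<in> extensional (Obj (fst (src (lsrc \<alpha>))))"
    "X \<in> Obj (fst (src (lsrc \<alpha>))) \<Longrightarrow> lcomp \<alpha> X \<in> Arr (fst (tgt (lsrc \<alpha>)))"
    "X \<in> Obj (fst (src (lsrc \<alpha>))) \<Longrightarrow> Dom (fst (tgt (lsrc \<alpha>))) (lcomp \<alpha> X) = omap (fct (lsrc \<alpha>)) X"
    "X \<in> Obj (fst (src (lsrc \<alpha>))) \<Longrightarrow> ole (fst (tgt (lsrc \<alpha>))) (Cod (fst (tgt (lsrc \<alpha>))) (lcomp \<alpha> X))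
        (omap (fct (ltgt \<alpha>)) X)"
proof -
  note a = max_lamsD[OF assms]
  note f = max_morphsD[OF a(1)] and g = max_morphsD[OF a(2), unfolded a(3,4)]
  note L = lam_transformationD[OF f(4,5) a(5)]
  show "lmid \<alpha> = lam_mid (fst (src (lsrc \<alpha>))) (fst (tgt (lsrc \<alpha>))) (fct (ltgt \<alpha>)) (lcomp \<alpha>)"
    by (rule lam_mid_unique[OF f(4,5) a(5)])
  show "lcomp \<alpha> \<in> extensional (Obj (fst (src (lsrc \<alpha>))))"
    "X \<in> Obj (fst (src (lsrc \<alpha>))) \<Longrightarrow> lcomp \<alpha> X \<in> Arr (fst (tgt (lsrc \<alpha>)))"
    "X \<in> Obj (fst (src (lsrc \<alpha>))) \<Longrightarrow> Dom (fst (tgt (lsrc \<alpha>))) (lcomp \<alpha> X) = omap (fct (lsrc \<alpha>)) X"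
    "X \<in> Obj (fst (src (lsrc \<alpha>))) \<Longrightarrow> ole (fst (tgt (lsrc \<alpha>))) (Cod (fst (tgt (lsrc \<alpha>))) (lcomp \<alpha> X))
        (omap (fct (ltgt \<alpha>)) X)"
    using L(2-5) L(10)[OF _ g(3)] by simp_all
qed

lemma L_lam_lc:
  assumes "\<alpha> \<in> max_lams"
  shows "L_lam \<alpha> \<in> lc_nats"
proof -
  note a = max_lamsD[OF assms]
  note f = max_morphsD[OF a(1)] and g = max_morphsD[OF a(2), unfolded a(3,4)]
  show ?thesis
    unfolding lc_nats_def using a nat_of_lam[OF f(4,5,3) g(3) a(5)] by (simp add: L_morph_lc
        L_lam_def)
qed

lemma lam2_eqI:
  assumes "\<alpha> \<in> max_lams" "\<beta> \<in> max_lams" "lsrc \<alpha> = lsrc \<beta>" "ltgt \<alpha> = ltgt \<beta>"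
    "\<And>X. X \<in> Obj (fst (src (lsrc \<beta>))) \<Longrightarrow> lcomp \<alpha> X = lcomp \<beta> X"
  shows "\<alpha> = \<beta>"
proof -
  have e: "lcomp \<alpha> = lcomp \<beta>"
    using max_lams_comp(2)[OF assms(1)] max_lams_comp(2)[OF assms(2)] assms(3,5)
    by (intro extensionalityI) simp_all
  show ?thesis
    by (rule lam2.equality)
      (use e assms(3,4) max_lams_comp(1)[OF assms(1)] max_lams_comp(1)[OF assms(2)] in simp_all)
qed

lemma L_lam_inject:
  assumes "\<alpha> \<in> max_lams" "\<beta> \<in> max_lams" "lsrc \<alpha> = lsrc \<beta>" "ltgt \<alpha> = ltgt \<beta>" "L_lam \<alpha> = L_lam \<beta>"
  shows "\<alpha> = \<beta>"
proof (rule lam2_eqI[OF assms(1-4)])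
  fix X assume "X \<in> Obj (fst (src (lsrc \<beta>)))"
  then show "lcomp \<alpha> X = lcomp \<beta> X"
    using arg_cong[OF assms(5), of "\<lambda>\<theta>. ncomp \<theta> X"] assms(3) by simp
qed

text \<open>The tool by which each operation on \<Lambda>-transformations is matched with one on
  natural transformations. Only the components and the restriction formula for \<open>lmid\<close>
  have to be compared; naturality, monotonicity and the double functor in the middle are supplied by
  \<open>\<theta>\<close>.\<close>

lemma max_lamsI:
  assumes F: "lsrc \<alpha> \<in> max_morphs" "ltgt \<alpha> \<in> max_morphs" "src (ltgt \<alpha>) = src (lsrc \<alpha>)" "tgt (ltgt \<alpha>)
      = tgt (lsrc \<alpha>)"
    and \<theta>: "\<theta> \<in> lc_nats" "nsrc \<theta> = L_morph (lsrc \<alpha>)" "ntgt \<theta> = L_morph (ltgt \<alpha>)"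
    and c: "lcomp \<alpha> \<in> extensional (Obj (fst (src (lsrc \<alpha>))))"
      "\<And>X. X \<in> Obj (fst (src (lsrc \<alpha>))) \<Longrightarrow> lcomp \<alpha> X = vfst (ncomp \<theta> X)"
    and m: "lmid \<alpha> = lam_mid (fst (src (lsrc \<alpha>))) (fst (tgt (lsrc \<alpha>))) (fct (ltgt \<alpha>)) (lcomp \<alpha>)"
  shows "\<alpha> \<in> max_lams \<and> L_lam \<alpha> = \<theta>"
proof -
  note f = max_morphsD[OF F(1)] and g = max_morphsD[OF F(2), unfolded F(3,4)]
  have n: "nat_transformation (L_cat (fst (src (lsrc \<alpha>)))) (L_cat (fst (tgt (lsrc \<alpha>))))
      (L_fct (fst (src (lsrc \<alpha>))) (fct (lsrc \<alpha>))) (L_fct (fst (src (lsrc \<alpha>))) (fct (ltgt \<alpha>))) (ncomp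
          \<theta>)"
    using lc_natsD(5)[OF \<theta>(1)] \<theta>(2,3) F(3) by simp
  note l = lam_of_nat[OF f(4,5,3) g(3) n c]
  have a: "\<alpha> \<in> max_lams"
    unfolding max_lams_def using F l(1) m by simp
  moreover have "L_lam \<alpha> = \<theta>"
    by (rule nat2_eqI[OF L_lam_lc[OF a] \<theta>(1)]) (use \<theta> l(2) in \<open>simp_all add: L_cat_sel\<close>)
  ultimately show ?thesis ..
qed

text \<open>Supplies 2-cells that are first found between the categories: inverses in
  \<open>isomorphism_lam2\<close>, and the 2-cell that inverts the counit up to isomorphism.\<close>

lemma lam_full:
  assumes F: "F \<in> max_morphs" "G \<in> max_morphs" "src G = src F" "tgt G = tgt F"
    and \<theta>: "\<theta> \<in> lc_nats" "nsrc \<theta> = L_morph F" "ntgt \<theta> = L_morph G"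
  obtains \<alpha> where "\<alpha> \<in> max_lams" "lsrc \<alpha> = F" "ltgt \<alpha> = G" "L_lam \<alpha> = \<theta>"
proof -
  define c where "c = (\<lambda>X\<in>Obj (fst (src F)). vfst (ncomp \<theta> X))"
  define \<alpha> where "\<alpha> = \<lparr>lsrc = F, ltgt = G, lmid = lam_mid (fst (src F)) (fst (tgt F)) (fct G) c,
      lcomp = c\<rparr>"
  have "\<alpha> \<in> max_lams \<and> L_lam \<alpha> = \<theta>"
    by (rule max_lamsI[of \<alpha> \<theta>]) (use F \<theta> in \<open>simp_all add: \<alpha>_def c_def\<close>)
  then show thesis
    using that[of \<alpha>] by (simp add: \<alpha>_def)
qed

lemma lam2_sel [simp]:
  "lsrc (lam2_id F) = F" "ltgt (lam2_id F) = F" "lsrc (lam2_vcomp \<gamma> \<alpha>) = lsrc \<alpha>" "ltgt (lam2_vcomp \<gamma>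
      \<alpha>) = ltgt \<gamma>"
  "lsrc (lam2_whisker_right \<beta> F) = morph_comp (lsrc \<beta>) F" "ltgt (lam2_whisker_right \<beta> F) =
      morph_comp (ltgt \<beta>) F"
  "lsrc (lam2_whisker_left H \<alpha>) = morph_comp H (lsrc \<alpha>)" "ltgt (lam2_whisker_left H \<alpha>) = morph_comp
      H (ltgt \<alpha>)"
  "lsrc (lam2_hcomp \<beta> \<alpha>) = morph_comp (lsrc \<beta>) (lsrc \<alpha>)" "ltgt (lam2_hcomp \<beta> \<alpha>) = morph_comp (ltgt
      \<beta>) (ltgt \<alpha>)"
  by (simp_all add: lam2_id_def lam2_vcomp_def lam2_whisker_right_def lam2_whisker_left_def
      lam2_hcomp_def Let_def)

lemma lam2_id:
  assumes F: "F \<in> max_morphs"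
  shows "lam2_id F \<in> max_lams" "L_lam (lam2_id F) = nat2_id (L_morph F)"
proof -
  note f = max_morphsD[OF F] note s = small_functorD[OF double_functorD(1)[OF f(3)]]
  have m: "fct F = lam_mid (fst (src F)) (fst (tgt F)) (fct F) (lcomp (lam2_id F))"
  proof (rule fct.equality)
    show "omap (fct F) = omap (lam_mid (fst (src F)) (fst (tgt F)) (fct F) (lcomp (lam2_id F)))"
      by (rule extensionalityI[OF s(4)]) (use s in \<open>simp_all add: lam_mid_def lam2_id_def\<close>)
    show "amap (fct F) = amap (lam_mid (fst (src F)) (fst (tgt F)) (fct F) (lcomp (lam2_id F)))"
      by (rule extensionalityI[OF s(5)]) (use s in \<open>simp_all add: lam_mid_def lam2_id_def
          restr_Dom[OF f(5)]\<close>)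
  qed simp
  have "lam2_id F \<in> max_lams \<and> L_lam (lam2_id F) = nat2_id (L_morph F)"
  proof (rule max_lamsI[of "lam2_id F" "nat2_id (L_morph F)"])
    show "lmid (lam2_id F) = lam_mid (fst (src (lsrc (lam2_id F)))) (fst (tgt (lsrc (lam2_id F))))
        (fct (ltgt (lam2_id F))) (lcomp (lam2_id F))"
      using m by (simp add: lam2_id_def)
  qed (use F s L_morph_lc[OF F] in \<open>simp_all add: nat2_id_lc lam2_id_def L_cat_sel\<close>)
  then show "lam2_id F \<in> max_lams" "L_lam (lam2_id F) = nat2_id (L_morph F)"
    by simp_all
qed

lemma fct_restrict_eqI:
  "(\<And>X. X \<in> A \<Longrightarrow> o1 X = o2 X) \<Longrightarrow> (\<And>f. f \<in> B \<Longrightarrow> a1 f = a2 f) \<Longrightarrow>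
   \<lparr>omap = restrict o1 A, amap = restrict a1 B\<rparr> = \<lparr>omap = restrict o2 A, amap = restrict a2 B\<rparr>"
  by (auto intro!: restrict_ext)

text \<open>Composition in \<open>L_cat\<close> restricts the component of \<open>\<gamma>\<close>
  to the codomain of that of \<open>\<alpha>\<close>, as the definition of the vertical composite
  does. What remains is the middle double functor, where a restriction of a restriction collapses by
  \<open>restr_restr\<close>.\<close>

lemma lam2_vcomp:
  assumes \<alpha>: "\<alpha> \<in> max_lams" and \<gamma>: "\<gamma> \<in> max_lams" and e: "ltgt \<alpha> = lsrc \<gamma>"
  shows "lam2_vcomp \<gamma> \<alpha> \<in> max_lams" "L_lam (lam2_vcomp \<gamma> \<alpha>) = nat2_vcomp (L_lam \<gamma>) (L_lam \<alpha>)"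
proof -
  note a = max_lamsD[OF \<alpha>, unfolded e] and g = max_lamsD[OF \<gamma>, unfolded max_lamsD(3,4)[OF \<alpha>,
      unfolded e]]
  note ac = max_lams_comp[OF \<alpha>, unfolded e] and gc = max_lams_comp[OF \<gamma>, unfolded a]
  note f = max_morphsD[OF a(1)] and h = max_morphsD[OF g(1), unfolded a] and k = max_morphsD[OF
      g(2), unfolded g a]
  let ?G = "fst (src (lsrc \<alpha>))" and ?H = "fst (tgt (lsrc \<alpha>))"
  note [simp] = ac(3-5) gc(3-5) ordered_groupoidD(1)[OF f(4)] ordered_groupoidD(1)[OF f(5)]
      restr(1,2)[OF f(5)]
    small_functorD(6-11)[OF double_functorD(1)[OF k(3)]] small_functorD(6-11)[OF
        double_functorD(1)[OF f(3)]]
  have mid: "X \<in> Obj ?G \<Longrightarrow> omap (lmid \<alpha>) X = Cod ?H (lcomp \<alpha> X)"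
    "hh \<in> Arr ?G \<Longrightarrow> amap (lmid \<gamma>) hh = restr ?H (amap (fct (ltgt \<gamma>)) hh) (Cod ?H (lcomp \<gamma> (Dom ?G
        hh)))" for X hh
    using ac(1) gc(1) by simp_all
  have le: "ole ?H (Cod ?H (restr ?H (lcomp \<gamma> X) (Cod ?H (lcomp \<alpha> X)))) (Cod ?H (lcomp \<gamma> X))" if "X
      \<in> Obj ?G" for X
    by (rule ole_Cod_restr[OF f(5)]) (use that in simp_all)
  have c: "lcomp (lam2_vcomp \<gamma> \<alpha>) X = restr ?H (lcomp \<gamma> X) (Cod ?H (lcomp \<alpha> X)) \<cdot>\<^bsub>?H\<^esub> lcomp \<alpha> X" if "X
      \<in> Obj ?G" for X
    using that mid by (simp add: lam2_vcomp_def Let_def)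
  have "lam2_vcomp \<gamma> \<alpha> \<in> max_lams \<and> L_lam (lam2_vcomp \<gamma> \<alpha>) = nat2_vcomp (L_lam \<gamma>) (L_lam \<alpha>)"
  proof (rule max_lamsI[of "lam2_vcomp \<gamma> \<alpha>" "nat2_vcomp (L_lam \<gamma>) (L_lam \<alpha>)"])
    show "lmid (lam2_vcomp \<gamma> \<alpha>) = lam_mid (fst (src (lsrc (lam2_vcomp \<gamma> \<alpha>)))) (fst (tgt (lsrc
        (lam2_vcomp \<gamma> \<alpha>))))
        (fct (ltgt (lam2_vcomp \<gamma> \<alpha>))) (lcomp (lam2_vcomp \<gamma> \<alpha>))"
      unfolding lam_mid_def lam2_sel
      unfolding lam2_vcomp_def Let_def lam2.simps
    proof (rule fct_restrict_eqI)
      fix X assume X: "X \<in> Obj ?G"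
      then show "Cod ?H (restr ?H (lcomp \<gamma> X) (omap (lmid \<alpha>) X)) =
          Cod ?H ((\<lambda>X\<in>Obj ?G. restr ?H (lcomp \<gamma> X) (omap (lmid \<alpha>) X) \<cdot>\<^bsub>?H\<^esub> lcomp \<alpha> X) X)"
        by (simp add: mid)
    next
      fix hh assume hh: "hh \<in> Arr ?G"
      then show "restr ?H (amap (lmid \<gamma>) hh) (Cod ?H (restr ?H (lcomp \<gamma> (Dom ?G hh)) (omap (lmid \<alpha>)
          (Dom ?G hh)))) =
          restr ?H (amap (fct (ltgt \<gamma>)) hh) (Cod ?H ((\<lambda>X\<in>Obj ?G. restr ?H (lcomp \<gamma> X) (omap (lmid \<alpha>)
              X) \<cdot>\<^bsub>?H\<^esub> lcomp \<alpha> X) (Dom ?G hh)))"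
        using le[of "Dom ?G hh"] by (simp add: mid restr_restr[OF f(5)])
    qed
    show "nat2_vcomp (L_lam \<gamma>) (L_lam \<alpha>) \<in> lc_nats"
      using \<alpha> \<gamma> e by (simp add: nat2_vcomp_lc L_lam_lc)
    show "lcomp (lam2_vcomp \<gamma> \<alpha>) \<in> extensional (Obj (fst (src (lsrc (lam2_vcomp \<gamma> \<alpha>)))))"
      by (simp add: lam2_vcomp_def Let_def)
    fix X assume "X \<in> Obj (fst (src (lsrc (lam2_vcomp \<gamma> \<alpha>))))"
    then show "lcomp (lam2_vcomp \<gamma> \<alpha>) X = vfst (ncomp (nat2_vcomp (L_lam \<gamma>) (L_lam \<alpha>)) X)"
      using a by (simp add: c L_cat_sel e)
  qed (use a g in simp_all)
  then show "lam2_vcomp \<gamma> \<alpha> \<in> max_lams" "L_lam (lam2_vcomp \<gamma> \<alpha>) = nat2_vcomp (L_lam \<gamma>) (L_lam \<alpha>)"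
    by simp_all
qed

lemma lam2_whisker_right:
  assumes \<beta>: "\<beta> \<in> max_lams" and F: "F \<in> max_morphs" and e: "tgt F = src (lsrc \<beta>)"
  shows "lam2_whisker_right \<beta> F \<in> max_lams"
    "L_lam (lam2_whisker_right \<beta> F) = nat2_hcomp (L_lam \<beta>) (nat2_id (L_morph F))"
proof -
  note b = max_lamsD[OF \<beta>] and bc = max_lams_comp[OF \<beta>]
  note f = max_morphsD[OF F, unfolded e] and g = max_morphsD[OF b(1)] and h = max_morphsD[OF b(2),
      unfolded b]
  note [simp] = bc(3-5) ordered_groupoidD(1)[OF f(4)] ordered_groupoidD(1)[OF f(5)]
      ordered_groupoidD(1)[OF g(5)]
    small_functorD(6-11)[OF double_functorD(1)[OF f(3)]] small_functorD(6-11)[OF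
        double_functorD(1)[OF g(3)]]
  have "lam2_whisker_right \<beta> F \<in> max_lams \<and> L_lam (lam2_whisker_right \<beta> F) = nat2_hcomp (L_lam \<beta>)
      (nat2_id (L_morph F))"
  proof (rule max_lamsI[of "lam2_whisker_right \<beta> F" "nat2_hcomp (L_lam \<beta>) (nat2_id (L_morph F))"])
    show "lmid (lam2_whisker_right \<beta> F) = lam_mid (fst (src (lsrc (lam2_whisker_right \<beta> F)))) (fst
        (tgt (lsrc (lam2_whisker_right \<beta> F))))
        (fct (ltgt (lam2_whisker_right \<beta> F))) (lcomp (lam2_whisker_right \<beta> F))"
      unfolding lam_mid_def lam2_sel morph_sel
      unfolding lam2_whisker_right_def fct_comp_def lam2.simps
      by (rule fct_restrict_eqI) (simp_all add: bc(1))
    show "nat2_hcomp (L_lam \<beta>) (nat2_id (L_morph F)) \<in> lc_nats"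
      using \<beta> F e by (simp add: nat2_hcomp_lc nat2_id_lc L_lam_lc L_morph_lc)
    show "lcomp (lam2_whisker_right \<beta> F) \<in> extensional (Obj (fst (src (lsrc (lam2_whisker_right \<beta>
        F)))))"
      by (simp add: lam2_whisker_right_def)
    fix X assume "X \<in> Obj (fst (src (lsrc (lam2_whisker_right \<beta> F))))"
    then show "lcomp (lam2_whisker_right \<beta> F) X = vfst (ncomp (nat2_hcomp (L_lam \<beta>) (nat2_id
        (L_morph F))) X)"
      using F e b by (simp add: lam2_whisker_right_def L_cat_sel ole_refl[OF f(5)] ole_refl[OF g(5)]
          restr_Dom[OF g(5)])
  qed (use \<beta> F e b L_morph_comp[OF F b(1) e] L_morph_comp[OF F b(2)] in \<open>simp_all add:
      morph_comp_max\<close>)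
  then show "lam2_whisker_right \<beta> F \<in> max_lams"
    "L_lam (lam2_whisker_right \<beta> F) = nat2_hcomp (L_lam \<beta>) (nat2_id (L_morph F))"
    by simp_all
qed

lemma lam2_whisker_left:
  assumes \<alpha>: "\<alpha> \<in> max_lams" and H: "H \<in> max_morphs" and e: "tgt (lsrc \<alpha>) = src H"
  shows "lam2_whisker_left H \<alpha> \<in> max_lams"
    "L_lam (lam2_whisker_left H \<alpha>) = nat2_hcomp (nat2_id (L_morph H)) (L_lam \<alpha>)"
proof -
  note b = max_lamsD[OF \<alpha>] and bc = max_lams_comp[OF \<alpha>, unfolded e]
  note g = max_morphsD[OF b(1), unfolded e] and h = max_morphsD[OF b(2), unfolded b e] and f =
      max_morphsD[OF H]
  note [simp] = bc(3-5) ordered_groupoidD(1)[OF g(4)] ordered_groupoidD(1)[OF g(5)]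
      ordered_groupoidD(1)[OF f(5)]
    small_functorD(6-11)[OF double_functorD(1)[OF f(3)]] small_functorD(6-11)[OF
        double_functorD(1)[OF g(3)]]
    small_functorD(6-11)[OF double_functorD(1)[OF h(3)]]
    double_functor_restr[OF f(4,5,3)]
  have le: "ole (fst (tgt H)) (omap (fct H) (Cod (fst (src H)) (lcomp \<alpha> X))) (omap (fct H) (omap
      (fct (ltgt \<alpha>)) X))"
    if "X \<in> Obj (fst (src (lsrc \<alpha>)))" for X
    using double_functorD(3)[OF f(3) bc(5)[OF that]] .
  have "lam2_whisker_left H \<alpha> \<in> max_lams \<and> L_lam (lam2_whisker_left H \<alpha>) = nat2_hcomp (nat2_id
      (L_morph H)) (L_lam \<alpha>)"
  proof (rule max_lamsI[of "lam2_whisker_left H \<alpha>" "nat2_hcomp (nat2_id (L_morph H)) (L_lam \<alpha>)"])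
    show "lmid (lam2_whisker_left H \<alpha>) = lam_mid (fst (src (lsrc (lam2_whisker_left H \<alpha>)))) (fst
        (tgt (lsrc (lam2_whisker_left H \<alpha>))))
        (fct (ltgt (lam2_whisker_left H \<alpha>))) (lcomp (lam2_whisker_left H \<alpha>))"
      unfolding lam_mid_def lam2_sel morph_sel
      unfolding lam2_whisker_left_def fct_comp_def lam2.simps b
      by (rule fct_restrict_eqI) (simp_all add: bc(1))
    show "nat2_hcomp (nat2_id (L_morph H)) (L_lam \<alpha>) \<in> lc_nats"
      using \<alpha> H e by (simp add: nat2_hcomp_lc nat2_id_lc L_lam_lc L_morph_lc)
    show "lcomp (lam2_whisker_left H \<alpha>) \<in> extensional (Obj (fst (src (lsrc (lam2_whisker_left H
        \<alpha>)))))"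
      by (simp add: lam2_whisker_left_def)
    fix X assume "X \<in> Obj (fst (src (lsrc (lam2_whisker_left H \<alpha>))))"
    then show "lcomp (lam2_whisker_left H \<alpha>) X = vfst (ncomp (nat2_hcomp (nat2_id (L_morph H))
        (L_lam \<alpha>)) X)"
      using H e b le[of X] by (simp add: lam2_whisker_left_def L_cat_sel ole_refl[OF f(5)]
          restr_Ide[OF f(5)])
  qed (use \<alpha> H e b L_morph_comp[OF b(1) H] L_morph_comp[OF b(2) H] in \<open>simp_all add:
      morph_comp_max\<close>)
  then show "lam2_whisker_left H \<alpha> \<in> max_lams"
    "L_lam (lam2_whisker_left H \<alpha>) = nat2_hcomp (nat2_id (L_morph H)) (L_lam \<alpha>)"
    by simp_all
qed

text \<open>The horizontal composite is defined from two whiskerings. Their images are horizontal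
  composites with identities, and interchange contracts these to \<open>nat2_hcomp\<close>.\<close>

lemma lam2_hcomp:
  assumes \<alpha>: "\<alpha> \<in> max_lams" and \<beta>: "\<beta> \<in> max_lams" and e: "tgt (lsrc \<alpha>) = src (lsrc \<beta>)"
  shows "lam2_hcomp \<beta> \<alpha> \<in> max_lams" "L_lam (lam2_hcomp \<beta> \<alpha>) = nat2_hcomp (L_lam \<beta>) (L_lam \<alpha>)"
proof -
  note a = max_lamsD[OF \<alpha>] and b = max_lamsD[OF \<beta>]
  have 1: "tgt (ltgt \<alpha>) = src (lsrc \<beta>)"
    using a e by simp
  note w = lam2_whisker_right[OF \<beta> a(2) 1] lam2_whisker_left[OF \<alpha> b(1) e]
  show "lam2_hcomp \<beta> \<alpha> \<in> max_lams"
    unfolding lam2_hcomp_def by (rule lam2_vcomp(1)) (use w in simp_all)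
  have "L_lam (lam2_hcomp \<beta> \<alpha>) =
      nat2_vcomp (nat2_hcomp (L_lam \<beta>) (nat2_id (L_morph (ltgt \<alpha>)))) (nat2_hcomp (nat2_id (L_morph
          (lsrc \<beta>))) (L_lam \<alpha>))"
    unfolding lam2_hcomp_def using w by (subst lam2_vcomp(2)) simp_all
  also have "\<dots> = nat2_hcomp (nat2_vcomp (L_lam \<beta>) (nat2_id (L_morph (lsrc \<beta>)))) (nat2_vcomp (nat2_id
      (L_morph (ltgt \<alpha>))) (L_lam \<alpha>))"
    by (rule nat2_interchange[symmetric]) (use \<alpha> \<beta> a b e in \<open>simp_all add: L_lam_lc nat2_id_lc
        L_morph_lc\<close>)
  also have "\<dots> = nat2_hcomp (L_lam \<beta>) (L_lam \<alpha>)"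
    using Cmp_Ide[OF category_Vert_lcGsite, of "L_lam \<beta>"] Ide_Cmp[OF category_Vert_lcGsite, of
        "L_lam \<alpha>"] \<alpha> \<beta>
    by (simp add: L_lam_lc)
  finally show "L_lam (lam2_hcomp \<beta> \<alpha>) = nat2_hcomp (L_lam \<beta>) (L_lam \<alpha>)" .
qed

lemma is_functor_Vert_L: "is_functor (Vert Esite_max) (Vert lcGsite) L_morph L_lam"
  by (rule category_reflect[OF category_Vert_lcGsite])
    (auto simp: L_morph_lc lam2_id max_lamsD L_lam_lc lam2_vcomp intro: L_lam_inject)

text \<open>Parallel arrows of the horizontal category share only their 0-cells, so the 1-cells at
  the ends of the 2-cells have to be recovered from their images.\<close>

lemma L_lam_inject_Horz:
  assumes \<alpha>: "\<alpha> \<in> max_lams" and \<beta>: "\<beta> \<in> max_lams" and e: "src (lsrc \<alpha>) = src (lsrc \<beta>)" "tgt (lsrc \<alpha>)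
      = tgt (lsrc \<beta>)"
    and L: "L_lam \<alpha> = L_lam \<beta>"
  shows "\<alpha> = \<beta>"
proof (rule L_lam_inject[OF \<alpha> \<beta> _ _ L])
  note a = max_lamsD[OF \<alpha>] and b = max_lamsD[OF \<beta>]
  show "lsrc \<alpha> = lsrc \<beta>"
    by (rule L_morph_inject) (use a b e arg_cong[OF L, of nsrc] in simp_all)
  show "ltgt \<alpha> = ltgt \<beta>"
    by (rule L_morph_inject) (use a b e arg_cong[OF L, of ntgt] in simp_all)
qed

lemma is_functor_Horz_L: "is_functor (Horz Esite_max) (Horz lcGsite) L_site L_lam"
proof (rule category_reflect[OF category_Horz_lcGsite], goal_cases)
  case (5 f g)
  then show ?case
    using L_lam_inject_Horz by simp
qed (simp_all add: L_site_lc lam2_id morph_id_max L_morph_id max_lamsD max_morphsD L_lam_lc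
    lam2_hcomp)

lemma two_category_Esite_max:
  "two_category (Esite_max :: (('u::universe) esite, ('u esite, 'u) morph, 'u lam2) twocat)"
  unfolding two_category_def
proof (intro conjI ballI impI; (elim conjE)?)
  fix F G :: "('u esite, 'u) morph"
  assume *: "F \<in> Arr (One Esite_max)" "G \<in> Arr (One Esite_max)" "Cod (One Esite_max) F = Dom (One
      Esite_max) G"
  then have F: "F \<in> max_morphs" and G: "G \<in> max_morphs" and e: "tgt F = src G" by simp_all
  have "nat2_hcomp (nat2_id (L_morph G)) (nat2_id (L_morph F)) = nat2_id (morph_comp (L_morph G)
      (L_morph F))"
    using two_category_lcGsite[where 'u = 'u] F G e unfolding two_category_def by (simp add:
        L_morph_lc)
  then have "lam2_hcomp (lam2_id G) (lam2_id F) = lam2_id (morph_comp G F)"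
    using F G e by (intro L_lam_inject) (simp_all add: lam2_hcomp lam2_id morph_comp_max
        L_morph_comp)
  then show "Ide (Vert Esite_max) G \<cdot>\<^bsub>Horz Esite_max\<^esub> Ide (Vert Esite_max) F = Ide (Vert Esite_max) (G
      \<cdot>\<^bsub>One Esite_max\<^esub> F)"
    by simp
next
  fix a a' b b' :: "'u lam2"
  assume "a \<in> Arr (Vert Esite_max)" "a' \<in> Arr (Vert Esite_max)" "b \<in> Arr (Vert Esite_max)" "b' \<in> Arr
      (Vert Esite_max)"
    "Cod (Vert Esite_max) a = Dom (Vert Esite_max) a'" "Cod (Vert Esite_max) b = Dom (Vert
        Esite_max) b'"
    "Cod (Horz Esite_max) a = Dom (Horz Esite_max) b"
  then have *: "a \<in> max_lams" "a' \<in> max_lams" "b \<in> max_lams" "b' \<in> max_lams"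
    and e: "ltgt a = lsrc a'" "ltgt b = lsrc b'" "tgt (lsrc a) = src (lsrc b)"
    by simp_all
  have e': "tgt (lsrc a') = src (lsrc b')"
    using max_lamsD(4)[OF *(1)] max_lamsD(3)[OF *(3)] e by simp
  have "lam2_hcomp (lam2_vcomp b' b) (lam2_vcomp a' a) = lam2_vcomp (lam2_hcomp b' a') (lam2_hcomp b
      a)"
    by (rule L_lam_inject) (use * e e' nat2_interchange[of "L_lam a" "L_lam a'" "L_lam b" "L_lam
        b'"] in
      \<open>simp_all add: lam2_vcomp lam2_hcomp L_lam_lc\<close>)
  then show "(b' \<cdot>\<^bsub>Vert Esite_max\<^esub> b) \<cdot>\<^bsub>Horz Esite_max\<^esub> (a' \<cdot>\<^bsub>Vert Esite_max\<^esub> a) =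
      (b' \<cdot>\<^bsub>Horz Esite_max\<^esub> a') \<cdot>\<^bsub>Vert Esite_max\<^esub> (b \<cdot>\<^bsub>Horz Esite_max\<^esub> a)"
    by simp
qed (auto simp: functorD(1)[OF is_functor_One_L] functorD(1)[OF is_functor_Vert_L] functorD(1)[OF
    is_functor_Horz_L] max_lamsD)

lemma two_functor_L:
  "two_functor (Esite_max :: (('u::universe) esite, ('u esite, 'u) morph, 'u lam2) twocat) lcGsite
      L_two"
  unfolding two_functor_def L_two_def
  using two_category_Esite_max two_category_lcGsite is_functor_One_L is_functor_Vert_L
      is_functor_Horz_L by simp

text \<open>The inverse is lifted by \<open>lam_full\<close>, and the two inverse laws are reflected
  by \<open>L_lam_inject\<close>.\<close>

lemma isomorphism_lam2:
  assumes \<alpha>: "\<alpha> \<in> max_lams" and i: "isomorphism (Vert lcGsite) (L_lam \<alpha>)"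
  shows "isomorphism (Vert Esite_max) \<alpha>"
proof -
  note a = max_lamsD[OF \<alpha>]
  let ?\<phi> = "inv_arr (Vert lcGsite) (L_lam \<alpha>)"
  note inv = inv_arr[OF category_Vert_lcGsite i]
  obtain \<beta> where b: "\<beta> \<in> max_lams" "lsrc \<beta> = ltgt \<alpha>" "ltgt \<beta> = lsrc \<alpha>" "L_lam \<beta> = ?\<phi>"
    by (rule lam_full[of "ltgt \<alpha>" "lsrc \<alpha>" ?\<phi>]) (use a inv in simp_all)
  have "lam2_vcomp \<beta> \<alpha> = lam2_id (lsrc \<alpha>)" "lam2_vcomp \<alpha> \<beta> = lam2_id (ltgt \<alpha>)"
    using inv(4,5) \<alpha> a b by (auto intro!: L_lam_inject simp: lam2_vcomp lam2_id)
  then show ?thesis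
    using \<alpha> a b by (intro isoI[OF functorD(1)[OF is_functor_Vert_L], of \<alpha> \<beta>]) simp_all
qed


section \<open>Equivalences of sites\<close>

text \<open>The sieve generated by the image under \<open>K\<close> is pulled back along the inverse
  of \<open>\<theta> A\<close>. Naturality rewrites the members of the pullback as arrows through
  the image of some \<open>f\<close> under \<open>K'\<close>.\<close>

lemma cover_preserving_nat_iso:
  assumes K: "small_functor (fst X) (fst Y) K" and K': "small_functor (fst X) (fst Y) K'"
    and J: "grothendieck_topology (fst X) (snd X)" "grothendieck_topology (fst Y) (snd Y)"
    and \<theta>: "nat_transformation (fst X) (fst Y) K K' \<theta>" "\<And>A. A \<in> Obj (fst X) \<Longrightarrow> isomorphism (fst Y) (\<theta>
        A)"
    and c: "cover_preserving X Y K"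
  shows "cover_preserving X Y K'"
  unfolding cover_preserving_def
proof (intro ballI)
  note [simp] = small_functorD[OF K] small_functorD[OF K'] nat_transformationD(2-4)[OF \<theta>(1)] \<theta>(2)
  fix A S assume A: "A \<in> Obj (fst X)" and S: "S \<in> snd X A"
  note S' = sieveD[OF topologyD(1)[OF J(1) S]]
  have "generated_sieve (fst Y) (amap K ` S) \<in> snd Y (omap K A)"
    using c A S unfolding cover_preserving_def by blast
  then have 1: "sieve_pullback (fst Y) (inv_arr (fst Y) (\<theta> A)) (generated_sieve (fst Y) (amap K `
      S)) \<in> snd Y (omap K' A)"
    using topologyD(3)[OF J(2), of "inv_arr (fst Y) (\<theta> A)"] A by simp
  show "generated_sieve (fst Y) (amap K' ` S) \<in> snd Y (omap K' A)"
  proof (rule topology_superset[OF _ J(2) 1])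
    show "sieve (fst Y) (omap K' A) (generated_sieve (fst Y) (amap K' ` S))"
      using A S' by (intro sieve_generated_sieve) auto
    show "sieve_pullback (fst Y) (inv_arr (fst Y) (\<theta> A)) (generated_sieve (fst Y) (amap K ` S)) \<subseteq>
        generated_sieve (fst Y) (amap K' ` S)"
    proof
      fix g assume "g \<in> sieve_pullback (fst Y) (inv_arr (fst Y) (\<theta> A)) (generated_sieve (fst Y)
          (amap K ` S))"
      then obtain f k where g: "g \<in> Arr (fst Y)" "Cod (fst Y) g = omap K' A" and f: "f \<in> S"
        and k: "k \<in> Arr (fst Y)" "Cod (fst Y) k = Dom (fst Y) (amap K f)"
        and e: "inv_arr (fst Y) (\<theta> A) \<cdot>\<^bsub>fst Y\<^esub> g = amap K f \<cdot>\<^bsub>fst Y\<^esub> k"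
        unfolding sieve_pullback_def generated_sieve_def using A by auto
      note f' = S'(1,2)[OF f]
      have "g = \<theta> A \<cdot>\<^bsub>fst Y\<^esub> (inv_arr (fst Y) (\<theta> A) \<cdot>\<^bsub>fst Y\<^esub> g)"
        using g A by simp
      also have "\<dots> = (\<theta> A \<cdot>\<^bsub>fst Y\<^esub> amap K f) \<cdot>\<^bsub>fst Y\<^esub> k"
        unfolding e using k f' A by (simp add: Cmp_assoc)
      also have "\<dots> = amap K' f \<cdot>\<^bsub>fst Y\<^esub> (\<theta> (Dom (fst X) f) \<cdot>\<^bsub>fst Y\<^esub> k)"
        using nat_transformationD(5)[OF \<theta>(1) f'(1), symmetric] k f' A by (simp add: Cmp_assoc)
      finally show "g \<in> generated_sieve (fst Y) (amap K' ` S)"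
        unfolding generated_sieve_def using f f' k A by fastforce
    qed
  qed simp
qed

text \<open>Legs are composed with inverse components of \<open>\<theta>\<close> to reach a cone for
  \<open>K\<close>; a factorisation through \<open>omap K W\<close> is carried back by composing
  with \<open>\<theta> W\<close>.\<close>

lemma cover_flat_nat_iso:
  fixes X Y :: "'u::universe gsite"
  assumes K: "small_functor (fst X) (fst Y) K" and K': "small_functor (fst X) (fst Y) K'"
    and J: "grothendieck_topology (fst Y) (snd Y)"
    and \<theta>: "nat_transformation (fst X) (fst Y) K K' \<theta>" "\<And>A. A \<in> Obj (fst X) \<Longrightarrow> isomorphism (fst Y) (\<theta>
        A)"
    and f: "cover_flat X Y K"
  shows "cover_flat X Y K'"
  unfolding cover_flat_iff flat_at_def
proof (intro allI impI, elim conjE)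
  note [simp] = small_functorD[OF K] small_functorD[OF K'] nat_transformationD(2-4)[OF \<theta>(1)] \<theta>(2)
  fix I :: "('u, 'u) cat" and D U \<tau>
  assume I: "finite_category I" and D: "small_functor I (fst X) D"
    and c: "cone I (fst Y) (fct_comp I K' D) U \<tau>"
  note [simp] = small_functorD[OF D]
  have [simp]: "U \<in> Obj (fst Y)" "i \<in> Obj I \<Longrightarrow> \<tau> i \<in> Arr (fst Y)" "i \<in> Obj I \<Longrightarrow> Dom (fst Y) (\<tau> i) = U"
    "i \<in> Obj I \<Longrightarrow> Cod (fst Y) (\<tau> i) = omap K' (omap D i)" for i
    using coneD(1-4)[OF c] by simp_all
  let ?t = "\<lambda>i. inv_arr (fst Y) (\<theta> (omap D i)) \<cdot>\<^bsub>fst Y\<^esub> \<tau> i"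
  have c': "cone I (fst Y) (fct_comp I K D) U ?t"
  proof (rule coneI)
    fix u assume u: "u \<in> Arr I"
    let ?a = "\<theta> (omap D (Dom I u))" and ?b = "\<theta> (omap D (Cod I u))"
    have n: "amap K' (amap D u) \<cdot>\<^bsub>fst Y\<^esub> ?a = ?b \<cdot>\<^bsub>fst Y\<^esub> amap K (amap D u)"
      using nat_transformationD(5)[OF \<theta>(1), of "amap D u"] u by simp
    have "amap K (amap D u) \<cdot>\<^bsub>fst Y\<^esub> ?t (Dom I u) =
        inv_arr (fst Y) ?b \<cdot>\<^bsub>fst Y\<^esub> ((?b \<cdot>\<^bsub>fst Y\<^esub> amap K (amap D u)) \<cdot>\<^bsub>fst Y\<^esub> ?t (Dom I u))"
      using u by (simp add: Cmp_assoc)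
    also have "\<dots> = inv_arr (fst Y) ?b \<cdot>\<^bsub>fst Y\<^esub> (amap K' (amap D u) \<cdot>\<^bsub>fst Y\<^esub> \<tau> (Dom I u))"
      unfolding n[symmetric] using u by (simp add: Cmp_assoc)
    also have "\<dots> = ?t (Cod I u)"
      using coneD(5)[OF c u] u by simp
    finally show "amap (fct_comp I K D) u \<cdot>\<^bsub>fst Y\<^esub> ?t (Dom I u) = ?t (Cod I u)"
      using u by simp
  qed simp_all
  have Z: "flat_sieve I (fst X) (fst Y) K D U ?t \<in> snd Y U"
    using f I D c' unfolding cover_flat_iff flat_at_def by blast
  show "flat_sieve I (fst X) (fst Y) K' D U \<tau> \<in> snd Y U"
  proof (rule topology_superset[OF _ J Z sieve_flat_sieve[OF K' D c]])
    show "flat_sieve I (fst X) (fst Y) K D U ?t \<subseteq> flat_sieve I (fst X) (fst Y) K' D U \<tau>"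
    proof
      fix h assume "h \<in> flat_sieve I (fst X) (fst Y) K D U ?t"
      then obtain W \<sigma> g where h: "h \<in> Arr (fst Y)" "Cod (fst Y) h = U" and \<sigma>: "cone I (fst X) D W \<sigma>"
        and g: "g \<in> Arr (fst Y)" "Dom (fst Y) g = Dom (fst Y) h" "Cod (fst Y) g = omap K W"
        and e: "\<And>i. i \<in> Obj I \<Longrightarrow> ?t i \<cdot>\<^bsub>fst Y\<^esub> h = amap K (\<sigma> i) \<cdot>\<^bsub>fst Y\<^esub> g"
        by (rule flat_sieveE) blast
      note [simp] = coneD(1-4)[OF \<sigma>]
      show "h \<in> flat_sieve I (fst X) (fst Y) K' D U \<tau>"
      proof (rule flat_sieveI[OF h \<sigma>, of "\<theta> W \<cdot>\<^bsub>fst Y\<^esub> g"])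
        fix i assume i: "i \<in> Obj I"
        have n: "amap K' (\<sigma> i) \<cdot>\<^bsub>fst Y\<^esub> \<theta> W = \<theta> (omap D i) \<cdot>\<^bsub>fst Y\<^esub> amap K (\<sigma> i)"
          using nat_transformationD(5)[OF \<theta>(1), of "\<sigma> i"] i by simp
        have "\<tau> i \<cdot>\<^bsub>fst Y\<^esub> h = \<theta> (omap D i) \<cdot>\<^bsub>fst Y\<^esub> (?t i \<cdot>\<^bsub>fst Y\<^esub> h)"
          using i h by (simp add: Cmp_assoc)
        also have "\<dots> = (\<theta> (omap D i) \<cdot>\<^bsub>fst Y\<^esub> amap K (\<sigma> i)) \<cdot>\<^bsub>fst Y\<^esub> g"
          unfolding e[OF i] using i g by (simp add: Cmp_assoc)
        also have "\<dots> = amap K' (\<sigma> i) \<cdot>\<^bsub>fst Y\<^esub> (\<theta> W \<cdot>\<^bsub>fst Y\<^esub> g)"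
          unfolding n[symmetric] using i g by (simp add: Cmp_assoc)
        finally show "\<tau> i \<cdot>\<^bsub>fst Y\<^esub> h = amap K' (\<sigma> i) \<cdot>\<^bsub>fst Y\<^esub> (\<theta> W \<cdot>\<^bsub>fst Y\<^esub> g)" .
      qed (use g in simp_all)
    qed
  qed simp
qed

text \<open>Naturality writes \<open>f\<close> as the conjugate of \<open>E (P f)\<close> by
  \<open>\<psi>\<close>, so \<open>P f\<close> determines \<open>f\<close>. The same formula with
  \<open>u\<close> in place of \<open>P f\<close> defines a preimage of \<open>u\<close>.\<close>

lemma inverse_equivalence_ff:
  fixes E P :: "'u fct"
  assumes E: "small_functor C D E" and full: "full_on C D (omap E) (amap E)"
    and faith: "faithful_on C (amap E)" and P: "small_functor D C P"
    and \<psi>: "nat_transformation D D (fct_comp D E P) (fct_id D) \<psi>" "\<And>X. X \<in> Obj D \<Longrightarrow> isomorphism D (\<psi>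
        X)"
  shows "full_on D C (omap P) (amap P)" "faithful_on D (amap P)" "ess_surj D C (omap P)"
proof -
  note [simp] = small_functorD[OF E] small_functorD[OF P] nat_transformationD(2-4)[OF \<psi>(1)] \<psi>(2)
  have n: "f \<cdot>\<^bsub>D\<^esub> \<psi> (Dom D f) = \<psi> (Cod D f) \<cdot>\<^bsub>D\<^esub> amap E (amap P f)" if "f \<in> Arr D" for f
    using nat_transformationD(5)[OF \<psi>(1) that] that by simp
  show "faithful_on D (amap P)"
    unfolding faithful_on_def
  proof (intro ballI impI, elim conjE)
    fix f g assume *: "f \<in> Arr D" "g \<in> Arr D" "Dom D f = Dom D g" "Cod D f = Cod D g" "amap P f =
        amap P g"
    then have "f \<cdot>\<^bsub>D\<^esub> \<psi> (Dom D g) = g \<cdot>\<^bsub>D\<^esub> \<psi> (Dom D g)"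
      using n[of f] n[of g] by simp
    then show "f = g"
      using * by - (rule isomorphism_right_cancel[of D "\<psi> (Dom D g)"], simp_all)
  qed
  show "full_on D C (omap P) (amap P)"
    unfolding full_on_def
  proof (intro ballI impI, elim conjE)
    fix X Y u assume *: "X \<in> Obj D" "Y \<in> Obj D" "u \<in> Arr C" "Dom C u = omap P X" "Cod C u = omap P
        Y"
    let ?f = "\<psi> Y \<cdot>\<^bsub>D\<^esub> (amap E u \<cdot>\<^bsub>D\<^esub> inv_arr D (\<psi> X))"
    have f: "?f \<in> Arr D" "Dom D ?f = X" "Cod D ?f = Y"
      using * by simp_all
    have "\<psi> Y \<cdot>\<^bsub>D\<^esub> amap E (amap P ?f) = \<psi> Y \<cdot>\<^bsub>D\<^esub> amap E u"
      using n[OF f(1)] f * by (simp add: Cmp_assoc)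
    then have "amap E (amap P ?f) = amap E u"
      using f * by - (rule isomorphism_left_cancel[of D "\<psi> Y"], simp_all)
    then have "amap P ?f = u"
      using f * by - (rule faithfulD[OF faith], simp_all)
    then show "\<exists>f\<in>Arr D. Dom D f = X \<and> Cod D f = Y \<and> amap P f = u"
      using f by blast
  qed
  obtain \<theta> where \<theta>: "nat_transformation C C (fct_id C) (fct_comp C P E) \<theta>" "\<And>A. A \<in> Obj C \<Longrightarrow>
      isomorphism C (\<theta> A)"
    using assms by (rule equivalence_unit) blast+
  show "ess_surj D C (omap P)"
    unfolding ess_surj_def
  proof (intro ballI)
    fix A assume A: "A \<in> Obj C"
    show "\<exists>B\<in>Obj D. \<exists>e. isomorphism C e \<and> Dom C e = omap P B \<and> Cod C e = A"
      by (rule bexI[of _ "omap E A"], rule exI[of _ "inv_arr C (\<theta> A)"])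
        (use A \<theta>(2)[OF A] nat_transformationD(2-4)[OF \<theta>(1) A] in simp_all)
  qed
qed


section \<open>The unit as a morphism of sites\<close>

definition eta_morph :: "'u::universe gsite \<Rightarrow> ('u gsite, 'u) morph" where
  "eta_morph X = \<lparr>src = X, tgt = L_site (G_site X), fct = eta_fct (fst X)\<rparr>"

lemma eta_morph_sel [simp]: "src (eta_morph X) = X" "tgt (eta_morph X) = L_site (G_site X)"
  "fct (eta_morph X) = eta_fct (fst X)"
  by (simp_all add: eta_morph_def)

lemma LG_site_lc: "X \<in> lc_sites \<Longrightarrow> L_site (G_site X) \<in> lc_sites"
  by (simp add: L_site_lc G_site_max)

lemma eta_covers_iff':
  assumes X: "X \<in> lc_sites" and R: "sieve (fst X) A R"
  shows "generated_sieve (L_cat (G_ogpd (fst X))) (amap (eta_fct (fst X)) ` R) \<in>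
      J_of (G_site X) (subob (fst X) (Ide (fst X) A)) \<longleftrightarrow> R \<in> snd X A"
  using lc_category.eta_covers_iff[OF lc_sites_lc_category[OF X] lc_sitesD(4)[OF X] R] by simp

lemma eta_morph_lc:
  assumes X: "X \<in> lc_sites"
  shows "eta_morph X \<in> lc_morphs"
proof -
  interpret lc_category "fst X"
    using X by (rule lc_sites_lc_category)
  note J = lc_sitesD(4)[OF X]
  have "cover_preserving X (L_site (G_site X)) (eta_fct (fst X))"
    unfolding cover_preserving_def using eta_covers_iff'[OF X topologyD(1)[OF J]] by simp
  moreover have "cover_flat X (L_site (G_site X)) (eta_fct (fst X))"
    by (rule cover_flat_equivalence[OF _ lc_sitesD(4)[OF LG_site_lc[OF X]]])
      (use small_functor_eta full_eta faithful_eta ess_surj_eta in simp_all)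
  ultimately show ?thesis
    unfolding lc_morphs_def using X LG_site_lc[OF X] small_functor_eta by simp
qed

text \<open>Flatness of the chosen \<open>P\<close> is automatic. For a cover \<open>S\<close> of
  \<open>Y\<close> the image of \<open>S\<close> under \<open>P\<close> covers because the unit
  reflects covers: in \<open>LG\<close> the sieve generated by its image under the unit contains the
  pullback of \<open>S\<close> along \<open>\<psi> Y\<close>.\<close>

lemma eta_inverse:
  assumes X: "X \<in> lc_sites"
  obtains p \<psi> where "p \<in> lc_morphs" "src p = L_site (G_site X)" "tgt p = X"
    "nat_transformation (L_cat (G_ogpd (fst X))) (L_cat (G_ogpd (fst X)))
      (fct_comp (L_cat (G_ogpd (fst X))) (eta_fct (fst X)) (fct p)) (fct_id (L_cat (G_ogpd (fst
          X)))) \<psi>"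
    "\<And>Y. Y \<in> Obj (L_cat (G_ogpd (fst X))) \<Longrightarrow> isomorphism (L_cat (G_ogpd (fst X))) (\<psi> Y)"
proof -
  interpret lc_category "fst X"
    using X by (rule lc_sites_lc_category)
  note J = lc_sitesD(4)[OF X]
  note J' = lc_sitesD(4)[OF LG_site_lc[OF X], simplified]
  obtain P \<psi> where P: "small_functor LG (fst X) P"
    and \<psi>: "nat_transformation LG LG (fct_comp LG (eta_fct (fst X)) P) (fct_id LG) \<psi>"
      "\<And>Y. Y \<in> Obj LG \<Longrightarrow> isomorphism LG (\<psi> Y)"
    using small_functor_eta full_eta faithful_eta ess_surj_eta by (rule equivalence_inverse) blast
  define p where "p = \<lparr>src = L_site (G_site X), tgt = X, fct = P\<rparr>"
  have [simp]: "src p = L_site (G_site X)" "tgt p = X" "fct p = P"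
    by (simp_all add: p_def)
  note ff = inverse_equivalence_ff[OF small_functor_eta full_eta faithful_eta P \<psi>]
  note [simp] = small_functorD[OF P] small_functorD(6-11)[OF small_functor_eta]
      nat_transformationD(2-4)[OF \<psi>(1)] \<psi>(2)
  have "cover_flat (L_site (G_site X)) X P"
    by (rule cover_flat_equivalence[OF _ J]) (use P ff in simp_all)
  moreover have "cover_preserving (L_site (G_site X)) X P"
    unfolding cover_preserving_def
  proof (intro ballI)
    fix Y S assume "Y \<in> Obj (fst (L_site (G_site X)))" "S \<in> snd (L_site (G_site X)) Y"
    then have Y: "Y \<in> Obj LG" and S: "S \<in> J_of (G_site X) Y"
      by simp_all
    note S' = sieveD[OF topologyD(1)[OF J' S]]
    let ?R = "generated_sieve (fst X) (amap P ` S)"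
    have R: "sieve (fst X) (omap P Y) ?R"
      by (rule sieve_generated_sieve) (use Y S' in auto)
    have Q: "sieve_pullback LG (\<psi> Y) S \<in> J_of (G_site X) (omap (eta_fct (fst X)) (omap P Y))"
      using topologyD(3)[OF J', of "\<psi> Y" S] S Y by simp
    have "generated_sieve LG (amap (eta_fct (fst X)) ` ?R) \<in> J_of (G_site X) (omap (eta_fct (fst X))
        (omap P Y))"
    proof (rule topology_superset[OF category_LG J' Q])
      show "sieve LG (omap (eta_fct (fst X)) (omap P Y)) (generated_sieve LG (amap (eta_fct (fst X))
          ` ?R))"
        using sieve_generated_eta[OF R] Y by simp
      show "sieve_pullback LG (\<psi> Y) S \<subseteq> generated_sieve LG (amap (eta_fct (fst X)) ` ?R)"
      proof
        fix s assume "s \<in> sieve_pullback LG (\<psi> Y) S"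
        then have s: "s \<in> Arr LG" "Cod LG s = omap (eta_fct (fst X)) (omap P Y)" and sS: "\<psi> Y \<cdot>\<^bsub>LG\<^esub> s
            \<in> S"
          unfolding sieve_pullback_def using Y by simp_all
        let ?f = "\<psi> Y \<cdot>\<^bsub>LG\<^esub> s" and ?D = "Dom LG s"
        have f: "?f \<in> Arr LG" "Dom LG ?f = ?D" "Cod LG ?f = Y"
          using s Y by simp_all
        have n: "?f \<cdot>\<^bsub>LG\<^esub> \<psi> ?D = \<psi> Y \<cdot>\<^bsub>LG\<^esub> amap (eta_fct (fst X)) (amap P ?f)"
          using nat_transformationD(5)[OF \<psi>(1) f(1)] f by simp
        have "s \<cdot>\<^bsub>LG\<^esub> \<psi> ?D = amap (eta_fct (fst X)) (amap P ?f)"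
          using n s Y f by - (rule isomorphism_left_cancel[of LG "\<psi> Y"], simp_all add: Cmp_assoc
              del: small_functorD(11)[OF P] small_functorD(11)[OF small_functor_eta])
        moreover have "s = (s \<cdot>\<^bsub>LG\<^esub> \<psi> ?D) \<cdot>\<^bsub>LG\<^esub> inv_arr LG (\<psi> ?D)"
          using s Y by (simp add: Cmp_assoc)
        \<comment> \<open>With \<open>?f\<close> the composite of \<open>s\<close> and
          \<open>\<psi> Y\<close>, a member of \<open>S\<close>, naturality factors \<open>s\<close>
          through the unit applied to \<open>amap P ?f\<close>.\<close>
        ultimately have e: "s = amap (eta_fct (fst X)) (amap P ?f) \<cdot>\<^bsub>LG\<^esub> inv_arr LG (\<psi> ?D)"
          by simp
        have "amap P ?f \<in> ?R"
          by (rule subset_generated_sieve[OF cat imageI[OF sS]]) (use f in simp)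
        moreover have "Cod LG (inv_arr LG (\<psi> ?D)) = Dom LG (amap (eta_fct (fst X)) (amap P ?f))"
          "inv_arr LG (\<psi> ?D) \<in> Arr LG"
          using s f by (simp_all del: small_functorD(11)[OF P])
        ultimately show "s \<in> generated_sieve LG (amap (eta_fct (fst X)) ` ?R)"
          unfolding generated_sieve_def[of LG] using e by blast
      qed
    qed
    then show "generated_sieve (fst X) (amap P ` S) \<in> snd X (omap P Y)"
      using eta_covers_iff'[OF X R] Y by simp
  qed
  ultimately have "p \<in> lc_morphs"
    unfolding lc_morphs_def using X LG_site_lc[OF X] P by simp
  then show thesis
    using \<psi> by (intro that[of p \<psi>]) simp_all
qed

lemma equivalence_eta:
  fixes X :: "'u::universe gsite"
  assumes X: "X \<in> lc_sites"
  shows "equivalence_in lcGsite (eta_morph X)"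
proof -
  interpret lc_category "fst X"
    using X by (rule lc_sites_lc_category)
  obtain p \<psi> where p: "p \<in> lc_morphs" "src p = L_site (G_site X)" "tgt p = X"
    and \<psi>: "nat_transformation LG LG (fct_comp LG (eta_fct (fst X)) (fct p)) (fct_id LG) \<psi>"
    "\<And>Y. Y \<in> Obj LG \<Longrightarrow> isomorphism LG (\<psi> Y)"
    using X by (rule eta_inverse) blast
  have P: "small_functor LG (fst X) (fct p)"
    using lc_morphsD(3)[OF p(1)] p by simp
  obtain \<theta> where \<theta>: "nat_transformation (fst X) (fst X) (fct_id (fst X)) (fct_comp (fst X) (fct p)
      (eta_fct (fst X))) \<theta>"
    "\<And>A. A \<in> Obj (fst X) \<Longrightarrow> isomorphism (fst X) (\<theta> A)"
    using small_functor_eta full_eta faithful_eta P \<psi> by (rule equivalence_unit) blast+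
  note e = eta_morph_lc[OF X]
  let ?a = "\<lparr>nsrc = morph_id X, ntgt = morph_comp p (eta_morph X), ncomp = \<theta>\<rparr>"
  let ?b = "\<lparr>nsrc = morph_comp (eta_morph X) p, ntgt = morph_id (L_site (G_site X)), ncomp = \<psi>\<rparr>"
  have a: "?a \<in> lc_nats" and b: "?b \<in> lc_nats"
    unfolding lc_nats_def using X p e \<theta> \<psi> LG_site_lc[OF X] by (simp_all add: morph_id_lc
        morph_comp_lc)
  have "isomorphism (Vert lcGsite) ?a" "isomorphism (Vert lcGsite) ?b"
    using isomorphism_nat2[OF a] isomorphism_nat2[OF b] \<theta> \<psi> p by simp_all
  then show ?thesis
    unfolding equivalence_in_def
  proof (intro conjI bexI[of _ p])
    show "\<exists>a. isomorphism (Vert lcGsite) a \<and> Dom (Vert lcGsite) a = Ide (One lcGsite) (Dom (One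
        lcGsite) (eta_morph X)) \<and>
        Cod (Vert lcGsite) a = p \<cdot>\<^bsub>One lcGsite\<^esub> eta_morph X"
      by (rule exI[of _ ?a]) (use \<open>isomorphism (Vert lcGsite) ?a\<close> in simp)
    show "\<exists>b. isomorphism (Vert lcGsite) b \<and> Dom (Vert lcGsite) b = eta_morph X \<cdot>\<^bsub>One lcGsite\<^esub> p \<and>
        Cod (Vert lcGsite) b = Ide (One lcGsite) (Cod (One lcGsite) (eta_morph X))"
      by (rule exI[of _ ?b]) (use \<open>isomorphism (Vert lcGsite) ?b\<close> in simp)
  qed (use e p in simp_all)
qed


section \<open>The 2-functor from sites to Ehresmann sites\<close>

lemma G_morph_sel [simp]: "src (G_morph F) = G_site (src F)" "tgt (G_morph F) = G_site (tgt F)"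
  "fct (G_morph F) = G_fct (fst (src F)) (fst (tgt F)) (fct F)"
  by (simp_all add: G_morph_def)

lemma lc_functor_morph:
  assumes "F \<in> lc_morphs"
  shows "lc_functor (fst (src F)) (fst (tgt F)) (fct F)"
  using lc_morphsD[OF assms] lc_sites_lc_category[of "src F"] lc_sites_lc_category[of "tgt F"]
  unfolding lc_functor_def lc_functor_axioms_def by auto

lemma eta_morph_natural:
  assumes F: "F \<in> lc_morphs"
  shows "morph_comp (L_morph (G_morph F)) (eta_morph (src F)) = morph_comp (eta_morph (tgt F)) F"
  by (rule morph_eqI) (use eta_natural[OF lc_functor_morph[OF F]] in simp_all)

lemma G_morph_max:
  assumes F: "F \<in> lc_morphs"
  shows "G_morph F \<in> max_morphs"
proof -
  note f = lc_morphsD[OF F]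
  interpret lc_functor "fst (src F)" "fst (tgt F)" "fct F"
    using F by (rule lc_functor_morph)
  note df = double_functor_G_map[OF equivariant_functor, folded G_fct_eq]
  let ?X = "src F" and ?Y = "tgt F"
  let ?K = "L_fct (G_ogpd (fst ?X)) (G_fct (fst ?X) (fst ?Y) (fct F))"
  have K: "small_functor C.LG C'.LG ?K"
    by (rule small_functor_L_fct[OF C.ordered_groupoid_G C'.ordered_groupoid_G df])
  obtain p \<psi> where p: "p \<in> lc_morphs" "src p = L_site (G_site ?X)" "tgt p = ?X"
    and \<psi>: "nat_transformation C.LG C.LG (fct_comp C.LG (eta_fct (fst ?X)) (fct p)) (fct_id C.LG) \<psi>"
    "\<And>Y. Y \<in> Obj C.LG \<Longrightarrow> isomorphism C.LG (\<psi> Y)"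
    using f(1) by (rule eta_inverse) blast
  have P: "small_functor C.LG (fst ?X) (fct p)"
    using lc_morphsD(3)[OF p(1)] p by simp
  let ?H = "morph_comp (morph_comp (eta_morph ?Y) F) p"
  have H: "?H \<in> lc_morphs"
    using F p f eta_morph_lc by (intro morph_comp_lc) simp_all
  have eH: "fct ?H = fct_comp C.LG ?K (fct_comp C.LG (eta_fct (fst ?X)) (fct p))"
    using eta_natural[OF lc_functor_axioms] fct_comp_assoc[OF P C.small_functor_eta K] p by simp
  note h = lc_morphsD[OF H, unfolded eH]
  note [simp] = small_functorD[OF K] small_functorD[OF P] small_functorD(6-11)[OF
      C.small_functor_eta] nat_transformationD(2-4)[OF \<psi>(1)]
  \<comment> \<open>\<open>\<psi>\<close> whiskered with \<open>?K\<close>. Naturality of the unit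
    makes \<open>fct ?H\<close> equal to \<open>?K\<close> after the unit after
    \<open>fct p\<close>, so this isomorphism leads from a morphism of sites to
    \<open>?K\<close>.\<close>
  define \<theta> where "\<theta> = (\<lambda>Y\<in>Obj C.LG. amap ?K (\<psi> Y))"
  have [simp]: "Y \<in> Obj C.LG \<Longrightarrow> \<theta> Y = amap ?K (\<psi> Y)" for Y
    by (simp add: \<theta>_def)
  have n: "amap ?K g \<cdot>\<^bsub>C'.LG\<^esub> amap ?K (\<psi> (Dom C.LG g)) =
      amap ?K (\<psi> (Cod C.LG g)) \<cdot>\<^bsub>C'.LG\<^esub> amap ?K (amap (eta_fct (fst ?X)) (amap (fct p) g))" if g: "g \<in>
          Arr C.LG" for g
    using arg_cong[OF nat_transformationD(5)[OF \<psi>(1) g], of "amap ?K"] g by simp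
  have \<theta>: "nat_transformation C.LG C'.LG (fct_comp C.LG ?K (fct_comp C.LG (eta_fct (fst ?X)) (fct
      p))) ?K \<theta>"
    unfolding nat_transformation_def
  proof (intro conjI ballI)
    show "\<theta> \<in> extensional (Obj C.LG)"
      by (simp add: \<theta>_def)
  qed (simp_all add: n)
  have i: "isomorphism C'.LG (\<theta> Y)" if "Y \<in> Obj C.LG" for Y
    using that functor_isomorphism[OF small_functorD(3)[OF K] \<psi>(2)[OF that]] by simp
  have J: "grothendieck_topology (fst (L_site (G_site ?X))) (snd (L_site (G_site ?X)))"
    "grothendieck_topology (fst (L_site (G_site ?Y))) (snd (L_site (G_site ?Y)))"
    using lc_sitesD(4)[OF LG_site_lc] f by simp_all
  have "cover_preserving (L_site (G_site ?X)) (L_site (G_site ?Y)) ?K"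
    by (rule cover_preserving_nat_iso[where \<theta> = \<theta> and K = "fct_comp C.LG ?K (fct_comp C.LG (eta_fct
        (fst ?X)) (fct p))"])
      (use K h p J \<theta> i in simp_all)
  moreover have "cover_flat (L_site (G_site ?X)) (L_site (G_site ?Y)) ?K"
    by (rule cover_flat_nat_iso[where \<theta> = \<theta> and K = "fct_comp C.LG ?K (fct_comp C.LG (eta_fct (fst
        ?X)) (fct p))"])
      (use K h p J \<theta> i in simp_all)
  ultimately have "L_morph (G_morph F) \<in> lc_morphs"
    unfolding lc_morphs_def using K f by (simp add: LG_site_lc)
  then show ?thesis
    using max_morphs_iff[of "G_morph F"] f df by (simp add: G_site_max)
qed

lemma G_morph_id:
  assumes X: "X \<in> lc_sites"
  shows "G_morph (morph_id X) = morph_id (G_site X)"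
proof (rule morph_eqI)
  interpret lc_functor "fst X" "fst X" "fct_id (fst X)"
    using lc_functor_morph[OF morph_id_lc[OF X]] by simp
  note [simp] = omap_G_map[OF equivariant_functor] amap_G_map[OF equivariant_functor]
  note df = double_functor_G_map[OF equivariant_functor]
  have "G_map (fst X) (fst X) (amap (fct_id (fst X))) = fct_id (G_ogpd (fst X))"
    by (rule small_functor_eqI[OF double_functorD(1)[OF df] small_functor_id[OF C.category_G_ogpd]])
      (auto elim!: C.G_ObjE C.G_ArrE)
  then show "fct (G_morph (morph_id X)) = fct (morph_id (G_site X))"
    by (simp add: G_fct_eq)
qed simp_all

lemma G_morph_comp:
  assumes F: "F \<in> lc_morphs" and H: "H \<in> lc_morphs" and e: "tgt F = src H"
  shows "G_morph (morph_comp H F) = morph_comp (G_morph H) (G_morph F)"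
proof (rule morph_eqI)
  interpret F: lc_functor "fst (src F)" "fst (src H)" "fct F"
    using lc_functor_morph[OF F] e by simp
  interpret H: lc_functor "fst (src H)" "fst (tgt H)" "fct H"
    using lc_functor_morph[OF H] .
  interpret HF: lc_functor "fst (src F)" "fst (tgt H)" "fct_comp (fst (src F)) (fct H) (fct F)"
    using lc_functor_morph[OF morph_comp_lc[OF F H e]] by simp
  note [simp] = F.omap_G_map[OF F.equivariant_functor] F.amap_G_map[OF F.equivariant_functor]
    H.omap_G_map[OF H.equivariant_functor] H.amap_G_map[OF H.equivariant_functor]
    HF.omap_G_map[OF HF.equivariant_functor] HF.amap_G_map[OF HF.equivariant_functor]
    F.equivariantD[OF F.equivariant_functor]
  note df = F.double_functor_G_map[OF F.equivariant_functor] H.double_functor_G_map[OF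
      H.equivariant_functor]
    HF.double_functor_G_map[OF HF.equivariant_functor]
  have "G_map (fst (src F)) (fst (tgt H)) (amap (fct_comp (fst (src F)) (fct H) (fct F))) =
      fct_comp (G_ogpd (fst (src F))) (G_map (fst (src H)) (fst (tgt H)) (amap (fct H))) (G_map (fst
          (src F)) (fst (src H)) (amap (fct F)))"
    by (rule small_functor_eqI[OF double_functorD(1)[OF df(3)] small_functor_comp[OF
        double_functorD(1)[OF df(1)] double_functorD(1)[OF df(2)]]])
      (auto elim!: F.C.G_ObjE F.C.G_ArrE)
  then show "fct (G_morph (morph_comp H F)) = fct (morph_comp (G_morph H) (G_morph F))"
    using e by (simp add: G_fct_eq)
qed simp_all

lemma is_functor_One_G: "is_functor (One lcGsite) (One Esite_max) G_site G_morph"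
  by (rule functorI)
    (simp_all add: category_One_lcGsite functorD(1)[OF is_functor_One_L] G_site_max G_morph_id
        G_morph_max G_morph_comp)

section \<open>The action on 2-cells\<close>

definition nat_map :: "'u::universe nat2 \<Rightarrow> 'u \<Rightarrow> 'u" where
  "nat_map \<theta> m = amap (fct (ntgt \<theta>)) m \<cdot>\<^bsub>fst (tgt (nsrc \<theta>))\<^esub> ncomp \<theta> (Dom (fst (src (nsrc \<theta>))) m)"

lemma G_nat_sel:
  "lsrc (G_nat \<theta>) = G_morph (nsrc \<theta>)" "ltgt (G_nat \<theta>) = G_morph (ntgt \<theta>)"
  "lmid (G_nat \<theta>) = G_map (fst (src (nsrc \<theta>))) (fst (tgt (nsrc \<theta>))) (nat_map \<theta>)"
  "lcomp (G_nat \<theta>) = G_comp (fst (src (nsrc \<theta>))) (fst (tgt (nsrc \<theta>))) (amap (fct (nsrc \<theta>))) (nat_map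
      \<theta>)"
  by (simp_all add: G_nat_def G_map_def G_comp_def nat_map_def Let_def)

text \<open>Naturality of \<open>\<theta>\<close> at \<open>h\<close> moves the image of
  \<open>h\<close> past the component, where it changes from the value of the target functor to that
  of the source functor.\<close>

lemma equivariant_nat_map:
  assumes \<theta>: "\<theta> \<in> lc_nats"
  shows "equivariant (fst (src (nsrc \<theta>))) (fst (tgt (nsrc \<theta>))) (fct (nsrc \<theta>)) (nat_map \<theta>)"
proof -
  note t = lc_natsD[OF \<theta>]
  note [simp] = small_functorD[OF lc_morphsD(3)[OF t(1)]] small_functorD[OF lc_morphsD(3)[OF t(2),
      unfolded t]]
    nat_transformationD(2-4)[OF t(5)]
  let ?C = "fst (src (nsrc \<theta>))" and ?D = "fst (tgt (nsrc \<theta>))"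
  have "nat_map \<theta> (m \<cdot>\<^bsub>?C\<^esub> h) = nat_map \<theta> m \<cdot>\<^bsub>?D\<^esub> amap (fct (nsrc \<theta>)) h"
    if h: "m \<in> Arr ?C" "h \<in> Arr ?C" "Cod ?C h = Dom ?C m" for m h
    using h nat_transformationD(5)[OF t(5) h(2)] by (simp add: nat_map_def Cmp_assoc)
  then show ?thesis
    unfolding equivariant_def by (simp add: nat_map_def)
qed

lemma G_nat_subob:
  assumes \<theta>: "\<theta> \<in> lc_nats" and m: "m \<in> Arr (fst (src (nsrc \<theta>)))"
  shows "omap (lmid (G_nat \<theta>)) (subob (fst (src (nsrc \<theta>))) m) = subob (fst (tgt (nsrc \<theta>))) (nat_map
      \<theta> m)"
    "lcomp (G_nat \<theta>) (subob (fst (src (nsrc \<theta>))) m) = spancl (fst (tgt (nsrc \<theta>))) (amap (fct (nsrc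
        \<theta>)) m) (nat_map \<theta> m)"
proof -
  interpret lc_functor "fst (src (nsrc \<theta>))" "fst (tgt (nsrc \<theta>))" "fct (nsrc \<theta>)"
    using lc_natsD(1)[OF \<theta>] by (rule lc_functor_morph)
  show "omap (lmid (G_nat \<theta>)) (subob (fst (src (nsrc \<theta>))) m) = subob (fst (tgt (nsrc \<theta>))) (nat_map \<theta>
      m)"
    "lcomp (G_nat \<theta>) (subob (fst (src (nsrc \<theta>))) m) = spancl (fst (tgt (nsrc \<theta>))) (amap (fct (nsrc
        \<theta>)) m) (nat_map \<theta> m)"
    using omap_G_map[OF equivariant_nat_map[OF \<theta>] m] G_comp_subob[OF equivariant_functor
        equivariant_nat_map[OF \<theta>] m]
    by (simp_all add: G_nat_sel)
qed

text \<open>The middle double functor lies below the image of the target functor, because both legs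
  of a span acquire the same factor, the component of \<open>\<theta>\<close> at the apex.\<close>

lemma G_nat_max:
  assumes \<theta>: "\<theta> \<in> lc_nats"
  shows "G_nat \<theta> \<in> max_lams"
proof -
  note t = lc_natsD[OF \<theta>]
  interpret lc_functor "fst (src (nsrc \<theta>))" "fst (tgt (nsrc \<theta>))" "fct (nsrc \<theta>)"
    using t(1) by (rule lc_functor_morph)
  interpret K': lc_functor "fst (src (nsrc \<theta>))" "fst (tgt (nsrc \<theta>))" "fct (ntgt \<theta>)"
    using lc_functor_morph[OF t(2)] t by simp
  note eq = equivariant_nat_map[OF \<theta>]
  let ?C = "fst (src (nsrc \<theta>))" and ?D = "fst (tgt (nsrc \<theta>))"
  have "fct_le (G_ogpd ?C) (G_ogpd ?D) (G_map ?C ?D (nat_map \<theta>)) (G_map ?C ?D (amap (fct (ntgt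
      \<theta>))))"
    unfolding fct_le_def
  proof (intro ballI)
    fix x assume "x \<in> Arr (G_ogpd ?C)"
    then obtain m n where x: "x = spancl ?C m n" "is_span ?C m n"
      by (rule C.G_ArrE)
    then have "m \<in> Arr ?C" "n \<in> Arr ?C" "Dom ?C n = Dom ?C m"
      by (simp_all add: C.span_Dom)
    then show "(amap (G_map ?C ?D (nat_map \<theta>)) x, amap (G_map ?C ?D (amap (fct (ntgt \<theta>)))) x) \<in> Le
        (G_ogpd ?D)"
      using amap_G_map[OF eq x(2)] K'.amap_G_map[OF K'.equivariant_functor x(2)] x
        K'.equivariantD(4)[OF K'.equivariant_functor x(2)] nat_transformationD(2-4)[OF t(5), of "Dom
            ?C m"]
      by (simp add: nat_map_def)
  qed
  then show ?thesis
    unfolding max_lams_def lam_transformation_def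
    using t double_functor_G_map[OF eq] hor_transformation_G_comp[OF equivariant_functor eq]
    by (simp add: G_nat_sel G_morph_max G_fct_eq)
qed

lemma G_nat_id:
  assumes F: "F \<in> lc_morphs"
  shows "G_nat (nat2_id F) = lam2_id (G_morph F)"
proof (rule lam2_eqI)
  note f = G_morph_max[OF F] and n = nat2_id_lc[OF F]
  interpret lc_functor "fst (src F)" "fst (tgt F)" "fct F"
    using F by (rule lc_functor_morph)
  show "G_nat (nat2_id F) \<in> max_lams" "lam2_id (G_morph F) \<in> max_lams"
    using f n by (simp_all add: G_nat_max lam2_id)
  fix X assume "X \<in> Obj (fst (src (lsrc (lam2_id (G_morph F)))))"
  then obtain m where m: "X = subob (fst (src F)) m" "m \<in> Arr (fst (src F))"
    by (auto elim: C.G_ObjE)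
  then show "lcomp (G_nat (nat2_id F)) X = lcomp (lam2_id (G_morph F)) X"
    using G_nat_subob(2)[OF n, of m] omap_G_map[OF equivariant_functor m(2)]
    by (simp add: lam2_id_def nat_map_def G_fct_eq)
qed (simp_all add: G_nat_sel)

text \<open>By \<open>lam2_eqI\<close> only components are compared. Restricting the component of
  \<open>G_nat \<phi>\<close> to the middle subobject composes both its legs with the component of
  \<open>\<theta>\<close> at \<open>Dom ?C m\<close>, after which the two spans share a leg and
  compose.\<close>

lemma G_nat_vcomp:
  assumes \<theta>: "\<theta> \<in> lc_nats" and \<phi>: "\<phi> \<in> lc_nats" and e: "ntgt \<theta> = nsrc \<phi>"
  shows "G_nat (nat2_vcomp \<phi> \<theta>) = lam2_vcomp (G_nat \<phi>) (G_nat \<theta>)"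
proof (rule lam2_eqI)
  note t = lc_natsD[OF \<theta>, unfolded e] and p = lc_natsD[OF \<phi>, unfolded lc_natsD(3,4)[OF \<theta>, unfolded
      e]]
  note n = nat2_vcomp_lc[OF \<theta> \<phi> e]
  interpret lc_functor "fst (src (nsrc \<theta>))" "fst (tgt (nsrc \<theta>))" "fct (nsrc \<theta>)"
    using t(1) by (rule lc_functor_morph)
  show "G_nat (nat2_vcomp \<phi> \<theta>) \<in> max_lams" "lam2_vcomp (G_nat \<phi>) (G_nat \<theta>) \<in> max_lams"
    using n \<theta> \<phi> e by (simp_all add: G_nat_max lam2_vcomp G_nat_sel)
  fix X assume "X \<in> Obj (fst (src (lsrc (lam2_vcomp (G_nat \<phi>) (G_nat \<theta>)))))"
  then obtain m where m: "X = subob (fst (src (nsrc \<theta>))) m" "m \<in> Arr (fst (src (nsrc \<theta>)))"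
    by (auto elim: C.G_ObjE simp: G_nat_sel)
  let ?C = "fst (src (nsrc \<theta>))" and ?D = "fst (tgt (nsrc \<theta>))"
  note [simp] = small_functorD[OF lc_morphsD(3)[OF p(1), unfolded t p]] small_functorD[OF
      lc_morphsD(3)[OF p(2), unfolded t p]]
    nat_transformationD(2-4)[OF t(5)] nat_transformationD(2-4)[OF p(5)[unfolded t p]]
  let ?a = "ncomp \<theta> (Dom ?C m)"
  have e1: "nat_map \<theta> m = amap (fct (nsrc \<phi>)) m \<cdot>\<^bsub>?D\<^esub> ?a" "nat_map (nat2_vcomp \<phi> \<theta>) m = nat_map \<phi> m
      \<cdot>\<^bsub>?D\<^esub> ?a"
    using m(2) t e by (simp_all add: nat_map_def Cmp_assoc)
  have nm: "nat_map \<phi> m \<in> Arr ?D" "Dom ?D (nat_map \<phi> m) = omap (fct (nsrc \<phi>)) (Dom ?C m)"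
    using m(2) t by (simp_all add: nat_map_def)
  have s: "is_span ?D (amap (fct (nsrc \<phi>)) m) (nat_map \<phi> m)"
    "is_span ?D (amap (fct (nsrc \<theta>)) m) (amap (fct (nsrc \<phi>)) m \<cdot>\<^bsub>?D\<^esub> ?a)"
    "is_span ?D (amap (fct (nsrc \<phi>)) m \<cdot>\<^bsub>?D\<^esub> ?a) (nat_map \<phi> m \<cdot>\<^bsub>?D\<^esub> ?a)"
    unfolding is_span_def using m(2) nm by simp_all
  have mid: "omap (lmid (G_nat \<theta>)) X = subob ?D (amap (fct (nsrc \<phi>)) m \<cdot>\<^bsub>?D\<^esub> ?a)"
    "lcomp (G_nat \<theta>) X = spancl ?D (amap (fct (nsrc \<theta>)) m) (amap (fct (nsrc \<phi>)) m \<cdot>\<^bsub>?D\<^esub> ?a)"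
    "lcomp (G_nat \<phi>) X = spancl ?D (amap (fct (nsrc \<phi>)) m) (nat_map \<phi> m)"
    using G_nat_subob[OF \<theta> m(2)] G_nat_subob[OF \<phi>, of m] m t by (simp_all add: e1)
  have "lcomp (lam2_vcomp (G_nat \<phi>) (G_nat \<theta>)) X = spancl ?D (amap (fct (nsrc \<theta>)) m) (nat_map \<phi> m
      \<cdot>\<^bsub>?D\<^esub> ?a)"
    using m s mid by (simp add: lam2_vcomp_def Let_def G_nat_sel(1,2))
  then show "lcomp (G_nat (nat2_vcomp \<phi> \<theta>)) X = lcomp (lam2_vcomp (G_nat \<phi>) (G_nat \<theta>)) X"
    using G_nat_subob(2)[OF n, of m] m by (simp add: e1)
qed (simp_all add: G_nat_sel)

text \<open>Again a comparison of components. After restriction the two whiskered components share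
  the leg \<open>?J (amap (fct (ntgt \<theta>)) m)\<close> composed with \<open>?J ?a\<close>, and
  the composite span is the component of the horizontal composite.\<close>

lemma G_nat_hcomp:
  assumes \<theta>: "\<theta> \<in> lc_nats" and \<phi>: "\<phi> \<in> lc_nats" and e: "tgt (nsrc \<theta>) = src (nsrc \<phi>)"
  shows "G_nat (nat2_hcomp \<phi> \<theta>) = lam2_hcomp (G_nat \<phi>) (G_nat \<theta>)"
proof (rule lam2_eqI)
  note t = lc_natsD[OF \<theta>, unfolded e] and p = lc_natsD[OF \<phi>]
  note n = nat2_hcomp_lc[OF \<theta> \<phi> e]
  let ?C = "fst (src (nsrc \<theta>))" and ?D = "fst (src (nsrc \<phi>))" and ?E = "fst (tgt (nsrc \<phi>))"
  interpret K: lc_functor ?C ?D "fct (nsrc \<theta>)"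
    using lc_functor_morph[OF t(1)] e by simp
  interpret K': lc_functor ?C ?D "fct (ntgt \<theta>)"
    using lc_functor_morph[OF t(2)] t by simp
  interpret J: lc_functor ?D ?E "fct (nsrc \<phi>)"
    using lc_functor_morph[OF p(1)] .
  interpret J': lc_functor ?D ?E "fct (ntgt \<phi>)"
    using lc_functor_morph[OF p(2)] p by simp
  show "G_nat (nat2_hcomp \<phi> \<theta>) \<in> max_lams" "lam2_hcomp (G_nat \<phi>) (G_nat \<theta>) \<in> max_lams"
    using n \<theta> \<phi> e by (simp_all add: G_nat_max lam2_hcomp G_nat_sel)
  show "lsrc (G_nat (nat2_hcomp \<phi> \<theta>)) = lsrc (lam2_hcomp (G_nat \<phi>) (G_nat \<theta>))"
    "ltgt (G_nat (nat2_hcomp \<phi> \<theta>)) = ltgt (lam2_hcomp (G_nat \<phi>) (G_nat \<theta>))"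
    using t p e by (simp_all add: G_nat_sel G_morph_comp)
  fix X assume "X \<in> Obj (fst (src (lsrc (lam2_hcomp (G_nat \<phi>) (G_nat \<theta>)))))"
  then have X: "X \<in> Obj (G_ogpd ?C)"
    by (simp add: G_nat_sel)
  then obtain m where m: "X = subob ?C m" "m \<in> Arr ?C"
    by (rule K.C.G_ObjE)
  note [simp] = nat_transformationD(2-4)[OF t(5)] nat_transformationD(2-4)[OF p(5)]
  let ?a = "ncomp \<theta> (Dom ?C m)" and ?b = "nat_map \<phi> (amap (fct (ntgt \<theta>)) m)"
  let ?J = "amap (fct (nsrc \<phi>))"
  have [simp]: "?b \<in> Arr ?E" "Dom ?E ?b = omap (fct (nsrc \<phi>)) (omap (fct (ntgt \<theta>)) (Dom ?C m))"
    using m(2) by (simp_all add: nat_map_def)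
  have e1: "nat_map \<theta> m = amap (fct (ntgt \<theta>)) m \<cdot>\<^bsub>?D\<^esub> ?a"
    "nat_map (nat2_hcomp \<phi> \<theta>) m = ?b \<cdot>\<^bsub>?E\<^esub> ?J ?a"
    using m(2) t e by (simp_all add: nat_map_def Cmp_assoc)
  have s: "is_span ?D (amap (fct (nsrc \<theta>)) m) (amap (fct (ntgt \<theta>)) m \<cdot>\<^bsub>?D\<^esub> ?a)"
    "is_span ?E (?J (amap (fct (ntgt \<theta>)) m)) ?b"
    "is_span ?E (?J (amap (fct (nsrc \<theta>)) m)) (?J (amap (fct (ntgt \<theta>)) m) \<cdot>\<^bsub>?E\<^esub> ?J ?a)"
    "is_span ?E (?J (amap (fct (ntgt \<theta>)) m) \<cdot>\<^bsub>?E\<^esub> ?J ?a) (?b \<cdot>\<^bsub>?E\<^esub> ?J ?a)"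
    unfolding is_span_def using m(2) by simp_all
  have c\<theta>: "omap (lmid (G_nat \<theta>)) X = subob ?D (amap (fct (ntgt \<theta>)) m \<cdot>\<^bsub>?D\<^esub> ?a)"
    "lcomp (G_nat \<theta>) X = spancl ?D (amap (fct (nsrc \<theta>)) m) (amap (fct (ntgt \<theta>)) m \<cdot>\<^bsub>?D\<^esub> ?a)"
    using G_nat_subob[OF \<theta> m(2)] m e by (simp_all add: e1)
  have c\<phi>: "lcomp (G_nat \<phi>) (subob ?D (amap (fct (ntgt \<theta>)) m)) = spancl ?E (?J (amap (fct (ntgt \<theta>))
      m)) ?b"
    using G_nat_subob(2)[OF \<phi>, of "amap (fct (ntgt \<theta>)) m"] m by simp
  have r: "lcomp (lam2_whisker_right (G_nat \<phi>) (ltgt (G_nat \<theta>))) X = spancl ?E (?J (amap (fct (ntgt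
      \<theta>)) m)) ?b"
    using m t X K'.omap_G_map[OF K'.equivariant_functor m(2)] c\<phi>
    by (simp add: lam2_whisker_right_def G_nat_sel(1,2) G_fct_eq)
  have l: "lcomp (lam2_whisker_left (lsrc (G_nat \<phi>)) (G_nat \<theta>)) X =
      spancl ?E (?J (amap (fct (nsrc \<theta>)) m)) (?J (amap (fct (ntgt \<theta>)) m) \<cdot>\<^bsub>?E\<^esub> ?J ?a)"
    "omap (lmid (lam2_whisker_left (lsrc (G_nat \<phi>)) (G_nat \<theta>))) X = subob ?E (?J (amap (fct (ntgt
        \<theta>)) m) \<cdot>\<^bsub>?E\<^esub> ?J ?a)"
    using m(2) X c\<theta> J.amap_G_map[OF J.equivariant_functor s(1)]
      J.omap_G_map[OF J.equivariant_functor, of "amap (fct (ntgt \<theta>)) m \<cdot>\<^bsub>?D\<^esub> ?a"]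
    by (simp_all add: lam2_whisker_left_def G_nat_sel(1,2) G_fct_eq)
  have "lcomp (lam2_hcomp (G_nat \<phi>) (G_nat \<theta>)) X = spancl ?E (?J (amap (fct (nsrc \<theta>)) m)) (?b \<cdot>\<^bsub>?E\<^esub> ?J
      ?a)"
    unfolding lam2_hcomp_def lam2_vcomp_def Let_def lam2.simps
    using X m(2) r l s by (simp add: G_nat_sel(1,2))
  then show "lcomp (G_nat (nat2_hcomp \<phi> \<theta>)) X = lcomp (lam2_hcomp (G_nat \<phi>) (G_nat \<theta>)) X"
    using G_nat_subob(2)[OF n, of m] m by (simp add: e1)
qed

lemma is_functor_Vert_G: "is_functor (Vert lcGsite) (Vert Esite_max) G_morph G_nat"
  by (rule functorI)
    (simp_all add: category_Vert_lcGsite functorD(1)[OF is_functor_Vert_L] G_morph_max G_nat_id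
        G_nat_max G_nat_vcomp G_nat_sel)

lemma is_functor_Horz_G: "is_functor (Horz lcGsite) (Horz Esite_max) G_site G_nat"
  by (rule functorI)
    (simp_all add: category_Horz_lcGsite functorD(1)[OF is_functor_Horz_L] G_site_max G_nat_id
        morph_id_lc G_morph_id
      G_nat_max G_nat_hcomp G_nat_sel)

lemma two_functor_G:
  "two_functor (lcGsite :: (('u::universe) gsite, ('u gsite, 'u) morph, 'u nat2) twocat) Esite_max
      G_two"
  unfolding two_functor_def G_two_def
  using two_category_Esite_max two_category_lcGsite is_functor_One_G is_functor_Vert_G
      is_functor_Horz_G by simp

text \<open>At \<open>A\<close> both sides are the image of \<open>ncomp \<theta> A\<close> under
  the unit. On the left this is the component of \<open>G_nat \<theta>\<close> at the maximal
  subobject, the span of an identity and \<open>ncomp \<theta> A\<close>.\<close>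

lemma eta_two_natural:
  assumes \<theta>: "\<theta> \<in> lc_nats"
  shows "nat2_hcomp (L_lam (G_nat \<theta>)) (nat2_id (eta_morph (src (nsrc \<theta>)))) =
    nat2_hcomp (nat2_id (eta_morph (tgt (nsrc \<theta>)))) \<theta>"
proof -
  note t = lc_natsD[OF \<theta>]
  let ?C = "fst (src (nsrc \<theta>))" and ?D = "fst (tgt (nsrc \<theta>))"
  note s = lc_morphsD(1,2)[OF t(1)]
  interpret lc_functor ?C ?D "fct (nsrc \<theta>)"
    using lc_functor_morph[OF t(1)] .
  interpret K': lc_functor ?C ?D "fct (ntgt \<theta>)"
    using lc_functor_morph[OF t(2)] t by simp
  note g = G_nat_max[OF \<theta>]
  note [simp] = nat_transformationD(2-4)[OF t(5)]
  have K: "small_functor C.LG C'.LG (L_fct (G_ogpd ?C) (G_fct ?C ?D (fct (nsrc \<theta>))))"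
    using lc_morphsD(3)[OF L_morph_lc[OF G_morph_max[OF t(1)]]] by simp
  show ?thesis
  proof (rule nat2_eqI)
    show "nat2_hcomp (L_lam (G_nat \<theta>)) (nat2_id (eta_morph (src (nsrc \<theta>)))) \<in> lc_nats"
      by (rule nat2_hcomp_lc) (use g s in \<open>simp_all add: L_lam_lc nat2_id_lc eta_morph_lc
          G_nat_sel\<close>)
    show "nat2_hcomp (nat2_id (eta_morph (tgt (nsrc \<theta>)))) \<theta> \<in> lc_nats"
      by (rule nat2_hcomp_lc) (use \<theta> s in \<open>simp_all add: nat2_id_lc eta_morph_lc\<close>)
    show "nsrc (nat2_hcomp (L_lam (G_nat \<theta>)) (nat2_id (eta_morph (src (nsrc \<theta>))))) = nsrc
        (nat2_hcomp (nat2_id (eta_morph (tgt (nsrc \<theta>)))) \<theta>)"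
      using eta_morph_natural[OF t(1)] by (simp add: G_nat_sel)
    show "ntgt (nat2_hcomp (L_lam (G_nat \<theta>)) (nat2_id (eta_morph (src (nsrc \<theta>))))) = ntgt
        (nat2_hcomp (nat2_id (eta_morph (tgt (nsrc \<theta>)))) \<theta>)"
      using eta_morph_natural[OF t(2)] t by (simp add: G_nat_sel)
    fix A assume "A \<in> Obj (fst (src (nsrc (nat2_hcomp (nat2_id (eta_morph (tgt (nsrc \<theta>)))) \<theta>))))"
    then have A: "A \<in> Obj ?C" by simp
    have eA: "subob ?C (Ide ?C A) \<in> Obj C.LG"
      using A by simp
    let ?l = "ncomp (L_lam (G_nat \<theta>)) (subob ?C (Ide ?C A))"
    have "omap (fct (ntgt (L_lam (G_nat \<theta>)))) (subob ?C (Ide ?C A)) = subob ?D (Ide ?D (omap (fct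
        (ntgt \<theta>)) A))"
      using A t K'.omap_G_map[OF K'.equivariant_functor, of "Ide ?C A"] by (simp add: G_nat_sel
          G_fct_eq)
    then have l: "?l = vpair (spancl ?D (Ide ?D (omap (fct (nsrc \<theta>)) A)) (ncomp \<theta> A)) (subob ?D (Ide
        ?D (omap (fct (ntgt \<theta>)) A)))"
      using A G_nat_subob(2)[OF \<theta>, of "Ide ?C A"] t
      by (simp add: G_nat_sel(1,2) nat_map_def)
    also have "\<dots> = amap (eta_fct ?D) (ncomp \<theta> A)"
      using A by (simp add: eta_fct_def)
    finally have l': "?l = amap (eta_fct ?D) (ncomp \<theta> A)" .
    note n = nat_transformationD(2-4)[OF lc_natsD(5)[OF L_lam_lc[OF g]], of "subob ?C (Ide ?C A)"]
    have "?l \<cdot>\<^bsub>C'.LG\<^esub> amap (L_fct (G_ogpd ?C) (G_fct ?C ?D (fct (nsrc \<theta>)))) (Ide C.LG (subob ?C (Ide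
        ?C A))) = ?l"
      using n eA small_functorD(6,7)[OF K eA] by (simp add: G_nat_sel(1,2))
    moreover have "Ide C'.LG (omap (eta_fct ?D) (omap (fct (ntgt \<theta>)) A)) \<cdot>\<^bsub>C'.LG\<^esub> amap (eta_fct ?D)
        (ncomp \<theta> A) =
        amap (eta_fct ?D) (ncomp \<theta> A)"
      using A small_functorD(6-10)[OF C'.small_functor_eta] by simp
    ultimately show "ncomp (nat2_hcomp (L_lam (G_nat \<theta>)) (nat2_id (eta_morph (src (nsrc \<theta>))))) A =
        ncomp (nat2_hcomp (nat2_id (eta_morph (tgt (nsrc \<theta>)))) \<theta>) A"
      using A l' t by (simp add: G_nat_sel(1,2))
  qed
qed


section \<open>The counit as a morphism of sites\<close>

definition eps_morph :: "'u::universe esite \<Rightarrow> ('u esite, 'u) morph" where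
  "eps_morph X = \<lparr>src = G_site (L_site X), tgt = X, fct = eps_fct (fst X)\<rparr>"

definition iota_morph :: "'u::universe esite \<Rightarrow> ('u esite, 'u) morph" where
  "iota_morph X = \<lparr>src = X, tgt = G_site (L_site X), fct = iota_fct (fst X)\<rparr>"

lemma eps_morph_sel [simp]: "src (eps_morph X) = G_site (L_site X)" "tgt (eps_morph X) = X"
  "fct (eps_morph X) = eps_fct (fst X)" "src (iota_morph X) = X" "tgt (iota_morph X) = G_site
      (L_site X)"
  "fct (iota_morph X) = iota_fct (fst X)"
  by (simp_all add: eps_morph_def iota_morph_def)

lemma generated_vsieve_vsieve: "ordered_groupoid \<G> \<Longrightarrow> vsieve \<G> A \<A> \<Longrightarrow> generated_vsieve \<G> \<A> = \<A>"
  unfolding generated_vsieve_def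
  using vsieveD[of \<G> A \<A>] ole_refl[of \<G>] oleD(1)[of \<G>] by blast

lemma max_sites_max_ogpd: "X \<in> max_sites \<Longrightarrow> max_ogpd (fst X)"
  unfolding max_ogpd_def max_ogpd_axioms_def ogpd_def by (simp add: max_sitesD)

text \<open>A cover of the class of \<open>m\<close>, with horizontal part \<open>h\<close>, comes
  from a cover \<open>S\<close> of the domain of \<open>h\<close>. The counit carries it to the
  vertical pullback of \<open>vimg (fst X) S\<close> along the inverse of \<open>h\<close>, which
  covers by stability.\<close>

lemma vcover_preserving_eps:
  assumes X: "X \<in> max_sites"
  shows "vcover_preserving (G_site (L_site X)) X (eps_fct (fst X))"
  unfolding vcover_preserving_def
proof (intro ballI)
  interpret max_ogpd "fst X"
    using X by (rule max_sites_max_ogpd)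
  note T = max_sitesD(3)[OF X]
  fix Y \<A> assume "\<A> \<in> snd (G_site (L_site X)) Y"
  then obtain m S where m: "m \<in> Arr L" "Y = subob L m" and S: "S \<in> J_of X (Dom L m)"
    and A: "\<A> = (\<lambda>n. subob L (m \<cdot>\<^bsub>L\<^esub> n)) ` S"
    by (auto simp: T_of_def)
  obtain h B where h: "m = vpair h B" "h \<in> Arr (fst X)" "ole (fst X) (Cod (fst X) h) B"
    using m(1) by (rule L_arrE)
  have S': "sieve L (Dom (fst X) h) S" "vimg (fst X) S \<in> snd X (Dom (fst X) h)"
    using S h by (simp_all add: J_of_iff L_cat_sel)
  let ?V = "vsieve_pullback (fst X) (inv_arr (fst X) h) (vimg (fst X) S)"
  have V: "?V \<in> snd X (Cod (fst X) h)"
    using ehresmannD(3)[OF T S'(2), of "inv_arr (fst X) h"] h by simp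
  have o: "omap (eps_fct (fst X)) (subob L (m \<cdot>\<^bsub>L\<^esub> vpair k (Dom (fst X) h))) = Cod (fst X) (restr (fst
      X) h (Cod (fst X) k))"
    if "k \<in> Arr (fst X)" "ole (fst X) (Cod (fst X) k) (Dom (fst X) h)" for k
    using that h by (simp add: L_cat_sel omap_eps)
  have "omap (eps_fct (fst X)) ` \<A> = ?V"
  proof (intro set_eqI iffI)
    fix C assume "C \<in> omap (eps_fct (fst X)) ` \<A>"
    then obtain n where n: "n \<in> S" "C = omap (eps_fct (fst X)) (subob L (m \<cdot>\<^bsub>L\<^esub> n))"
      unfolding A by auto
    obtain k where k: "k \<in> Arr (fst X)" "n = vpair k (Dom (fst X) h)" "Cod (fst X) k \<in> vimg (fst X)
        S"
      using n(1) sieve_L_cat_iff[OF og S'(1)] by auto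
    have le: "ole (fst X) (Cod (fst X) k) (Dom (fst X) h)"
      using vsieveD(2)[OF vsieve_vimg[OF og S'(1)] k(3)] .
    have C: "C = Cod (fst X) (restr (fst X) h (Cod (fst X) k))"
      using n k o[OF k(1) le] by simp
    have "restr (fst X) (inv_arr (fst X) h) C = inv_arr (fst X) (restr (fst X) h (Cod (fst X) k))"
      unfolding C by (rule restr_inv_arr[OF og h(2) le])
    then show "C \<in> ?V"
      unfolding vsieve_pullback_def using C k h le ole_Cod_restr[OF og h(2) le] by simp
  next
    fix C assume "C \<in> ?V"
    then have C: "ole (fst X) C (Cod (fst X) h)" "Cod (fst X) (restr (fst X) (inv_arr (fst X) h) C)
        \<in> vimg (fst X) S"
      unfolding vsieve_pullback_def using h by simp_all
    let ?i = "restr (fst X) (inv_arr (fst X) h) C" let ?D = "Cod (fst X) ?i"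
    have le: "ole (fst X) ?D (Dom (fst X) h)"
      using ole_Cod_restr[OF og, of "inv_arr (fst X) h" C] C h by simp
    have D: "vpair (Ide (fst X) ?D) (Dom (fst X) h) \<in> S"
      unfolding sieve_L_cat_iff[OF og S'(1)] using C(2) oleD(1)[OF le] by auto
    have "inv_arr (fst X) (inv_arr (fst X) h) = h"
      using h by (intro inv_arr_eqI) (simp_all add: is_inverse_def)
    then have "restr (fst X) h ?D = inv_arr (fst X) ?i"
      using restr_inv_arr[OF og, of "inv_arr (fst X) h" C] C h by simp
    then have "Cod (fst X) (restr (fst X) h ?D) = C"
      using C h by simp
    then have "C = omap (eps_fct (fst X)) (subob L (m \<cdot>\<^bsub>L\<^esub> vpair (Ide (fst X) ?D) (Dom (fst X) h)))"
      using o[of "Ide (fst X) ?D"] oleD(1)[OF le] le by simp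
    then show "C \<in> omap (eps_fct (fst X)) ` \<A>"
      unfolding A using D by blast
  qed
  then show "generated_vsieve (fst X) (omap (eps_fct (fst X)) ` \<A>) \<in> snd X (omap (eps_fct (fst X))
      Y)"
    using generated_vsieve_vsieve[OF og ehresmannD(1)[OF T V]] V m h by (simp add: omap_eps)
qed

text \<open>Objects below \<open>B\<close> have the same maximal object as \<open>B\<close>. So the
  image of \<A> consists of the subobjects \<open>?m n\<close> with \<open>n\<close> in
  \<open>hsieve (fst X) B \<A>\<close>, which is the form in which \<open>T_of\<close> lists its
  covers.\<close>

lemma vcover_preserving_iota:
  assumes X: "X \<in> max_sites"
  shows "vcover_preserving X (G_site (L_site X)) (iota_fct (fst X))"
  unfolding vcover_preserving_def
proof (intro ballI)
  interpret max_ogpd "fst X"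
    using X by (rule max_sites_max_ogpd)
  note T = max_sitesD(3)[OF X] and T' = max_sitesD(3)[OF G_site_max[OF L_site_lc[OF X]]]
  fix B \<A> assume B: "B \<in> Obj (fst X)" and A: "\<A> \<in> snd X B"
  note v = vsieveD[OF ehresmannD(1)[OF T A]]
  let ?m = "vpair (Ide (fst X) B) (max_above (fst X) B)"
  have m: "?m \<in> Arr L" "Dom L ?m = B"
    using B by (simp_all add: L_cat_sel)
  have S: "hsieve (fst X) B \<A> \<in> J_of X B"
    using hsieve_in_J_of[OF og T A] .
  have "omap (iota_fct (fst X)) ` \<A> = (\<lambda>n. subob L (?m \<cdot>\<^bsub>L\<^esub> n)) ` hsieve (fst X) B \<A>"
  proof -
    have c: "subob L (?m \<cdot>\<^bsub>L\<^esub> vpair h B) = omap (iota_fct (fst X)) (Cod (fst X) h)"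
      if h: "h \<in> Arr (fst X)" "Cod (fst X) h \<in> \<A>" for h
    proof -
      have le: "ole (fst X) (Cod (fst X) h) B"
        using v(2)[OF h(2)] .
      have le': "ole (fst X) (Cod (fst X) h) (max_above (fst X) B)"
        using ole_trans[OF og le max_above(1)[OF B]] .
      show ?thesis
        using h B le le' max_above_eq[OF le] subob_iota[OF h(1) le'] by (simp add: L_cat_sel)
    qed
    show ?thesis
    proof (intro set_eqI iffI)
      fix Y assume "Y \<in> omap (iota_fct (fst X)) ` \<A>"
      then obtain C where C: "C \<in> \<A>" "Y = omap (iota_fct (fst X)) C" by auto
      have "C \<in> Obj (fst X)" using oleD(1)[OF v(2)[OF C(1)]] .
      then show "Y \<in> (\<lambda>n. subob L (?m \<cdot>\<^bsub>L\<^esub> n)) ` hsieve (fst X) B \<A>"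
        using C c[of "Ide (fst X) C"] unfolding hsieve_def
        by (intro image_eqI[of _ _ "vpair (Ide (fst X) C) B"]) (auto intro!: exI[of _ "Ide (fst X)
            C"])
    next
      fix Y assume "Y \<in> (\<lambda>n. subob L (?m \<cdot>\<^bsub>L\<^esub> n)) ` hsieve (fst X) B \<A>"
      then show "Y \<in> omap (iota_fct (fst X)) ` \<A>"
        unfolding hsieve_def using c by (auto simp del: omap_iota)
    qed
  qed
  then have V: "omap (iota_fct (fst X)) ` \<A> \<in> T_of (L_site X) (subob L ?m)"
    unfolding T_of_def using m S
    by (intro CollectI exI[of _ ?m] exI[of _ "hsieve (fst X) B \<A>"]) simp
  have "vsieve (G_ogpd L) (subob L ?m) (omap (iota_fct (fst X)) ` \<A>)"
    using ehresmannD(1)[OF T', of "omap (iota_fct (fst X)) ` \<A>" "subob L ?m"] V by simp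
  then show "generated_vsieve (fst (G_site (L_site X))) (omap (iota_fct (fst X)) ` \<A>) \<in>
      snd (G_site (L_site X)) (omap (iota_fct (fst X)) B)"
    using generated_vsieve_vsieve[OF L.ordered_groupoid_G] V B by simp
qed

text \<open>The unit at \<open>L_cat (fst X)\<close> is an equivalence, \<open>Q\<close> is a left
  inverse of it by \<open>L_eps_eta\<close>, and \<open>I\<close> is a section of \<open>Q\<close>
  by \<open>eps_iota\<close>. So \<open>retraction_ff\<close> and \<open>section_ff\<close> apply
  one after the other.\<close>

lemma L_eps_ff:
  assumes X: "X \<in> max_sites"
  defines "Q \<equiv> L_fct (G_ogpd (L_cat (fst X))) (eps_fct (fst X))"
    and "I \<equiv> L_fct (fst X) (iota_fct (fst X))" and "D \<equiv> L_cat (G_ogpd (L_cat (fst X)))"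
  shows "small_functor D (L_cat (fst X)) Q" "full_on D (L_cat (fst X)) (omap Q) (amap Q)"
      "faithful_on D (amap Q)"
    "ess_surj D (L_cat (fst X)) (omap Q)" "small_functor (L_cat (fst X)) D I"
    "fct_comp (L_cat (fst X)) Q I = fct_id (L_cat (fst X))"
    "full_on (L_cat (fst X)) D (omap I) (amap I)" "faithful_on (L_cat (fst X)) (amap I)"
    "ess_surj (L_cat (fst X)) D (omap I)"
proof -
  interpret max_ogpd "fst X"
    using X by (rule max_sites_max_ogpd)
  show Q: "small_functor D (L_cat (fst X)) Q"
    unfolding Q_def D_def by (rule small_functor_L_fct[OF L.ordered_groupoid_G og
        double_functor_eps])
  show I: "small_functor (L_cat (fst X)) D I"
    unfolding I_def D_def by (rule small_functor_L_fct[OF og L.ordered_groupoid_G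
        double_functor_iota])
  show ff: "full_on D (L_cat (fst X)) (omap Q) (amap Q)" "faithful_on D (amap Q)" "ess_surj D (L_cat
      (fst X)) (omap Q)"
    using retraction_ff[OF L.small_functor_eta L.full_eta L.ess_surj_eta Q[unfolded Q_def D_def]
        L_eps_eta]
    unfolding Q_def D_def by simp_all
  show QI: "fct_comp (L_cat (fst X)) Q I = fct_id (L_cat (fst X))"
    unfolding Q_def I_def using L_fct_comp[OF og L.ordered_groupoid_G og double_functor_iota
        double_functor_eps]
    by (simp add: eps_iota L_fct_id)
  show "full_on (L_cat (fst X)) D (omap I) (amap I)" "faithful_on (L_cat (fst X)) (amap I)"
    "ess_surj (L_cat (fst X)) D (omap I)"
    using section_ff[OF Q ff(1,2) I QI] by simp_all
qed

lemma eps_morph_max: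
  assumes X: "X \<in> max_sites"
  shows "eps_morph X \<in> max_morphs"
proof -
  interpret max_ogpd "fst X"
    using X by (rule max_sites_max_ogpd)
  have G: "G_site (L_site X) \<in> max_sites"
    using X by (simp add: G_site_max L_site_lc)
  have "cover_flat (L_site (G_site (L_site X))) (L_site X) (L_fct (G_ogpd L) (eps_fct (fst X)))"
    by (rule cover_flat_equivalence) (use L_eps_ff(1-4)[OF X] lc_sitesD(4)[OF L_site_lc[OF X]] in
        simp_all)
  then have "vcover_flat (G_site (L_site X)) X (eps_fct (fst X))"
    using double_functor_eps max_sitesD[OF X] by (intro vcover_flat_of_L) simp_all
  then show ?thesis
    unfolding max_morphs_def using X G double_functor_eps vcover_preserving_eps[OF X] by simp
qed

lemma iota_morph_max:
  assumes X: "X \<in> max_sites"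
  shows "iota_morph X \<in> max_morphs"
proof -
  interpret max_ogpd "fst X"
    using X by (rule max_sites_max_ogpd)
  have G: "G_site (L_site X) \<in> max_sites"
    using X by (simp add: G_site_max L_site_lc)
  have "cover_flat (L_site X) (L_site (G_site (L_site X))) (L_fct (fst X) (iota_fct (fst X)))"
    by (rule cover_flat_equivalence) (use L_eps_ff(5,7-9)[OF X] lc_sitesD(4)[OF L_site_lc[OF G]] in
        simp_all)
  then have "vcover_flat X (G_site (L_site X)) (iota_fct (fst X))"
    using double_functor_iota max_sitesD(3)[OF G] by (intro vcover_flat_of_L) simp_all
  then show ?thesis
    unfolding max_morphs_def using X G double_functor_iota vcover_preserving_iota[OF X] by simp
qed

text \<open>One of the two invertible 2-cells is an identity, since the counit undoes
  \<open>iota_morph\<close> strictly. The other is found between the categories from the full and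
  faithful \<open>?Q\<close> and lifted to ordered groupoids by \<open>lam_full\<close>.\<close>

lemma equivalence_eps:
  fixes X :: "'u::universe esite"
  assumes X: "X \<in> max_sites"
  shows "equivalence_in Esite_max (eps_morph X)"
proof -
  interpret max_ogpd "fst X"
    using X by (rule max_sites_max_ogpd)
  note e = eps_morph_max[OF X] and i = iota_morph_max[OF X]
  have G: "G_site (L_site X) \<in> max_sites"
    using X by (simp add: G_site_max L_site_lc)
  let ?Q = "L_fct (G_ogpd L) (eps_fct (fst X))" and ?I = "L_fct (fst X) (iota_fct (fst X))"
  note ff = L_eps_ff[OF X]
  \<comment> \<open>\<open>?Q\<close> after \<open>?I\<close> is the identity functor, so the
    identity transformation can play the part of the given isomorphism in
    \<open>equivalence_unit\<close>.\<close>
  let ?\<psi> = "\<lambda>A\<in>Obj L. Ide L A"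
  have "nat_transformation L L (fct_comp L ?Q ?I) (fct_id L) ?\<psi>"
    unfolding nat_transformation_def ff(6) by simp
  then obtain \<theta> where \<theta>: "nat_transformation L.LG L.LG (fct_id L.LG) (fct_comp L.LG ?I ?Q) \<theta>"
    "\<And>Y. Y \<in> Obj L.LG \<Longrightarrow> isomorphism L.LG (\<theta> Y)"
    using ff(1-3,5) by (elim equivalence_unit[of L.LG L ?Q ?I ?\<psi>, rotated 4]) simp_all
  let ?ie = "morph_comp (iota_morph X) (eps_morph X)"
  have ie: "?ie \<in> max_morphs"
    by (rule morph_comp_max[OF e i]) simp
  let ?t = "\<lparr>nsrc = L_morph (morph_id (G_site (L_site X))), ntgt = L_morph ?ie, ncomp = \<theta>\<rparr>"
  have t: "?t \<in> lc_nats"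
    unfolding lc_nats_def using \<theta>(1) L_morph_lc[OF ie] L_morph_lc[OF morph_id_max[OF G]]
        L_morph_comp[OF e i]
    by (simp add: L_fct_id)
  obtain a where a: "a \<in> max_lams" "lsrc a = morph_id (G_site (L_site X))" "ltgt a = ?ie" "L_lam a =
      ?t"
    by (rule lam_full[of "morph_id (G_site (L_site X))" ?ie ?t]) (use t ie morph_id_max[OF G] in
        simp_all)
  have "isomorphism (Vert lcGsite) ?t"
    by (rule isomorphism_nat2[OF t]) (use \<theta>(2) in simp)
  then have ia: "isomorphism (Vert Esite_max) a"
    using isomorphism_lam2[OF a(1)] a(4) by simp
  have ei: "morph_comp (eps_morph X) (iota_morph X) = morph_id X"
    by (rule morph_eqI) (simp_all add: eps_iota)
  have ib: "isomorphism (Vert Esite_max) (lam2_id (morph_id X))"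
    using isomorphism_Ide[OF functorD(1)[OF is_functor_Vert_L], of "morph_id X"] morph_id_max[OF X]
        by simp
  show ?thesis
    unfolding equivalence_in_def
  proof (intro conjI bexI[of _ "iota_morph X"])
    show "\<exists>a. isomorphism (Vert Esite_max) a \<and> Dom (Vert Esite_max) a = Ide (One Esite_max) (Dom
        (One Esite_max) (eps_morph X)) \<and>
        Cod (Vert Esite_max) a = iota_morph X \<cdot>\<^bsub>One Esite_max\<^esub> eps_morph X"
      by (rule exI[of _ a]) (use ia a in simp)
    show "\<exists>b. isomorphism (Vert Esite_max) b \<and> Dom (Vert Esite_max) b = eps_morph X \<cdot>\<^bsub>One Esite_max\<^esub>
        iota_morph X \<and>
        Cod (Vert Esite_max) b = Ide (One Esite_max) (Cod (One Esite_max) (eps_morph X))"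
      by (rule exI[of _ "lam2_id (morph_id X)"]) (use ib ei in simp)
  qed (use e i in simp_all)
qed

section \<open>Naturality of the counit and the triangle identities\<close>

lemma eps_morph_natural:
  assumes F: "F \<in> max_morphs"
  shows "morph_comp F (eps_morph (src F)) = morph_comp (eps_morph (tgt F)) (G_morph (L_morph F))"
  by (rule morph_eqI) (use eps_natural[OF max_morphsD(4,5,3)[OF F]] in simp_all)

text \<open>The sides are compared after the faithful \<open>L_lam\<close>, at the class of an arrow
  with horizontal part \<open>h\<close>. There the component of
  \<open>G_nat (L_lam \<alpha>)\<close> is a span whose horizontal parts are, by naturality of
  \<open>\<alpha>\<close>, the image of \<open>h\<close> and that image followed by
  \<open>lcomp \<alpha> ?B\<close>. The counit cancels the common part and leaves
  \<open>lcomp \<alpha> ?B\<close>.\<close>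

lemma eps_two_natural:
  assumes \<alpha>: "\<alpha> \<in> max_lams"
  shows "lam2_hcomp \<alpha> (lam2_id (eps_morph (src (lsrc \<alpha>)))) =
    lam2_hcomp (lam2_id (eps_morph (tgt (lsrc \<alpha>)))) (G_nat (L_lam \<alpha>))"
proof -
  note a = max_lamsD[OF \<alpha>] and ac = max_lams_comp[OF \<alpha>]
  note s = max_morphsD(1,2)[OF a(1)]
  note f = max_morphsD[OF a(1)] and k = max_morphsD[OF a(2), unfolded a]
  interpret G: max_ogpd "fst (src (lsrc \<alpha>))"
    using s(1) by (rule max_sites_max_ogpd)
  interpret H: max_ogpd "fst (tgt (lsrc \<alpha>))"
    using s(2) by (rule max_sites_max_ogpd)
  let ?G = "fst (src (lsrc \<alpha>))" and ?H = "fst (tgt (lsrc \<alpha>))"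
  let ?e = "eps_morph (src (lsrc \<alpha>))" and ?e' = "eps_morph (tgt (lsrc \<alpha>))"
  note e = eps_morph_max[OF s(1)] and e' = eps_morph_max[OF s(2)]
  note l = L_lam_lc[OF \<alpha>] note g = G_nat_max[OF l]
  note ie = lam2_id[OF e] and ie' = lam2_id[OF e']
  have c1: "tgt (lsrc (lam2_id ?e)) = src (lsrc \<alpha>)" "tgt (lsrc (G_nat (L_lam \<alpha>))) = src (lsrc
      (lam2_id ?e'))"
    by (simp_all add: G_nat_sel(1,2))
  note h1 = lam2_hcomp[OF ie(1) \<alpha> c1(1)] and h2 = lam2_hcomp[OF g ie'(1) c1(2)]
  show ?thesis
  proof (rule L_lam_inject[OF h1(1) h2(1)])
    show "lsrc (lam2_hcomp \<alpha> (lam2_id ?e)) = lsrc (lam2_hcomp (lam2_id ?e') (G_nat (L_lam \<alpha>)))"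
      using eps_morph_natural[OF a(1)] by (simp add: G_nat_sel(1,2))
    show "ltgt (lam2_hcomp \<alpha> (lam2_id ?e)) = ltgt (lam2_hcomp (lam2_id ?e') (G_nat (L_lam \<alpha>)))"
      using eps_morph_natural[OF a(2)] a by (simp add: G_nat_sel(1,2))
    show "L_lam (lam2_hcomp \<alpha> (lam2_id ?e)) = L_lam (lam2_hcomp (lam2_id ?e') (G_nat (L_lam \<alpha>)))"
    proof (rule nat2_eqI[OF L_lam_lc[OF h1(1)] L_lam_lc[OF h2(1)]])
      show "nsrc (L_lam (lam2_hcomp \<alpha> (lam2_id ?e))) = nsrc (L_lam (lam2_hcomp (lam2_id ?e') (G_nat
          (L_lam \<alpha>))))"
        using eps_morph_natural[OF a(1)] by (simp add: G_nat_sel(1,2))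
      show "ntgt (L_lam (lam2_hcomp \<alpha> (lam2_id ?e))) = ntgt (L_lam (lam2_hcomp (lam2_id ?e') (G_nat
          (L_lam \<alpha>))))"
        using eps_morph_natural[OF a(2)] a by (simp add: G_nat_sel(1,2))
      fix Y assume "Y \<in> Obj (fst (src (nsrc (L_lam (lam2_hcomp (lam2_id ?e') (G_nat (L_lam \<alpha>)))))))"
      then have Y: "Y \<in> Obj (G_ogpd G.L)" "Y \<in> Obj G.L.LG"
        by (simp_all add: G_nat_sel(1,2) L_cat_sel)
      obtain m where m: "Y = subob G.L m" "m \<in> Arr G.L"
        using Y(1) by (rule G.L.G_ObjE)
      obtain h B where h: "m = vpair h B" "h \<in> Arr ?G" "ole ?G (Cod ?G h) B"
        using m(2) by (rule L_arrE)
      note [simp] = ac(3-5) small_functorD(6-11)[OF double_functorD(1)[OF f(3)]]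
        small_functorD(6-11)[OF double_functorD(1)[OF k(3)]]
      have le: "ole ?H (omap (fct (lsrc \<alpha>)) (Cod ?G h)) (omap (fct (lsrc \<alpha>)) B)"
        "ole ?H (omap (fct (ltgt \<alpha>)) (Cod ?G h)) (omap (fct (ltgt \<alpha>)) B)"
        using double_functorD(3)[OF f(3) h(3)] double_functorD(3)[OF k(3) h(3)] by simp_all
      let ?A = "Dom ?G h" and ?B = "Cod ?G h"
      let ?r = "restr ?H (amap (fct (ltgt \<alpha>)) h) (Cod ?H (lcomp \<alpha> ?A))"
      have n: "?r \<cdot>\<^bsub>?H\<^esub> lcomp \<alpha> ?A = lcomp \<alpha> ?B \<cdot>\<^bsub>?H\<^esub> amap (fct (lsrc \<alpha>)) h"
        using lam_transformationD(7,9)[OF f(4,5) a(5) h(2)] h(2) by simp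
      have leB: "ole ?H (Cod ?H (lcomp \<alpha> ?B)) (omap (fct (ltgt \<alpha>)) B)"
        using ole_trans[OF f(5) _ le(2)] ac(5)[of ?B] h(2) by simp
      have nm: "nat_map (L_lam \<alpha>) m = vpair (?r \<cdot>\<^bsub>?H\<^esub> lcomp \<alpha> ?A) (omap (fct (ltgt \<alpha>)) B)"
        using h a le by (simp add: nat_map_def L_cat_sel)
      have mL: "m \<in> Arr (fst (src (nsrc (L_lam \<alpha>))))" "Y = subob (fst (src (nsrc (L_lam \<alpha>)))) m"
        using m by simp_all
      interpret T: lc_functor G.L H.L "fct (ntgt (L_lam \<alpha>))"
        using lc_functor_morph[OF lc_natsD(2)[OF l]] a by simp
      have tY: "omap (fct (ltgt (G_nat (L_lam \<alpha>)))) Y = subob H.L (vpair (amap (fct (ltgt \<alpha>)) h)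
          (omap (fct (ltgt \<alpha>)) B))"
        using T.omap_G_map[OF T.equivariant_functor m(2)] m h a le by (simp add: G_nat_sel(1,2)
            G_fct_eq)
      have cY: "lcomp (G_nat (L_lam \<alpha>)) Y = spancl H.L (vpair (amap (fct (lsrc \<alpha>)) h) (omap (fct
          (lsrc \<alpha>)) B))
          (vpair (?r \<cdot>\<^bsub>?H\<^esub> lcomp \<alpha> ?A) (omap (fct (ltgt \<alpha>)) B))"
        using G_nat_subob(2)[OF l mL(1)] mL(2) nm h le by simp
      have LG: "ncomp (L_lam (G_nat (L_lam \<alpha>))) Y = vpair (lcomp (G_nat (L_lam \<alpha>)) Y) (omap (fct
          (ltgt (G_nat (L_lam \<alpha>)))) Y)"
        using Y by (simp add: G_nat_sel(1,2))
      have eY: "omap (eps_fct ?G) Y = ?B"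
        using m h by (simp add: G.omap_eps)
      have ec: "amap (eps_fct ?H) (lcomp (G_nat (L_lam \<alpha>)) Y) = lcomp \<alpha> ?B"
        unfolding cY n using h le leB by (subst H.amap_eps) (simp_all add: Cmp_assoc)
      have et: "omap (eps_fct ?H) (omap (fct (ltgt (G_nat (L_lam \<alpha>)))) Y) = omap (fct (ltgt \<alpha>)) ?B"
        unfolding tY using h le by (simp add: H.omap_eps)
      note N = nat_transformationD(2-4)[OF lc_natsD(5)[OF L_lam_lc[OF g]], of Y]
      have NA: "vpair (lcomp (G_nat (L_lam \<alpha>)) Y) (omap (fct (ltgt (G_nat (L_lam \<alpha>)))) Y) \<in> Arr
          H.L.LG"
        using N(1) Y LG by (simp add: G_nat_sel(1,2))
      have R: "amap (L_fct (G_ogpd H.L) (eps_fct ?H)) (ncomp (L_lam (G_nat (L_lam \<alpha>))) Y) = vpair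
          (lcomp \<alpha> ?B) (omap (fct (ltgt \<alpha>)) ?B)"
        unfolding LG using NA ec et by (simp add: L_cat_sel)
      have "ncomp (L_lam (lam2_hcomp \<alpha> (lam2_id ?e))) Y =
          vpair (lcomp \<alpha> ?B) (omap (fct (ltgt \<alpha>)) ?B) \<cdot>\<^bsub>H.L\<^esub> amap (L_fct ?G (fct (lsrc \<alpha>))) (Ide G.L
              ?B)"
        unfolding h1(2) ie(2) using Y h a eY by (simp add: L_cat_sel)
      also have "\<dots> = vpair (lcomp \<alpha> ?B) (omap (fct (ltgt \<alpha>)) ?B)"
        using h by (simp add: L_cat_sel)
      finally have left: "ncomp (L_lam (lam2_hcomp \<alpha> (lam2_id ?e))) Y = vpair (lcomp \<alpha> ?B) (omap
          (fct (ltgt \<alpha>)) ?B)" .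
      have ty: "omap (fct (ntgt (L_lam (G_nat (L_lam \<alpha>))))) Y = omap (fct (ltgt (G_nat (L_lam \<alpha>))))
          Y"
        "omap (fct (ltgt (G_nat (L_lam \<alpha>)))) Y \<in> Obj (G_ogpd H.L)"
        using Y tY h le a by (simp_all add: G_nat_sel(1,2) L_cat_sel)
      have "ncomp (L_lam (lam2_hcomp (lam2_id ?e') (G_nat (L_lam \<alpha>)))) Y =
          Ide H.L (omap (fct (ltgt \<alpha>)) ?B) \<cdot>\<^bsub>H.L\<^esub> vpair (lcomp \<alpha> ?B) (omap (fct (ltgt \<alpha>)) ?B)"
        unfolding h2(2) ie'(2) using Y ty et R by (simp add: G_nat_sel(1,2) L_cat_sel(1))
      also have "\<dots> = vpair (lcomp \<alpha> ?B) (omap (fct (ltgt \<alpha>)) ?B)"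
        using h by (simp add: L_cat_sel)
      finally show "ncomp (L_lam (lam2_hcomp \<alpha> (lam2_id ?e))) Y =
          ncomp (L_lam (lam2_hcomp (lam2_id ?e') (G_nat (L_lam \<alpha>)))) Y"
        using left by simp
    qed
  qed
qed

text \<open>The unit turns \<open>m\<close> and \<open>n\<close> into arrows whose horizontal parts
  are the spans of an identity with \<open>m\<close> and with \<open>n\<close>. The counit composes
  the second of these with the inverse of the first, which is the span of \<open>m\<close> and
  \<open>n\<close> again.\<close>

lemma eps_G_eta:
  assumes X: "X \<in> lc_sites"
  shows "morph_comp (eps_morph (G_site X)) (G_morph (eta_morph X)) = morph_id (G_site X)"
proof (rule morph_eqI)
  interpret lc_functor "fst X" "L_cat (G_ogpd (fst X))" "eta_fct (fst X)"
    using lc_functor_morph[OF eta_morph_lc[OF X]] by simp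
  interpret G: ogpd "G_ogpd (fst X)"
    by unfold_locales simp
  let ?C = "fst X"
  note [simp] = omap_G_map[OF equivariant_functor] amap_G_map[OF equivariant_functor]
  note df = double_functor_G_map[OF equivariant_functor]
  have s [simp]: "is_span ?C (Ide ?C (Dom ?C m)) m" "is_span ?C m (Ide ?C (Dom ?C m))" if "m \<in> Arr
      ?C" for m
    unfolding is_span_def using that by simp_all
  have a [simp]: "amap (eta_fct ?C) m = vpair (spancl ?C (Ide ?C (Dom ?C m)) m) (subob ?C (Ide ?C
      (Cod ?C m)))" if "m \<in> Arr ?C" for m
    using that by (simp add: eta_fct_def)
  have "fct_comp (G_ogpd ?C) (eps_fct (G_ogpd ?C)) (G_map ?C C.LG (amap (eta_fct ?C))) = fct_id
      (G_ogpd ?C)"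
  proof (rule small_functor_eqI[OF small_functor_comp[OF double_functorD(1)[OF df]
      double_functorD(1)[OF G.double_functor_eps]]
        small_functor_id[OF C.category_G_ogpd]])
    fix Y assume Y: "Y \<in> Obj (G_ogpd ?C)"
    then obtain m where m: "Y = subob ?C m" "m \<in> Arr ?C"
      by (rule C.G_ObjE)
    then show "omap (fct_comp (G_ogpd ?C) (eps_fct (G_ogpd ?C)) (G_map ?C C.LG (amap (eta_fct ?C))))
        Y = omap (fct_id (G_ogpd ?C)) Y"
      using C.ole_G_max by (simp add: G.omap_eps)
  next
    fix x assume "x \<in> Arr (G_ogpd ?C)"
    then obtain m n where x: "x = spancl ?C m n" "is_span ?C m n"
      by (rule C.G_ArrE)
    then have m: "m \<in> Arr ?C" "n \<in> Arr ?C" "Dom ?C n = Dom ?C m"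
      by (simp_all add: C.span_Dom)
    have s': "is_span ?C (Ide ?C (Dom ?C m)) n"
      using s(1)[OF m(2)] m by simp
    show "amap (fct_comp (G_ogpd ?C) (eps_fct (G_ogpd ?C)) (G_map ?C C.LG (amap (eta_fct ?C)))) x =
        amap (fct_id (G_ogpd ?C)) x"
      using x m s' C.ole_G_max by (simp add: G.amap_eps)
  qed
  then show "fct (morph_comp (eps_morph (G_site X)) (G_morph (eta_morph X))) = fct (morph_id (G_site
      X))"
    by (simp add: G_fct_eq)
qed simp_all

lemma L_eps_eta_morph:
  assumes X: "X \<in> max_sites"
  shows "morph_comp (L_morph (eps_morph X)) (eta_morph (L_site X)) = morph_id (L_site X)"
proof (rule morph_eqI)
  interpret max_ogpd "fst X"
    using X by (rule max_sites_max_ogpd)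
  show "fct (morph_comp (L_morph (eps_morph X)) (eta_morph (L_site X))) = fct (morph_id (L_site X))"
    using L_eps_eta by simp
qed simp_all

theorem theorem6p16:
  shows "two_adjoint_biequivalence
    (lcGsite :: (('u::universe) gsite, ('u gsite, 'u) morph, 'u nat2) twocat)
    (Esite_max :: ('u esite, ('u esite, 'u) morph, 'u lam2) twocat)
    G_two L_two"
proof -
  have "two_natural (lcGsite :: ('u gsite, ('u gsite, 'u) morph, 'u nat2) twocat) lcGsite two_id
      (two_comp L_two G_two) eta_morph"
    unfolding two_natural_def
    by (simp add: two_id_def two_comp_def L_two_def G_two_def eta_morph_lc lc_morphsD
        eta_morph_natural eta_two_natural)
  moreover have "two_natural (Esite_max :: ('u esite, ('u esite, 'u) morph, 'u lam2) twocat)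
      Esite_max (two_comp G_two L_two) two_id eps_morph"
    unfolding two_natural_def
    by (simp add: two_id_def two_comp_def L_two_def G_two_def eps_morph_max max_morphsD
        eps_morph_natural eps_two_natural)
  ultimately have "two_adjunction (lcGsite :: ('u gsite, ('u gsite, 'u) morph, 'u nat2) twocat)
      (Esite_max :: ('u esite, ('u esite, 'u) morph, 'u lam2) twocat) G_two L_two eta_morph
          eps_morph"
    unfolding two_adjunction_def using two_functor_G two_functor_L
    by (simp add: G_two_def L_two_def eps_G_eta L_eps_eta_morph)
  then show ?thesis
    unfolding two_adjoint_biequivalence_def
    by (intro exI[of _ eta_morph] exI[of _ eps_morph]) (simp add: equivalence_eta equivalence_eps)
qed

end
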